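(* Assume that $|u(q^\dagger)|\ge\bar c_0$ in $I\times\Omega$ for some constant $\bar c_0>0$. (a) If the space dimension is $d=2$, then for any $\epsilon\in(0,\tfrac12)$ there is a constant $C>0$ (independent of $q$) such that $$\|q-q^\dagger\|_{H^{-1-\epsilon}(\Omega)}\le C\,\|u(q)-u(q^\dagger)\|_{L^2(I;H_0^1(\Omega))}\qquad\text{for all } q\in K.\qquad(\ast)$$ (b) If the space dimension is $d=3$ and $\partial_t u(q^\dagger)\in L^2(I;L^3(\Omega))$, then for any $\epsilon\in(0,\tfrac12)$ the estimate $(\ast)$ still holds for some constant $C>0$ (independent of $q$).
   Context: $\Omega\subset\mathbb{R}^d$ ($d=2,3$) is an open bounded connected domain with $C^2$ boundary, $T>0$, and $I$ is an open subinterval of $(0,T]$. Standing assumptions: $a\in W^{1,\infty}(\Omega)$ with a positive lower bound, $f\in L^2(0,T;L^2(\Omega))$, $g\in L^2(0,T;H^{3/2}(\partial\Omega))\cap H^{3/4}(0,T;L^2(\partial\Omega))$, $u_0\in H^1(\Omega)$. With constants $0<\underline q\le\bar q$, the admissible set is $K=\{q\in L^2(\Omega): \underline q\le q\le\bar q \text{ a.e. in }\Omega\}$. For $q\in K$, $u(q)\in L^2(0,T;H^2(\Omega))\cap H^1(0,T;L^2(\Omega))$ denotes the unique solution of $$\partial_t u-\nabla\cdot(a\nabla u)+q u=f\ \text{ in }\Omega\times(0,T],\quad u(\cdot,0)=u_0\ \text{ in }\Omega,\quad u=g\ \text{ on }\partial\Omega\times(0,T].$$ $q^\dagger\in K$ is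 the true radiativity. $\|\cdot\|_{s,\Omega}$ is the norm of $H^s(\Omega)$; $\|v\|_{L^2(I;H_0^1(\Omega))}=(\int_I\|v(t)\|_{1,\Omega}^2dt)^{1/2}$. For $s>0$, $H^s_0(\Omega)$ is the completion of $C_c^\infty(\Omega)$ under $\|\cdot\|_{s,\Omega}$, and $H^{-s}(\Omega)$ is the dual space of $H_0^s(\Omega)$ with respect to the $L^2(\Omega)$ inner product. *)

theory Defs
  imports "HOL-Analysis.Analysis"
begin

text \<open>
  Elements of function spaces are represented by functions defined everywhere; only their
  almost-everywhere class on the underlying set matters. A function of time and space is
  curried, so that \<open>u t\<close> is its value at time \<open>t\<close> as a function of space.
\<close>

definition Lp_space :: "'b measure \<Rightarrow> real \<Rightarrow> ('b \<Rightarrow> real) set" where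
  "Lp_space M p = {f \<in> borel_measurable M. integrable M (\<lambda>x. \<bar>f x\<bar> powr p)}"

definition Lp_norm :: "'b measure \<Rightarrow> real \<Rightarrow> ('b \<Rightarrow> real) \<Rightarrow> real" where
  "Lp_norm M p f = (\<integral>x. \<bar>f x\<bar> powr p \<partial>M) powr (1 / p)"

definition Linf_space :: "'b measure \<Rightarrow> ('b \<Rightarrow> real) set" where
  "Linf_space M = {f \<in> borel_measurable M. \<exists>C. AE x in M. \<bar>f x\<bar> \<le> C}"


section \<open>Smooth functions and domains of class C2\<close>

definition pderivative :: "'a \<Rightarrow> ('a::euclidean_space \<Rightarrow> real) \<Rightarrow> 'a \<Rightarrow> real" where
  "pderivative i f x = frechet_derivative f (at x) i"

primrec C_k :: "nat \<Rightarrow> ('a::euclidean_space \<Rightarrow> real) \<Rightarrow> bool" where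
  "C_k 0 f \<longleftrightarrow> continuous_on UNIV f"
| "C_k (Suc k) f \<longleftrightarrow> (\<forall>x. f differentiable at x) \<and> (\<forall>i\<in>Basis. C_k k (pderivative i f))"

definition smooth :: "('a::euclidean_space \<Rightarrow> real) \<Rightarrow> bool" where
  "smooth f \<longleftrightarrow> (\<forall>k. C_k k f)"

definition test_functions :: "'a::euclidean_space set \<Rightarrow> ('a \<Rightarrow> real) set" where
  "test_functions \<Omega> =
     {\<phi>. smooth \<phi> \<and> compact (closure {x. \<phi> x \<noteq> 0}) \<and> closure {x. \<phi> x \<noteq> 0} \<subseteq> \<Omega>}"

text \<open>
  Near each boundary point, \<open>\<Omega>\<close> is the strict epigraph of a C2 function over a hyperplane. The
  unit vector \<open>e\<close> is the last axis of the rotated coordinate system, and \<open>\<gamma>\<close> is only evaluated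
  on the hyperplane orthogonal to \<open>e\<close>.
\<close>

definition C2_boundary :: "'a::euclidean_space set \<Rightarrow> bool" where
  "C2_boundary \<Omega> \<longleftrightarrow>
     (\<forall>x0\<in>frontier \<Omega>. \<exists>r>0. \<exists>e \<gamma>. norm e = 1 \<and> C_k 2 \<gamma> \<and>
        \<Omega> \<inter> ball x0 r = {x \<in> ball x0 r. \<gamma> (x - (x \<bullet> e) *\<^sub>R e) < x \<bullet> e})"


section \<open>Weak derivatives and Sobolev spaces\<close>

definition locally_integrable :: "'a::euclidean_space set \<Rightarrow> ('a \<Rightarrow> real) \<Rightarrow> bool" where
  "locally_integrable \<Omega> f \<longleftrightarrow> (\<forall>K. compact K \<and> K \<subseteq> \<Omega> \<longrightarrow> integrable (lebesgue_on K) f)"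

definition has_weak_pd ::
    "'a::euclidean_space set \<Rightarrow> 'a \<Rightarrow> ('a \<Rightarrow> real) \<Rightarrow> ('a \<Rightarrow> real) \<Rightarrow> bool" where
  "has_weak_pd \<Omega> i f g \<longleftrightarrow> locally_integrable \<Omega> f \<and> locally_integrable \<Omega> g \<and>
     (\<forall>\<phi>\<in>test_functions \<Omega>.
        (\<integral>x. f x * pderivative i \<phi> x \<partial>lebesgue_on \<Omega>) = - (\<integral>x. g x * \<phi> x \<partial>lebesgue_on \<Omega>))"

definition weak_pd :: "'a::euclidean_space set \<Rightarrow> 'a \<Rightarrow> ('a \<Rightarrow> real) \<Rightarrow> 'a \<Rightarrow> real" where
  "weak_pd \<Omega> i f = (SOME g. has_weak_pd \<Omega> i f g)"

definition weak_grad :: "'a::euclidean_space set \<Rightarrow> ('a \<Rightarrow> real) \<Rightarrow> 'a \<Rightarrow> 'a" where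
  "weak_grad \<Omega> f x = (\<Sum>i\<in>Basis. weak_pd \<Omega> i f x *\<^sub>R i)"

definition weak_div :: "'a::euclidean_space set \<Rightarrow> ('a \<Rightarrow> 'a) \<Rightarrow> 'a \<Rightarrow> real" where
  "weak_div \<Omega> F x = (\<Sum>i\<in>Basis. weak_pd \<Omega> i (\<lambda>y. F y \<bullet> i) x)"

definition W1inf_space :: "'a::euclidean_space set \<Rightarrow> ('a \<Rightarrow> real) set" where
  "W1inf_space \<Omega> = {f \<in> Linf_space (lebesgue_on \<Omega>).
     \<forall>i\<in>Basis. \<exists>g\<in>Linf_space (lebesgue_on \<Omega>). has_weak_pd \<Omega> i f g}"

text \<open>
  Sobolev--Slobodeckij spaces of order \<open>k + \<theta>\<close> with \<open>0 \<le> \<theta> < 1\<close>: all weak derivatives up to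
  order \<open>k\<close> are square integrable and, if \<open>\<theta> > 0\<close>, those of order \<open>k\<close> have a finite Gagliardo
  seminorm of order \<open>\<theta>\<close>. The recursion lets the sum of squares run over all tensor components
  of each iterated gradient.
\<close>

definition gagliardo :: "real \<Rightarrow> ('a::euclidean_space \<Rightarrow> real) \<Rightarrow> 'a \<times> 'a \<Rightarrow> real" where
  "gagliardo \<theta> f = (\<lambda>(x, y). (f x - f y)\<^sup>2 / norm (x - y) powr (real DIM('a) + 2 * \<theta>))"

primrec in_sobolev :: "nat \<Rightarrow> real \<Rightarrow> 'a::euclidean_space set \<Rightarrow> ('a \<Rightarrow> real) \<Rightarrow> bool" where
  "in_sobolev 0 \<theta> \<Omega> f \<longleftrightarrow> f \<in> Lp_space (lebesgue_on \<Omega>) 2 \<and>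
     (0 < \<theta> \<longrightarrow> integrable (lebesgue_on (\<Omega> \<times> \<Omega>)) (gagliardo \<theta> f))"
| "in_sobolev (Suc k) \<theta> \<Omega> f \<longleftrightarrow> f \<in> Lp_space (lebesgue_on \<Omega>) 2 \<and>
     (\<forall>i\<in>Basis. \<exists>g. has_weak_pd \<Omega> i f g \<and> in_sobolev k \<theta> \<Omega> g)"

primrec sobolev_sq :: "nat \<Rightarrow> real \<Rightarrow> 'a::euclidean_space set \<Rightarrow> ('a \<Rightarrow> real) \<Rightarrow> real" where
  "sobolev_sq 0 \<theta> \<Omega> f = (Lp_norm (lebesgue_on \<Omega>) 2 f)\<^sup>2 +
     (if 0 < \<theta> then (\<integral>z. gagliardo \<theta> f z \<partial>lebesgue_on (\<Omega> \<times> \<Omega>)) else 0)"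
| "sobolev_sq (Suc k) \<theta> \<Omega> f = (Lp_norm (lebesgue_on \<Omega>) 2 f)\<^sup>2 +
     (\<Sum>i\<in>Basis. sobolev_sq k \<theta> \<Omega> (weak_pd \<Omega> i f))"

definition Hs_space :: "real \<Rightarrow> 'a::euclidean_space set \<Rightarrow> ('a \<Rightarrow> real) set" where
  "Hs_space s \<Omega> = {f. in_sobolev (nat \<lfloor>s\<rfloor>) (frac s) \<Omega> f}"

definition Hs_norm :: "real \<Rightarrow> 'a::euclidean_space set \<Rightarrow> ('a \<Rightarrow> real) \<Rightarrow> real" where
  "Hs_norm s \<Omega> f = sqrt (sobolev_sq (nat \<lfloor>s\<rfloor>) (frac s) \<Omega> f)"

text \<open>The completion of the test functions, realised as their closure in the complete space
  \<^term>\<open>Hs_space s \<Omega>\<close>.\<close>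

definition Hs0_space :: "real \<Rightarrow> 'a::euclidean_space set \<Rightarrow> ('a \<Rightarrow> real) set" where
  "Hs0_space s \<Omega> = {v \<in> Hs_space s \<Omega>.
     \<exists>\<phi>. (\<forall>n. \<phi> n \<in> test_functions \<Omega>) \<and> (\<lambda>n. Hs_norm s \<Omega> (\<lambda>x. \<phi> n x - v x)) \<longlonglongrightarrow> 0}"

text \<open>
  The norm of order \<open>-s\<close> of a function \<open>f\<close>, regarded as the functional on
  \<^term>\<open>Hs0_space s \<Omega>\<close> given by the L2 inner product. For square integrable \<open>f\<close> the supremum is
  over a bounded set, and elements \<open>v\<close> of norm zero contribute \<open>0 / 0 = 0\<close>.
\<close>

definition Hs_dual_norm :: "real \<Rightarrow> 'a::euclidean_space set \<Rightarrow> ('a \<Rightarrow> real) \<Rightarrow> real" where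
  "Hs_dual_norm s \<Omega> f =
     (SUP v\<in>Hs0_space s \<Omega>. \<bar>\<integral>x. f x * v x \<partial>lebesgue_on \<Omega>\<bar> / Hs_norm s \<Omega> v)"


section \<open>Boundary values\<close>

definition hausdorff_outer :: "real \<Rightarrow> 'a::metric_space set \<Rightarrow> ennreal" where
  "hausdorff_outer s A =
     (SUP \<delta>\<in>{0<..}. INF U\<in>{U :: nat \<Rightarrow> 'a set. A \<subseteq> (\<Union>i. U i) \<and>
          (\<forall>i. bounded (U i) \<and> diameter (U i) \<le> \<delta>)}.
        (\<Sum>i. ennreal (unit_ball_vol s * (diameter (U i) / 2) powr s)))"

definition hausdorff_measure :: "real \<Rightarrow> 'a::metric_space measure" where
  "hausdorff_measure s = measure_of UNIV (sets borel) (hausdorff_outer s)"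

definition surface_measure :: "'a::euclidean_space set \<Rightarrow> 'a measure" where
  "surface_measure \<Omega> =
     completion (restrict_space (hausdorff_measure (real DIM('a) - 1)) (frontier \<Omega>))"

text \<open>The trace operator from H1 to L2 of the boundary is the continuous extension of the
  restriction map on functions smooth up to the boundary.\<close>

definition has_trace :: "'a::euclidean_space set \<Rightarrow> ('a \<Rightarrow> real) \<Rightarrow> ('a \<Rightarrow> real) \<Rightarrow> bool" where
  "has_trace \<Omega> v h \<longleftrightarrow> v \<in> Hs_space 1 \<Omega> \<and> h \<in> Lp_space (surface_measure \<Omega>) 2 \<and>
     (\<exists>\<phi>. (\<forall>n. smooth (\<phi> n)) \<and>
        (\<lambda>n. Hs_norm 1 \<Omega> (\<lambda>x. \<phi> n x - v x)) \<longlonglongrightarrow> 0 \<and>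
        (\<lambda>n. Lp_norm (surface_measure \<Omega>) 2 (\<lambda>x. \<phi> n x - h x)) \<longlonglongrightarrow> 0)"

text \<open>The boundary space of order \<open>s\<close> is the trace space of order \<open>s + 1/2\<close> with its quotient
  norm.\<close>

definition Hs_bd_space :: "real \<Rightarrow> 'a::euclidean_space set \<Rightarrow> ('a \<Rightarrow> real) set" where
  "Hs_bd_space s \<Omega> = {h. \<exists>v\<in>Hs_space (s + 1/2) \<Omega>. has_trace \<Omega> v h}"

definition Hs_bd_norm :: "real \<Rightarrow> 'a::euclidean_space set \<Rightarrow> ('a \<Rightarrow> real) \<Rightarrow> real" where
  "Hs_bd_norm s \<Omega> h = (INF v\<in>{v \<in> Hs_space (s + 1/2) \<Omega>. has_trace \<Omega> v h}. Hs_norm (s + 1/2) \<Omega> v)"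


section \<open>Functions of time with values in function spaces\<close>

text \<open>
  Square integrable functions from \<open>J\<close> into a separable space \<open>X\<close> of (classes of) functions over
  the measure space \<open>M\<close>, with norm \<open>N\<close>. Measurability with values in \<open>X\<close> is rendered by joint
  measurability of the representative, which is equivalent for a suitable choice of
  representatives.
\<close>

definition L2_time ::
    "real set \<Rightarrow> 'b measure \<Rightarrow> ('b \<Rightarrow> real) set \<Rightarrow> (('b \<Rightarrow> real) \<Rightarrow> real) \<Rightarrow> (real \<Rightarrow> 'b \<Rightarrow> real) set"
  where
  "L2_time J M X N = {u.
     (\<lambda>(t, x). u t x) \<in> borel_measurable (completion (lebesgue_on J \<Otimes>\<^sub>M M)) \<and>
     (AE t in lebesgue_on J. u t \<in> X) \<and> integrable (lebesgue_on J) (\<lambda>t. (N (u t))\<^sup>2)}"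

definition L2_time_norm ::
    "real set \<Rightarrow> (('b \<Rightarrow> real) \<Rightarrow> real) \<Rightarrow> (real \<Rightarrow> 'b \<Rightarrow> real) \<Rightarrow> real" where
  "L2_time_norm J N u = sqrt (\<integral>t. (N (u t))\<^sup>2 \<partial>lebesgue_on J)"

definition L2Lp_space :: "real set \<Rightarrow> 'b measure \<Rightarrow> real \<Rightarrow> (real \<Rightarrow> 'b \<Rightarrow> real) set" where
  "L2Lp_space J M p = L2_time J M (Lp_space M p) (Lp_norm M p)"

definition L2Hs_space :: "real set \<Rightarrow> 'a::euclidean_space set \<Rightarrow> real \<Rightarrow> (real \<Rightarrow> 'a \<Rightarrow> real) set"
  where
  "L2Hs_space J \<Omega> s = L2_time J (lebesgue_on \<Omega>) (Hs_space s \<Omega>) (Hs_norm s \<Omega>)"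

definition L2Hs_bd_space ::
    "real set \<Rightarrow> 'a::euclidean_space set \<Rightarrow> real \<Rightarrow> (real \<Rightarrow> 'a \<Rightarrow> real) set" where
  "L2Hs_bd_space J \<Omega> s = L2_time J (surface_measure \<Omega>) (Hs_bd_space s \<Omega>) (Hs_bd_norm s \<Omega>)"

definition HthetaL2_space :: "real \<Rightarrow> real set \<Rightarrow> 'b measure \<Rightarrow> (real \<Rightarrow> 'b \<Rightarrow> real) set" where
  "HthetaL2_space \<theta> J M = {u \<in> L2Lp_space J M 2.
     integrable (lebesgue_on (J \<times> J))
       (\<lambda>(t, s). (Lp_norm M 2 (\<lambda>x. u t x - u s x))\<^sup>2 / \<bar>t - s\<bar> powr (1 + 2 * \<theta>))}"

text \<open>The weak time derivative in L2: the two vector-valued integrals agree as elements of L2,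
  that is, almost everywhere in \<open>M\<close>.\<close>

definition has_time_deriv ::
    "real set \<Rightarrow> 'b measure \<Rightarrow> (real \<Rightarrow> 'b \<Rightarrow> real) \<Rightarrow> (real \<Rightarrow> 'b \<Rightarrow> real) \<Rightarrow> bool" where
  "has_time_deriv J M u v \<longleftrightarrow> u \<in> L2Lp_space J M 2 \<and> v \<in> L2Lp_space J M 2 \<and>
     (\<forall>\<phi>\<in>test_functions J. AE x in M.
        (\<integral>t. deriv \<phi> t * u t x \<partial>lebesgue_on J) = - (\<integral>t. \<phi> t * v t x \<partial>lebesgue_on J))"

definition time_deriv :: "real set \<Rightarrow> 'b measure \<Rightarrow> (real \<Rightarrow> 'b \<Rightarrow> real) \<Rightarrow> real \<Rightarrow> 'b \<Rightarrow> real" where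
  "time_deriv J M u = (SOME v. has_time_deriv J M u v)"

definition H1L2_space :: "real set \<Rightarrow> 'b measure \<Rightarrow> (real \<Rightarrow> 'b \<Rightarrow> real) set" where
  "H1L2_space J M = {u. \<exists>v. has_time_deriv J M u v}"

text \<open>The initial value is that of the representative which is continuous from \<open>[0, T]\<close> to L2.\<close>

definition has_initial_value ::
    "real \<Rightarrow> 'b measure \<Rightarrow> (real \<Rightarrow> 'b \<Rightarrow> real) \<Rightarrow> ('b \<Rightarrow> real) \<Rightarrow> bool" where
  "has_initial_value T M u u0 \<longleftrightarrow>
     (\<exists>U. (\<forall>t\<in>{0..T}. U t \<in> Lp_space M 2) \<and>
        (\<forall>t\<in>{0..T}. ((\<lambda>s. Lp_norm M 2 (\<lambda>x. U s x - U t x)) \<longlongrightarrow> 0) (at t within {0..T})) \<and>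
        (AE t in lebesgue_on {0<..<T}. AE x in M. U t x = u t x) \<and>
        (AE x in M. U 0 x = u0 x))"


section \<open>The parabolic problem\<close>

definition admissible :: "'a::euclidean_space set \<Rightarrow> real \<Rightarrow> real \<Rightarrow> ('a \<Rightarrow> real) set" where
  "admissible \<Omega> qlow qup = {q \<in> Lp_space (lebesgue_on \<Omega>) 2.
     AE x in lebesgue_on \<Omega>. qlow \<le> q x \<and> q x \<le> qup}"

definition parabolic_solution ::
    "'a::euclidean_space set \<Rightarrow> real \<Rightarrow> ('a \<Rightarrow> real) \<Rightarrow> (real \<Rightarrow> 'a \<Rightarrow> real) \<Rightarrow> (real \<Rightarrow> 'a \<Rightarrow> real) \<Rightarrow>
     ('a \<Rightarrow> real) \<Rightarrow> ('a \<Rightarrow> real) \<Rightarrow> (real \<Rightarrow> 'a \<Rightarrow> real) \<Rightarrow> bool" where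
  "parabolic_solution \<Omega> T a f g u0 q u \<longleftrightarrow>
     u \<in> L2Hs_space {0<..<T} \<Omega> 2 \<and> u \<in> H1L2_space {0<..<T} (lebesgue_on \<Omega>) \<and>
     (AE t in lebesgue_on {0<..<T}. AE x in lebesgue_on \<Omega>.
        time_deriv {0<..<T} (lebesgue_on \<Omega>) u t x
          - weak_div \<Omega> (\<lambda>y. a y *\<^sub>R weak_grad \<Omega> (u t) y) x + q x * u t x = f t x) \<and>
     has_initial_value T (lebesgue_on \<Omega>) u u0 \<and>
     (AE t in lebesgue_on {0<..<T}. has_trace \<Omega> (u t) (g t))"

end

theory Submission
  imports Defs
begin

text \<open>
  Write \<open>w = u q - u qdag\<close>. The difference of the two equations reads
  \<open>w_t - div (a grad w) + q w = (qdag - q) u qdag\<close>. Testing it with \<open>\<eta>(t) \<phi>(x) / u qdag(t, x)\<close>,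
  where \<open>\<eta>\<close> is a bump supported in \<open>I\<close>, leaves the pairing of \<open>qdag - q\<close> with \<open>\<phi>\<close> on the right.
  On the left, \<open>w_t\<close> is moved in time onto \<open>\<eta> / u qdag\<close> and the elliptic part is integrated by
  parts in space. The products \<open>u_t(qdag) \<phi> w\<close> and \<open>\<phi> grad w \<bullet> grad (u qdag)\<close> that appear are
  controlled by the embedding of H1 into L4, valid for \<open>d \<le> 3\<close>, as \<open>u qdag\<close> is H2 in space and its
  time derivative is L2. Hence the pairing is bounded by the norm of \<open>w\<close> times the H1 norm of \<open>\<phi>\<close>,
  which the norm of order \<open>1 + \<epsilon>\<close> dominates.

  Since weak derivatives of arbitrary functions are hard to divide and multiply, a weak derivative
  is replaced throughout by the derivative of a representative along almost every segment; the L4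
  embedding follows by averaging such segments over the interior cones of the C2 domain.
\<close>

text \<open>The quotient by \<open>u qdag\<close> shapes the proof: its reciprocal has to be
  differentiated in space for the flux and in time for \<open>w_t\<close>, while
  \<open>u qdag\<close> has only weak derivatives. One calculus serves both, because a weak time
  derivative is a derivative in direction \<open>(1, 0)\<close> of space-time. Encoded by its
  integral along segments, a derivative passes to reciprocals and products by comparing difference
  quotients, and each limit of vanishing step is replaced by an error bound quadratic in the step.
  All functions are first exchanged for Borel functions on the whole space that vanish off the
  domain, which can be translated and put under Fubini freely. The test function is compactly
  supported in space and time, so no boundary terms arise. At a fixed time the estimate costs the H1
  norm of \<open>w t\<close> times one plus the H2 norm of \<open>u qdag t\<close> plus the L2 norm
  of its time derivative. The second factor is square integrable in time, so Cauchy-Schwarz in time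
  leaves exactly the norm of \<open>w\<close> on the right.\<close>

section \<open>Square-integrable Borel functions on the whole space\<close>

definition sq_int :: "('a::euclidean_space \<Rightarrow> real) \<Rightarrow> bool" where
  "sq_int f \<longleftrightarrow> f \<in> borel_measurable borel \<and> integrable lborel (\<lambda>x. (f x)\<^sup>2)"

definition nrm2 :: "('a::euclidean_space \<Rightarrow> real) \<Rightarrow> real" where
  "nrm2 f = sqrt (\<integral>x. (f x)\<^sup>2 \<partial>lborel)"

lemma sq_int_measurable [measurable_dest]: "sq_int f \<Longrightarrow> f \<in> borel_measurable borel"
  by (simp add: sq_int_def)

lemma nrm2_nonneg [simp]: "0 \<le> nrm2 f"
  by (simp add: nrm2_def)

lemma nrm2_power2: "(nrm2 f)\<^sup>2 = (\<integral>x. (f x)\<^sup>2 \<partial>lborel)"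
  by (simp add: nrm2_def)

lemma two_mult_le: "2 * \<bar>x * y\<bar> \<le> x\<^sup>2 + (y::real)\<^sup>2"
  using sum_squares_bound[of "\<bar>x\<bar>" "\<bar>y\<bar>"] by (simp add: abs_mult mult.assoc)

lemma integrable_mult_L2:
  fixes f g :: "'b \<Rightarrow> real"
  assumes [measurable]: "f \<in> borel_measurable M" "g \<in> borel_measurable M"
    and "integrable M (\<lambda>x. (f x)\<^sup>2)" "integrable M (\<lambda>x. (g x)\<^sup>2)"
  shows "integrable M (\<lambda>x. f x * g x)"
proof (rule Bochner_Integration.integrable_bound[OF Bochner_Integration.integrable_add[OF assms(3,4)]])
  show "AE x in M. norm (f x * g x) \<le> norm ((f x)\<^sup>2 + (g x)\<^sup>2)"
    using two_mult_le by (intro AE_I2) (smt (verit) real_norm_def)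
qed measurable

text \<open>The integral of the square of \<open>c * f x - d * g x\<close> is a nonnegative
  quadratic form in \<open>c\<close> and \<open>d\<close>, and evaluating it at suitable points
  gives the bound.\<close>

lemma Cauchy_Schwarz_integral:
  fixes f g :: "'b \<Rightarrow> real"
  assumes [measurable]: "f \<in> borel_measurable M" "g \<in> borel_measurable M"
    and f: "integrable M (\<lambda>x. (f x)\<^sup>2)" and g: "integrable M (\<lambda>x. (g x)\<^sup>2)"
  shows "\<bar>\<integral>x. f x * g x \<partial>M\<bar> \<le> sqrt (\<integral>x. (f x)\<^sup>2 \<partial>M) * sqrt (\<integral>x. (g x)\<^sup>2 \<partial>M)"
proof -
  have fg: "integrable M (\<lambda>x. f x * g x)" by (rule integrable_mult_L2) fact+
  define A B C where "A = (\<integral>x. (f x)\<^sup>2 \<partial>M)" and "B = (\<integral>x. (g x)\<^sup>2 \<partial>M)" and "C = (\<integral>x. f x * g x \<partial>M)"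
  have "0 \<le> A" "0 \<le> B" by (auto simp: A_def B_def)
  have pos: "0 \<le> c\<^sup>2 * A - 2 * c * d * C + d\<^sup>2 * B" for c d
  proof -
    have "0 \<le> (\<integral>x. (c * f x - d * g x)\<^sup>2 \<partial>M)" by simp
    also have "(\<lambda>x. (c * f x - d * g x)\<^sup>2) = (\<lambda>x. c\<^sup>2 * (f x)\<^sup>2 - 2 * c * d * (f x * g x) + d\<^sup>2 * (g x)\<^sup>2)"
      by (auto simp: power2_eq_square algebra_simps)
    also have "(\<integral>x. c\<^sup>2 * (f x)\<^sup>2 - 2 * c * d * (f x * g x) + d\<^sup>2 * (g x)\<^sup>2 \<partial>M) = c\<^sup>2 * A - 2 * c * d * C + d\<^sup>2 * B"
      using f g fg by (simp add: A_def B_def C_def)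
    finally show ?thesis .
  qed
  have "C\<^sup>2 \<le> A * B"
  proof (cases "A = 0")
    case True
    show ?thesis
    proof (cases "C = 0")
      case False
      \<comment> \<open>With \<open>A = 0\<close> the form is affine in \<open>c\<close>; this
        \<open>c\<close> would give it the value -1.\<close>
      have "0 \<le> - (B + 1) + B" 
        using pos[of "(B + 1) / (2 * C)" 1] True False by simp
      then show ?thesis by simp
    qed (use True in simp)
  next
    case False
    with \<open>0 \<le> A\<close> have "A > 0" by simp
    \<comment> \<open>The choice \<open>c = C\<close>, \<open>d = A\<close> is the minimising
      ratio.\<close>
    have "0 \<le> C\<^sup>2 * A - 2 * C * A * C + A\<^sup>2 * B" by (rule pos)
    also have "\<dots> = A * (A * B - C\<^sup>2)" by (simp add: power2_eq_square algebra_simps)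
    finally show ?thesis using \<open>A > 0\<close> by (simp add: zero_le_mult_iff)
  qed
  then have "\<bar>C\<bar> \<le> sqrt (A * B)" by (simp add: real_le_rsqrt)
  then show ?thesis by (simp add: A_def B_def C_def real_sqrt_mult)
qed

lemma sq_int_mult: "sq_int f \<Longrightarrow> sq_int g \<Longrightarrow> integrable lborel (\<lambda>x. f x * g x)"
  unfolding sq_int_def by (intro integrable_mult_L2) auto

lemma abs_integral_mult_le: "sq_int f \<Longrightarrow> sq_int g \<Longrightarrow> \<bar>\<integral>x. f x * g x \<partial>lborel\<bar> \<le> nrm2 f * nrm2 g"
  unfolding sq_int_def nrm2_def by (intro Cauchy_Schwarz_integral) auto

lemma sq_intI_bound:
  assumes "sq_int g" and [measurable]: "f \<in> borel_measurable borel" and "\<And>x. \<bar>f x\<bar> \<le> \<bar>g x\<bar>"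
  shows "sq_int f" "nrm2 f \<le> nrm2 g"
proof -
  have *: "(f x)\<^sup>2 \<le> (g x)\<^sup>2" for x using assms(3)[of x] by (simp add: abs_le_square_iff)
  have g: "integrable lborel (\<lambda>x. (g x)\<^sup>2)" using assms(1) by (simp add: sq_int_def)
  have i: "integrable lborel (\<lambda>x. (f x)\<^sup>2)"
    by (rule Bochner_Integration.integrable_bound[OF g]) (use * in auto)
  then show "sq_int f" by (simp add: sq_int_def)
  show "nrm2 f \<le> nrm2 g" unfolding nrm2_def using i g * by (intro real_sqrt_le_mono integral_mono) auto
qed

lemma sq_int_zero [simp]: "sq_int (\<lambda>x. 0)" by (simp add: sq_int_def)

lemma sq_int_cmult: "sq_int f \<Longrightarrow> sq_int (\<lambda>x. c * f x)"
  by (auto simp: sq_int_def power_mult_distrib)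

lemma nrm2_cmult: "nrm2 (\<lambda>x. c * f x) = \<bar>c\<bar> * nrm2 f"
  by (simp add: nrm2_def power_mult_distrib real_sqrt_mult)

lemma sq_int_add:
  assumes "sq_int f" "sq_int g" shows "sq_int (\<lambda>x. f x + g x)"
proof -
  have [measurable]: "f \<in> borel_measurable borel" "g \<in> borel_measurable borel"
    using assms by (auto simp: sq_int_def)
  have "integrable lborel (\<lambda>x. (f x)\<^sup>2 + 2 * (f x * g x) + (g x)\<^sup>2)"
    using assms sq_int_mult[OF assms] by (auto simp: sq_int_def)
  also have "(\<lambda>x. (f x)\<^sup>2 + 2 * (f x * g x) + (g x)\<^sup>2) = (\<lambda>x. (f x + g x)\<^sup>2)"
    by (auto simp: power2_eq_square algebra_simps)
  finally show ?thesis by (simp add: sq_int_def)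
qed

lemma sq_int_minus: "sq_int f \<Longrightarrow> sq_int (\<lambda>x. - f x)"
  using sq_int_cmult[of f "-1"] by simp

lemma sq_int_diff: "sq_int f \<Longrightarrow> sq_int g \<Longrightarrow> sq_int (\<lambda>x. f x - g x)"
  using sq_int_add[of f "\<lambda>x. - g x"] sq_int_minus[of g] by simp

lemma sq_int_sum: "(\<And>i. i \<in> A \<Longrightarrow> sq_int (f i)) \<Longrightarrow> sq_int (\<lambda>x. \<Sum>i\<in>A. f i x)"
  by (induction A rule: infinite_finite_induct) (auto intro: sq_int_add)

lemma sq_int_abs: "sq_int f \<Longrightarrow> sq_int (\<lambda>x. \<bar>f x\<bar>)"
  by (auto simp: sq_int_def)

lemma nrm2_triangle:
  assumes "sq_int f" "sq_int g"
  shows "nrm2 (\<lambda>x. f x + g x) \<le> nrm2 f + nrm2 g"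
proof (rule power2_le_imp_le)
  have i: "integrable lborel (\<lambda>x. (f x)\<^sup>2)" "integrable lborel (\<lambda>x. (g x)\<^sup>2)" using assms by (auto simp: sq_int_def)
  have "(nrm2 (\<lambda>x. f x + g x))\<^sup>2 = (\<integral>x. (f x)\<^sup>2 + 2 * (f x * g x) + (g x)\<^sup>2 \<partial>lborel)"
    unfolding nrm2_power2 by (simp add: power2_eq_square algebra_simps)
  also have "\<dots> = (nrm2 f)\<^sup>2 + 2 * (\<integral>x. f x * g x \<partial>lborel) + (nrm2 g)\<^sup>2"
    using i sq_int_mult[OF assms] by (simp add: nrm2_power2)
  also have "\<dots> \<le> (nrm2 f)\<^sup>2 + 2 * (nrm2 f * nrm2 g) + (nrm2 g)\<^sup>2"
    using abs_integral_mult_le[OF assms] by simp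
  finally show "(nrm2 (\<lambda>x. f x + g x))\<^sup>2 \<le> (nrm2 f + nrm2 g)\<^sup>2"
    by (simp add: power2_eq_square algebra_simps)
qed simp

lemma integral_translation:
  fixes f :: "'a::euclidean_space \<Rightarrow> real"
  assumes [measurable]: "f \<in> borel_measurable borel"
  shows "(\<integral>x. f (x + c) \<partial>lborel) = (\<integral>x. f x \<partial>lborel)"
proof -
  have "(\<integral>x. f x \<partial>lborel) = (\<integral>x. f x \<partial>distr lborel borel ((+) c))" by (simp add: lborel_distr_plus)
  also have "\<dots> = (\<integral>x. f (x + c) \<partial>lborel)" by (subst integral_distr) (auto simp: add.commute)
  finally show ?thesis ..
qed

lemma integrable_translation:
  fixes f :: "'a::euclidean_space \<Rightarrow> real"
  assumes "integrable lborel f"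
  shows "integrable lborel (\<lambda>x. f (x + c))"
proof -
  have [measurable]: "f \<in> borel_measurable borel" using assms by auto
  have "integrable (distr lborel borel ((+) c)) f" by (simp add: lborel_distr_plus assms)
  then show ?thesis by (subst (asm) integrable_distr_eq) (auto simp: add.commute)
qed

lemma nn_integral_translation:
  fixes f :: "'a::euclidean_space \<Rightarrow> ennreal"
  assumes [measurable]: "f \<in> borel_measurable borel"
  shows "(\<integral>\<^sup>+x. f (x + c) \<partial>lborel) = (\<integral>\<^sup>+x. f x \<partial>lborel)"
proof -
  have "(\<integral>\<^sup>+x. f x \<partial>lborel) = (\<integral>\<^sup>+x. f x \<partial>distr lborel borel ((+) c))" by (simp add: lborel_distr_plus)
  also have "\<dots> = (\<integral>\<^sup>+x. f (x + c) \<partial>lborel)" by (subst nn_integral_distr) (auto simp: add.commute)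
  finally show ?thesis ..
qed

text \<open>The exceptional set is first enlarged to a measurable null set, because transport along
  \<open>distr\<close> needs a measurable predicate.\<close>

lemma AE_translation:
  fixes P :: "'a::euclidean_space \<Rightarrow> bool"
  assumes "AE x in lborel. P x"
  shows "AE x in lborel. P (x + c)"
proof -
  obtain N where N: "{x. \<not> P x} \<subseteq> N" "N \<in> null_sets lborel"
    using AE_E[OF assms] by (metis (no_types, lifting) null_setsI space_borel space_lborel UNIV_I Collect_cong)
  have "AE x in lborel. x \<notin> N" using N(2) by (rule AE_not_in)
  then have "AE x in distr lborel borel ((+) c). x \<notin> N" by (subst lborel_distr_plus)
  then have "AE x in lborel. x + c \<notin> N" using N(2) by (subst (asm) AE_distr_iff) (auto simp: add.commute)
  then show ?thesis using N(1) by auto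
qed

lemma sq_int_translation: "sq_int f \<Longrightarrow> sq_int (\<lambda>x. f (x + c))"
  unfolding sq_int_def using integrable_translation[of "\<lambda>x. (f x)\<^sup>2" c] by auto

lemma sq_int_translation_minus: "sq_int f \<Longrightarrow> sq_int (\<lambda>x. f (x - c))"
  using sq_int_translation[of f "- c"] by simp

lemma sq_int_imp_set_integrable:
  fixes f :: "'a::euclidean_space \<Rightarrow> real"
  assumes "sq_int f" and [measurable]: "A \<in> sets borel" and "emeasure lborel A < \<infinity>"
  shows "integrable lborel (\<lambda>x. indicator A x * f x)"
proof -
  have "sq_int (indicator A :: 'a \<Rightarrow> real)" using assms(3)
    using integrable_real_indicator[of A lborel] by (simp add: sq_int_def power2_eq_square flip: indicator_inter_arith)
  from sq_int_mult[OF this assms(1)] show ?thesis .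
qed

lemma continuous_compact_support_bounded:
  fixes \<phi> :: "'a::euclidean_space \<Rightarrow> real"
  assumes "continuous_on UNIV \<phi>" "compact K" "\<And>x. x \<notin> K \<Longrightarrow> \<phi> x = 0"
  obtains B where "0 \<le> B" "\<And>x. \<bar>\<phi> x\<bar> \<le> B"
proof -
  have "compact (\<phi> ` K)" using assms by (intro compact_continuous_image) (auto intro: continuous_on_subset)
  then have "bounded (\<phi> ` K)" by (rule compact_imp_bounded)
  then obtain B where B: "\<And>x. x \<in> K \<Longrightarrow> \<bar>\<phi> x\<bar> \<le> B" by (auto simp: bounded_real)
  have "\<bar>\<phi> x\<bar> \<le> max B 0" for x using B[of x] assms(3)[of x] by (cases "x \<in> K") auto
  then show thesis using that[of "max B 0"] by auto
qed

lemma sq_int_continuous_compact_support: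
  fixes \<phi> :: "'a::euclidean_space \<Rightarrow> real"
  assumes c: "continuous_on UNIV \<phi>" and K: "compact K" "\<And>x. x \<notin> K \<Longrightarrow> \<phi> x = 0"
  shows "sq_int \<phi>"
proof -
  have [measurable]: "\<phi> \<in> borel_measurable borel" using c by (rule borel_measurable_continuous_onI)
  have "integrable lborel (\<lambda>x. indicator K x *\<^sub>R (\<phi> x)\<^sup>2)"
    using K by (intro borel_integrable_compact continuous_intros continuous_on_subset[OF c]) auto
  moreover have "(\<lambda>x. indicator K x *\<^sub>R (\<phi> x)\<^sup>2) = (\<lambda>x. (\<phi> x)\<^sup>2)" using K(2) by (auto simp: indicator_def fun_eq_iff)
  ultimately show ?thesis by (simp add: sq_int_def)
qed

section \<open>Smooth bump functions\<close>

lemma has_derivative_pderivative: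
  assumes "f differentiable at x"
  shows "(f has_derivative (\<lambda>h. \<Sum>i\<in>Basis. (h \<bullet> i) * pderivative i f x)) (at x)"
proof -
  have d: "(f has_derivative frechet_derivative f (at x)) (at x)" using assms by (simp add: frechet_derivative_works)
  then have l: "linear (frechet_derivative f (at x))" by (rule has_derivative_linear)
  have "frechet_derivative f (at x) h = (\<Sum>i\<in>Basis. (h \<bullet> i) * pderivative i f x)" for h
  proof -
    have "frechet_derivative f (at x) h = frechet_derivative f (at x) (\<Sum>i\<in>Basis. (h \<bullet> i) *\<^sub>R i)"
      by (simp add: euclidean_representation)
    also have "\<dots> = (\<Sum>i\<in>Basis. frechet_derivative f (at x) ((h \<bullet> i) *\<^sub>R i))" by (rule linear_sum[OF l])
    finally show ?thesis by (simp add: linear_scale[OF l] pderivative_def)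
  qed
  then have "frechet_derivative f (at x) = (\<lambda>h. \<Sum>i\<in>Basis. (h \<bullet> i) * pderivative i f x)" ..
  with d show ?thesis by simp
qed

lemma pderivativeI: "(f has_derivative f') (at x) \<Longrightarrow> pderivative i f x = f' i"
  using frechet_derivative_at[of f f' x] by (simp add: pderivative_def)

lemma C_k_differentiable: "C_k (Suc k) f \<Longrightarrow> f differentiable at x"
  by simp

lemma C_k_continuous: "C_k k f \<Longrightarrow> continuous_on UNIV f"
  by (cases k) (auto intro!: differentiable_imp_continuous_on simp: differentiable_on_def)

lemma C_k_Suc_imp: "C_k (Suc k) f \<Longrightarrow> C_k k f"
proof (induction k arbitrary: f)
  case 0
  then show ?case using C_k_continuous[of "Suc 0" f] by simp
next
  case (Suc k)
  then show ?case by (metis C_k.simps(2))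
qed

lemma C_k_const: "C_k k (\<lambda>x. c)"
proof (induction k arbitrary: c)
  case (Suc k)
  have "pderivative i (\<lambda>x. c) = (\<lambda>x. 0)" for i :: 'a
    by (rule ext, rule pderivativeI) (rule has_derivative_const)
  with Suc show ?case by simp
qed simp

lemma C_k_add: "C_k k f \<Longrightarrow> C_k k g \<Longrightarrow> C_k k (\<lambda>x. f x + g x)"
proof (induction k arbitrary: f g)
  case (Suc k)
  have "pderivative i (\<lambda>x. f x + g x) = (\<lambda>x. pderivative i f x + pderivative i g x)" for i
    using Suc.prems by (intro ext pderivativeI)
      (auto simp: pderivative_def frechet_derivative_works intro!: has_derivative_add)
  with Suc show ?case by (auto intro!: differentiable_add)
qed (simp add: continuous_on_add continuous_on_mult)

lemma pderivative_mult:
  assumes "f differentiable at x" "g differentiable at x"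
  shows "pderivative i (\<lambda>x. f x * g x) x = f x * pderivative i g x + pderivative i f x * g x"
proof -
  have "((\<lambda>x. f x * g x) has_derivative
      (\<lambda>h. f x * frechet_derivative g (at x) h + frechet_derivative f (at x) h * g x)) (at x)"
    using assms by (intro has_derivative_mult) (auto simp: frechet_derivative_works)
  from pderivativeI[OF this] show ?thesis by (simp add: pderivative_def)
qed

lemma C_k_mult: "C_k k f \<Longrightarrow> C_k k g \<Longrightarrow> C_k k (\<lambda>x. f x * g x)"
proof (induction k arbitrary: f g)
  case (Suc k)
  have "pderivative i (\<lambda>x. f x * g x) = (\<lambda>x. f x * pderivative i g x + pderivative i f x * g x)" for i
    using Suc.prems by (intro ext pderivative_mult) auto
  moreover have "C_k k (\<lambda>x. f x * pderivative i g x + pderivative i f x * g x)" if "i \<in> Basis" for i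
    using Suc.prems C_k_Suc_imp that by (intro C_k_add Suc.IH) auto
  ultimately show ?case using Suc.prems by (auto intro!: differentiable_mult)
qed (simp add: continuous_on_add continuous_on_mult)

lemma C_k_prod: "(\<And>i. i \<in> A \<Longrightarrow> C_k k (f i)) \<Longrightarrow> C_k k (\<lambda>x. \<Prod>i\<in>A. f i x)"
  by (induction A rule: infinite_finite_induct) (auto intro: C_k_const C_k_mult)

text \<open>For \<open>k = 0\<close> this is the standard smooth function vanishing to infinite
  order at 0. The powers \<open>y ^ k\<close> in the denominator make the family closed under
  differentiation up to linear combinations.\<close>

definition flat :: "nat \<Rightarrow> real \<Rightarrow> real" where
  "flat k y = (if y \<le> 0 then 0 else exp (- 1 / y) / y ^ k)"

lemma flat_nonneg: "0 \<le> flat k y"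
  by (simp add: flat_def)

text \<open>Keeping only the term of order \<open>k + 2\<close> of the series of
  \<open>exp (1 / y)\<close> absorbs the pole \<open>1 / y ^ k\<close> and leaves two powers of
  \<open>y\<close>. Two are what the derivative at 0 needs in order to vanish.\<close>

lemma flat_le: "flat k y \<le> fact (k + 2) * y\<^sup>2"
proof (cases "y > 0")
  case True
  have "(1 / y) ^ (k + 2) / fact (k + 2) \<le> exp (1 / y)"
  proof -
    have "(\<Sum>n\<in>{k+2}. (1 / y) ^ n /\<^sub>R fact n) \<le> (\<Sum>n. (1 / y) ^ n /\<^sub>R fact n)"
      using True by (intro sum_le_suminf summable_exp_generic) auto
    then show ?thesis by (simp add: exp_def divide_inverse mult.commute)
  qed
  moreover define c :: real where "c = fact (k + 2)"
  ultimately have "(1 / y) ^ (k + 2) / c \<le> exp (1 / y)" "c > 0" by (auto simp: c_def simp del: fact_Suc)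
  then have "1 \<le> c * y ^ (k + 2) * exp (1 / y)"
    using True by (simp add: field_simps power_divide)
  then have "exp (- 1 / y) \<le> c * y ^ (k + 2)"
    using True by (simp add: exp_minus field_simps)
  then show ?thesis using True unfolding c_def[symmetric] by (simp add: flat_def field_simps power_add power2_eq_square)
next
  case False
  then show ?thesis by (simp add: flat_def)
qed

lemma flat_le_1: "flat 0 y \<le> 1"
  by (simp add: flat_def)

lemma flat_pos_iff: "flat k y \<noteq> 0 \<longleftrightarrow> 0 < y"
  by (simp add: flat_def)

lemma flat_has_derivative:
  "(flat k has_real_derivative flat (k + 2) y - real k * flat (k + 1) y) (at y)"
proof -
  consider "y < 0" | "y = 0" | "y > 0" by linarith
  then show ?thesis
  proof cases
    case 1
    have "((\<lambda>y. 0) has_real_derivative flat (k + 2) y - real k * flat (k + 1) y) (at y)"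
      using 1 by (auto simp: flat_def)
    then show ?thesis
      by (rule has_field_derivative_transform_within_open[where S = "{..<0}"]) (use 1 in \<open>auto simp: flat_def\<close>)
  next
    case 3
    have "((\<lambda>y. exp (- 1 / y) / y ^ k) has_real_derivative
        (exp (- 1 / y) * (1 / y\<^sup>2) * y ^ k - exp (- 1 / y) * (real k * y ^ (k - 1))) / (y ^ k * y ^ k)) (at y)"
      using 3 by (auto intro!: derivative_eq_intros simp: power2_eq_square)
    also have "(exp (- 1 / y) * (1 / y\<^sup>2) * y ^ k - exp (- 1 / y) * (real k * y ^ (k - 1))) / (y ^ k * y ^ k)
      = flat (k + 2) y - real k * flat (k + 1) y"
      using 3 by (cases k) (auto simp: flat_def field_simps power2_eq_square)
    finally show ?thesis
      by (rule has_field_derivative_transform_within_open[where S = "{0<..}"]) (use 3 in \<open>auto simp: flat_def\<close>)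
  next
    case 2
    \<comment> \<open>One of the two powers in \<open>flat_le\<close> cancels the denominator and
      the other one tends to 0.\<close>
    have "((\<lambda>h. flat k h / h) \<longlongrightarrow> 0) (at 0)"
    proof (rule Lim_null_comparison)
      show "\<forall>\<^sub>F h in at 0. norm (flat k h / h) \<le> fact (k + 2) * \<bar>h\<bar>"
      proof (rule always_eventually, rule allI)
        fix h :: real
        define c :: real where "c = fact (k + 2)"
        have "flat k h \<le> c * (\<bar>h\<bar> * \<bar>h\<bar>)" using flat_le[of k h] by (simp add: c_def power2_eq_square)
        then show "norm (flat k h / h) \<le> fact (k + 2) * \<bar>h\<bar>"
          unfolding c_def[symmetric] using flat_nonneg[of k h]
          by (cases "h = 0") (auto simp: field_simps)
      qed
      show "((\<lambda>h::real. fact (k + 2) * \<bar>h\<bar>) \<longlongrightarrow> 0) (at 0)"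
        by (intro tendsto_mult_right_zero tendsto_rabs_zero tendsto_ident_at)
    qed
    then show ?thesis using 2 by (simp add: DERIV_def flat_def)
  qed
qed

text \<open>Induction on the order \<open>m\<close> with \<open>k\<close> arbitrary, since one
  derivative raises the index \<open>k\<close> by 1 and by 2.\<close>

lemma C_k_flat_affine: "C_k m (\<lambda>x. flat k (c * (x \<bullet> j) + d))"
proof (induction m arbitrary: k)
  case 0
  have c: "continuous_on UNIV (flat k)"
    by (intro continuous_at_imp_continuous_on ballI DERIV_isCont[OF flat_has_derivative])
  have "continuous_on UNIV (\<lambda>x. c * (x \<bullet> j) + d)" by (intro continuous_intros)
  then have "continuous_on UNIV (\<lambda>x. flat k (c * (x \<bullet> j) + d))" by (rule continuous_on_compose2[OF c]) simp
  then show ?case by simp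
next
  case (Suc m)
  have d: "((\<lambda>x. flat k (c * (x \<bullet> j) + d)) has_derivative
      (\<lambda>h. (c * (h \<bullet> j)) * (flat (k + 2) (c * (x \<bullet> j) + d) - real k * flat (k + 1) (c * (x \<bullet> j) + d)))) (at x)" for x
  proof -
    have "((\<lambda>x. c * (x \<bullet> j) + d) has_derivative (\<lambda>h. c * (h \<bullet> j))) (at x)"
      by (auto intro!: derivative_eq_intros)
    from DERIV_compose_FDERIV[OF flat_has_derivative this] show ?thesis by (simp add: mult.commute)
  qed
  have "pderivative i (\<lambda>x. flat k (c * (x \<bullet> j) + d))
     = (\<lambda>x. (c * (i \<bullet> j)) * flat (k + 2) (c * (x \<bullet> j) + d) + (- (c * (i \<bullet> j) * real k)) * flat (k + 1) (c * (x \<bullet> j) + d))" for i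
    by (rule ext, subst pderivativeI[OF d]) (simp add: algebra_simps)
  moreover have "C_k m (\<lambda>x. (c * (i \<bullet> j)) * flat (k + 2) (c * (x \<bullet> j) + d) + (- (c * (i \<bullet> j) * real k)) * flat (k + 1) (c * (x \<bullet> j) + d))" for i
    by (intro C_k_add C_k_mult C_k_const Suc.IH)
  moreover have "(\<lambda>x. flat k (c * (x \<bullet> j) + d)) differentiable at x" for x
    unfolding differentiable_def by (rule exI) (rule d)
  ultimately show ?case by (simp only: C_k.simps) simp
qed

text \<open>A product over coordinates, so that bumps on a product space factor into bumps on its
  components. Larger \<open>n\<close> steepens the edges; \<open>Suc n\<close> keeps the slope
  nonzero for \<open>n = 0\<close>.\<close>

definition bump :: "'a::euclidean_space \<Rightarrow> 'a \<Rightarrow> nat \<Rightarrow> 'a \<Rightarrow> real" where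
  "bump a b n x = (\<Prod>i\<in>Basis. flat 0 (real (Suc n) * (x \<bullet> i - a \<bullet> i)) * flat 0 (real (Suc n) * (b \<bullet> i - x \<bullet> i)))"

lemma smooth_bump: "smooth (bump a b n)"
  unfolding smooth_def
proof
  fix k
  have "C_k k (\<lambda>x. \<Prod>i\<in>Basis. flat 0 (real (Suc n) * (x \<bullet> i) + (- real (Suc n) * (a \<bullet> i))) *
         flat 0 ((- real (Suc n)) * (x \<bullet> i) + real (Suc n) * (b \<bullet> i)))"
    by (intro C_k_prod C_k_mult C_k_flat_affine)
  also have "(\<lambda>x. \<Prod>i\<in>Basis. flat 0 (real (Suc n) * (x \<bullet> i) + (- real (Suc n) * (a \<bullet> i))) *
         flat 0 ((- real (Suc n)) * (x \<bullet> i) + real (Suc n) * (b \<bullet> i))) = bump a b n"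
    by (rule ext) (simp add: bump_def algebra_simps)
  finally show "C_k k (bump a b n)" .
qed

lemma bump_nonzero_iff: "bump a b n x \<noteq> 0 \<longleftrightarrow> x \<in> box a b"
  by (auto simp: bump_def flat_pos_iff mem_box zero_less_mult_iff)

lemma bump_eq_0: "x \<notin> cbox a b \<Longrightarrow> bump a b n x = 0"
  using bump_nonzero_iff[of a b n x] box_subset_cbox by blast

lemma bump_nonneg: "0 \<le> bump a b n x"
  unfolding bump_def by (intro prod_nonneg mult_nonneg_nonneg flat_nonneg)

lemma bump_le_1: "bump a b n x \<le> 1"
  unfolding bump_def by (intro prod_le_1 conjI mult_nonneg_nonneg mult_le_one flat_nonneg flat_le_1)

lemma smooth_imp_continuous: "smooth f \<Longrightarrow> continuous_on UNIV f"
  unfolding smooth_def using C_k.simps(1) by blast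

lemma smooth_imp_differentiable: "smooth f \<Longrightarrow> f differentiable at x"
  unfolding smooth_def using C_k_differentiable by blast

lemma smooth_pderivative: "smooth f \<Longrightarrow> i \<in> Basis \<Longrightarrow> smooth (pderivative i f)"
  unfolding smooth_def by (metis C_k.simps(2))

lemma bump_test_function: "cbox a b \<subseteq> D \<Longrightarrow> bump a b n \<in> test_functions D"
proof -
  assume ab: "cbox a b \<subseteq> D"
  have "closure {x. bump a b n x \<noteq> 0} \<subseteq> cbox a b"
    using bump_eq_0 by (intro closure_minimal) auto
  moreover from this have "compact (closure {x. bump a b n x \<noteq> 0})"
    using bounded_subset[OF bounded_cbox] closure_subset by (metis compact_closure order_trans)
  ultimately show ?thesis using ab smooth_bump by (auto simp: test_functions_def)
qed

text \<open>Inside the open box every factor tends to \<open>exp 0\<close>; outside it the value is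
  0 for every \<open>n\<close>.\<close>

lemma bump_tendsto: "(\<lambda>n. bump a b n x) \<longlonglongrightarrow> indicator (box a b) x"
proof (cases "x \<in> box a b")
  case True
  have lim: "(\<lambda>n. flat 0 (real (Suc n) * y)) \<longlonglongrightarrow> 1" if "y > 0" for y
  proof -
    have "(\<lambda>n. exp (- inverse (real (Suc n)) * inverse y)) \<longlonglongrightarrow> exp (- 0 * inverse y)"
      by (intro tendsto_intros LIMSEQ_inverse_real_of_nat)
    moreover have "exp (- inverse (real (Suc n)) * inverse y) = flat 0 (real (Suc n) * y)" for n
      using that by (simp add: flat_def divide_inverse mult_le_0_iff del: of_nat_Suc)
    ultimately show ?thesis by simp
  qed
  have "(\<lambda>n. bump a b n x) \<longlonglongrightarrow> (\<Prod>i\<in>(Basis::'a set). 1 * 1)"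
    unfolding bump_def using True by (intro tendsto_prod tendsto_mult lim) (auto simp: mem_box)
  with True show ?thesis by simp
next
  case False
  then have "bump a b n x = 0" for n using bump_nonzero_iff by blast
  with False show ?thesis by simp
qed

lemma bump_translation: "bump a b n (x - c) = bump (a + c) (b + c) n x"
  by (simp add: bump_def inner_simps algebra_simps)

section \<open>The fundamental lemma of the calculus of variations\<close>

text \<open>Boxes form an intersection-stable generator of the Borel sets, so the vanishing of the
  integral spreads to all Borel sets by a Dynkin argument, and a density with all integrals zero is
  zero. The total integral is a separate assumption because the whole space is not a box, and
  complements need it.\<close>

lemma integral_box_zero_imp_AE_zero:
  fixes G :: "'a::euclidean_space \<Rightarrow> real"
  assumes G: "integrable lborel G" and box: "\<And>c d. (\<integral>x. indicator (box c d) x * G x \<partial>lborel) = 0"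
    and G0: "(\<integral>x. G x \<partial>lborel) = 0"
  shows "AE x in lborel. G x = 0"
proof -
  have *: "set_lebesgue_integral lborel A G = 0" if "A \<in> sets lborel" for A
  proof -
  from that
  have A: "A \<in> sigma_sets UNIV (range (\<lambda>(a, b). box a b))"
    by (simp add: borel_eq_box)
  have sub: "range (\<lambda>(a, b). box a b :: 'a set) \<subseteq> Pow UNIV" by simp
  have "Int_stable (range (\<lambda>(a, b). box a b :: 'a set))"
    by (auto simp: Int_stable_def box_Int_box)
  then show "set_lebesgue_integral lborel A G = 0" using sub A
  proof (induction rule: sigma_sets_induct_disjoint)
    case (basic A)
    then show ?case using box by (auto simp: set_lebesgue_integral_def)
  next
    case empty
    then show ?case by (simp add: set_lebesgue_integral_def)
  next
    case (compl A)
    then have [measurable]: "A \<in> sets borel" by (simp add: borel_eq_box)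
    have "(\<integral>x. indicator A x * G x \<partial>lborel) = 0" using compl by (simp add: set_lebesgue_integral_def)
    moreover have "(\<integral>x. indicator (UNIV - A) x * G x \<partial>lborel) = (\<integral>x. G x - indicator A x * G x \<partial>lborel)"
      by (intro Bochner_Integration.integral_cong) (auto simp: indicator_def)
    moreover have "integrable lborel (\<lambda>x. indicator A x * G x)"
      using integrable_mult_indicator[of A lborel G] G by simp
    ultimately show ?case using G0 G by (simp add: set_lebesgue_integral_def)
  next
    case (union A)
    then have m: "A i \<in> sets lborel" for i by (auto simp: borel_eq_box)
    have int: "set_integrable lborel (\<Union>i. A i) G"
      unfolding set_integrable_def using m G by (intro integrable_mult_indicator sets.countable_UN) auto
    have disj: "\<And>i j. i \<noteq> j \<Longrightarrow> A i \<inter> A j = {}" using union(1) by (auto simp: disjoint_family_on_def)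
    have "set_lebesgue_integral lborel (\<Union>i. A i) G = (\<Sum>i. set_lebesgue_integral lborel (A i) G)"
      by (rule lebesgue_integral_countable_add[OF m disj int])
    with union show ?case by simp
  qed
  qed
  then show ?thesis using density_unique_real[OF G, of "\<lambda>_. 0"] by (simp add: set_lebesgue_integral_def)
qed

text \<open>Testing with bumps is enough: by dominated convergence they produce integrals over open
  boxes, and countably many closed boxes exhaust \<open>D\<close>. Integrability is only asked on
  boxes inside \<open>D\<close>, so that locally integrable functions are covered.\<close>

lemma fundamental_lemma:
  fixes F :: "'a::euclidean_space \<Rightarrow> real"
  assumes D: "open D" and int: "\<And>a b. cbox a b \<subseteq> D \<Longrightarrow> integrable lborel (\<lambda>x. indicator (cbox a b) x * F x)"
    and [measurable]: "F \<in> borel_measurable borel"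
    and 0: "\<And>a b n. cbox a b \<subseteq> D \<Longrightarrow> (\<integral>x. F x * bump a b n x \<partial>lborel) = 0"
  shows "AE x in lborel. x \<in> D \<longrightarrow> F x = 0"
proof -
  have [measurable]: "bump a b n \<in> borel_measurable borel" for a b :: 'a and n
    by (intro borel_measurable_continuous_onI smooth_imp_continuous smooth_bump)
  have box0: "(\<integral>x. indicator (box a b) x * F x \<partial>lborel) = 0" if "cbox a b \<subseteq> D" for a b
  proof -
    have "(\<lambda>n. \<integral>x. F x * bump a b n x \<partial>lborel) \<longlonglongrightarrow> (\<integral>x. indicator (box a b) x * F x \<partial>lborel)"
    proof (rule integral_dominated_convergence[where w = "\<lambda>x. \<bar>indicator (cbox a b) x * F x\<bar>"])
      show "integrable lborel (\<lambda>x. \<bar>indicator (cbox a b) x * F x\<bar>)" using int[OF that] by (rule integrable_abs)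
      show "AE x in lborel. (\<lambda>n. F x * bump a b n x) \<longlonglongrightarrow> indicator (box a b) x * F x"
      proof (rule AE_I2)
        fix x show "(\<lambda>n. F x * bump a b n x) \<longlonglongrightarrow> indicator (box a b) x * F x"
          using tendsto_mult_left[OF bump_tendsto, of "F x" a b x] by (simp add: mult.commute)
      qed
      show "AE x in lborel. norm (F x * bump a b n x) \<le> \<bar>indicator (cbox a b) x * F x\<bar>" for n
      proof (rule AE_I2)
        fix x show "norm (F x * bump a b n x) \<le> \<bar>indicator (cbox a b) x * F x\<bar>"
          by (cases "x \<in> cbox a b") (simp_all add: abs_mult mult_left_le bump_nonneg bump_le_1 bump_eq_0)
      qed
    qed measurable
    then show ?thesis using 0[OF that] by (simp add: LIMSEQ_const_iff)
  qed
  obtain \<D> where \<D>: "countable \<D>" "\<D> \<subseteq> Pow D" "\<And>X. X \<in> \<D> \<Longrightarrow> \<exists>a b. X = cbox a b" "\<Union>\<D> = D"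
    by (rule open_countable_Union_open_cbox[OF D]) (rule that)
  have "AE x in lborel. x \<in> X \<longrightarrow> F x = 0" if X: "X \<in> \<D>" for X
  proof -
    obtain a b where ab: "X = cbox a b" using \<D>(3)[OF X] by auto
    with \<D>(2) X have sub: "cbox a b \<subseteq> D" by auto
    define G where "G x = indicator (box a b) x * F x" for x
    have "integrable lborel (\<lambda>x. indicator (box a b) x *\<^sub>R (indicator (cbox a b) x * F x))"
      by (rule integrable_mult_indicator) (use int[OF sub] in auto)
    moreover have "indicator (box a b) x *\<^sub>R (indicator (cbox a b) x * F x) = G x" for x
      using box_subset_cbox[of a b] by (auto simp: G_def indicator_def)
    ultimately have iG: "integrable lborel G" by simp
    have "AE x in lborel. G x = 0"
    proof (rule integral_box_zero_imp_AE_zero[OF iG])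
      show "(\<integral>x. G x \<partial>lborel) = 0" unfolding G_def by (rule box0[OF sub])
      fix c d
      \<comment> \<open>A box cut with the covering box is again a box inside \<open>D\<close>, so
        its integral is known to vanish.\<close>
      define l u where "l = (\<Sum>i\<in>Basis. max (a \<bullet> i) (c \<bullet> i) *\<^sub>R i)" and "u = (\<Sum>i\<in>Basis. min (b \<bullet> i) (d \<bullet> i) *\<^sub>R i)"
      have "box c d \<inter> box a b = box l u"
        by (auto simp: l_def u_def mem_box)
      then have eq: "indicator (box c d) x * G x = indicator (box l u) x * F x" for x
        using indicator_inter_arith[of "box c d" "box a b" x] unfolding G_def by (metis mult.assoc)
      have "cbox l u \<subseteq> cbox a b"
        by (auto simp: l_def u_def mem_box)
      with sub have "cbox l u \<subseteq> D" by (rule order_trans[rotated])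
      with eq show "(\<integral>x. indicator (box c d) x * G x \<partial>lborel) = 0" using box0 by simp
    qed
    \<comment> \<open>The bumps only see the open box, whereas the cover consists of closed
      ones.\<close>
    moreover have "AE x in lborel. x \<notin> cbox a b - box a b"
      by (rule AE_not_in) (rule null_sets_cbox_Diff_box)
    ultimately show ?thesis unfolding ab by eventually_elim (auto simp: G_def)
  qed
  then have "AE x in lborel. \<forall>X\<in>\<D>. x \<in> X \<longrightarrow> F x = 0"
    using \<D>(1) by (subst AE_ball_countable) auto
  then show ?thesis using \<D>(4) by (auto elim!: eventually_mono)
qed

section \<open>Directional derivatives along almost every segment\<close>

text \<open>The fundamental theorem of calculus along segments, taken as the meaning of a weak
  derivative in direction \<open>h\<close>. The exceptional null set may depend on \<open>s\<close>,
  which avoids choosing an absolutely continuous representative. Only segments lying wholly in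
  \<open>D\<close> count, so nothing is claimed across the boundary.\<close>

definition dir_deriv :: "'a::euclidean_space set \<Rightarrow> 'a \<Rightarrow> ('a \<Rightarrow> real) \<Rightarrow> ('a \<Rightarrow> real) \<Rightarrow> bool" where
  "dir_deriv D h f g \<longleftrightarrow> (\<forall>s\<ge>0. AE x in lborel. (\<forall>\<tau>\<in>{0..s}. x + \<tau> *\<^sub>R h \<in> D) \<longrightarrow>
     f (x + s *\<^sub>R h) - f x = (\<integral>\<tau>. indicator {0..s} \<tau> * g (x + \<tau> *\<^sub>R h) \<partial>lborel))"

lemma dir_derivD:
  "dir_deriv D h f g \<Longrightarrow> 0 \<le> s \<Longrightarrow> AE x in lborel. (\<forall>\<tau>\<in>{0..s}. x + \<tau> *\<^sub>R h \<in> D) \<longrightarrow>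
     f (x + s *\<^sub>R h) - f x = (\<integral>\<tau>. indicator {0..s} \<tau> * g (x + \<tau> *\<^sub>R h) \<partial>lborel)"
  by (auto simp: dir_deriv_def)

lemma dir_deriv_mono: "dir_deriv D h f g \<Longrightarrow> E \<subseteq> D \<Longrightarrow> dir_deriv E h f g"
  unfolding dir_deriv_def by (intro allI impI, drule spec, drule mp, assumption, erule eventually_mono) blast

lemma nn_integral_square: "sq_int g \<Longrightarrow> (\<integral>\<^sup>+x. ennreal ((g x)\<^sup>2) \<partial>lborel) = ennreal ((nrm2 g)\<^sup>2)"
  unfolding nrm2_power2 by (intro nn_integral_eq_integral) (auto simp: sq_int_def)

lemma sq_intI_nn_integral:
  assumes [measurable]: "f \<in> borel_measurable borel" and le: "(\<integral>\<^sup>+x. ennreal ((f x)\<^sup>2) \<partial>lborel) \<le> ennreal (c\<^sup>2)"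
    and c: "0 \<le> c"
  shows "sq_int f" "nrm2 f \<le> c"
proof -
  have "integrable lborel (\<lambda>x. (f x)\<^sup>2)"
    using le by (intro integrableI_nonneg) (auto simp: order_le_less_trans)
  then show "sq_int f" by (simp add: sq_int_def)
  from nn_integral_square[OF this] le have "(nrm2 f)\<^sup>2 \<le> c\<^sup>2" by simp
  then show "nrm2 f \<le> c" using c by (simp add: power2_le_iff_abs_le)
qed

text \<open>Cauchy-Schwarz in the segment parameter yields one factor \<open>s\<close>; Fubini
  together with translation invariance yields a second one under the square.\<close>

lemma sq_int_segment_integral:
  fixes g :: "'a::euclidean_space \<Rightarrow> real"
  assumes g: "sq_int g" and s: "0 \<le> s"
  shows "sq_int (\<lambda>x. \<integral>\<tau>. indicator {0..s} \<tau> * g (x + \<tau> *\<^sub>R h) \<partial>lborel)" (is "sq_int ?J")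
    and "nrm2 (\<lambda>x. \<integral>\<tau>. indicator {0..s} \<tau> * g (x + \<tau> *\<^sub>R h) \<partial>lborel) \<le> s * nrm2 g"
proof -
  have [measurable]: "g \<in> borel_measurable borel" using g by measurable
  have m[measurable]: "?J \<in> borel_measurable borel" by measurable
  have pt: "ennreal ((?J x)\<^sup>2) \<le> ennreal s * (\<integral>\<^sup>+\<tau>. indicator {0..s} \<tau> * ennreal ((g (x + \<tau> *\<^sub>R h))\<^sup>2) \<partial>lborel)" for x
  proof -
    \<comment> \<open>If the segment integral does not exist its value is 0, so the bound holds
      there too.\<close>
    have "ennreal \<bar>?J x\<bar> \<le> (\<integral>\<^sup>+\<tau>. ennreal (norm (indicator {0..s} \<tau> * g (x + \<tau> *\<^sub>R h))) \<partial>lborel)"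
      using integral_norm_bound_ennreal[of lborel "\<lambda>\<tau>. indicator {0..s} \<tau> * g (x + \<tau> *\<^sub>R h)"]
      by (cases "integrable lborel (\<lambda>\<tau>. indicator {0..s} \<tau> * g (x + \<tau> *\<^sub>R h))") (auto simp: not_integrable_integral_eq)
    also have "\<dots> = (\<integral>\<^sup>+\<tau>. indicator {0..s} \<tau> * (indicator {0..s} \<tau> * ennreal \<bar>g (x + \<tau> *\<^sub>R h)\<bar>) \<partial>lborel)"
      by (intro nn_integral_cong) (auto simp: indicator_def abs_mult)
    finally have "(ennreal \<bar>?J x\<bar>)\<^sup>2 \<le> (\<integral>\<^sup>+\<tau>. indicator {0..s} \<tau> * (indicator {0..s} \<tau> * ennreal \<bar>g (x + \<tau> *\<^sub>R h)\<bar>) \<partial>lborel)\<^sup>2"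
      by (rule power_mono) simp
    also have "\<dots> \<le> (\<integral>\<^sup>+\<tau>. (indicator {0..s} \<tau>)\<^sup>2 \<partial>lborel) * (\<integral>\<^sup>+\<tau>. (indicator {0..s} \<tau> * ennreal \<bar>g (x + \<tau> *\<^sub>R h)\<bar>)\<^sup>2 \<partial>lborel)"
      by (rule Cauchy_Schwarz_nn_integral) measurable
    also have "(\<integral>\<^sup>+\<tau>. (indicator {0..s} \<tau>)\<^sup>2 \<partial>lborel) = ennreal s"
      using s by (simp add: power2_eq_square flip: indicator_inter_arith)
    also have "(\<integral>\<^sup>+\<tau>. (indicator {0..s} \<tau> * ennreal \<bar>g (x + \<tau> *\<^sub>R h)\<bar>)\<^sup>2 \<partial>lborel)
        = (\<integral>\<^sup>+\<tau>. indicator {0..s} \<tau> * ennreal ((g (x + \<tau> *\<^sub>R h))\<^sup>2) \<partial>lborel)"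
      by (intro nn_integral_cong) (auto simp: indicator_def ennreal_power)
    finally show ?thesis by (simp add: ennreal_power)
  qed
  have "(\<integral>\<^sup>+x. ennreal ((?J x)\<^sup>2) \<partial>lborel)
      \<le> (\<integral>\<^sup>+x. ennreal s * (\<integral>\<^sup>+\<tau>. indicator {0..s} \<tau> * ennreal ((g (x + \<tau> *\<^sub>R h))\<^sup>2) \<partial>lborel) \<partial>lborel)"
    by (intro nn_integral_mono pt)
  also have "\<dots> = ennreal s * (\<integral>\<^sup>+x. \<integral>\<^sup>+\<tau>. indicator {0..s} \<tau> * ennreal ((g (x + \<tau> *\<^sub>R h))\<^sup>2) \<partial>lborel \<partial>lborel)"
    by (rule nn_integral_cmult) measurable
  also have "(\<integral>\<^sup>+x. \<integral>\<^sup>+\<tau>. indicator {0..s} \<tau> * ennreal ((g (x + \<tau> *\<^sub>R h))\<^sup>2) \<partial>lborel \<partial>lborel)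
      = (\<integral>\<^sup>+\<tau>. \<integral>\<^sup>+x. indicator {0..s} \<tau> * ennreal ((g (x + \<tau> *\<^sub>R h))\<^sup>2) \<partial>lborel \<partial>lborel)"
    by (rule lborel_pair.Fubini') measurable
  also have "\<dots> = (\<integral>\<^sup>+\<tau>. indicator {0..s} \<tau> * ennreal ((nrm2 g)\<^sup>2) \<partial>lborel)"
    using nn_integral_translation[of "\<lambda>x. ennreal ((g x)\<^sup>2)"]
    by (intro nn_integral_cong) (simp add: nn_integral_cmult nn_integral_square[OF g])
  also have "\<dots> = ennreal s * ennreal ((nrm2 g)\<^sup>2)"
    using s by (simp add: nn_integral_multc)
  finally have "(\<integral>\<^sup>+x. ennreal ((?J x)\<^sup>2) \<partial>lborel) \<le> ennreal ((s * nrm2 g)\<^sup>2)"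
    using s by (simp add: power_mult_distrib power2_eq_square ennreal_mult mult_ac)
  from sq_intI_nn_integral[OF m this] s show "sq_int ?J" "nrm2 ?J \<le> s * nrm2 g" by auto
qed

text \<open>The L2 Lipschitz bound of a function with square-integrable derivative, cut off to base
  points whose segments stay in \<open>D\<close>. This is the only way in which the size of a
  derivative enters the difference quotient arguments.\<close>

lemma translation_bound:
  assumes d: "dir_deriv D h f g" and g: "sq_int g" and [measurable]: "f \<in> borel_measurable borel" "A \<in> sets borel"
    and s: "0 \<le> s" and A: "\<And>x \<tau>. x \<in> A \<Longrightarrow> 0 \<le> \<tau> \<Longrightarrow> \<tau> \<le> s \<Longrightarrow> x + \<tau> *\<^sub>R h \<in> D"
  shows "sq_int (\<lambda>x. indicator A x * (f (x + s *\<^sub>R h) - f x))" (is "sq_int ?F")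
    and "nrm2 (\<lambda>x. indicator A x * (f (x + s *\<^sub>R h) - f x)) \<le> s * nrm2 g"
proof -
  let ?J = "\<lambda>x. \<integral>\<tau>. indicator {0..s} \<tau> * g (x + \<tau> *\<^sub>R h) \<partial>lborel"
  have [measurable]: "?F \<in> borel_measurable borel" by measurable
  have "(\<integral>\<^sup>+x. ennreal ((?F x)\<^sup>2) \<partial>lborel) \<le> (\<integral>\<^sup>+x. ennreal ((?J x)\<^sup>2) \<partial>lborel)"
    using dir_derivD[OF d s] A by (intro nn_integral_mono_AE) (auto simp: indicator_def elim!: eventually_mono)
  also have "\<dots> = ennreal ((nrm2 ?J)\<^sup>2)" by (intro nn_integral_square sq_int_segment_integral g s)
  also have "\<dots> \<le> ennreal ((s * nrm2 g)\<^sup>2)"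
    using sq_int_segment_integral(2)[OF g s] by (intro ennreal_leI power_mono) auto
  finally show "sq_int ?F" "nrm2 ?F \<le> s * nrm2 g"
    using s by (auto intro!: sq_intI_nn_integral)
qed

text \<open>Fubini applies because the product is dominated by the sum of the squares, whose
  integral over a segment of length \<open>s\<close> is finite.\<close>

lemma integral_segment_swap:
  fixes g \<psi> :: "'a::euclidean_space \<Rightarrow> real"
  assumes g: "sq_int g" and \<psi>: "sq_int \<psi>" and s: "0 \<le> s"
  shows "(\<integral>x. (\<integral>\<tau>. indicator {0..s} \<tau> * g (x + \<tau> *\<^sub>R h) \<partial>lborel) * \<psi> x \<partial>lborel)
       = (\<integral>\<tau>. indicator {0..s} \<tau> * (\<integral>x. g (x + \<tau> *\<^sub>R h) * \<psi> x \<partial>lborel) \<partial>lborel)"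
proof -
  have [measurable]: "g \<in> borel_measurable borel" "\<psi> \<in> borel_measurable borel" using g \<psi> by measurable
  let ?f = "\<lambda>(x, \<tau>). indicator {0..s} \<tau> * (g (x + \<tau> *\<^sub>R h) * \<psi> x)"
  have "integrable (lborel \<Otimes>\<^sub>M lborel) ?f"
  proof (rule integrableI_bounded)
    show "?f \<in> borel_measurable (lborel \<Otimes>\<^sub>M lborel)" by measurable
    have "(\<integral>\<^sup>+z. ennreal (norm (?f z)) \<partial>(lborel \<Otimes>\<^sub>M lborel))
        \<le> (\<integral>\<^sup>+z. (case z of (x, \<tau>) \<Rightarrow> indicator {0..s} \<tau> * (ennreal ((g (x + \<tau> *\<^sub>R h))\<^sup>2) + ennreal ((\<psi> x)\<^sup>2))) \<partial>(lborel \<Otimes>\<^sub>M lborel))"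
    proof (rule nn_integral_mono)
      fix z :: "'a \<times> real"
      obtain x \<tau> where z: "z = (x, \<tau>)" by (cases z)
      have "\<bar>g (x + \<tau> *\<^sub>R h) * \<psi> x\<bar> \<le> (g (x + \<tau> *\<^sub>R h))\<^sup>2 + (\<psi> x)\<^sup>2"
        using two_mult_le[of "g (x + \<tau> *\<^sub>R h)" "\<psi> x"] by linarith
      then show "ennreal (norm (?f z)) \<le> (case z of (x, \<tau>) \<Rightarrow> indicator {0..s} \<tau> * (ennreal ((g (x + \<tau> *\<^sub>R h))\<^sup>2) + ennreal ((\<psi> x)\<^sup>2)))"
        by (auto simp: z indicator_def simp flip: ennreal_plus intro!: ennreal_leI)
    qed
    also have "\<dots> = (\<integral>\<^sup>+\<tau>. \<integral>\<^sup>+x. indicator {0..s} \<tau> * (ennreal ((g (x + \<tau> *\<^sub>R h))\<^sup>2) + ennreal ((\<psi> x)\<^sup>2)) \<partial>lborel \<partial>lborel)"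
      by (subst lborel_pair.nn_integral_snd[symmetric]) (auto simp: case_prod_beta)
    also have "\<dots> = (\<integral>\<^sup>+\<tau>. indicator {0..s} \<tau> * (ennreal ((nrm2 g)\<^sup>2) + ennreal ((nrm2 \<psi>)\<^sup>2)) \<partial>lborel)"
      using nn_integral_translation[of "\<lambda>x. ennreal ((g x)\<^sup>2)"]
      by (intro nn_integral_cong)
        (simp add: nn_integral_cmult nn_integral_add nn_integral_square[OF g] nn_integral_square[OF \<psi>])
    also have "\<dots> < \<infinity>" using s by (simp add: nn_integral_multc ennreal_mult_less_top flip: ennreal_plus)
    finally show "(\<integral>\<^sup>+z. ennreal (norm (?f z)) \<partial>(lborel \<Otimes>\<^sub>M lborel)) < \<infinity>" .
  qed
  from lborel_pair.Fubini_integral[OF this]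
  have "(\<integral>\<tau>. (\<integral>x. indicator {0..s} \<tau> * (g (x + \<tau> *\<^sub>R h) * \<psi> x) \<partial>lborel) \<partial>lborel)
      = (\<integral>x. (\<integral>\<tau>. indicator {0..s} \<tau> * (g (x + \<tau> *\<^sub>R h) * \<psi> x) \<partial>lborel) \<partial>lborel)"
    .
  then show ?thesis by (simp add: mult.assoc flip: integral_mult_left_zero)
qed

text \<open>The weight \<open>\<psi>\<close> selects base points whose segments lie in
  \<open>D\<close>, so the segment formula may be inserted under the integral.\<close>

lemma dir_deriv_pairing:
  assumes d: "dir_deriv D h f g" and [simp]: "sq_int f" and g: "sq_int g" and \<psi>: "sq_int \<psi>" and s: "0 \<le> s"
    and D: "\<And>x \<tau>. \<psi> x \<noteq> 0 \<Longrightarrow> 0 \<le> \<tau> \<Longrightarrow> \<tau> \<le> s \<Longrightarrow> x + \<tau> *\<^sub>R h \<in> D"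
  shows "(\<integral>x. (f (x + s *\<^sub>R h) - f x) * \<psi> x \<partial>lborel)
       = (\<integral>\<tau>. indicator {0..s} \<tau> * (\<integral>x. g (x + \<tau> *\<^sub>R h) * \<psi> x \<partial>lborel) \<partial>lborel)"
proof -
  have [measurable]: "f \<in> borel_measurable borel" "g \<in> borel_measurable borel" "\<psi> \<in> borel_measurable borel"
    using g \<psi> \<open>sq_int f\<close> by (auto simp: sq_int_def)
  have "(\<integral>x. (f (x + s *\<^sub>R h) - f x) * \<psi> x \<partial>lborel)
      = (\<integral>x. (\<integral>\<tau>. indicator {0..s} \<tau> * g (x + \<tau> *\<^sub>R h) \<partial>lborel) * \<psi> x \<partial>lborel)"
    using dir_derivD[OF d s] by (intro integral_cong_AE) (auto elim!: eventually_mono dest: D)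
  then show ?thesis using integral_segment_swap[OF g \<psi> s] by simp
qed

text \<open>A segment traversed backwards: the base point moves to the other end and the parameter
  is reflected to \<open>s - \<tau>\<close>.\<close>

lemma dir_deriv_uminus:
  assumes d: "dir_deriv D h f g" and [measurable]: "g \<in> borel_measurable borel"
  shows "dir_deriv D (- h) f (\<lambda>x. - g x)"
  unfolding dir_deriv_def
proof (intro allI impI)
  fix s :: real assume s: "0 \<le> s"
  have "AE x in lborel. (\<forall>\<tau>\<in>{0..s}. x + (- (s *\<^sub>R h)) + \<tau> *\<^sub>R h \<in> D) \<longrightarrow>
     f (x + (- (s *\<^sub>R h)) + s *\<^sub>R h) - f (x + (- (s *\<^sub>R h))) = (\<integral>\<tau>. indicator {0..s} \<tau> * g (x + (- (s *\<^sub>R h)) + \<tau> *\<^sub>R h) \<partial>lborel)"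
    using AE_translation[OF dir_derivD[OF d s]] .
  then show "AE x in lborel. (\<forall>\<tau>\<in>{0..s}. x + \<tau> *\<^sub>R - h \<in> D) \<longrightarrow>
     f (x + s *\<^sub>R - h) - f x = (\<integral>\<tau>. indicator {0..s} \<tau> * - g (x + \<tau> *\<^sub>R - h) \<partial>lborel)"
  proof (rule eventually_mono, intro impI)
    fix x
    assume A: "(\<forall>\<tau>\<in>{0..s}. x + (- (s *\<^sub>R h)) + \<tau> *\<^sub>R h \<in> D) \<longrightarrow>
     f (x + (- (s *\<^sub>R h)) + s *\<^sub>R h) - f (x + (- (s *\<^sub>R h))) = (\<integral>\<tau>. indicator {0..s} \<tau> * g (x + (- (s *\<^sub>R h)) + \<tau> *\<^sub>R h) \<partial>lborel)"
      and B: "\<forall>\<tau>\<in>{0..s}. x + \<tau> *\<^sub>R - h \<in> D"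
    have "x + (- (s *\<^sub>R h)) + \<tau> *\<^sub>R h \<in> D" if "\<tau> \<in> {0..s}" for \<tau>
      using B[rule_format, of "s - \<tau>"] that by (simp add: algebra_simps)
    with A have "f (x + s *\<^sub>R - h) - f x = - (\<integral>\<tau>. indicator {0..s} \<tau> * g (x + (- (s *\<^sub>R h)) + \<tau> *\<^sub>R h) \<partial>lborel)"
      by simp
    also have "(\<integral>\<tau>. indicator {0..s} \<tau> * g (x + (- (s *\<^sub>R h)) + \<tau> *\<^sub>R h) \<partial>lborel)
      = (\<integral>\<tau>. indicator {0..s} (s + (-1) * \<tau>) * g (x + (- (s *\<^sub>R h)) + (s + (-1) * \<tau>) *\<^sub>R h) \<partial>lborel)"
      by (subst lborel_integral_real_affine[where c = "-1" and t = s]) auto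
    also have "\<dots> = (\<integral>\<tau>. indicator {0..s} \<tau> * g (x + \<tau> *\<^sub>R - h) \<partial>lborel)"
      by (intro Bochner_Integration.integral_cong) (auto simp: indicator_def algebra_simps)
    finally show "f (x + s *\<^sub>R - h) - f x = (\<integral>\<tau>. indicator {0..s} \<tau> * - g (x + \<tau> *\<^sub>R - h) \<partial>lborel)"
      by simp
  qed
qed

section \<open>Integration by parts from difference quotients\<close>

lemma compact_translate_subset_open:
  fixes K :: "'a::real_normed_vector set"
  assumes "compact K" "open D" "K \<subseteq> D"
  obtains s0 where "0 < s0" "\<And>x \<tau>. x \<in> K \<Longrightarrow> \<bar>\<tau>\<bar> \<le> s0 \<Longrightarrow> x + \<tau> *\<^sub>R h \<in> D"
proof -
  obtain e where e: "0 < e" "(\<Union>x\<in>K. ball x e) \<subseteq> D"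
    using compact_subset_open_imp_ball_epsilon_subset[OF assms] by blast
  \<comment> \<open>The added 1 keeps the denominator positive for \<open>h = 0\<close>.\<close>
  define s0 where "s0 = e / (norm h + 1)"
  have n: "0 < norm h + 1" by (smt (verit) norm_ge_zero)
  have "x + \<tau> *\<^sub>R h \<in> D" if "x \<in> K" "\<bar>\<tau>\<bar> \<le> s0" for x \<tau>
  proof -
    have "\<bar>\<tau>\<bar> * norm h \<le> s0 * norm h" using that(2) by (intro mult_right_mono) auto
    also have "\<dots> < s0 * (norm h + 1)" using e n by (intro mult_strict_left_mono) (auto simp: s0_def)
    also have "\<dots> = e" using n by (simp add: s0_def)
    finally have "x + \<tau> *\<^sub>R h \<in> ball x e" by (simp add: dist_norm)
    with that(1) e(2) show ?thesis by blast
  qed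
  moreover have "0 < s0" using e n by (simp add: s0_def)
  ultimately show ?thesis using that by blast
qed

text \<open>Stands in for the limit of an average over a shrinking segment, with an explicit
  error.\<close>

lemma segment_average_close:
  fixes F :: "real \<Rightarrow> real"
  assumes [measurable]: "F \<in> borel_measurable borel" and s: "0 \<le> s"
    and F: "\<And>\<tau>. 0 \<le> \<tau> \<Longrightarrow> \<tau> \<le> s \<Longrightarrow> \<bar>F \<tau> - P\<bar> \<le> C"
  shows "\<bar>(\<integral>\<tau>. indicator {0..s} \<tau> * F \<tau> \<partial>lborel) - s * P\<bar> \<le> s * C"
proof -
  have C: "0 \<le> C" using F[of 0] s by simp
  have c: "integrable lborel (\<lambda>\<tau>. indicator {0..s} \<tau> * c :: real)" for c
    using s by (intro integrable_mult_left integrable_real_indicator) auto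
  have ci: "(\<integral>\<tau>. indicator {0..s} \<tau> * c \<partial>lborel) = s * c" for c :: real
    using s by simp
  have i: "integrable lborel (\<lambda>\<tau>. indicator {0..s} \<tau> * (F \<tau> - P))"
    using F C by (intro Bochner_Integration.integrable_bound[OF c[of C]] AE_I2) (auto simp: indicator_def)
  have "integrable lborel (\<lambda>\<tau>. indicator {0..s} \<tau> * (F \<tau> - P) + indicator {0..s} \<tau> * P)"
    by (intro Bochner_Integration.integrable_add i c)
  then have "(\<integral>\<tau>. indicator {0..s} \<tau> * F \<tau> \<partial>lborel) - s * P = (\<integral>\<tau>. indicator {0..s} \<tau> * (F \<tau> - P) \<partial>lborel)"
    unfolding ci[of P, symmetric] using c[of P] by (subst Bochner_Integration.integral_diff[symmetric]) (auto simp: algebra_simps)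
  moreover have "\<bar>\<integral>\<tau>. indicator {0..s} \<tau> * (F \<tau> - P) \<partial>lborel\<bar> \<le> (\<integral>\<tau>. indicator {0..s} \<tau> * C \<partial>lborel)"
    using F C by (intro order_trans[OF integral_abs_bound] integral_mono integrable_abs i c) (auto simp: indicator_def)
  ultimately show ?thesis unfolding ci by simp
qed

text \<open>Dividing by \<open>s\<close> leaves a bound that vanishes with \<open>s\<close>.
  Identities between integrals are proved in this form: \<open>s\<close> times their defect is shown
  to be of second order.\<close>

lemma eq_zero_if_quadratic_bound:
  fixes P :: real
  assumes "0 < s0" and "\<And>s. 0 < s \<Longrightarrow> s \<le> s0 \<Longrightarrow> \<bar>s * P\<bar> \<le> s * (s * C)"
  shows "P = 0"
proof (rule ccontr)
  assume P: "P \<noteq> 0"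
  have *: "\<bar>P\<bar> \<le> s * C" if "0 < s" "s \<le> s0" for s
    using assms(2)[OF that] that by (simp add: abs_mult)
  have "C > 0" using *[of s0] P assms(1) by (smt (verit) mult_nonneg_nonpos)
  \<comment> \<open>Small enough that \<open>s * C\<close> is at most half of
    \<open>\<bar>P\<bar>\<close>.\<close>
  define s where "s = min s0 (\<bar>P\<bar> / (2 * C))"
  have "0 < s" "s \<le> s0" using assms(1) P \<open>C > 0\<close> by (auto simp: s_def)
  have "s * C \<le> \<bar>P\<bar> / (2 * C) * C" using \<open>C > 0\<close> by (intro mult_right_mono) (auto simp: s_def)
  then show False using *[OF \<open>0 < s\<close> \<open>s \<le> s0\<close>] \<open>C > 0\<close> P by simp
qed

text \<open>A translation moves the difference from \<open>r\<close> to \<open>\<psi>\<close>, where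
  it becomes an average of shifted values of \<open>\<psi>'\<close>. Undoing the shift costs the L2
  oscillation of \<open>r\<close> on \<open>K\<close>, outside of which \<open>\<psi>'\<close>
  vanishes. No derivative of \<open>r\<close> is mentioned, only a Lipschitz bound, so the lemma can
  be applied to a reciprocal before its derivative is known.\<close>

lemma difference_pairing_close_weak:
  assumes \<psi>: "dir_deriv UNIV h \<psi> \<psi>'" "sq_int \<psi>" "sq_int \<psi>'" and r: "sq_int r"
    and K: "\<And>x. x \<notin> K \<Longrightarrow> \<psi>' x = 0" and s: "0 \<le> s"
    and b: "\<And>\<tau>. 0 \<le> \<tau> \<Longrightarrow> \<tau> \<le> s \<Longrightarrow> sq_int (\<lambda>x. indicator K x * (r (x + \<tau> *\<^sub>R h) - r x)) \<and>
        nrm2 (\<lambda>x. indicator K x * (r (x + \<tau> *\<^sub>R h) - r x)) \<le> s * L"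
  shows "\<bar>(\<integral>x. (r (x + s *\<^sub>R h) - r x) * \<psi> x \<partial>lborel) + s * (\<integral>x. r x * \<psi>' x \<partial>lborel)\<bar> \<le> s * (s * (L * nrm2 \<psi>'))"
proof -
  have [measurable]: "r \<in> borel_measurable borel" "\<psi> \<in> borel_measurable borel" "\<psi>' \<in> borel_measurable borel"
    using r \<psi> by (auto simp: sq_int_def)
  have d': "dir_deriv UNIV (- h) \<psi> (\<lambda>x. - \<psi>' x)" using dir_deriv_uminus[OF \<psi>(1)] by simp
  have "(\<integral>x. (r (x + s *\<^sub>R h) - r x) * \<psi> x \<partial>lborel)
      = (\<integral>x. r (x + s *\<^sub>R h) * \<psi> x \<partial>lborel) - (\<integral>x. r x * \<psi> x \<partial>lborel)"
    by (subst Bochner_Integration.integral_diff[symmetric])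
      (auto intro!: sq_int_mult r \<psi> sq_int_translation simp: algebra_simps)
  also have "(\<integral>x. r (x + s *\<^sub>R h) * \<psi> x \<partial>lborel) = (\<integral>x. r x * \<psi> (x + s *\<^sub>R - h) \<partial>lborel)"
    by (subst integral_translation[of "\<lambda>x. r x * \<psi> (x + s *\<^sub>R - h)" "s *\<^sub>R h", symmetric]) auto
  also have "(\<integral>x. r x * \<psi> (x + s *\<^sub>R - h) \<partial>lborel) - (\<integral>x. r x * \<psi> x \<partial>lborel)
      = (\<integral>x. (\<psi> (x + s *\<^sub>R - h) - \<psi> x) * r x \<partial>lborel)"
    by (subst Bochner_Integration.integral_diff[symmetric])
      (auto intro!: sq_int_mult r \<psi> sq_int_translation_minus simp: algebra_simps)
  also have "\<dots> = (\<integral>\<tau>. indicator {0..s} \<tau> * (\<integral>x. - \<psi>' (x + \<tau> *\<^sub>R - h) * r x \<partial>lborel) \<partial>lborel)"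
    using s by (intro dir_deriv_pairing[OF d' \<psi>(2) _ r] sq_int_minus \<psi>) auto
  finally have X: "(\<integral>x. (r (x + s *\<^sub>R h) - r x) * \<psi> x \<partial>lborel)
      = (\<integral>\<tau>. indicator {0..s} \<tau> * (\<integral>x. - \<psi>' (x + \<tau> *\<^sub>R - h) * r x \<partial>lborel) \<partial>lborel)" .
  have "\<bar>(\<integral>\<tau>. indicator {0..s} \<tau> * (\<integral>x. - \<psi>' (x + \<tau> *\<^sub>R - h) * r x \<partial>lborel) \<partial>lborel)
        - s * - (\<integral>x. r x * \<psi>' x \<partial>lborel)\<bar> \<le> s * (s * (L * nrm2 \<psi>'))"
  proof (rule segment_average_close)
    fix \<tau> assume t: "0 \<le> \<tau>" "\<tau> \<le> s"
    have "(\<integral>x. - \<psi>' (x + \<tau> *\<^sub>R - h) * r x \<partial>lborel) = (\<integral>x. - (r (x + \<tau> *\<^sub>R h) * \<psi>' x) \<partial>lborel)"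
      by (subst integral_translation[of "\<lambda>x. - \<psi>' (x + \<tau> *\<^sub>R - h) * r x" "\<tau> *\<^sub>R h", symmetric]) (auto simp: mult.commute)
    then have "(\<integral>x. - \<psi>' (x + \<tau> *\<^sub>R - h) * r x \<partial>lborel) - - (\<integral>x. r x * \<psi>' x \<partial>lborel)
        = - ((\<integral>x. r (x + \<tau> *\<^sub>R h) * \<psi>' x \<partial>lborel) - (\<integral>x. r x * \<psi>' x \<partial>lborel))" by simp
    also have "\<dots> = - (\<integral>x. r (x + \<tau> *\<^sub>R h) * \<psi>' x - r x * \<psi>' x \<partial>lborel)"
      by (subst Bochner_Integration.integral_diff[symmetric])
        (auto intro!: sq_int_mult r \<psi> sq_int_translation simp: algebra_simps)
    also have "(\<integral>x. r (x + \<tau> *\<^sub>R h) * \<psi>' x - r x * \<psi>' x \<partial>lborel)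
        = (\<integral>x. (indicator K x * (r (x + \<tau> *\<^sub>R h) - r x)) * \<psi>' x \<partial>lborel)"
      using K by (intro Bochner_Integration.integral_cong) (auto simp: indicator_def algebra_simps)
    also have "\<bar>- \<dots>\<bar> \<le> nrm2 (\<lambda>x. indicator K x * (r (x + \<tau> *\<^sub>R h) - r x)) * nrm2 \<psi>'"
      using abs_integral_mult_le[of "\<lambda>x. indicator K x * (r (x + \<tau> *\<^sub>R h) - r x)" \<psi>'] b[OF t] \<psi>(3) by simp
    also have "\<dots> \<le> s * L * nrm2 \<psi>'" using b[OF t] by (intro mult_right_mono) auto
    finally show "\<bar>(\<integral>x. - \<psi>' (x + \<tau> *\<^sub>R - h) * r x \<partial>lborel) - - (\<integral>x. r x * \<psi>' x \<partial>lborel)\<bar> \<le> s * (L * nrm2 \<psi>')"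
      by (simp add: mult.assoc)
  qed (use s in auto)
  then show ?thesis unfolding X by simp
qed

text \<open>Here the derivative of \<open>f\<close> is known: its difference becomes an average of
  shifted values of \<open>g\<close>. The shift is passed on to \<open>\<psi>\<close>, whose L2
  oscillation bounds the error.\<close>

lemma difference_pairing_close_strong:
  assumes f: "dir_deriv D h f g" "sq_int f" "sq_int g" and \<psi>: "sq_int \<psi>" and s: "0 \<le> s"
    and D: "\<And>x \<tau>. \<psi> x \<noteq> 0 \<Longrightarrow> 0 \<le> \<tau> \<Longrightarrow> \<tau> \<le> s \<Longrightarrow> x + \<tau> *\<^sub>R h \<in> D"
    and b: "\<And>\<tau>. 0 \<le> \<tau> \<Longrightarrow> \<tau> \<le> s \<Longrightarrow> nrm2 (\<lambda>x. \<psi> (x + \<tau> *\<^sub>R - h) - \<psi> x) \<le> s * M"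
  shows "\<bar>(\<integral>x. (f (x + s *\<^sub>R h) - f x) * \<psi> x \<partial>lborel) - s * (\<integral>x. g x * \<psi> x \<partial>lborel)\<bar> \<le> s * (s * (nrm2 g * M))"
proof -
  have [measurable]: "f \<in> borel_measurable borel" "g \<in> borel_measurable borel" "\<psi> \<in> borel_measurable borel"
    using f \<psi> by (auto simp: sq_int_def)
  have "(\<integral>x. (f (x + s *\<^sub>R h) - f x) * \<psi> x \<partial>lborel)
      = (\<integral>\<tau>. indicator {0..s} \<tau> * (\<integral>x. g (x + \<tau> *\<^sub>R h) * \<psi> x \<partial>lborel) \<partial>lborel)"
    by (rule dir_deriv_pairing[OF f \<psi> s D])
  moreover have "\<bar>(\<integral>\<tau>. indicator {0..s} \<tau> * (\<integral>x. g (x + \<tau> *\<^sub>R h) * \<psi> x \<partial>lborel) \<partial>lborel) - s * (\<integral>x. g x * \<psi> x \<partial>lborel)\<bar>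
      \<le> s * (s * (nrm2 g * M))"
  proof (rule segment_average_close)
    fix \<tau> assume t: "0 \<le> \<tau>" "\<tau> \<le> s"
    have "(\<integral>x. g (x + \<tau> *\<^sub>R h) * \<psi> x \<partial>lborel) = (\<integral>x. g x * \<psi> (x + \<tau> *\<^sub>R - h) \<partial>lborel)"
      by (subst integral_translation[of "\<lambda>x. g x * \<psi> (x + \<tau> *\<^sub>R - h)" "\<tau> *\<^sub>R h", symmetric]) auto
    then have "(\<integral>x. g (x + \<tau> *\<^sub>R h) * \<psi> x \<partial>lborel) - (\<integral>x. g x * \<psi> x \<partial>lborel)
        = (\<integral>x. g x * \<psi> (x + \<tau> *\<^sub>R - h) \<partial>lborel) - (\<integral>x. g x * \<psi> x \<partial>lborel)" by simp
    also have "\<dots> = (\<integral>x. g x * (\<psi> (x + \<tau> *\<^sub>R - h) - \<psi> x) \<partial>lborel)"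
      by (subst Bochner_Integration.integral_diff[symmetric])
        (auto intro!: sq_int_mult f \<psi> sq_int_translation_minus simp: algebra_simps)
    also have "\<bar>\<dots>\<bar> \<le> nrm2 g * nrm2 (\<lambda>x. \<psi> (x + \<tau> *\<^sub>R - h) - \<psi> x)"
      by (intro abs_integral_mult_le f sq_int_diff sq_int_translation \<psi>)
    also have "\<dots> \<le> nrm2 g * (s * M)" by (intro mult_left_mono b t) auto
    finally show "\<bar>(\<integral>x. g (x + \<tau> *\<^sub>R h) * \<psi> x \<partial>lborel) - (\<integral>x. g x * \<psi> x \<partial>lborel)\<bar> \<le> s * (nrm2 g * M)"
      by (simp add: mult_ac)
  qed (use s in auto)
  ultimately show ?thesis by simp
qed

text \<open>The integral of \<open>\<psi>\<close> against the increment of \<open>f\<close> is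
  expanded twice, once through \<open>g\<close> and once through \<open>\<psi>'\<close>. The two
  expansions differ by second-order terms only, so their leading terms agree. The second factor is
  itself only weakly differentiable, which is why no mollification takes place.\<close>

theorem integration_by_parts_dir_deriv:
  assumes D: "open D" and f: "dir_deriv D h f g" "sq_int f" "sq_int g"
    and \<psi>: "dir_deriv UNIV h \<psi> \<psi>'" "sq_int \<psi>" "sq_int \<psi>'"
    and K: "compact K" "K \<subseteq> D" "\<And>x. x \<notin> K \<Longrightarrow> \<psi> x = 0" "\<And>x. x \<notin> K \<Longrightarrow> \<psi>' x = 0"
  shows "(\<integral>x. f x * \<psi>' x \<partial>lborel) = - (\<integral>x. g x * \<psi> x \<partial>lborel)"
proof -
  have [measurable]: "f \<in> borel_measurable borel" "\<psi> \<in> borel_measurable borel" "\<psi>' \<in> borel_measurable borel" "K \<in> sets borel"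
    using f \<psi> K(1) by (auto simp: sq_int_def borel_compact)
  have d': "dir_deriv UNIV (- h) \<psi> (\<lambda>x. - \<psi>' x)" using dir_deriv_uminus[OF \<psi>(1)] by simp
  obtain s0 where s0: "0 < s0" "\<And>x \<tau>. x \<in> K \<Longrightarrow> \<bar>\<tau>\<bar> \<le> s0 \<Longrightarrow> x + \<tau> *\<^sub>R h \<in> D"
    using compact_translate_subset_open[OF K(1) D K(2)] by blast
  let ?C = "nrm2 g * nrm2 \<psi>'"
  have "(\<integral>x. f x * \<psi>' x \<partial>lborel) + (\<integral>x. g x * \<psi> x \<partial>lborel) = 0"
  proof (rule eq_zero_if_quadratic_bound[OF s0(1)])
    fix s assume s: "0 < s" "s \<le> s0"
    define X where "X = (\<integral>x. (f (x + s *\<^sub>R h) - f x) * \<psi> x \<partial>lborel)"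
    have "\<bar>X - s * (\<integral>x. g x * \<psi> x \<partial>lborel)\<bar> \<le> s * (s * ?C)" unfolding X_def
    proof (rule difference_pairing_close_strong[OF f \<psi>(2)])
      fix x \<tau> assume "\<psi> x \<noteq> 0" "0 \<le> \<tau>" "\<tau> \<le> s"
      then show "x + \<tau> *\<^sub>R h \<in> D" using K(3) s by (intro s0) auto
    next
      fix \<tau> assume t: "0 \<le> \<tau>" "\<tau> \<le> s"
      have "nrm2 (\<lambda>x. indicator UNIV x * (\<psi> (x + \<tau> *\<^sub>R - h) - \<psi> x)) \<le> \<tau> * nrm2 (\<lambda>x. - \<psi>' x)"
        using t by (intro translation_bound[OF d'] sq_int_minus \<psi>; simp)
      also have "\<dots> \<le> s * nrm2 \<psi>'" using t nrm2_cmult[of "-1" \<psi>'] by (simp add: mult_right_mono)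
      finally show "nrm2 (\<lambda>x. \<psi> (x + \<tau> *\<^sub>R - h) - \<psi> x) \<le> s * nrm2 \<psi>'" by simp
    qed (use s in simp)
    moreover have "\<bar>X + s * (\<integral>x. f x * \<psi>' x \<partial>lborel)\<bar> \<le> s * (s * ?C)" unfolding X_def
    proof (rule difference_pairing_close_weak[OF \<psi> f(2) K(4)])
      fix \<tau> assume t: "0 \<le> \<tau>" "\<tau> \<le> s"
      have b: "sq_int (\<lambda>x. indicator K x * (f (x + \<tau> *\<^sub>R h) - f x))"
        "nrm2 (\<lambda>x. indicator K x * (f (x + \<tau> *\<^sub>R h) - f x)) \<le> \<tau> * nrm2 g"
        using t s by (intro translation_bound[OF f(1,3)] s0; simp)+
      moreover have "\<tau> * nrm2 g \<le> s * nrm2 g" using t by (simp add: mult_right_mono)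
      ultimately show "sq_int (\<lambda>x. indicator K x * (f (x + \<tau> *\<^sub>R h) - f x)) \<and>
          nrm2 (\<lambda>x. indicator K x * (f (x + \<tau> *\<^sub>R h) - f x)) \<le> s * nrm2 g" by linarith
    qed (use s in auto)
    ultimately show "\<bar>s * ((\<integral>x. f x * \<psi>' x \<partial>lborel) + (\<integral>x. g x * \<psi> x \<partial>lborel))\<bar> \<le> s * (s * (2 * ?C))"
      by (simp add: algebra_simps)
  qed
  then show ?thesis by simp
qed

section \<open>Test functions in one direction and product rules\<close>

text \<open>Regularity is required along \<open>h\<close> only. In space-time this admits a smooth
  function of time multiplied by a merely continuous function of space. The derivative
  \<open>\<phi>'\<close> is an explicit argument, so that products and translates carry theirs
  along.\<close>

definition test_dir :: "'a::euclidean_space set \<Rightarrow> 'a \<Rightarrow> ('a \<Rightarrow> real) \<Rightarrow> ('a \<Rightarrow> real) \<Rightarrow> bool" where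
  "test_dir D h \<phi> \<phi>' \<longleftrightarrow> continuous_on UNIV \<phi> \<and> continuous_on UNIV \<phi>' \<and>
     (\<exists>K. compact K \<and> K \<subseteq> D \<and> (\<forall>x. x \<notin> K \<longrightarrow> \<phi> x = 0 \<and> \<phi>' x = 0)) \<and>
     (\<forall>x. ((\<lambda>s. \<phi> (x + s *\<^sub>R h)) has_real_derivative \<phi>' x) (at 0))"

lemma test_dirE:
  assumes "test_dir D h \<phi> \<phi>'"
  obtains K where "compact K" "K \<subseteq> D" "\<And>x. x \<notin> K \<Longrightarrow> \<phi> x = 0" "\<And>x. x \<notin> K \<Longrightarrow> \<phi>' x = 0"
  using assms unfolding test_dir_def by blast

lemma test_dir_sq_int:
  assumes "test_dir D h \<phi> \<phi>'" shows "sq_int \<phi>" "sq_int \<phi>'"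
  using assms unfolding test_dir_def by (blast intro: sq_int_continuous_compact_support)+

lemma test_dir_bounded:
  assumes "test_dir D h \<phi> \<phi>'"
  obtains B where "0 \<le> B" "\<And>x. \<bar>\<phi> x\<bar> \<le> B" "\<And>x. \<bar>\<phi>' x\<bar> \<le> B"
proof -
  obtain K where K: "compact K" "\<And>x. x \<notin> K \<Longrightarrow> \<phi> x = 0" "\<And>x. x \<notin> K \<Longrightarrow> \<phi>' x = 0"
    using test_dirE[OF assms] by metis
  have c: "continuous_on UNIV \<phi>" "continuous_on UNIV \<phi>'" using assms by (auto simp: test_dir_def)
  obtain B where B: "0 \<le> B" "\<And>x. \<bar>\<phi> x\<bar> \<le> B" using continuous_compact_support_bounded[OF c(1) K(1,2)] by metis
  obtain B' where B': "0 \<le> B'" "\<And>x. \<bar>\<phi>' x\<bar> \<le> B'" using continuous_compact_support_bounded[OF c(2) K(1,3)] by metis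
  show thesis using that[of "max B B'"] B B' by (meson max.coboundedI1 max.coboundedI2)
qed

lemma test_dir_mult:
  assumes \<phi>: "test_dir D h \<phi> \<phi>'" and \<xi>: "test_dir UNIV h \<xi> \<xi>'"
  shows "test_dir D h (\<lambda>x. \<phi> x * \<xi> x) (\<lambda>x. \<phi> x * \<xi>' x + \<phi>' x * \<xi> x)"
  unfolding test_dir_def
proof (intro conjI allI)
  show "continuous_on UNIV (\<lambda>x. \<phi> x * \<xi> x)" "continuous_on UNIV (\<lambda>x. \<phi> x * \<xi>' x + \<phi>' x * \<xi> x)"
    using assms by (auto simp: test_dir_def intro!: continuous_on_mult continuous_on_add)
  obtain K where K: "compact K" "K \<subseteq> D" "\<And>x. x \<notin> K \<Longrightarrow> \<phi> x = 0" "\<And>x. x \<notin> K \<Longrightarrow> \<phi>' x = 0"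
    using test_dirE[OF \<phi>] by metis
  show "\<exists>K. compact K \<and> K \<subseteq> D \<and> (\<forall>x. x \<notin> K \<longrightarrow> \<phi> x * \<xi> x = 0 \<and> \<phi> x * \<xi>' x + \<phi>' x * \<xi> x = 0)"
    using K by (intro exI[of _ K]) auto
  fix x
  have "((\<lambda>s. \<phi> (x + s *\<^sub>R h)) has_real_derivative \<phi>' x) (at 0)" "((\<lambda>s. \<xi> (x + s *\<^sub>R h)) has_real_derivative \<xi>' x) (at 0)"
    using assms by (auto simp: test_dir_def)
  from DERIV_mult[OF this] show "((\<lambda>s. \<phi> (x + s *\<^sub>R h) * \<xi> (x + s *\<^sub>R h)) has_real_derivative \<phi> x * \<xi>' x + \<phi>' x * \<xi> x) (at 0)"
    by (simp add: algebra_simps)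
qed

lemma test_dir_imp_dir_deriv:
  assumes "test_dir D h \<phi> \<phi>'"
  shows "dir_deriv UNIV h \<phi> \<phi>'"
  unfolding dir_deriv_def
proof (intro allI impI AE_I2)
  fix s :: real and x assume s: "0 \<le> s"
  have d: "((\<lambda>s. \<phi> (x + s *\<^sub>R h)) has_real_derivative \<phi>' (x + \<tau> *\<^sub>R h)) (at \<tau>)" for \<tau>
  proof -
    have "((\<lambda>s. \<phi> ((x + \<tau> *\<^sub>R h) + s *\<^sub>R h)) has_real_derivative \<phi>' (x + \<tau> *\<^sub>R h)) (at 0)"
      using assms by (simp add: test_dir_def)
    also have "(\<lambda>s. \<phi> ((x + \<tau> *\<^sub>R h) + s *\<^sub>R h)) = (\<lambda>s. \<phi> (x + (s + \<tau>) *\<^sub>R h))"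
      by (simp add: algebra_simps)
    finally show ?thesis using DERIV_shift[of "\<lambda>s. \<phi> (x + s *\<^sub>R h)" "\<phi>' (x + \<tau> *\<^sub>R h)" 0 \<tau>] by simp
  qed
  have "(\<integral>\<tau>. indicator {0..s} \<tau> *\<^sub>R \<phi>' (x + \<tau> *\<^sub>R h) \<partial>lborel) = \<phi> (x + s *\<^sub>R h) - \<phi> (x + 0 *\<^sub>R h)"
  proof (rule integral_FTC_atLeastAtMost[OF s])
    have "continuous_on UNIV \<phi>'" using assms by (simp add: test_dir_def)
    then show "continuous_on {0..s} (\<lambda>\<tau>. \<phi>' (x + \<tau> *\<^sub>R h))"
      by (rule continuous_on_compose2) (auto intro!: continuous_intros)
    show "((\<lambda>s. \<phi> (x + s *\<^sub>R h)) has_vector_derivative \<phi>' (x + \<tau> *\<^sub>R h)) (at \<tau> within {0..s})" for \<tau>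
      using d[of \<tau>] by (metis DERIV_subset has_real_derivative_iff_has_vector_derivative top_greatest)
  qed
  then show "\<phi> (x + s *\<^sub>R h) - \<phi> x = (\<integral>\<tau>. indicator {0..s} \<tau> * \<phi>' (x + \<tau> *\<^sub>R h) \<partial>lborel)" by simp
qed

lemma dir_deriv_weak:
  assumes D: "open D" and f: "dir_deriv D h f g" "sq_int f" "sq_int g" and \<phi>: "test_dir D h \<phi> \<phi>'"
  shows "(\<integral>x. f x * \<phi>' x \<partial>lborel) = - (\<integral>x. g x * \<phi> x \<partial>lborel)"
proof -
  obtain K where K: "compact K" "K \<subseteq> D" "\<And>x. x \<notin> K \<Longrightarrow> \<phi> x = 0" "\<And>x. x \<notin> K \<Longrightarrow> \<phi>' x = 0"
    using test_dirE[OF \<phi>] by metis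
  show ?thesis
    by (rule integration_by_parts_dir_deriv[OF D f test_dir_imp_dir_deriv[OF \<phi>] test_dir_sq_int[OF \<phi>] K])
qed

lemma test_dir_translation:
  assumes \<phi>: "test_dir D h \<phi> \<phi>'" and sub: "\<And>x. x \<in> D \<Longrightarrow> x + c \<in> E"
  shows "test_dir E h (\<lambda>x. \<phi> (x - c)) (\<lambda>x. \<phi>' (x - c))"
  unfolding test_dir_def
proof (intro conjI allI)
  have c: "continuous_on UNIV \<phi>" "continuous_on UNIV \<phi>'" using \<phi> by (auto simp: test_dir_def)
  show "continuous_on UNIV (\<lambda>x. \<phi> (x - c))"
    by (rule continuous_on_compose2[OF c(1)]) (auto intro!: continuous_intros)
  show "continuous_on UNIV (\<lambda>x. \<phi>' (x - c))"
    by (rule continuous_on_compose2[OF c(2)]) (auto intro!: continuous_intros)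
  obtain K where K: "compact K" "K \<subseteq> D" "\<And>x. x \<notin> K \<Longrightarrow> \<phi> x = 0" "\<And>x. x \<notin> K \<Longrightarrow> \<phi>' x = 0"
    using test_dirE[OF \<phi>] by metis
  show "\<exists>K. compact K \<and> K \<subseteq> E \<and> (\<forall>x. x \<notin> K \<longrightarrow> \<phi> (x - c) = 0 \<and> \<phi>' (x - c) = 0)"
  proof (intro exI conjI allI impI)
    show "compact ((\<lambda>x. x + c) ` K)" using K(1) by (intro compact_continuous_image continuous_intros)
    show "(\<lambda>x. x + c) ` K \<subseteq> E" using K(2) sub by auto
    fix x assume "x \<notin> (\<lambda>x. x + c) ` K"
    then have "x - c \<notin> K" by (metis diff_add_cancel imageI)
    then show "\<phi> (x - c) = 0" "\<phi>' (x - c) = 0" using K by auto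
  qed
  fix x
  have "((\<lambda>s. \<phi> ((x - c) + s *\<^sub>R h)) has_real_derivative \<phi>' (x - c)) (at 0)"
    using \<phi> by (simp add: test_dir_def)
  then show "((\<lambda>s. \<phi> (x + s *\<^sub>R h - c)) has_real_derivative \<phi>' (x - c)) (at 0)"
    by (simp add: algebra_simps)
qed

lemma test_dir_smooth:
  assumes "\<phi> \<in> test_functions D"
  shows "test_dir D h \<phi> (\<lambda>x. \<Sum>i\<in>Basis. (h \<bullet> i) * pderivative i \<phi> x)"
  unfolding test_dir_def
proof (intro conjI allI)
  have s: "smooth \<phi>" and K: "compact (closure {x. \<phi> x \<noteq> 0})" "closure {x. \<phi> x \<noteq> 0} \<subseteq> D"
    using assms by (auto simp: test_functions_def)
  show "continuous_on UNIV \<phi>" by (rule smooth_imp_continuous[OF s])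
  show "continuous_on UNIV (\<lambda>x. \<Sum>i\<in>Basis. (h \<bullet> i) * pderivative i \<phi> x)"
    by (intro continuous_on_sum continuous_on_mult continuous_on_const smooth_imp_continuous smooth_pderivative s)
  show "((\<lambda>\<tau>. \<phi> (x + \<tau> *\<^sub>R h)) has_real_derivative (\<Sum>i\<in>Basis. (h \<bullet> i) * pderivative i \<phi> x)) (at 0)" for x
  proof -
    have 1: "((\<lambda>\<tau>. x + \<tau> *\<^sub>R h) has_derivative (\<lambda>\<tau>. \<tau> *\<^sub>R h)) (at 0)" by (auto intro!: derivative_eq_intros)
    have 2: "(\<phi> has_derivative (\<lambda>h. \<Sum>i\<in>Basis. (h \<bullet> i) * pderivative i \<phi> x)) (at (x + 0 *\<^sub>R h))"
      using has_derivative_pderivative[OF smooth_imp_differentiable[OF s]] by simp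
    have eq: "(*) (\<Sum>i\<in>Basis. (h \<bullet> i) * pderivative i \<phi> x) = (\<lambda>\<tau>. \<Sum>i\<in>Basis. \<tau> * ((h \<bullet> i) * pderivative i \<phi> x))"
      by (rule ext, subst mult.commute, rule sum_distrib_left)
    show ?thesis unfolding has_field_derivative_def eq
      using has_derivative_compose[OF 1 2] by (simp only: inner_scaleR_left mult.assoc)
  qed
  show "\<exists>K. compact K \<and> K \<subseteq> D \<and> (\<forall>x. x \<notin> K \<longrightarrow> \<phi> x = 0 \<and> (\<Sum>i\<in>Basis. (h \<bullet> i) * pderivative i \<phi> x) = 0)"
  proof (intro exI[of _ "closure {x. \<phi> x \<noteq> 0}"] conjI K allI impI)
    fix x assume x: "x \<notin> closure {x. \<phi> x \<noteq> 0}"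
    then show "\<phi> x = 0" using closure_subset[of "{x. \<phi> x \<noteq> 0}"] by blast
    have "((\<lambda>x. 0) has_derivative (\<lambda>x. 0)) (at x)" by simp
    then have "(\<phi> has_derivative (\<lambda>x. 0)) (at x)"
    proof (rule has_derivative_transform_within_open)
      show "open (- closure {x. \<phi> x \<noteq> 0})" by (rule open_Compl) (rule closed_closure)
      show "x \<in> - closure {x. \<phi> x \<noteq> 0}" unfolding Compl_iff by (rule x)
      fix y assume "y \<in> - closure {x. \<phi> x \<noteq> 0}"
      then have "y \<notin> {x. \<phi> x \<noteq> 0}" using closure_subset[of "{x. \<phi> x \<noteq> 0}"] by blast
      then show "0 = \<phi> y" by simp
    qed
    from pderivativeI[OF this] show "(\<Sum>i\<in>Basis. (h \<bullet> i) * pderivative i \<phi> x) = 0" by simp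
  qed
qed

lemma test_dir_unique: "test_dir D h \<phi> \<phi>' \<Longrightarrow> test_dir E h \<phi> \<phi>'' \<Longrightarrow> \<phi>' = \<phi>''"
  unfolding test_dir_def by (intro ext) (metis DERIV_unique)

text \<open>By compactness of the segment. Openness of the set of admissible base points makes the
  fundamental lemma applicable to it.\<close>

lemma open_segment_translates:
  fixes D :: "'a::euclidean_space set"
  assumes "open D"
  shows "open {x. \<forall>\<tau>\<in>{0..s}. x + \<tau> *\<^sub>R h \<in> D}"
proof (rule openI)
  fix x assume x: "x \<in> {x. \<forall>\<tau>\<in>{0..s}. x + \<tau> *\<^sub>R h \<in> D}"
  have "compact ((\<lambda>\<tau>. x + \<tau> *\<^sub>R h) ` {0..s})" by (intro compact_continuous_image continuous_intros) auto
  moreover have "(\<lambda>\<tau>. x + \<tau> *\<^sub>R h) ` {0..s} \<subseteq> D" using x by auto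
  ultimately obtain e where e: "0 < e" "(\<Union>y\<in>(\<lambda>\<tau>. x + \<tau> *\<^sub>R h) ` {0..s}. ball y e) \<subseteq> D"
    using compact_subset_open_imp_ball_epsilon_subset[OF _ assms] by metis
  have "ball x e \<subseteq> {x. \<forall>\<tau>\<in>{0..s}. x + \<tau> *\<^sub>R h \<in> D}"
  proof clarsimp
    fix y \<tau> assume y: "dist x y < e" and t: "0 \<le> \<tau>" "\<tau> \<le> s"
    have "y + \<tau> *\<^sub>R h \<in> ball (x + \<tau> *\<^sub>R h) e" using y by (simp add: dist_norm)
    have "ball (x + \<tau> *\<^sub>R h) e \<subseteq> D" using e(2) t by (simp add: UN_subset_iff)
    with \<open>y + \<tau> *\<^sub>R h \<in> ball (x + \<tau> *\<^sub>R h) e\<close> show "y + \<tau> *\<^sub>R h \<in> D" by (rule subsetD[rotated])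
  qed
  with e(1) show "\<exists>e>0. ball x e \<subseteq> {x. \<forall>\<tau>\<in>{0..s}. x + \<tau> *\<^sub>R h \<in> D}" by blast
qed

text \<open>The defect of the segment formula is tested with a bump. The increment is shifted onto
  the bump, expanded along the segment, and the weak identity is applied to every translated bump;
  the result is the pairing of the bump with the segment integral. The fundamental lemma then kills
  the defect. Hence a weak derivative tested with bumps alone already gives the segment
  formula.\<close>

lemma dir_derivI_bump:
  fixes f g :: "'a::euclidean_space \<Rightarrow> real"
  assumes D: "open D" and f: "sq_int f" and g: "sq_int g"
    and weak: "\<And>a b n \<phi>'. cbox a b \<subseteq> D \<Longrightarrow> test_dir D h (bump a b n) \<phi>' \<Longrightarrow>
        (\<integral>x. f x * \<phi>' x \<partial>lborel) = - (\<integral>x. g x * bump a b n x \<partial>lborel)"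
  shows "dir_deriv D h f g"
  unfolding dir_deriv_def
proof (intro allI impI)
  fix s :: real assume s: "0 \<le> s"
  have [measurable]: "f \<in> borel_measurable borel" "g \<in> borel_measurable borel" using f g by (auto simp: sq_int_def)
  define J where "J x = (\<integral>\<tau>. indicator {0..s} \<tau> * g (x + \<tau> *\<^sub>R h) \<partial>lborel)" for x
  have J: "sq_int J" unfolding J_def by (rule sq_int_segment_integral[OF g s])
  define E where "E = {x. \<forall>\<tau>\<in>{0..s}. x + \<tau> *\<^sub>R h \<in> D}"
  have oE: "open E" unfolding E_def by (rule open_segment_translates[OF D])
  define F where "F x = f (x + s *\<^sub>R h) - f x - J x" for x
  have F: "sq_int F" unfolding F_def by (intro sq_int_diff sq_int_translation f J)
  have "AE x in lborel. x \<in> E \<longrightarrow> F x = 0"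
  proof (rule fundamental_lemma[OF oE])
    show "integrable lborel (\<lambda>x. indicator (cbox a b) x * F x)" for a b
      using emeasure_lborel_cbox_finite[of a b] by (intro sq_int_imp_set_integrable F) auto
    show "F \<in> borel_measurable borel" using F by (simp add: sq_int_def)
    fix a b :: 'a and n assume ab: "cbox a b \<subseteq> E"
    let ?\<phi> = "bump a b n"
    define \<phi>' where "\<phi>' = (\<lambda>x. \<Sum>i\<in>Basis. (h \<bullet> i) * pderivative i ?\<phi> x)"
    have t: "test_dir (cbox a b) h ?\<phi> \<phi>'" unfolding \<phi>'_def by (intro test_dir_smooth bump_test_function order_refl)
    have \<phi>: "sq_int ?\<phi>" "sq_int \<phi>'" using test_dir_sq_int[OF t] .
    have [measurable]: "?\<phi> \<in> borel_measurable borel" "\<phi>' \<in> borel_measurable borel" using \<phi> by (auto simp: sq_int_def)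
    have d': "dir_deriv UNIV (- h) ?\<phi> (\<lambda>x. - \<phi>' x)"
      using dir_deriv_uminus[OF test_dir_imp_dir_deriv[OF t]] by simp
    have "(\<integral>x. (f (x + s *\<^sub>R h) - f x) * ?\<phi> x \<partial>lborel)
        = (\<integral>x. f (x + s *\<^sub>R h) * ?\<phi> x \<partial>lborel) - (\<integral>x. f x * ?\<phi> x \<partial>lborel)"
      by (subst Bochner_Integration.integral_diff[symmetric])
        (auto intro!: sq_int_mult f \<phi> sq_int_translation simp: algebra_simps)
    also have "(\<integral>x. f (x + s *\<^sub>R h) * ?\<phi> x \<partial>lborel) = (\<integral>x. f x * ?\<phi> (x + s *\<^sub>R - h) \<partial>lborel)"
      by (subst integral_translation[of "\<lambda>x. f x * ?\<phi> (x + s *\<^sub>R - h)" "s *\<^sub>R h", symmetric]) auto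
    also have "(\<integral>x. f x * ?\<phi> (x + s *\<^sub>R - h) \<partial>lborel) - (\<integral>x. f x * ?\<phi> x \<partial>lborel)
       = (\<integral>x. (?\<phi> (x + s *\<^sub>R - h) - ?\<phi> x) * f x \<partial>lborel)"
      by (subst Bochner_Integration.integral_diff[symmetric])
        (auto intro!: sq_int_mult f \<phi> sq_int_translation_minus simp: algebra_simps)
    also have "\<dots> = (\<integral>\<tau>. indicator {0..s} \<tau> * (\<integral>x. - \<phi>' (x + \<tau> *\<^sub>R - h) * f x \<partial>lborel) \<partial>lborel)"
      using s by (intro dir_deriv_pairing[OF d' \<phi>(1) _ f] sq_int_minus \<phi>) auto
    also have "\<dots> = (\<integral>\<tau>. indicator {0..s} \<tau> * (\<integral>x. g (x + \<tau> *\<^sub>R h) * ?\<phi> x \<partial>lborel) \<partial>lborel)"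
    proof (intro Bochner_Integration.integral_cong refl)
      fix \<tau>
      show "indicator {0..s} \<tau> * (\<integral>x. - \<phi>' (x + \<tau> *\<^sub>R - h) * f x \<partial>lborel)
          = indicator {0..s} \<tau> * (\<integral>x. g (x + \<tau> *\<^sub>R h) * ?\<phi> x \<partial>lborel)"
      proof (cases "\<tau> \<in> {0..s}")
        case True
        have sub: "x + \<tau> *\<^sub>R h \<in> D" if "x \<in> cbox a b" for x using ab that True by (auto simp: E_def)
        \<comment> \<open>A translated bump is the bump of the translated box, so the hypothesis on
          bumps applies to it.\<close>
        have t2: "test_dir D h (bump (a + \<tau> *\<^sub>R h) (b + \<tau> *\<^sub>R h) n) (\<lambda>x. \<phi>' (x - \<tau> *\<^sub>R h))"
          using test_dir_translation[OF t sub] by (simp add: bump_translation)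
        have "cbox (a + \<tau> *\<^sub>R h) (b + \<tau> *\<^sub>R h) \<subseteq> D"
        proof
          fix x assume "x \<in> cbox (a + \<tau> *\<^sub>R h) (b + \<tau> *\<^sub>R h)"
          then have "x - \<tau> *\<^sub>R h \<in> cbox a b" by (auto simp: mem_box inner_simps algebra_simps)
          from sub[OF this] show "x \<in> D" by simp
        qed
        from weak[OF this t2]
        have "(\<integral>x. - \<phi>' (x + \<tau> *\<^sub>R - h) * f x \<partial>lborel) = (\<integral>x. g x * ?\<phi> (x - \<tau> *\<^sub>R h) \<partial>lborel)"
          by (simp add: mult.commute bump_translation)
        also have "\<dots> = (\<integral>x. g (x + \<tau> *\<^sub>R h) * ?\<phi> x \<partial>lborel)"
          by (subst integral_translation[of "\<lambda>x. g x * ?\<phi> (x - \<tau> *\<^sub>R h)" "\<tau> *\<^sub>R h", symmetric]) auto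
        finally show ?thesis by simp
      qed simp
    qed
    also have "\<dots> = (\<integral>x. J x * ?\<phi> x \<partial>lborel)"
      unfolding J_def by (rule integral_segment_swap[OF g \<phi>(1) s, symmetric])
    finally have eq: "(\<integral>x. (f (x + s *\<^sub>R h) - f x) * ?\<phi> x \<partial>lborel) = (\<integral>x. J x * ?\<phi> x \<partial>lborel)" .
    have "(\<integral>x. F x * ?\<phi> x \<partial>lborel) = (\<integral>x. (f (x + s *\<^sub>R h) - f x) * ?\<phi> x - J x * ?\<phi> x \<partial>lborel)"
      by (simp add: F_def algebra_simps)
    also have "\<dots> = (\<integral>x. (f (x + s *\<^sub>R h) - f x) * ?\<phi> x \<partial>lborel) - (\<integral>x. J x * ?\<phi> x \<partial>lborel)"
      by (intro Bochner_Integration.integral_diff sq_int_mult sq_int_diff sq_int_translation f \<phi> J)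
    finally show "(\<integral>x. F x * ?\<phi> x \<partial>lborel) = 0" using eq by simp
  qed
  then show "AE x in lborel. (\<forall>\<tau>\<in>{0..s}. x + \<tau> *\<^sub>R h \<in> D) \<longrightarrow>
     f (x + s *\<^sub>R h) - f x = (\<integral>\<tau>. indicator {0..s} \<tau> * g (x + \<tau> *\<^sub>R h) \<partial>lborel)"
    by (rule eventually_mono) (auto simp: E_def F_def J_def)
qed

lemma sq_int_mult_bounded:
  assumes f: "sq_int f" and [measurable]: "\<phi> \<in> borel_measurable borel" and B: "\<And>x. \<bar>\<phi> x\<bar> \<le> B"
  shows "sq_int (\<lambda>x. f x * \<phi> x)"
proof (rule sq_intI_bound(1)[OF sq_int_cmult[OF f, of B]])
  show "(\<lambda>x. f x * \<phi> x) \<in> borel_measurable borel" using f by (auto simp: sq_int_def)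
  have "\<bar>f x\<bar> * \<bar>\<phi> x\<bar> \<le> \<bar>f x\<bar> * \<bar>B\<bar>" for x using B[of x] by (intro mult_left_mono) auto
  then show "\<bar>f x * \<phi> x\<bar> \<le> \<bar>B * f x\<bar>" for x by (simp add: abs_mult mult.commute)
qed

lemma test_dir_mult_bounded:
  assumes "sq_int f" "test_dir D h \<phi> \<phi>'"
  shows "sq_int (\<lambda>x. f x * \<phi> x)" "sq_int (\<lambda>x. f x * \<phi>' x)"
proof -
  obtain B where "\<And>x. \<bar>\<phi> x\<bar> \<le> B" "\<And>x. \<bar>\<phi>' x\<bar> \<le> B" using test_dir_bounded[OF assms(2)] by metis
  moreover have "\<phi> \<in> borel_measurable borel" "\<phi>' \<in> borel_measurable borel"
    using test_dir_sq_int[OF assms(2)] by (auto simp: sq_int_def)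
  ultimately show "sq_int (\<lambda>x. f x * \<phi> x)" "sq_int (\<lambda>x. f x * \<phi>' x)"
    using assms(1) by (auto intro: sq_int_mult_bounded)
qed

text \<open>A product of \<open>\<phi>\<close> with a bump is again a test function for
  \<open>f\<close>, which gives the product rule in weak form. The compact support of
  \<open>\<phi>\<close> in \<open>D\<close> makes the product differentiable on the whole
  space.\<close>

lemma dir_deriv_mult_test:
  assumes D: "open D" and f: "dir_deriv D h f g" "sq_int f" "sq_int g" and \<phi>: "test_dir D h \<phi> \<phi>'"
  shows "dir_deriv UNIV h (\<lambda>x. f x * \<phi> x) (\<lambda>x. f x * \<phi>' x + g x * \<phi> x)"
proof (rule dir_derivI_bump)
  show "open (UNIV :: 'a set)" by simp
  show "sq_int (\<lambda>x. f x * \<phi> x)" "sq_int (\<lambda>x. f x * \<phi>' x + g x * \<phi> x)"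
    by (intro sq_int_add test_dir_mult_bounded[OF f(2) \<phi>] test_dir_mult_bounded[OF f(3) \<phi>])+
  fix a b n \<xi>' assume \<xi>: "test_dir UNIV h (bump a b n) \<xi>'"
  let ?\<xi> = "bump a b n"
  have i: "integrable lborel (\<lambda>x. f x * \<phi> x * \<xi>' x)" "integrable lborel (\<lambda>x. f x * \<phi>' x * ?\<xi> x)" "integrable lborel (\<lambda>x. g x * \<phi> x * ?\<xi> x)"
    by (intro sq_int_mult test_dir_mult_bounded[OF f(2) \<phi>] test_dir_mult_bounded[OF f(3) \<phi>] test_dir_sq_int[OF \<xi>])+
  have "(\<integral>x. f x * (\<phi> x * \<xi>' x + \<phi>' x * ?\<xi> x) \<partial>lborel) = - (\<integral>x. g x * (\<phi> x * ?\<xi> x) \<partial>lborel)"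
    by (rule dir_deriv_weak[OF D f test_dir_mult[OF \<phi> \<xi>]])
  also have "(\<integral>x. f x * (\<phi> x * \<xi>' x + \<phi>' x * ?\<xi> x) \<partial>lborel) = (\<integral>x. f x * \<phi> x * \<xi>' x \<partial>lborel) + (\<integral>x. f x * \<phi>' x * ?\<xi> x \<partial>lborel)"
    using i by (subst Bochner_Integration.integral_add[symmetric]) (auto simp: algebra_simps)
  finally show "(\<integral>x. f x * \<phi> x * \<xi>' x \<partial>lborel) = - (\<integral>x. (f x * \<phi>' x + g x * \<phi> x) * ?\<xi> x \<partial>lborel)"
    using i by (simp add: distrib_right mult.assoc)
qed

text \<open>The product of \<open>f2\<close> and \<open>\<phi>\<close> serves as the compactly
  supported second factor. Thus \<open>f1\<close> and \<open>f2\<close> may both be merely weakly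
  differentiable, although the derivative of \<open>f1 * f2\<close> need not be square
  integrable.\<close>

theorem integration_by_parts_product:
  assumes D: "open D" and f1: "dir_deriv D h f1 g1" "sq_int f1" "sq_int g1"
    and f2: "dir_deriv D h f2 g2" "sq_int f2" "sq_int g2" and \<phi>: "test_dir D h \<phi> \<phi>'"
  shows "(\<integral>x. f1 x * (f2 x * \<phi>' x + g2 x * \<phi> x) \<partial>lborel) = - (\<integral>x. g1 x * (f2 x * \<phi> x) \<partial>lborel)"
proof -
  obtain K where K: "compact K" "K \<subseteq> D" "\<And>x. x \<notin> K \<Longrightarrow> \<phi> x = 0" "\<And>x. x \<notin> K \<Longrightarrow> \<phi>' x = 0"
    using test_dirE[OF \<phi>] by metis
  show ?thesis
    by (rule integration_by_parts_dir_deriv[OF D f1 dir_deriv_mult_test[OF D f2 \<phi>] _ _ K(1,2)])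
      (use K in \<open>auto intro!: sq_int_add test_dir_mult_bounded[OF f2(2) \<phi>] test_dir_mult_bounded[OF f2(3) \<phi>]\<close>)
qed

section \<open>The derivative of a reciprocal\<close>

lemma sq_intI_bound_AE:
  assumes g: "sq_int g" and [measurable]: "f \<in> borel_measurable borel" and le: "AE x in lborel. \<bar>f x\<bar> \<le> \<bar>g x\<bar>"
  shows "sq_int f" "nrm2 f \<le> nrm2 g"
proof -
  have "(\<integral>\<^sup>+x. ennreal ((f x)\<^sup>2) \<partial>lborel) \<le> (\<integral>\<^sup>+x. ennreal ((g x)\<^sup>2) \<partial>lborel)"
    using le by (intro nn_integral_mono_AE) (auto elim!: eventually_mono simp: abs_le_square_iff)
  then have "(\<integral>\<^sup>+x. ennreal ((f x)\<^sup>2) \<partial>lborel) \<le> ennreal ((nrm2 g)\<^sup>2)" by (simp add: nn_integral_square[OF g])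
  then show "sq_int f" "nrm2 f \<le> nrm2 g" by (auto intro!: sq_intI_nn_integral)
qed

text \<open>The increment of a reciprocal is exactly minus the increment of \<open>f\<close> times
  the two reciprocals at the end points. This makes \<open>r\<close> L2 Lipschitz, and freezing one
  reciprocal gives the derivative up to a product of two increments. The bound concerns
  \<open>\<bar>f x\<bar>\<close>, so no sign of \<open>f\<close> is fixed. Setting \<open>r\<close>
  to 0 where the bound fails makes \<open>\<bar>r x\<bar> \<le> 1 / c\<close> true at every point,
  and boundedness of \<open>D\<close> makes \<open>r\<close> square integrable.\<close>

lemma dir_deriv_inverse:
  fixes f :: "'a::euclidean_space \<Rightarrow> real"
  assumes D: "open D" "bounded D" and f: "dir_deriv D h f g" "sq_int f" "sq_int g"
    and c: "0 < c" and lower: "AE x in lborel. x \<in> D \<longrightarrow> c \<le> \<bar>f x\<bar>"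
  defines "r \<equiv> \<lambda>x. if x \<in> D \<and> c \<le> \<bar>f x\<bar> then 1 / f x else 0"
  shows "dir_deriv D h r (\<lambda>x. - g x * (r x)\<^sup>2)" "sq_int r" "sq_int (\<lambda>x. - g x * (r x)\<^sup>2)" "\<And>x. \<bar>r x\<bar> \<le> 1 / c"
proof -
  have [measurable]: "f \<in> borel_measurable borel" "g \<in> borel_measurable borel" "D \<in> sets borel"
    using f D by (auto simp: sq_int_def)
  have [measurable]: "r \<in> borel_measurable borel" unfolding r_def by measurable
  show rb: "\<bar>r x\<bar> \<le> 1 / c" for x using c by (auto simp: r_def divide_simps)
  have rb2: "\<bar>(r x)\<^sup>2\<bar> \<le> 1 / c\<^sup>2" for x using power_mono[OF rb[of x], of 2] by (simp add: power_divide)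
  have iD: "sq_int (indicator D :: 'a \<Rightarrow> real)"
    using emeasure_bounded_finite[OF D(2)] integrable_real_indicator[of D lborel]
    by (simp add: sq_int_def power2_eq_square flip: indicator_inter_arith)
  show r: "sq_int r"
  proof (rule sq_intI_bound(1)[OF sq_int_cmult[OF iD, of "1 / c"]])
    show "\<bar>r x\<bar> \<le> \<bar>1 / c * indicator D x\<bar>" for x
      using rb[of x] c by (cases "x \<in> D") (auto simp: r_def)
  qed measurable
  have g': "sq_int (\<lambda>x. g x * (r x)\<^sup>2)" by (rule sq_int_mult_bounded[OF f(3) _ rb2]) measurable
  then show g'': "sq_int (\<lambda>x. - g x * (r x)\<^sup>2)" using sq_int_minus by fastforce
  have diff: "\<bar>r y - r x\<bar> \<le> 1 / c\<^sup>2 * \<bar>f y - f x\<bar>" and mult: "r y - r x = - (f y - f x) * r x * r y"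
    if "x \<in> D" "y \<in> D" "x \<in> D \<longrightarrow> c \<le> \<bar>f x\<bar>" "y \<in> D \<longrightarrow> c \<le> \<bar>f y\<bar>" for x y
  proof -
    have nz: "f x \<noteq> 0" "f y \<noteq> 0" using that c by auto
    show m: "r y - r x = - (f y - f x) * r x * r y" using that nz by (simp add: r_def field_simps)
    have "\<bar>r x\<bar> * \<bar>r y\<bar> \<le> (1 / c) * (1 / c)" using c by (intro mult_mono rb) auto
    from mult_left_mono[OF this, of "\<bar>f y - f x\<bar>"] show "\<bar>r y - r x\<bar> \<le> 1 / c\<^sup>2 * \<bar>f y - f x\<bar>"
      unfolding m by (simp only: abs_mult abs_minus_cancel) (simp add: power2_eq_square mult_ac)
  qed
  show "dir_deriv D h r (\<lambda>x. - g x * (r x)\<^sup>2)"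
  proof (rule dir_derivI_bump[OF D(1) r g''])
    fix a b n \<phi>' assume ab: "cbox a b \<subseteq> D" and t0: "test_dir D h (bump a b n) \<phi>'"
    define \<phi> where "\<phi> = bump a b n"
    have t: "test_dir D h \<phi> \<phi>'" using t0 by (simp add: \<phi>_def)
    have \<phi>1: "\<bar>\<phi> x\<bar> \<le> 1" for x using bump_nonneg[of a b n x] bump_le_1[of a b n x] by (simp add: \<phi>_def)
    obtain K where K: "compact K" "K \<subseteq> D" "\<And>x. x \<notin> K \<Longrightarrow> \<phi> x = 0" "\<And>x. x \<notin> K \<Longrightarrow> \<phi>' x = 0"
      using test_dirE[OF t] by metis
    have [measurable]: "K \<in> sets borel" using K(1) by (rule borel_compact)
    note \<phi> = test_dir_sq_int[OF t]
    have [measurable]: "\<phi> \<in> borel_measurable borel" "\<phi>' \<in> borel_measurable borel" using \<phi> by (auto simp: sq_int_def)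
    have d: "dir_deriv UNIV h \<phi> \<phi>'" by (rule test_dir_imp_dir_deriv[OF t])
    have d': "dir_deriv UNIV (- h) \<phi> (\<lambda>x. - \<phi>' x)" using dir_deriv_uminus[OF d] by simp
    have f': "dir_deriv D (- h) f (\<lambda>x. - g x)" using dir_deriv_uminus[OF f(1)] by simp
    obtain s0 where s0: "0 < s0" "\<And>x \<tau>. x \<in> K \<Longrightarrow> \<bar>\<tau>\<bar> \<le> s0 \<Longrightarrow> x + \<tau> *\<^sub>R h \<in> D"
      using compact_translate_subset_open[OF K(1) D(1) K(2)] by blast
    \<comment> \<open>Both signs occur: \<open>h\<close> in the increment of \<open>r\<close>, and
      \<open>- h\<close> when the weight \<open>\<psi>\<close> is shifted back.\<close>
    have rdiff: "sq_int (\<lambda>x. indicator K x * (r (x + \<tau> *\<^sub>R k) - r x))"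
      "nrm2 (\<lambda>x. indicator K x * (r (x + \<tau> *\<^sub>R k) - r x)) \<le> \<tau> * (nrm2 g / c\<^sup>2)"
      if "0 \<le> \<tau>" "\<tau> \<le> s0" "k = h \<or> k = - h" for \<tau> k
    proof -
      have seg: "x + \<sigma> *\<^sub>R k \<in> D" if "x \<in> K" "0 \<le> \<sigma>" "\<sigma> \<le> \<tau>" for x \<sigma>
        using s0(2)[of x \<sigma>] s0(2)[of x "- \<sigma>"] that \<open>\<tau> \<le> s0\<close> \<open>k = h \<or> k = - h\<close> by auto
      have "sq_int (\<lambda>x. indicator K x * (f (x + \<tau> *\<^sub>R k) - f x)) \<and>
          nrm2 (\<lambda>x. indicator K x * (f (x + \<tau> *\<^sub>R k) - f x)) \<le> \<tau> * nrm2 g"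
        using that(3)
      proof
        assume "k = h" then show ?thesis using translation_bound[OF f(1,3), of K \<tau>] seg that(1) by simp
      next
        assume "k = - h" then show ?thesis
          using translation_bound[OF f' sq_int_minus[OF f(3)], of K \<tau>] seg that(1) nrm2_cmult[of "-1" g] by simp
      qed
      then have F: "sq_int (\<lambda>x. indicator K x * (f (x + \<tau> *\<^sub>R k) - f x))"
          "nrm2 (\<lambda>x. indicator K x * (f (x + \<tau> *\<^sub>R k) - f x)) \<le> \<tau> * nrm2 g" by auto
      have ae: "AE x in lborel. \<bar>indicator K x * (r (x + \<tau> *\<^sub>R k) - r x)\<bar> \<le> \<bar>1 / c\<^sup>2 * (indicator K x * (f (x + \<tau> *\<^sub>R k) - f x))\<bar>"
        using lower AE_translation[OF lower, of "\<tau> *\<^sub>R k"]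
      proof eventually_elim
        case (elim x)
        show ?case
        proof (cases "x \<in> K")
          case True
          then have "x \<in> D" "x + \<tau> *\<^sub>R k \<in> D" using K(2) seg[of x \<tau>] that(1) by auto
          from diff[OF this elim] True show ?thesis by (simp add: abs_mult)
        qed simp
      qed
      note B = sq_intI_bound_AE[OF sq_int_cmult[OF F(1), of "1 / c\<^sup>2"] _ ae]
      show "sq_int (\<lambda>x. indicator K x * (r (x + \<tau> *\<^sub>R k) - r x))" by (rule B(1)) measurable
      have "nrm2 (\<lambda>x. indicator K x * (r (x + \<tau> *\<^sub>R k) - r x)) \<le> nrm2 (\<lambda>x. 1 / c\<^sup>2 * (indicator K x * (f (x + \<tau> *\<^sub>R k) - f x)))"
        by (rule B(2)) measurable
      also have "\<dots> = 1 / c\<^sup>2 * nrm2 (\<lambda>x. indicator K x * (f (x + \<tau> *\<^sub>R k) - f x))" by (subst nrm2_cmult) simp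
      also have "\<dots> \<le> 1 / c\<^sup>2 * (\<tau> * nrm2 g)" by (intro mult_left_mono F) auto
      finally show "nrm2 (\<lambda>x. indicator K x * (r (x + \<tau> *\<^sub>R k) - r x)) \<le> \<tau> * (nrm2 g / c\<^sup>2)" by (simp add: mult_ac)
    qed
    \<comment> \<open>The weight against which \<open>g\<close> must appear if the derivative of
      \<open>r\<close> is to be \<open>- g x * (r x)\<^sup>2\<close>.\<close>
    define \<psi> where "\<psi> x = (r x)\<^sup>2 * \<phi> x" for x
    have \<psi>: "sq_int \<psi>" unfolding \<psi>_def using sq_int_mult_bounded[OF \<phi>(1) _ rb2] by (simp add: mult.commute)
    have [measurable]: "\<psi> \<in> borel_measurable borel" using \<psi> by (auto simp: sq_int_def)
    \<comment> \<open>The L2 Lipschitz constant of \<open>\<psi>\<close>: the first summand comes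
      from varying \<open>\<phi>\<close>, the second from varying the square of
      \<open>r\<close>.\<close>
    define M where "M = 1 / c\<^sup>2 * nrm2 \<phi>' + 2 / c * (nrm2 g / c\<^sup>2)"
    \<comment> \<open>Collects three second-order errors: moving the increment of \<open>r\<close>
      onto \<open>\<phi>\<close>, the product of two increments, and the expansion of the increment
      of \<open>f\<close>.\<close>
    define C where "C = nrm2 g / c\<^sup>2 * nrm2 \<phi>' + nrm2 g * (1 / c * (nrm2 g / c\<^sup>2)) + nrm2 g * M"
    have "(\<integral>x. r x * \<phi>' x \<partial>lborel) - (\<integral>x. g x * \<psi> x \<partial>lborel) = 0"
    proof (rule eq_zero_if_quadratic_bound[OF s0(1)])
      fix s assume s: "0 < s" "s \<le> s0"
      define X where "X = (\<integral>x. (r (x + s *\<^sub>R h) - r x) * \<phi> x \<partial>lborel)"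
      have 1: "\<bar>X + s * (\<integral>x. r x * \<phi>' x \<partial>lborel)\<bar> \<le> s * (s * (nrm2 g / c\<^sup>2 * nrm2 \<phi>'))" unfolding X_def
      proof (rule difference_pairing_close_weak[OF d \<phi> r K(4)])
        fix \<tau> assume t: "0 \<le> \<tau>" "\<tau> \<le> s"
        have "nrm2 (\<lambda>x. indicator K x * (r (x + \<tau> *\<^sub>R h) - r x)) \<le> \<tau> * (nrm2 g / c\<^sup>2)"
          using t s by (intro rdiff) auto
        also have "\<dots> \<le> s * (nrm2 g / c\<^sup>2)" using t by (intro mult_right_mono) auto
        finally show "sq_int (\<lambda>x. indicator K x * (r (x + \<tau> *\<^sub>R h) - r x)) \<and>
            nrm2 (\<lambda>x. indicator K x * (r (x + \<tau> *\<^sub>R h) - r x)) \<le> s * (nrm2 g / c\<^sup>2)"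
          using t s by (intro conjI rdiff(1)) auto
      qed (use s in auto)
      define Y where "Y = (\<integral>x. (f (x + s *\<^sub>R h) - f x) * \<psi> x \<partial>lborel)"
      have 2: "\<bar>Y - s * (\<integral>x. g x * \<psi> x \<partial>lborel)\<bar> \<le> s * (s * (nrm2 g * M))" unfolding Y_def
      proof (rule difference_pairing_close_strong[OF f \<psi>])
        fix x \<tau> assume "\<psi> x \<noteq> 0" "0 \<le> \<tau>" "\<tau> \<le> s"
        then show "x + \<tau> *\<^sub>R h \<in> D" using K(3) s by (intro s0) (auto simp: \<psi>_def)
      next
        fix \<tau> assume t: "0 \<le> \<tau>" "\<tau> \<le> s"
        let ?A = "\<lambda>x. 1 / c\<^sup>2 * \<bar>indicator UNIV x * (\<phi> (x + \<tau> *\<^sub>R - h) - \<phi> x)\<bar>"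
        let ?B = "\<lambda>x. 2 / c * \<bar>indicator K x * (r (x + \<tau> *\<^sub>R - h) - r x)\<bar>"
        have A0: "sq_int (\<lambda>x. indicator UNIV x * (\<phi> (x + \<tau> *\<^sub>R - h) - \<phi> x))"
          "nrm2 (\<lambda>x. indicator UNIV x * (\<phi> (x + \<tau> *\<^sub>R - h) - \<phi> x)) \<le> \<tau> * nrm2 (\<lambda>x. - \<phi>' x)"
          using t by (intro translation_bound[OF d'] sq_int_minus \<phi>; simp)+
        have B0: "sq_int (\<lambda>x. indicator K x * (r (x + \<tau> *\<^sub>R - h) - r x))"
          "nrm2 (\<lambda>x. indicator K x * (r (x + \<tau> *\<^sub>R - h) - r x)) \<le> \<tau> * (nrm2 g / c\<^sup>2)"
          using t s by (intro rdiff; simp)+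
        have abs2: "nrm2 (\<lambda>x. \<bar>F x\<bar>) = nrm2 F" for F :: "'a \<Rightarrow> real" by (simp add: nrm2_def)
        have AB: "sq_int ?A" "sq_int ?B" using A0(1) B0(1) by (intro sq_int_cmult sq_int_abs; simp)+
        have "nrm2 (\<lambda>x. \<psi> (x + \<tau> *\<^sub>R - h) - \<psi> x) \<le> nrm2 (\<lambda>x. ?A x + ?B x)"
        proof (rule sq_intI_bound(2)[OF sq_int_add[OF AB]])
          fix x
          define y where "y = x + \<tau> *\<^sub>R - h"
          \<comment> \<open>The difference of squares is factored so that only one increment of
            \<open>r\<close> remains, multiplied by bounded terms; \<open>\<phi> x\<close> confines
            it to \<open>K\<close>.\<close>
          have "\<psi> y - \<psi> x = (r y)\<^sup>2 * (\<phi> y - \<phi> x) + \<phi> x * ((r y + r x) * (r y - r x))"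
            by (simp add: \<psi>_def power2_eq_square algebra_simps)
          also have "\<bar>\<dots>\<bar> \<le> \<bar>(r y)\<^sup>2 * (\<phi> y - \<phi> x)\<bar> + \<bar>\<phi> x * ((r y + r x) * (r y - r x))\<bar>"
            by (rule abs_triangle_ineq)
          also have "\<bar>(r y)\<^sup>2 * (\<phi> y - \<phi> x)\<bar> \<le> 1 / c\<^sup>2 * \<bar>\<phi> y - \<phi> x\<bar>"
            unfolding abs_mult using rb2[of y] by (intro mult_right_mono) auto
          also have "\<bar>\<phi> x * ((r y + r x) * (r y - r x))\<bar> \<le> ?B x"
          proof (cases "x \<in> K")
            case True
            have "\<bar>r y + r x\<bar> \<le> 2 / c" using rb[of x] rb[of y] by linarith
            then have "\<bar>\<phi> x\<bar> * (\<bar>r y + r x\<bar> * \<bar>r y - r x\<bar>) \<le> 1 * (2 / c * \<bar>r y - r x\<bar>)"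
              using \<phi>1[of x] c by (intro mult_mono) auto
            then show ?thesis using True by (simp add: abs_mult y_def)
          qed (simp add: K)
          finally show "\<bar>\<psi> (x + \<tau> *\<^sub>R - h) - \<psi> x\<bar> \<le> \<bar>?A x + ?B x\<bar>"
            by (simp add: y_def)
        qed measurable
        also have "\<dots> \<le> nrm2 ?A + nrm2 ?B" by (rule nrm2_triangle[OF AB])
        also have "\<dots> = 1 / c\<^sup>2 * nrm2 (\<lambda>x. indicator UNIV x * (\<phi> (x + \<tau> *\<^sub>R - h) - \<phi> x))
            + 2 / c * nrm2 (\<lambda>x. indicator K x * (r (x + \<tau> *\<^sub>R - h) - r x))"
          unfolding nrm2_cmult abs2 using c by simp
        also have "\<dots> \<le> 1 / c\<^sup>2 * (\<tau> * nrm2 \<phi>') + 2 / c * (\<tau> * (nrm2 g / c\<^sup>2))"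
          using A0(2) B0(2) c nrm2_cmult[of "-1" \<phi>'] by (intro add_mono mult_left_mono) auto
        also have "\<dots> = \<tau> * M" by (simp add: M_def algebra_simps)
        also have "\<dots> \<le> s * M" using t c by (intro mult_right_mono) (auto simp: M_def)
        finally show "nrm2 (\<lambda>x. \<psi> (x + \<tau> *\<^sub>R - h) - \<psi> x) \<le> s * M" .
      qed (use s in simp)
      let ?F = "\<lambda>x. indicator K x * (f (x + s *\<^sub>R h) - f x)"
      let ?R = "\<lambda>x. indicator K x * (r (x + s *\<^sub>R h) - r x)"
      have F: "sq_int ?F" "nrm2 ?F \<le> s * nrm2 g"
        using s by (intro translation_bound[OF f(1,3)] s0; simp)+
      have R: "sq_int ?R" "nrm2 ?R \<le> s * (nrm2 g / c\<^sup>2)"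
        using s by (intro rdiff; simp)+
      have rphi: "\<bar>r x * \<phi> x\<bar> \<le> 1 / c" for x
        using mult_mono[OF rb[of x] \<phi>1[of x]] c by (simp add: abs_mult)
      have Rr: "sq_int (\<lambda>x. ?R x * (r x * \<phi> x))" by (rule sq_int_mult_bounded[OF R(1) _ rphi]) measurable
      have "nrm2 (\<lambda>x. ?R x * (r x * \<phi> x)) \<le> nrm2 (\<lambda>x. 1 / c * ?R x)"
      proof (rule sq_intI_bound(2)[OF sq_int_cmult[OF R(1)]])
        show "\<bar>?R x * (r x * \<phi> x)\<bar> \<le> \<bar>1 / c * ?R x\<bar>" for x
          using mult_left_mono[OF rphi[of x], of "\<bar>?R x\<bar>"] c by (simp add: abs_mult mult_ac)
      qed measurable
      also have "\<dots> = 1 / c * nrm2 ?R" unfolding nrm2_cmult using c by simp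
      also have "\<dots> \<le> 1 / c * (s * (nrm2 g / c\<^sup>2))" using c by (intro mult_left_mono R) auto
      finally have Rr2: "nrm2 (\<lambda>x. ?R x * (r x * \<phi> x)) \<le> 1 / c * (s * (nrm2 g / c\<^sup>2))" .
      define Z where "Z = (\<integral>x. ?F x * (?R x * (r x * \<phi> x)) \<partial>lborel)"
      have "\<bar>Z\<bar> \<le> nrm2 ?F * nrm2 (\<lambda>x. ?R x * (r x * \<phi> x))" unfolding Z_def by (rule abs_integral_mult_le[OF F(1) Rr])
      also have "\<dots> \<le> (s * nrm2 g) * (1 / c * (s * (nrm2 g / c\<^sup>2)))" using s by (intro mult_mono F Rr2) auto
      finally have 3: "\<bar>Z\<bar> \<le> s * (s * (nrm2 g * (1 / c * (nrm2 g / c\<^sup>2))))" by (simp add: mult_ac)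
      \<comment> \<open>In the exact increment of \<open>r\<close>, the reciprocal at the far end is
        written as \<open>r x\<close> plus its own increment. The first part contributes
        \<open>- Y\<close>, the second the product \<open>Z\<close> of two increments.\<close>
      have "X = (\<integral>x. - ((f (x + s *\<^sub>R h) - f x) * \<psi> x) - ?F x * (?R x * (r x * \<phi> x)) \<partial>lborel)"
        unfolding X_def
      proof (rule integral_cong_AE)
        show "AE x in lborel. (r (x + s *\<^sub>R h) - r x) * \<phi> x = - ((f (x + s *\<^sub>R h) - f x) * \<psi> x) - ?F x * (?R x * (r x * \<phi> x))"
          using lower AE_translation[OF lower, of "s *\<^sub>R h"]
        proof eventually_elim
          case (elim x)
          show ?case
          proof (cases "x \<in> K")
            case True
            then have "x \<in> D" "x + s *\<^sub>R h \<in> D" using K(2) s0(2)[of x s] s by auto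
            from mult[OF this elim] True have e: "r (x + s *\<^sub>R h) - r x = - (f (x + s *\<^sub>R h) - f x) * r x * r (x + s *\<^sub>R h)" by simp
            have "(r (x + s *\<^sub>R h) - r x) * \<phi> x = - (f (x + s *\<^sub>R h) - f x) * r x * (r x + (r (x + s *\<^sub>R h) - r x)) * \<phi> x"
              by (subst e) simp
            then show ?thesis using True by (simp add: \<psi>_def power2_eq_square algebra_simps)
          qed (simp add: K \<psi>_def)
        qed
      qed measurable
      also have "\<dots> = (\<integral>x. - ((f (x + s *\<^sub>R h) - f x) * \<psi> x) \<partial>lborel) - Z" unfolding Z_def
        by (intro Bochner_Integration.integral_diff integrable_minus sq_int_mult sq_int_diff sq_int_translation f \<psi> F Rr)
      finally have 4: "X = - Y - Z" by (simp add: Y_def)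
      \<comment> \<open>Since \<open>X = - Y - Z\<close>, the first-order terms are what
        \<open>X\<close> and \<open>Y\<close> approximate, and three errors of second order
        remain.\<close>
      have "s * ((\<integral>x. r x * \<phi>' x \<partial>lborel) - (\<integral>x. g x * \<psi> x \<partial>lborel))
        = (X + s * (\<integral>x. r x * \<phi>' x \<partial>lborel)) + (Y - s * (\<integral>x. g x * \<psi> x \<partial>lborel)) + Z"
        unfolding 4 by (simp add: algebra_simps)
      also have "\<bar>\<dots>\<bar> \<le> s * (s * (nrm2 g / c\<^sup>2 * nrm2 \<phi>')) + s * (s * (nrm2 g * M)) + s * (s * (nrm2 g * (1 / c * (nrm2 g / c\<^sup>2))))"
        using 1 2 3 by linarith
      also have "\<dots> = s * (s * C)" by (simp add: C_def algebra_simps)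
      finally show "\<bar>s * ((\<integral>x. r x * \<phi>' x \<partial>lborel) - (\<integral>x. g x * \<psi> x \<partial>lborel))\<bar> \<le> s * (s * C)" .
    qed
    then show "(\<integral>x. r x * \<phi>' x \<partial>lborel) = - (\<integral>x. - g x * (r x)\<^sup>2 * bump a b n x \<partial>lborel)"
      by (simp add: \<psi>_def \<phi>_def mult.assoc)
  qed
qed

section \<open>Cone condition\<close>

lemma cone_condition_interior:
  fixes \<Omega> :: "'a::euclidean_space set"
  assumes "open \<Omega>" "x0 \<in> \<Omega>"
  shows "\<exists>r>0. \<exists>h0. \<exists>\<rho>>0. \<forall>x\<in>\<Omega> \<inter> ball x0 r. \<forall>s\<in>{0..1}. \<forall>h\<in>ball h0 \<rho>. x + s *\<^sub>R h \<in> \<Omega>"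
proof -
  obtain e where e: "e > 0" "ball x0 e \<subseteq> \<Omega>" using assms openE by blast
  have "x + s *\<^sub>R h \<in> \<Omega>" if "x \<in> ball x0 (e / 2)" "s \<in> {0..1}" "h \<in> ball 0 (e / 2)" for x s h
  proof -
    have "norm (s *\<^sub>R h) \<le> norm h" using that(2) by (simp add: mult_left_le_one_le)
    then have "dist x0 (x + s *\<^sub>R h) < e"
      using that(1,3) norm_triangle_ineq4[of "x0 - x" "s *\<^sub>R h"] by (simp add: dist_norm diff_diff_add)
    then show ?thesis using e(2) by auto
  qed
  then show ?thesis using e(1) by (intro exI[of _ "e / 2"] exI[of _ 0] conjI) auto
qed

text \<open>The partial derivatives are continuous, hence bounded on a ball. The constant is local,
  since the gradient of \<open>\<gamma>\<close> may be unbounded on the whole space.\<close>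

lemma C2_Lipschitz_on_ball:
  fixes \<gamma> :: "'a::euclidean_space \<Rightarrow> real"
  assumes "C_k 2 \<gamma>"
  obtains L where "0 \<le> L" "\<And>x y. x \<in> cball c R \<Longrightarrow> y \<in> cball c R \<Longrightarrow> \<bar>\<gamma> x - \<gamma> y\<bar> \<le> L * norm (x - y)"
proof -
  have C: "C_k (Suc (Suc 0)) \<gamma>" using assms by (simp add: numeral_2_eq_2)
  have "\<exists>B. \<forall>x\<in>cball c R. \<bar>pderivative i \<gamma> x\<bar> \<le> B" if "i \<in> Basis" for i
  proof -
    have "C_k (Suc 0) (pderivative i \<gamma>)" using C that by simp
    then have "continuous_on (cball c R) (pderivative i \<gamma>)"
      by (rule continuous_on_subset[OF C_k_continuous]) simp
    then have "bounded (pderivative i \<gamma> ` cball c R)"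
      by (intro compact_imp_bounded compact_continuous_image compact_cball)
    then show ?thesis by (auto simp: bounded_real)
  qed
  then obtain B where B: "\<And>i x. i \<in> Basis \<Longrightarrow> x \<in> cball c R \<Longrightarrow> \<bar>pderivative i \<gamma> x\<bar> \<le> B i" by metis
  define L where "L = (\<Sum>i\<in>(Basis :: 'a set). \<bar>B i\<bar>)"
  show thesis
  proof
    show "0 \<le> L" by (simp add: L_def sum_nonneg)
    fix x y assume xy: "x \<in> cball c R" "y \<in> cball c R"
    have "norm (\<gamma> x - \<gamma> y) \<le> L * norm (x - y)"
    proof (rule differentiable_bound[OF convex_cball _ _ xy])
      fix z assume z: "z \<in> cball c R"
      have "\<gamma> differentiable at z" using C by simp
      from has_derivative_pderivative[OF this]
      show "(\<gamma> has_derivative (\<lambda>h. \<Sum>i\<in>Basis. (h \<bullet> i) * pderivative i \<gamma> z)) (at z within cball c R)"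
        by (rule has_derivative_at_withinI)
      show "onorm (\<lambda>h. \<Sum>i\<in>Basis. (h \<bullet> i) * pderivative i \<gamma> z) \<le> L"
      proof (rule onorm_bound)
        show "0 \<le> L" by fact
        fix h :: 'a
        have "norm (\<Sum>i\<in>Basis. (h \<bullet> i) * pderivative i \<gamma> z) \<le> (\<Sum>i\<in>Basis. norm ((h \<bullet> i) * pderivative i \<gamma> z))"
          by (rule norm_sum)
        also have "\<dots> \<le> (\<Sum>i\<in>Basis. norm h * \<bar>B i\<bar>)"
        proof (rule sum_mono)
          fix i :: 'a assume i: "i \<in> Basis"
          have "\<bar>pderivative i \<gamma> z\<bar> \<le> \<bar>B i\<bar>" using B[OF i z] by linarith
          then show "norm ((h \<bullet> i) * pderivative i \<gamma> z) \<le> norm h * \<bar>B i\<bar>"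
            unfolding norm_mult real_norm_def abs_mult using Basis_le_norm[OF i, of h] by (intro mult_mono) auto
        qed
        also have "\<dots> = L * norm h" by (simp add: L_def sum_distrib_left mult.commute)
        finally show "norm (\<Sum>i\<in>Basis. (h \<bullet> i) * pderivative i \<gamma> z) \<le> L * norm h" .
      qed
    qed
    then show "\<bar>\<gamma> x - \<gamma> y\<bar> \<le> L * norm (x - y)" by simp
  qed
qed

text \<open>Moving from a point of the epigraph in a direction close to \<open>e\<close> gains
  height faster than \<open>\<gamma>\<close> can rise, by its Lipschitz bound.\<close>

lemma cone_condition_boundary:
  fixes \<Omega> :: "'a::euclidean_space set"
  assumes \<Omega>: "C2_boundary \<Omega>" and x0: "x0 \<in> frontier \<Omega>"
  shows "\<exists>r>0. \<exists>h0. \<exists>\<rho>>0. \<forall>x\<in>\<Omega> \<inter> ball x0 r. \<forall>s\<in>{0..1}. \<forall>h\<in>ball h0 \<rho>. x + s *\<^sub>R h \<in> \<Omega>"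
proof -
  obtain r e \<gamma> where r: "r > 0" and e: "norm e = 1" and \<gamma>: "C_k 2 \<gamma>"
    and eq: "\<Omega> \<inter> ball x0 r = {x \<in> ball x0 r. \<gamma> (x - (x \<bullet> e) *\<^sub>R e) < x \<bullet> e}"
    using bspec[OF \<Omega>[unfolded C2_boundary_def] x0] by (elim exE conjE)
  \<comment> \<open>The orthogonal projection onto the hyperplane on which \<open>\<gamma>\<close>
    is evaluated.\<close>
  define P where "P x = x - (x \<bullet> e) *\<^sub>R e" for x
  have mem: "y \<in> \<Omega> \<longleftrightarrow> \<gamma> (P y) < y \<bullet> e" if "y \<in> ball x0 r" for y
    using arg_cong[OF eq, of "\<lambda>S. y \<in> S"] that unfolding P_def by (simp only: Int_iff mem_Collect_eq simp_thms)
  have ee: "e \<bullet> e = 1" using e by (simp add: dot_square_norm)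
  have Padd: "P (x + y) = P x + P y" and Pscale: "P (s *\<^sub>R x) = s *\<^sub>R P x" for x y s
    by (simp_all add: P_def inner_simps algebra_simps)
  have Pe: "P e = 0" by (simp add: P_def ee)
  have Pn: "norm (P x) \<le> norm x" for x
  proof -
    have "(norm (P x))\<^sup>2 = (norm x)\<^sup>2 - (x \<bullet> e)\<^sup>2"
      unfolding P_def power2_norm_eq_inner by (simp add: inner_simps ee power2_eq_square inner_commute)
    also have "\<dots> \<le> (norm x)\<^sup>2" by simp
    finally show ?thesis by simp
  qed
  obtain L where L: "0 \<le> L" "\<And>x y. x \<in> cball (P x0) r \<Longrightarrow> y \<in> cball (P x0) r \<Longrightarrow> \<bar>\<gamma> x - \<gamma> y\<bar> \<le> L * norm (x - y)"
    using C2_Lipschitz_on_ball[OF \<gamma>] by metis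
  \<comment> \<open>The opening of the cone: horizontal drift \<open>l * \<delta>\<close> raises
    \<open>\<gamma>\<close> by at most \<open>L * (l * \<delta>)\<close>, which must stay below the
    height gain \<open>l * (1 - \<delta>)\<close>.\<close>
  define \<delta> where "\<delta> = 1 / (L + 2)"
  have \<delta>: "0 < \<delta>" "L * \<delta> < 1 - \<delta>" "\<delta> < 1" using L(1) by (auto simp: \<delta>_def field_simps)
  \<comment> \<open>Directions then have norm below \<open>r / 2\<close>, so starting points in the
    ball of radius \<open>r / 2\<close> do not leave the chart.\<close>
  define l where "l = r / 4"
  have "x + s *\<^sub>R h \<in> \<Omega>" if x: "x \<in> \<Omega>" "x \<in> ball x0 (r / 2)" and s: "s \<in> {0..1}" and h: "h \<in> ball (l *\<^sub>R e) (l * \<delta>)" for x s h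
  proof -
    have hl: "norm (h - l *\<^sub>R e) < l * \<delta>" using h by (simp add: dist_norm norm_minus_commute)
    have l: "0 < l" using r by (simp add: l_def)
    have "l * \<delta> < l" using \<delta> l by simp
    moreover have "norm h \<le> norm (h - l *\<^sub>R e) + l" using norm_triangle_ineq[of "h - l *\<^sub>R e" "l *\<^sub>R e"] e l by simp
    ultimately have "norm h < 2 * l" using hl by linarith
    then have sh: "norm (s *\<^sub>R h) < r / 2"
      using s mult_left_le_one_le[of "norm h" s] by (simp add: l_def)
    have b: "x + s *\<^sub>R h \<in> ball x0 r"
      using x(2) sh norm_triangle_ineq4[of "x0 - x" "s *\<^sub>R h"] by (simp add: dist_norm diff_diff_add)
    have xb: "x \<in> ball x0 r" using x(2) r by auto
    have Pb: "P y \<in> cball (P x0) r" if "y \<in> ball x0 r" for y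
    proof -
      have "P x0 - P y = P (x0 - y)" using Padd[of "x0 - y" y] by simp
      then show ?thesis using Pn[of "x0 - y"] that by (simp add: dist_norm)
    qed
    have "P h = P (h - l *\<^sub>R e)" using Padd[of "h - l *\<^sub>R e" "l *\<^sub>R e"] by (simp add: Pscale Pe)
    then have Ph: "norm (P h) \<le> l * \<delta>" using Pn[of "h - l *\<^sub>R e"] hl by simp
    have "h \<bullet> e = l + (h - l *\<^sub>R e) \<bullet> e" by (simp add: inner_simps ee)
    moreover have "\<bar>(h - l *\<^sub>R e) \<bullet> e\<bar> \<le> l * \<delta>"
      using Cauchy_Schwarz_ineq2[of "h - l *\<^sub>R e" e] hl e by simp
    ultimately have "h \<bullet> e \<ge> l - l * \<delta>" by linarith
    then have he: "h \<bullet> e \<ge> l * (1 - \<delta>)" by (simp add: right_diff_distrib)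
    show ?thesis
    proof (cases "s = 0")
      case False
      then have s0: "0 < s" using s by simp
      have "\<bar>\<gamma> (P (x + s *\<^sub>R h)) - \<gamma> (P x)\<bar> \<le> L * norm (P (x + s *\<^sub>R h) - P x)"
        by (intro L Pb b xb)
      also have "\<dots> = s * (L * norm (P h))" using s0 by (simp add: Padd Pscale)
      also have "\<dots> \<le> s * (L * (l * \<delta>))" using s0 L Ph by (intro mult_left_mono) auto
      also have "\<dots> = s * (l * (L * \<delta>))" by simp
      also have "\<dots> < s * (l * (1 - \<delta>))" using s0 l \<delta> by (intro mult_strict_left_mono) auto
      also have "\<dots> \<le> s * (h \<bullet> e)" using s0 he by (intro mult_left_mono) auto
      finally have "\<gamma> (P (x + s *\<^sub>R h)) < \<gamma> (P x) + s * (h \<bullet> e)" by linarith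
      also have "\<gamma> (P x) < x \<bullet> e" using mem[OF xb] x(1) by simp
      finally have "\<gamma> (P (x + s *\<^sub>R h)) < (x + s *\<^sub>R h) \<bullet> e" by (simp add: inner_simps)
      with mem[OF b] show ?thesis by simp
    qed (use x in simp)
  qed
  moreover have "0 < r / 2" "0 < l * \<delta>" using r \<delta> by (auto simp: l_def)
  ultimately show ?thesis by (intro exI[of _ "r / 2"] exI[of _ "l *\<^sub>R e"] exI[of _ "l * \<delta>"] conjI) auto
qed

text \<open>The cones depend on the point, but compactness of the closure leaves finitely many. The
  sets \<open>V\<close> may extend beyond \<open>\<Omega>\<close>; the condition only concerns their
  part inside.\<close>

lemma cone_condition_cover:
  fixes \<Omega> :: "'a::euclidean_space set"
  assumes \<Omega>: "open \<Omega>" "bounded \<Omega>" "C2_boundary \<Omega>"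
  shows "\<exists>\<D>. finite \<D> \<and> \<Omega> \<subseteq> \<Union>\<D> \<and> (\<forall>V\<in>\<D>. open V \<and>
     (\<exists>h0. \<exists>\<rho>>0. \<forall>x\<in>\<Omega> \<inter> V. \<forall>s\<in>{0..1}. \<forall>h\<in>ball h0 \<rho>. x + s *\<^sub>R h \<in> \<Omega>))"
proof -
  define \<C> where "\<C> = {V. open V \<and> (\<exists>h0. \<exists>\<rho>>0. \<forall>x\<in>\<Omega> \<inter> V. \<forall>s\<in>{0..1}. \<forall>h\<in>ball h0 \<rho>. x + s *\<^sub>R h \<in> \<Omega>)}"
  have "closure \<Omega> \<subseteq> \<Union>\<C>"
  proof
    fix x0 assume "x0 \<in> closure \<Omega>"
    then have "x0 \<in> \<Omega> \<or> x0 \<in> frontier \<Omega>" by (simp add: frontier_def interior_open[OF \<Omega>(1)])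
    then have "\<exists>r>0. \<exists>h0. \<exists>\<rho>>0. \<forall>x\<in>\<Omega> \<inter> ball x0 r. \<forall>s\<in>{0..1}. \<forall>h\<in>ball h0 \<rho>. x + s *\<^sub>R h \<in> \<Omega>"
      using cone_condition_interior[OF \<Omega>(1), of x0] cone_condition_boundary[OF \<Omega>(3), of x0] by (elim disjE) simp_all
    then obtain r where "r > 0 \<and>
      (\<exists>h0. \<exists>\<rho>>0. \<forall>x\<in>\<Omega> \<inter> ball x0 r. \<forall>s\<in>{0..1}. \<forall>h\<in>ball h0 \<rho>. x + s *\<^sub>R h \<in> \<Omega>)" ..
    then have "r > 0" "ball x0 r \<in> \<C>" unfolding \<C>_def by simp_all
    then show "x0 \<in> \<Union>\<C>" by (intro UnionI[of "ball x0 r"]) simp_all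
  qed
  moreover have "compact (closure \<Omega>)" using \<Omega>(2) by (simp add: compact_closure)
  moreover have "\<forall>V\<in>\<C>. open V" by (simp add: \<C>_def)
  ultimately have "\<exists>\<D>\<subseteq>\<C>. finite \<D> \<and> closure \<Omega> \<subseteq> \<Union>\<D>"
    by (simp add: compact_eq_Heine_Borel)
  then obtain \<D> where \<D>: "\<D> \<subseteq> \<C>" "finite \<D>" "closure \<Omega> \<subseteq> \<Union>\<D>" by (elim exE conjE)
  show ?thesis
  proof (intro exI[of _ \<D>] conjI ballI \<D>(2))
    show "\<Omega> \<subseteq> \<Union>\<D>" using closure_subset \<D>(3) by (rule order_trans)
    fix V assume "V \<in> \<D>"
    then have "V \<in> \<C>" using \<D>(1) by (rule subsetD[rotated])
    then show "open V" "\<exists>h0. \<exists>\<rho>>0. \<forall>x\<in>\<Omega> \<inter> V. \<forall>s\<in>{0..1}. \<forall>h\<in>ball h0 \<rho>. x + s *\<^sub>R h \<in> \<Omega>"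
      unfolding \<C>_def by simp_all
  qed
qed

section \<open>Embedding into L4\<close>

lemma nn_integral_powr_unit: "(\<integral>\<^sup>+s. indicator {0..1} s * ennreal (s powr (- 3 / 4)) \<partial>lborel) = 4"
proof -
  have "((\<lambda>s. s powr (- 3 / 4)) has_integral (1 powr (- 3 / 4 + 1) / (- 3 / 4 + 1))) {0..1::real}"
    by (rule has_integral_powr_from_0) auto
  from nn_integral_has_integral_lebesgue[OF _ this]
  have "(\<integral>\<^sup>+s. ennreal (indicator {0..1} s * s powr (- 3 / 4)) \<partial>lborel) = 4" by simp
  moreover have "(\<integral>\<^sup>+s. ennreal (indicator {0..1} s * s powr (- 3 / 4)) \<partial>lborel)
      = (\<integral>\<^sup>+s. indicator {0..1} s * ennreal (s powr (- 3 / 4)) \<partial>lborel)"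
    by (intro nn_integral_cong) (simp add: indicator_def)
  ultimately show ?thesis by simp
qed

lemma nn_integral_scale:
  fixes F :: "'a::euclidean_space \<Rightarrow> ennreal"
  assumes [measurable]: "F \<in> borel_measurable borel" and s: "0 < s"
  shows "(\<integral>\<^sup>+h. F (x + s *\<^sub>R h) \<partial>lborel) = ennreal (1 / s ^ DIM('a)) * (\<integral>\<^sup>+y. F y \<partial>lborel)"
proof -
  have "(\<integral>\<^sup>+y. F y \<partial>lborel) = (\<integral>\<^sup>+y. F y \<partial>density (distr lborel borel (\<lambda>h. x + s *\<^sub>R h)) (\<lambda>_. ennreal (\<bar>s\<bar> ^ DIM('a))))"
    using lborel_affine[of s x] s by simp
  also have "\<dots> = ennreal (s ^ DIM('a)) * (\<integral>\<^sup>+h. F (x + s *\<^sub>R h) \<partial>lborel)"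
    using s by (simp add: nn_integral_density nn_integral_distr nn_integral_cmult)
  finally show ?thesis
    using s by (simp flip: mult.assoc ennreal_mult)
qed

text \<open>Cauchy-Schwarz after splitting off \<open>s powr (- 3 / 8)\<close>, whose square has
  integral 4 over the unit interval. The exponent suits two successive applications: they produce
  the weight \<open>s powr (9 / 4)\<close>, which against \<open>s powr (- 3)\<close> leaves the
  integrable \<open>s powr (- 3 / 4)\<close> again.\<close>

lemma power2_nn_integral_le_weighted:
  assumes [measurable]: "F \<in> borel_measurable borel"
  shows "(\<integral>\<^sup>+s. indicator {0..1} s * F s \<partial>lborel)\<^sup>2
     \<le> 4 * (\<integral>\<^sup>+s. indicator {0..1} s * (ennreal (s powr (3 / 4)) * (F s)\<^sup>2) \<partial>lborel)"
proof -
  have "(\<integral>\<^sup>+s. indicator {0..1} s * F s \<partial>lborel)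
      = (\<integral>\<^sup>+s. (indicator {0..1} s * ennreal (s powr (- 3 / 8))) * (indicator {0..1} s * (ennreal (s powr (3 / 8)) * F s)) \<partial>lborel)"
  proof (rule nn_integral_cong_AE)
    \<comment> \<open>The factorisation fails only at \<open>s = 0\<close>, where both powers are
      0.\<close>
    show "AE s in lborel. indicator {0..1} s * F s
      = (indicator {0..1} s * ennreal (s powr (- 3 / 8))) * (indicator {0..1} s * (ennreal (s powr (3 / 8)) * F s))"
      using AE_lborel_singleton[of "0::real"]
    proof eventually_elim
      case (elim s)
      then have "s \<in> {0..1} \<Longrightarrow> ennreal (s powr (- 3 / 8)) * ennreal (s powr (3 / 8)) = 1"
        by (simp flip: ennreal_mult powr_add)
      then show ?case by (auto simp: indicator_def simp flip: mult.assoc)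
    qed
  qed
  then have "(\<integral>\<^sup>+s. indicator {0..1} s * F s \<partial>lborel)\<^sup>2
     \<le> (\<integral>\<^sup>+s. (indicator {0..1} s * ennreal (s powr (- 3 / 8)))\<^sup>2 \<partial>lborel) * (\<integral>\<^sup>+s. (indicator {0..1} s * (ennreal (s powr (3 / 8)) * F s))\<^sup>2 \<partial>lborel)"
    by (simp only:) (rule Cauchy_Schwarz_nn_integral; measurable)
  also have "(\<integral>\<^sup>+s. (indicator {0..1} s * ennreal (s powr (- 3 / 8)))\<^sup>2 \<partial>lborel) = (\<integral>\<^sup>+s. indicator {0..1} s * ennreal (s powr (- 3 / 4)) \<partial>lborel)"
    by (intro nn_integral_cong) (auto simp: indicator_def ennreal_power power2_eq_square simp flip: powr_add ennreal_mult)
  also have "\<dots> = 4" by (rule nn_integral_powr_unit)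
  also have "(\<integral>\<^sup>+s. (indicator {0..1} s * (ennreal (s powr (3 / 8)) * F s))\<^sup>2 \<partial>lborel)
      = (\<integral>\<^sup>+s. indicator {0..1} s * (ennreal (s powr (3 / 4)) * (F s)\<^sup>2) \<partial>lborel)"
  proof (rule nn_integral_cong)
    fix s :: real
    have "(ennreal (s powr (3 / 8)))\<^sup>2 = ennreal (s powr (3 / 4))"
      by (simp add: power2_eq_square flip: powr_add ennreal_mult)
    then show "(indicator {0..1} s * (ennreal (s powr (3 / 8)) * F s))\<^sup>2 = indicator {0..1} s * (ennreal (s powr (3 / 4)) * (F s)\<^sup>2)"
      by (simp add: indicator_def power_mult_distrib)
  qed
  finally show ?thesis .
qed

text \<open>
  The average of \<open>H\<close> over the cone with apex \<open>x\<close> is split into the averages over the balls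
  \<open>x + s B\<close>; each of these is bounded in \<open>L2\<close> uniformly in \<open>s\<close>, and its supremum is at most
  a multiple of \<open>s\<close> to the power \<open>- d / 2\<close>. Since \<open>d \<le> 3\<close>, interpolation gives an integrable
  power of \<open>s\<close> for the \<open>L4\<close> norm.
\<close>

lemma cone_average_L4:
  fixes H :: "'a::euclidean_space \<Rightarrow> ennreal"
  assumes [measurable]: "H \<in> borel_measurable borel" "B \<in> sets borel" and dim: "DIM('a) \<le> 3"
  shows "(\<integral>\<^sup>+x. (\<integral>\<^sup>+s. indicator {0..1} s * (\<integral>\<^sup>+h. indicator B h * H (x + s *\<^sub>R h) \<partial>lborel) \<partial>lborel) ^ 4 \<partial>lborel)
      \<le> 256 * emeasure lborel B ^ 3 * (\<integral>\<^sup>+x. (H x)\<^sup>2 \<partial>lborel)\<^sup>2"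
proof -
  define N where "N = (\<integral>\<^sup>+x. (H x)\<^sup>2 \<partial>lborel)"
  define \<beta> where "\<beta> = emeasure lborel B"
  define m where "m s x = (\<integral>\<^sup>+h. indicator B h * H (x + s *\<^sub>R h) \<partial>lborel)" for s x
  define k where "k s x = (\<integral>\<^sup>+h. indicator B h * (H (x + s *\<^sub>R h))\<^sup>2 \<partial>lborel)" for s x
  have mm[measurable]: "(\<lambda>(s, x). m s x) \<in> borel_measurable (borel \<Otimes>\<^sub>M borel)" unfolding m_def by measurable
  have km[measurable]: "(\<lambda>(s, x). k s x) \<in> borel_measurable (borel \<Otimes>\<^sub>M borel)" unfolding k_def by measurable
  have mk: "(m s x)\<^sup>2 \<le> \<beta> * k s x" for s x
  proof -
    have "m s x = (\<integral>\<^sup>+h. indicator B h * (indicator B h * H (x + s *\<^sub>R h)) \<partial>lborel)"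
      unfolding m_def by (intro nn_integral_cong) (auto simp: indicator_def)
    then have "(m s x)\<^sup>2 \<le> (\<integral>\<^sup>+h. (indicator B h)\<^sup>2 \<partial>lborel) * (\<integral>\<^sup>+h. (indicator B h * H (x + s *\<^sub>R h))\<^sup>2 \<partial>lborel)"
      by (simp only:) (rule Cauchy_Schwarz_nn_integral; measurable)
    also have "(\<integral>\<^sup>+h. (indicator B h)\<^sup>2 \<partial>lborel) = \<beta>"
      by (simp add: \<beta>_def power2_eq_square flip: indicator_inter_arith)
    also have "(\<integral>\<^sup>+h. (indicator B h * H (x + s *\<^sub>R h))\<^sup>2 \<partial>lborel) = k s x"
      unfolding k_def by (intro nn_integral_cong) (auto simp: indicator_def)
    finally show ?thesis .
  qed
  \<comment> \<open>Scaling costs \<open>1 / s ^ DIM('a)\<close>; for \<open>s \<le> 1\<close> this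
    is at most \<open>1 / s ^ 3\<close>, which is where the dimension enters.\<close>
  have kb: "ennreal (s powr (9 / 4)) * k s x \<le> ennreal (s powr (- 3 / 4)) * N" if s: "0 < s" "s \<le> 1" for s x
  proof -
    have "k s x \<le> (\<integral>\<^sup>+h. (H (x + s *\<^sub>R h))\<^sup>2 \<partial>lborel)"
      unfolding k_def by (intro nn_integral_mono) (auto simp: indicator_def)
    also have "\<dots> = ennreal (1 / s ^ DIM('a)) * N"
      unfolding N_def using s by (intro nn_integral_scale) auto
    also have "\<dots> \<le> ennreal (1 / s ^ 3) * N"
      using s dim by (intro mult_right_mono ennreal_leI divide_left_mono power_decreasing) auto
    finally have "ennreal (s powr (9 / 4)) * k s x \<le> ennreal (s powr (9 / 4)) * (ennreal (1 / s ^ 3) * N)"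
      by (rule mult_left_mono) simp
    also have "\<dots> = ennreal (s powr (9 / 4) * (1 / s ^ 3)) * N" using s by (subst ennreal_mult) (auto simp: mult.assoc)
    also have "s powr (9 / 4) * (1 / s ^ 3) = s powr (- 3 / 4)"
    proof -
      have "s powr (9 / 4) = s powr (- 3 / 4) * s powr 3" by (subst powr_add[symmetric]) simp
      also have "s powr 3 = s ^ 3" using s by (subst powr_numeral) auto
      finally show ?thesis using s by simp
    qed
    finally show ?thesis .
  qed
  have kint: "(\<integral>\<^sup>+x. k s x \<partial>lborel) = \<beta> * N" for s
  proof -
    have "(\<integral>\<^sup>+x. k s x \<partial>lborel) = (\<integral>\<^sup>+h. \<integral>\<^sup>+x. indicator B h * (H (x + s *\<^sub>R h))\<^sup>2 \<partial>lborel \<partial>lborel)"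
      unfolding k_def by (rule lborel_pair.Fubini') measurable
    also have "\<dots> = (\<integral>\<^sup>+h. indicator B h * N \<partial>lborel)"
      using nn_integral_translation[of "\<lambda>x. (H x)\<^sup>2"] by (intro nn_integral_cong) (simp add: nn_integral_cmult N_def)
    also have "\<dots> = \<beta> * N" by (simp add: nn_integral_multc \<beta>_def)
    finally show ?thesis .
  qed
  \<comment> \<open>The weighted inequality is applied twice. The first application gives
    \<open>4 * \<beta>\<close>, squared in the fourth power; the second gives \<open>4 * N\<close>,
    so that 64 arises as 16 times 4. One factor \<open>k s x\<close> is kept, because its integral
    over \<open>x\<close> does not depend on \<open>s\<close>.\<close>
  have pt: "(\<integral>\<^sup>+s. indicator {0..1} s * m s x \<partial>lborel) ^ 4
      \<le> 64 * \<beta>\<^sup>2 * N * (\<integral>\<^sup>+s. indicator {0..1} s * (ennreal (s powr (- 3 / 4)) * k s x) \<partial>lborel)" for x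
  proof -
    let ?Q = "\<integral>\<^sup>+s. indicator {0..1} s * (ennreal (s powr (3 / 4)) * k s x) \<partial>lborel"
    have "(\<integral>\<^sup>+s. indicator {0..1} s * m s x \<partial>lborel)\<^sup>2
        \<le> 4 * (\<integral>\<^sup>+s. indicator {0..1} s * (ennreal (s powr (3 / 4)) * (m s x)\<^sup>2) \<partial>lborel)"
      by (rule power2_nn_integral_le_weighted) measurable
    also have "\<dots> \<le> 4 * (\<integral>\<^sup>+s. \<beta> * (indicator {0..1} s * (ennreal (s powr (3 / 4)) * k s x)) \<partial>lborel)"
      using mk by (intro mult_left_mono nn_integral_mono) (auto simp: indicator_def mult.left_commute[of \<beta>] intro!: mult_left_mono)
    also have "\<dots> = 4 * \<beta> * ?Q" by (simp add: nn_integral_cmult mult.assoc)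
    finally have 1: "(\<integral>\<^sup>+s. indicator {0..1} s * m s x \<partial>lborel)\<^sup>2 \<le> 4 * \<beta> * ?Q" .
    have "?Q\<^sup>2 \<le> 4 * (\<integral>\<^sup>+s. indicator {0..1} s * (ennreal (s powr (3 / 4)) * (ennreal (s powr (3 / 4)) * k s x)\<^sup>2) \<partial>lborel)"
      by (rule power2_nn_integral_le_weighted) measurable
    also have "\<dots> \<le> 4 * (\<integral>\<^sup>+s. N * (indicator {0..1} s * (ennreal (s powr (- 3 / 4)) * k s x)) \<partial>lborel)"
    proof (intro mult_left_mono nn_integral_mono_AE)
      show "AE s in lborel. indicator {0..1} s * (ennreal (s powr (3 / 4)) * (ennreal (s powr (3 / 4)) * k s x)\<^sup>2)
          \<le> N * (indicator {0..1} s * (ennreal (s powr (- 3 / 4)) * k s x))"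
        using AE_lborel_singleton[of "0::real"]
      proof eventually_elim
        case (elim s)
        show ?case
        proof (cases "s \<in> {0..1}")
          case True
          then have s: "0 < s" "s \<le> 1" using elim by auto
          have e: "ennreal (s powr (3 / 4)) * (ennreal (s powr (3 / 4)) * ennreal (s powr (3 / 4))) = ennreal (s powr (9 / 4))"
            by (simp flip: ennreal_mult powr_add)
          have "a * (a * c)\<^sup>2 = a * (a * a) * c * c" for a c :: ennreal by (simp add: power2_eq_square mult_ac)
          then have "ennreal (s powr (3 / 4)) * (ennreal (s powr (3 / 4)) * k s x)\<^sup>2 = ennreal (s powr (9 / 4)) * k s x * k s x"
            unfolding e by (simp only: e)
          also have "\<dots> \<le> ennreal (s powr (- 3 / 4)) * N * k s x" by (intro mult_right_mono kb s) simp
          finally show ?thesis using True by (simp add: mult_ac)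
        qed simp
      qed
    qed simp
    also have "\<dots> = 4 * N * (\<integral>\<^sup>+s. indicator {0..1} s * (ennreal (s powr (- 3 / 4)) * k s x) \<partial>lborel)"
      by (simp add: nn_integral_cmult mult.assoc)
    finally have 2: "?Q\<^sup>2 \<le> 4 * N * (\<integral>\<^sup>+s. indicator {0..1} s * (ennreal (s powr (- 3 / 4)) * k s x) \<partial>lborel)" .
    have "(\<integral>\<^sup>+s. indicator {0..1} s * m s x \<partial>lborel) ^ 4 = ((\<integral>\<^sup>+s. indicator {0..1} s * m s x \<partial>lborel)\<^sup>2)\<^sup>2" by simp
    also have "\<dots> \<le> (4 * \<beta> * ?Q)\<^sup>2" by (intro power_mono 1) simp
    also have "\<dots> = 16 * \<beta>\<^sup>2 * ?Q\<^sup>2" by (simp add: power_mult_distrib)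
    also have "\<dots> \<le> 16 * \<beta>\<^sup>2 * (4 * N * (\<integral>\<^sup>+s. indicator {0..1} s * (ennreal (s powr (- 3 / 4)) * k s x) \<partial>lborel))"
      by (intro mult_left_mono 2) simp
    also have "16 * \<beta>\<^sup>2 * (4 * N * Z) = 64 * \<beta>\<^sup>2 * N * Z" for Z
    proof -
      have "16 * \<beta>\<^sup>2 * (4 * N * Z) = (16 * 4) * \<beta>\<^sup>2 * N * Z" by (simp only: mult_ac)
      then show ?thesis by simp
    qed
    finally show ?thesis .
  qed
  have "(\<integral>\<^sup>+x. (\<integral>\<^sup>+s. indicator {0..1} s * m s x \<partial>lborel) ^ 4 \<partial>lborel)
      \<le> (\<integral>\<^sup>+x. 64 * \<beta>\<^sup>2 * N * (\<integral>\<^sup>+s. indicator {0..1} s * (ennreal (s powr (- 3 / 4)) * k s x) \<partial>lborel) \<partial>lborel)"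
    by (intro nn_integral_mono pt)
  also have "\<dots> = 64 * \<beta>\<^sup>2 * N * (\<integral>\<^sup>+x. \<integral>\<^sup>+s. indicator {0..1} s * (ennreal (s powr (- 3 / 4)) * k s x) \<partial>lborel \<partial>lborel)"
    by (rule nn_integral_cmult) measurable
  also have "(\<integral>\<^sup>+x. \<integral>\<^sup>+s. indicator {0..1} s * (ennreal (s powr (- 3 / 4)) * k s x) \<partial>lborel \<partial>lborel)
      = (\<integral>\<^sup>+s. \<integral>\<^sup>+x. indicator {0..1} s * (ennreal (s powr (- 3 / 4)) * k s x) \<partial>lborel \<partial>lborel)"
    by (rule lborel_pair.Fubini') measurable
  also have "\<dots> = (\<integral>\<^sup>+s. indicator {0..1} s * ennreal (s powr (- 3 / 4)) * (\<beta> * N) \<partial>lborel)"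
    by (intro nn_integral_cong) (simp add: nn_integral_cmult kint mult.assoc)
  also have "\<dots> = (\<integral>\<^sup>+s. indicator {0..1} s * ennreal (s powr (- 3 / 4)) \<partial>lborel) * (\<beta> * N)"
    by (rule nn_integral_multc) measurable
  also have "64 * \<beta>\<^sup>2 * N * \<dots> = 256 * \<beta> ^ 3 * N\<^sup>2"
    unfolding nn_integral_powr_unit by (simp add: power2_eq_square power3_eq_cube mult_ac)
  finally show ?thesis by (simp add: m_def N_def \<beta>_def)
qed

text \<open>For every direction \<open>h\<close> of the cone and every \<open>s\<close>, the value
  at the apex is at most the value at \<open>x + s h\<close> plus the integral of the gradient along
  the whole ray. Averaging over \<open>h\<close> and \<open>s\<close> bounds it by the cone average
  of \<open>\<bar>f\<bar>\<close> plus a multiple of the gradient, to which the L4 bound for cone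
  averages applies.\<close>

lemma local_L4_bound:
  fixes f :: "'a::euclidean_space \<Rightarrow> real"
  assumes dim: "DIM('a) \<le> 3" and f: "sq_int f" and g: "\<And>i. i \<in> Basis \<Longrightarrow> sq_int (g i)"
    and d: "\<And>h. dir_deriv \<Omega> h f (\<lambda>x. \<Sum>i\<in>Basis. (h \<bullet> i) * g i x)"
    and [measurable]: "V \<in> sets borel" and \<rho>: "0 < \<rho>" and M: "norm h0 + \<rho> \<le> M"
    and cone: "\<And>x s h. x \<in> V \<Longrightarrow> 0 \<le> s \<Longrightarrow> s \<le> 1 \<Longrightarrow> h \<in> ball h0 \<rho> \<Longrightarrow> x + s *\<^sub>R h \<in> \<Omega>"
  shows "emeasure lborel (ball h0 \<rho>) * (\<integral>\<^sup>+x. indicator V x * ennreal ((f x) ^ 4) \<partial>lborel)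
     \<le> 256 * (\<integral>\<^sup>+x. ennreal ((\<bar>f x\<bar> + M * (\<Sum>i\<in>Basis. \<bar>g i x\<bar>))\<^sup>2) \<partial>lborel)\<^sup>2"
proof -
  have [measurable]: "f \<in> borel_measurable borel" using f by (simp add: sq_int_def)
  have gm[measurable]: "g i \<in> borel_measurable borel" if "i \<in> Basis" for i using g[OF that] by (simp add: sq_int_def)
  define B where "B = ball h0 \<rho>"
  have [measurable]: "B \<in> sets borel" by (simp add: B_def)
  define \<beta> where "\<beta> = emeasure lborel B"
  define G where "G x = M * (\<Sum>i\<in>Basis. \<bar>g i x\<bar>)" for x
  have M0: "0 \<le> M" using M \<rho> norm_ge_zero[of h0] by linarith
  have G0: "0 \<le> G x" for x using M0 by (auto simp: G_def intro!: sum_nonneg)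
  have [measurable]: "G \<in> borel_measurable borel" unfolding G_def by measurable
  define H where "H x = ennreal (\<bar>f x\<bar> + G x)" for x
  have [measurable]: "H \<in> borel_measurable borel" unfolding H_def by measurable
  define J where "J x h = (\<integral>\<^sup>+\<tau>. indicator {0..1} \<tau> * ennreal (G (x + \<tau> *\<^sub>R h)) \<partial>lborel)" for x h
  have Jm[measurable]: "(\<lambda>(x, h). J x h) \<in> borel_measurable (borel \<Otimes>\<^sub>M borel)" unfolding J_def by measurable
  \<comment> \<open>The premise makes the statement trivial off the cone, so it can be asserted for
    every pair of direction and parameter.\<close>
  define P where "P x y \<longleftrightarrow> x \<in> V \<and> fst y \<in> B \<and> snd y \<in> {0..1} \<longrightarrow>
      ennreal \<bar>f x\<bar> \<le> ennreal \<bar>f (x + snd y *\<^sub>R fst y)\<bar> + J x (fst y)" for x and y :: "'a \<times> real"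
  have P1: "AE x in lborel. P x (h, s)" for h s
  proof (cases "h \<in> B \<and> s \<in> {0..1}")
    case True
    then have s: "0 \<le> s" "s \<le> 1" and h: "h \<in> ball h0 \<rho>" by (auto simp: B_def)
    have hM: "norm h \<le> M" using h norm_triangle_ineq2[of h h0] M by (simp add: dist_norm norm_minus_commute)
    show ?thesis using dir_derivD[OF d[of h] s(1)]
    proof (rule eventually_mono)
      fix x assume eq: "(\<forall>\<tau>\<in>{0..s}. x + \<tau> *\<^sub>R h \<in> \<Omega>) \<longrightarrow> f (x + s *\<^sub>R h) - f x
        = (\<integral>\<tau>. indicator {0..s} \<tau> * (\<Sum>i\<in>Basis. (h \<bullet> i) * g i (x + \<tau> *\<^sub>R h)) \<partial>lborel)"
      show "P x (h, s)" unfolding P_def fst_conv snd_conv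
      proof
        assume x: "x \<in> V \<and> h \<in> B \<and> s \<in> {0..1}"
        let ?K = "\<lambda>\<tau>. indicator {0..s} \<tau> * (\<Sum>i\<in>Basis. (h \<bullet> i) * g i (x + \<tau> *\<^sub>R h))"
        have "x + \<tau> *\<^sub>R h \<in> \<Omega>" if "\<tau> \<in> {0..s}" for \<tau> using that s x by (intro cone) (auto simp: B_def)
        with eq have e: "f x = f (x + s *\<^sub>R h) - (\<integral>\<tau>. ?K \<tau> \<partial>lborel)" by simp
        have gb: "\<bar>\<Sum>i\<in>Basis. (h \<bullet> i) * g i y\<bar> \<le> G y" for y
        proof -
          have "\<bar>\<Sum>i\<in>Basis. (h \<bullet> i) * g i y\<bar> \<le> (\<Sum>i\<in>Basis. \<bar>(h \<bullet> i) * g i y\<bar>)" by (rule sum_abs)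
          also have "\<dots> \<le> (\<Sum>i\<in>Basis. M * \<bar>g i y\<bar>)"
            unfolding abs_mult using Basis_le_norm hM by (intro sum_mono mult_right_mono) (auto intro: order_trans)
          finally show ?thesis by (simp add: G_def sum_distrib_left)
        qed
        have "ennreal \<bar>\<integral>\<tau>. ?K \<tau> \<partial>lborel\<bar> \<le> (\<integral>\<^sup>+\<tau>. ennreal (norm (?K \<tau>)) \<partial>lborel)"
          using integral_norm_bound_ennreal[of lborel ?K]
          by (cases "integrable lborel ?K") (auto simp: not_integrable_integral_eq)
        also have "\<dots> \<le> J x h" unfolding J_def
        proof (rule nn_integral_mono)
          fix \<tau>
          show "ennreal (norm (?K \<tau>)) \<le> indicator {0..1} \<tau> * ennreal (G (x + \<tau> *\<^sub>R h))"
            using gb[of "x + \<tau> *\<^sub>R h"] s by (auto simp: indicator_def intro!: ennreal_leI)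
        qed
        finally have k: "ennreal \<bar>\<integral>\<tau>. ?K \<tau> \<partial>lborel\<bar> \<le> J x h" .
        have "\<bar>f x\<bar> \<le> \<bar>f (x + s *\<^sub>R h)\<bar> + \<bar>\<integral>\<tau>. ?K \<tau> \<partial>lborel\<bar>" using e by linarith
        then have "ennreal \<bar>f x\<bar> \<le> ennreal \<bar>f (x + s *\<^sub>R h)\<bar> + ennreal \<bar>\<integral>\<tau>. ?K \<tau> \<partial>lborel\<bar>"
          by (simp flip: ennreal_plus add: ennreal_leI)
        also have "\<dots> \<le> ennreal \<bar>f (x + s *\<^sub>R h)\<bar> + J x h" by (intro add_left_mono k)
        finally show "ennreal \<bar>f x\<bar> \<le> ennreal \<bar>f (x + s *\<^sub>R h)\<bar> + J x h" .
      qed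
    qed
  qed (auto simp: P_def)
  \<comment> \<open>The segment formula holds for almost every \<open>x\<close> once
    \<open>h\<close> and \<open>s\<close> are fixed; Fubini turns this round, so that a single null
    set of apexes is excluded.\<close>
  have "AE x in lborel. AE y in lborel. P x y"
  proof (subst lborel_pair.AE_commute)
    have "{z \<in> space (lborel \<Otimes>\<^sub>M (lborel \<Otimes>\<^sub>M lborel)). P (fst z) (snd z)} \<in> sets (lborel \<Otimes>\<^sub>M (lborel \<Otimes>\<^sub>M lborel))"
      unfolding P_def by measurable
    then show "{z \<in> space (lborel \<Otimes>\<^sub>M lborel). P (fst z) (snd z)} \<in> sets (lborel \<Otimes>\<^sub>M lborel)"
      by (simp only: lborel_prod)
    show "AE y in lborel. AE x in lborel. P x y"
    proof (rule AE_I2)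
      fix y :: "'a \<times> real" show "AE x in lborel. P x y" using P1[of "fst y" "snd y"] by simp
    qed
  qed
  then have main: "AE x in lborel. indicator V x * (\<beta> * ennreal \<bar>f x\<bar>)
      \<le> (\<integral>\<^sup>+s. indicator {0..1} s * (\<integral>\<^sup>+h. indicator B h * H (x + s *\<^sub>R h) \<partial>lborel) \<partial>lborel)"
  proof (rule eventually_mono)
    fix x assume ae: "AE y in lborel. P x y"
    show "indicator V x * (\<beta> * ennreal \<bar>f x\<bar>)
      \<le> (\<integral>\<^sup>+s. indicator {0..1} s * (\<integral>\<^sup>+h. indicator B h * H (x + s *\<^sub>R h) \<partial>lborel) \<partial>lborel)"
    proof (cases "x \<in> V")
      case True
      have ae': "AE y in lborel \<Otimes>\<^sub>M lborel. P x y" unfolding lborel_prod by (rule ae)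
      have "\<beta> * ennreal \<bar>f x\<bar> = (\<integral>\<^sup>+h. \<integral>\<^sup>+s. indicator B h * (indicator {0..1::real} s * ennreal \<bar>f x\<bar>) \<partial>lborel \<partial>lborel)"
      proof -
        have "(\<integral>\<^sup>+s. indicator B h * (indicator {0..1::real} s * ennreal \<bar>f x\<bar>) \<partial>lborel) = indicator B h * ennreal \<bar>f x\<bar>" for h
          by (subst nn_integral_cmult) (auto simp: nn_integral_multc)
        moreover have "(\<integral>\<^sup>+h. indicator B h * ennreal \<bar>f x\<bar> \<partial>lborel) = \<beta> * ennreal \<bar>f x\<bar>"
          by (simp add: nn_integral_multc \<beta>_def)
        ultimately show ?thesis by simp
      qed
      also have "\<dots> = (\<integral>\<^sup>+y. indicator B (fst y) * (indicator {0..1::real} (snd y) * ennreal \<bar>f x\<bar>) \<partial>(lborel \<Otimes>\<^sub>M lborel))"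
        by (subst lborel.nn_integral_fst[symmetric]) auto
      also have "\<dots> \<le> (\<integral>\<^sup>+y. indicator B (fst y) * (indicator {0..1::real} (snd y) * (ennreal \<bar>f (x + snd y *\<^sub>R fst y)\<bar> + J x (fst y))) \<partial>(lborel \<Otimes>\<^sub>M lborel))"
        using ae' True by (intro nn_integral_mono_AE) (auto simp: P_def indicator_def elim!: eventually_mono)
      also have "\<dots> = (\<integral>\<^sup>+h. \<integral>\<^sup>+s. indicator B h * (indicator {0..1} s * (ennreal \<bar>f (x + s *\<^sub>R h)\<bar> + J x h)) \<partial>lborel \<partial>lborel)"
        by (subst lborel.nn_integral_fst[symmetric]) auto
      \<comment> \<open>The ray integral \<open>J x h\<close> does not depend on \<open>s\<close>.
        Its average over the unit interval is itself, hence equals the average of \<open>G\<close>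
        along the ray and merges with the first term into \<open>H\<close>.\<close>
      also have "\<dots> = (\<integral>\<^sup>+h. \<integral>\<^sup>+s. indicator {0..1} s * (indicator B h * H (x + s *\<^sub>R h)) \<partial>lborel \<partial>lborel)"
      proof (rule nn_integral_cong)
        fix h :: 'a
        have "(\<integral>\<^sup>+s. indicator {0..1} s * (ennreal \<bar>f (x + s *\<^sub>R h)\<bar> + J x h) \<partial>lborel)
            = (\<integral>\<^sup>+s. indicator {0..1} s * ennreal \<bar>f (x + s *\<^sub>R h)\<bar> \<partial>lborel) + J x h"
          by (simp add: distrib_left nn_integral_add nn_integral_multc)
        also have "\<dots> = (\<integral>\<^sup>+s. indicator {0..1} s * ennreal \<bar>f (x + s *\<^sub>R h)\<bar> + indicator {0..1} s * ennreal (G (x + s *\<^sub>R h)) \<partial>lborel)"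
          unfolding J_def by (rule nn_integral_add[symmetric]) measurable
        also have "\<dots> = (\<integral>\<^sup>+s. indicator {0..1} s * H (x + s *\<^sub>R h) \<partial>lborel)"
          using G0 by (intro nn_integral_cong) (simp add: H_def indicator_def ennreal_plus)
        finally have "(\<integral>\<^sup>+s. indicator {0..1} s * (ennreal \<bar>f (x + s *\<^sub>R h)\<bar> + J x h) \<partial>lborel)
            = (\<integral>\<^sup>+s. indicator {0..1} s * H (x + s *\<^sub>R h) \<partial>lborel)" .
        then show "(\<integral>\<^sup>+s. indicator B h * (indicator {0..1} s * (ennreal \<bar>f (x + s *\<^sub>R h)\<bar> + J x h)) \<partial>lborel)
            = (\<integral>\<^sup>+s. indicator {0..1} s * (indicator B h * H (x + s *\<^sub>R h)) \<partial>lborel)"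
          by (cases "h \<in> B") (auto simp: indicator_def)
      qed
      also have "\<dots> = (\<integral>\<^sup>+s. \<integral>\<^sup>+h. indicator {0..1} s * (indicator B h * H (x + s *\<^sub>R h)) \<partial>lborel \<partial>lborel)"
        by (rule lborel_pair.Fubini') measurable
      also have "\<dots> = (\<integral>\<^sup>+s. indicator {0..1} s * (\<integral>\<^sup>+h. indicator B h * H (x + s *\<^sub>R h) \<partial>lborel) \<partial>lborel)"
        by (simp add: nn_integral_cmult)
      finally show ?thesis using True by simp
    qed simp
  qed
  have fin: "\<beta> < \<infinity>" unfolding \<beta>_def B_def by (rule emeasure_lborel_ball_finite)
  have pos: "\<beta> > 0"
  proof -
    have "\<beta> \<noteq> 0" unfolding \<beta>_def B_def
      using \<rho> open_not_negligible[of "ball h0 \<rho>"] by (auto simp: negligible_iff_null_sets null_sets_def)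
    then show ?thesis by (simp add: zero_less_iff_neq_zero)
  qed
  have "\<beta> ^ 4 * (\<integral>\<^sup>+x. indicator V x * ennreal ((f x) ^ 4) \<partial>lborel) = (\<integral>\<^sup>+x. (indicator V x * (\<beta> * ennreal \<bar>f x\<bar>)) ^ 4 \<partial>lborel)"
    by (subst nn_integral_cmult[symmetric])
      (auto intro!: nn_integral_cong simp: indicator_def power_mult_distrib ennreal_power)
  also have "\<dots> \<le> (\<integral>\<^sup>+x. (\<integral>\<^sup>+s. indicator {0..1} s * (\<integral>\<^sup>+h. indicator B h * H (x + s *\<^sub>R h) \<partial>lborel) \<partial>lborel) ^ 4 \<partial>lborel)"
    using main by (intro nn_integral_mono_AE) (auto elim!: eventually_mono intro!: power_mono)
  also have "\<dots> \<le> 256 * \<beta> ^ 3 * (\<integral>\<^sup>+x. (H x)\<^sup>2 \<partial>lborel)\<^sup>2"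
    unfolding \<beta>_def by (rule cone_average_L4) (auto simp: dim)
  \<comment> \<open>Averaging left \<open>\<beta> ^ 4\<close> on one side and
    \<open>\<beta> ^ 3\<close> on the other; cancelling is allowed as \<open>\<beta>\<close> is
    positive and finite.\<close>
  finally have "\<beta> ^ 3 * (\<beta> * (\<integral>\<^sup>+x. indicator V x * ennreal ((f x) ^ 4) \<partial>lborel)) \<le> \<beta> ^ 3 * (256 * (\<integral>\<^sup>+x. (H x)\<^sup>2 \<partial>lborel)\<^sup>2)"
    by (simp add: power3_eq_cube power4_eq_xxxx mult_ac)
  then have "\<beta> * (\<integral>\<^sup>+x. indicator V x * ennreal ((f x) ^ 4) \<partial>lborel) \<le> 256 * (\<integral>\<^sup>+x. (H x)\<^sup>2 \<partial>lborel)\<^sup>2"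
    using pos fin by (subst (asm) ennreal_mult_le_mult_iff) (auto simp: power_eq_top_ennreal)
  moreover have "(H x)\<^sup>2 = ennreal ((\<bar>f x\<bar> + M * (\<Sum>i\<in>Basis. \<bar>g i x\<bar>))\<^sup>2)" for x
    using G0[of x] unfolding H_def G_def[symmetric] by (subst ennreal_power) auto
  ultimately show ?thesis by (simp add: \<beta>_def B_def)
qed

lemma nrm2_abs: "nrm2 (\<lambda>x. \<bar>f x\<bar>) = nrm2 f"
  by (simp add: nrm2_def)

lemma nrm2_sum: "finite A \<Longrightarrow> (\<And>i. i \<in> A \<Longrightarrow> sq_int (f i)) \<Longrightarrow> nrm2 (\<lambda>x. \<Sum>i\<in>A. f i x) \<le> (\<Sum>i\<in>A. nrm2 (f i))"
proof (induction A rule: finite_induct)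
  case (insert a A)
  have "nrm2 (\<lambda>x. f a x + (\<Sum>i\<in>A. f i x)) \<le> nrm2 (f a) + nrm2 (\<lambda>x. \<Sum>i\<in>A. f i x)"
    using insert.prems by (intro nrm2_triangle sq_int_sum) auto
  then show ?case using insert by force
qed (simp add: nrm2_def)

text \<open>All directions are required at once, not only those of the basis, because the rays of a
  cone point in an open set of directions.\<close>

definition weak_gradient :: "'a::euclidean_space set \<Rightarrow> ('a \<Rightarrow> real) \<Rightarrow> ('a \<Rightarrow> 'a \<Rightarrow> real) \<Rightarrow> bool" where
  "weak_gradient \<Omega> f g \<longleftrightarrow> sq_int f \<and> (\<forall>i\<in>Basis. sq_int (g i)) \<and> (\<forall>x. x \<notin> \<Omega> \<longrightarrow> f x = 0) \<and>
     (\<forall>h. dir_deriv \<Omega> h f (\<lambda>x. \<Sum>i\<in>Basis. (h \<bullet> i) * g i x))"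

lemma local_L4_constant:
  fixes \<Omega> V :: "'a::euclidean_space set"
  assumes dim: "DIM('a) \<le> 3" and V: "open V" "open \<Omega>"
    and cone: "\<exists>h0. \<exists>\<rho>>0. \<forall>x\<in>\<Omega> \<inter> V. \<forall>s\<in>{0..1}. \<forall>h\<in>ball h0 \<rho>. x + s *\<^sub>R h \<in> \<Omega>"
  shows "\<exists>K\<ge>0. \<forall>f g. weak_gradient \<Omega> f g \<longrightarrow> (\<integral>\<^sup>+x. indicator (\<Omega> \<inter> V) x * ennreal ((f x) ^ 4) \<partial>lborel)
     \<le> ennreal (K * (nrm2 f + (\<Sum>i\<in>Basis. nrm2 (g i))) ^ 4)"
proof -
  obtain h0 where "\<exists>\<rho>>0. \<forall>x\<in>\<Omega> \<inter> V. \<forall>s\<in>{0..1}. \<forall>h\<in>ball h0 \<rho>. x + s *\<^sub>R h \<in> \<Omega>" using cone ..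
  then obtain \<rho> where "\<rho> > 0 \<and> (\<forall>x\<in>\<Omega> \<inter> V. \<forall>s\<in>{0..1}. \<forall>h\<in>ball h0 \<rho>. x + s *\<^sub>R h \<in> \<Omega>)" ..
  then have \<rho>: "\<rho> > 0" and c: "\<And>x s h. x \<in> \<Omega> \<inter> V \<Longrightarrow> 0 \<le> s \<Longrightarrow> s \<le> 1 \<Longrightarrow> h \<in> ball h0 \<rho> \<Longrightarrow> x + s *\<^sub>R h \<in> \<Omega>" by simp_all
  \<comment> \<open>The last two summands bound the length of the directions; the 1 lets
    \<open>M\<close> also dominate the coefficient of \<open>nrm2 f\<close>.\<close>
  define M where "M = 1 + norm h0 + \<rho>"
  have M: "1 \<le> M" "norm h0 + \<rho> \<le> M" using \<rho> by (auto simp: M_def)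
  define b where "b = measure lborel (ball h0 \<rho>)"
  have eb: "emeasure lborel (ball h0 \<rho>) = ennreal b"
    unfolding b_def using emeasure_lborel_ball_finite[of h0 \<rho>] by (intro emeasure_eq_ennreal_measure) auto
  have b: "b > 0"
  proof -
    have "emeasure lborel (ball h0 \<rho>) \<noteq> 0"
      using \<rho> open_not_negligible[of "ball h0 \<rho>"] by (auto simp: negligible_iff_null_sets null_sets_def)
    then have "b \<noteq> 0" unfolding eb by (auto simp: ennreal_eq_0_iff)
    moreover have "0 \<le> b" by (simp add: b_def)
    ultimately show ?thesis by simp
  qed
  show ?thesis
  proof (intro exI[of _ "256 * M ^ 4 / b"] conjI allI impI)
    show "0 \<le> 256 * M ^ 4 / b" using M b by simp
    fix f g assume fg: "weak_gradient \<Omega> f g"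
    have f: "sq_int f" and g: "\<And>i. i \<in> Basis \<Longrightarrow> sq_int (g i)"
      and d: "\<And>h. dir_deriv \<Omega> h f (\<lambda>x. \<Sum>i\<in>Basis. (h \<bullet> i) * g i x)" using fg by (auto simp: weak_gradient_def)
    define T where "T = nrm2 f + (\<Sum>i\<in>Basis. nrm2 (g i))"
    define H where "H x = \<bar>f x\<bar> + M * (\<Sum>i\<in>Basis. \<bar>g i x\<bar>)" for x
    have sg: "sq_int (\<lambda>x. \<Sum>i\<in>Basis. \<bar>g i x\<bar>)" by (intro sq_int_sum sq_int_abs g)
    have H: "sq_int H" unfolding H_def by (intro sq_int_add sq_int_abs f sq_int_cmult sg)
    have "nrm2 H \<le> nrm2 (\<lambda>x. \<bar>f x\<bar>) + nrm2 (\<lambda>x. M * (\<Sum>i\<in>Basis. \<bar>g i x\<bar>))"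
      unfolding H_def by (intro nrm2_triangle sq_int_abs f sq_int_cmult sg)
    also have "\<dots> = nrm2 f + M * nrm2 (\<lambda>x. \<Sum>i\<in>Basis. \<bar>g i x\<bar>)" using M by (simp add: nrm2_abs nrm2_cmult)
    also have "nrm2 (\<lambda>x. \<Sum>i\<in>Basis. \<bar>g i x\<bar>) \<le> (\<Sum>i\<in>Basis. nrm2 (\<lambda>x. \<bar>g i x\<bar>))"
      by (intro nrm2_sum sq_int_abs g) auto
    also have "nrm2 f + M * (\<Sum>i\<in>Basis. nrm2 (\<lambda>x. \<bar>g i x\<bar>)) \<le> M * T"
    proof -
      have "1 * nrm2 f \<le> M * nrm2 f" using M by (intro mult_right_mono) auto
      then show ?thesis by (simp add: nrm2_abs T_def distrib_left)
    qed
    finally have HT: "nrm2 H \<le> M * T" using M by simp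
    let ?X = "\<integral>\<^sup>+x. indicator (\<Omega> \<inter> V) x * ennreal ((f x) ^ 4) \<partial>lborel"
    have "ennreal b * ?X \<le> 256 * (\<integral>\<^sup>+x. ennreal ((H x)\<^sup>2) \<partial>lborel)\<^sup>2"
      unfolding eb[symmetric] H_def
      by (rule local_L4_bound[OF dim f g d _ \<rho> M(2) c]) (use V in auto)
    also have "\<dots> = 256 * (ennreal ((nrm2 H)\<^sup>2))\<^sup>2" by (simp only: nn_integral_square[OF H])
    also have "\<dots> = ennreal (256 * (nrm2 H) ^ 4)"
      by (simp add: ennreal_power ennreal_mult flip: power_mult)
    also have "\<dots> \<le> ennreal (256 * (M * T) ^ 4)" by (intro ennreal_leI mult_left_mono power_mono HT) auto
    finally have le: "ennreal b * ?X \<le> ennreal (256 * (M * T) ^ 4)" .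
    have "?X = ennreal (1 / b) * (ennreal b * ?X)" using b by (simp flip: mult.assoc ennreal_mult)
    also have "\<dots> \<le> ennreal (1 / b) * ennreal (256 * (M * T) ^ 4)" by (intro mult_left_mono le) simp
    also have "\<dots> = ennreal (1 / b * (256 * (M * T) ^ 4))" using b by (intro ennreal_mult[symmetric]) auto
    also have "1 / b * (256 * (M * T) ^ 4) = 256 * M ^ 4 / b * T ^ 4" by (simp add: power_mult_distrib)
    finally show "?X \<le> ennreal (256 * M ^ 4 / b * (nrm2 f + (\<Sum>i\<in>Basis. nrm2 (g i))) ^ 4)" by (simp add: T_def)
  qed
qed

text \<open>The local bounds are summed over the finite cover. The L4 norm appears as the L2 norm of
  the square, so that products of two such functions are handled by Cauchy-Schwarz.\<close>

theorem L4_embedding: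
  fixes \<Omega> :: "'a::euclidean_space set"
  assumes \<Omega>: "open \<Omega>" "bounded \<Omega>" "C2_boundary \<Omega>" and dim: "DIM('a) \<le> 3"
  shows "\<exists>C\<ge>0. \<forall>f g. weak_gradient \<Omega> f g \<longrightarrow>
     sq_int (\<lambda>x. (f x)\<^sup>2) \<and> nrm2 (\<lambda>x. (f x)\<^sup>2) \<le> C * (nrm2 f + (\<Sum>i\<in>Basis. nrm2 (g i)))\<^sup>2"
proof -
  obtain \<D> where "finite \<D> \<and> \<Omega> \<subseteq> \<Union>\<D> \<and> (\<forall>V\<in>\<D>. open V \<and>
     (\<exists>h0. \<exists>\<rho>>0. \<forall>x\<in>\<Omega> \<inter> V. \<forall>s\<in>{0..1}. \<forall>h\<in>ball h0 \<rho>. x + s *\<^sub>R h \<in> \<Omega>))"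
    using cone_condition_cover[OF \<Omega>] ..
  then have \<D>: "finite \<D>" "\<Omega> \<subseteq> \<Union>\<D>" "\<And>V. V \<in> \<D> \<Longrightarrow> open V"
    "\<And>V. V \<in> \<D> \<Longrightarrow> \<exists>h0. \<exists>\<rho>>0. \<forall>x\<in>\<Omega> \<inter> V. \<forall>s\<in>{0..1}. \<forall>h\<in>ball h0 \<rho>. x + s *\<^sub>R h \<in> \<Omega>" by simp_all
  have "\<forall>V\<in>\<D>. \<exists>K\<ge>0. \<forall>f g. weak_gradient \<Omega> f g \<longrightarrow> (\<integral>\<^sup>+x. indicator (\<Omega> \<inter> V) x * ennreal ((f x) ^ 4) \<partial>lborel)
     \<le> ennreal (K * (nrm2 f + (\<Sum>i\<in>Basis. nrm2 (g i))) ^ 4)"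
    by (intro ballI local_L4_constant[OF dim \<D>(3) \<Omega>(1) \<D>(4)])
  from bchoice[OF this] obtain K where "\<forall>V\<in>\<D>. 0 \<le> K V \<and> (\<forall>f g. weak_gradient \<Omega> f g \<longrightarrow>
     (\<integral>\<^sup>+x. indicator (\<Omega> \<inter> V) x * ennreal ((f x) ^ 4) \<partial>lborel)
     \<le> ennreal (K V * (nrm2 f + (\<Sum>i\<in>Basis. nrm2 (g i))) ^ 4))" ..
  then have K: "\<And>V. V \<in> \<D> \<Longrightarrow> 0 \<le> K V"
    "\<And>V f g. V \<in> \<D> \<Longrightarrow> weak_gradient \<Omega> f g \<Longrightarrow> (\<integral>\<^sup>+x. indicator (\<Omega> \<inter> V) x * ennreal ((f x) ^ 4) \<partial>lborel)
     \<le> ennreal (K V * (nrm2 f + (\<Sum>i\<in>Basis. nrm2 (g i))) ^ 4)" by simp_all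
  \<comment> \<open>The local constants bound fourth powers, whereas \<open>nrm2\<close> of the
    square is the root of such an integral.\<close>
  define C where "C = sqrt (\<Sum>V\<in>\<D>. K V)"
  have C2: "C\<^sup>2 = (\<Sum>V\<in>\<D>. K V)" "0 \<le> C" unfolding C_def using K(1) by (auto intro!: sum_nonneg)
  show ?thesis
  proof (intro exI[of _ C] conjI allI impI C2(2))
    fix f g assume fg: "weak_gradient \<Omega> f g"
    have [measurable]: "f \<in> borel_measurable borel" and f0: "\<And>x. x \<notin> \<Omega> \<Longrightarrow> f x = 0"
      using fg by (auto simp: weak_gradient_def sq_int_def)
    have [measurable]: "\<Omega> \<inter> V \<in> sets borel" if "V \<in> \<D>" for V using \<D>(3)[OF that] \<Omega>(1) by auto
    define T where "T = nrm2 f + (\<Sum>i\<in>Basis. nrm2 (g i))"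
    have T: "0 \<le> T" by (simp add: T_def sum_nonneg)
    have "(\<integral>\<^sup>+x. ennreal (((f x)\<^sup>2)\<^sup>2) \<partial>lborel) \<le> (\<integral>\<^sup>+x. (\<Sum>V\<in>\<D>. indicator (\<Omega> \<inter> V) x * ennreal ((f x) ^ 4)) \<partial>lborel)"
    proof (rule nn_integral_mono)
      fix x
      show "ennreal (((f x)\<^sup>2)\<^sup>2) \<le> (\<Sum>V\<in>\<D>. indicator (\<Omega> \<inter> V) x * ennreal ((f x) ^ 4))"
      proof (cases "x \<in> \<Omega>")
        case True
        then obtain V where V: "V \<in> \<D>" "x \<in> V" using \<D>(2) by blast
        have "ennreal (((f x)\<^sup>2)\<^sup>2) = indicator (\<Omega> \<inter> V) x * ennreal ((f x) ^ 4)"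
          using V True by simp
        also have "\<dots> \<le> (\<Sum>V\<in>\<D>. indicator (\<Omega> \<inter> V) x * ennreal ((f x) ^ 4))"
          using V(1) \<D>(1) by (intro member_le_sum) auto
        finally show ?thesis .
      qed (simp add: f0)
    qed
    also have "\<dots> = (\<Sum>V\<in>\<D>. \<integral>\<^sup>+x. indicator (\<Omega> \<inter> V) x * ennreal ((f x) ^ 4) \<partial>lborel)"
      by (rule nn_integral_sum) measurable
    also have "\<dots> \<le> (\<Sum>V\<in>\<D>. ennreal (K V * T ^ 4))" unfolding T_def by (intro sum_mono K(2) fg)
    also have "\<dots> = ennreal (\<Sum>V\<in>\<D>. K V * T ^ 4)" using K(1) by (intro sum_ennreal) auto
    also have "(\<Sum>V\<in>\<D>. K V * T ^ 4) = (C * T\<^sup>2)\<^sup>2" by (simp add: power_mult_distrib C2 sum_distrib_right)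
    finally have "(\<integral>\<^sup>+x. ennreal (((f x)\<^sup>2)\<^sup>2) \<partial>lborel) \<le> ennreal ((C * T\<^sup>2)\<^sup>2)" .
    from sq_intI_nn_integral[OF _ this] C2(2) T
    show "sq_int (\<lambda>x. (f x)\<^sup>2)" "nrm2 (\<lambda>x. (f x)\<^sup>2) \<le> C * (nrm2 f + (\<Sum>i\<in>Basis. nrm2 (g i)))\<^sup>2"
      by (auto simp: T_def)
  qed
qed

section \<open>Borel representatives\<close>

text \<open>\<open>F\<close> is a Borel version of \<open>f\<close> on \<open>S\<close>, extended by
  zero. It carries integrals over \<open>S\<close> with respect to Lebesgue measure to integrals
  over the whole space with respect to \<open>lborel\<close>.\<close>

definition rep :: "'a::euclidean_space set \<Rightarrow> ('a \<Rightarrow> real) \<Rightarrow> ('a \<Rightarrow> real) \<Rightarrow> bool" where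
  "rep S f F \<longleftrightarrow> F \<in> borel_measurable borel \<and> (\<forall>x. x \<notin> S \<longrightarrow> F x = 0) \<and> (AE x in lborel. x \<in> S \<longrightarrow> F x = f x)"

lemma AE_lebesgue_on:
  "S \<in> sets borel \<Longrightarrow> (AE x in lebesgue_on S. P x) \<longleftrightarrow> (AE x in lborel. x \<in> S \<longrightarrow> P x)"
  by (simp add: AE_restrict_space_iff AE_completion_iff)

lemma rep_exists:
  fixes f :: "'a::euclidean_space \<Rightarrow> real"
  assumes [measurable]: "S \<in> sets borel" and f: "f \<in> borel_measurable (lebesgue_on S)"
  shows "\<exists>F. rep S f F"
proof -
  have "(\<lambda>x. if x \<in> S then f x else 0) \<in> borel_measurable lebesgue" by (rule borel_measurable_if_I[OF f]) simp
  from completion_ex_borel_measurable_real[OF this]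
  obtain F where F: "F \<in> borel_measurable lborel" "AE x in lborel. (if x \<in> S then f x else 0) = F x" by (elim bexE)
  have [measurable]: "F \<in> borel_measurable borel" using F(1) by simp
  have "rep S f (\<lambda>x. if x \<in> S then F x else 0)"
    unfolding rep_def using F(2) by (auto elim!: eventually_mono)
  then show ?thesis by (intro exI[of _ "\<lambda>x. if x \<in> S then F x else 0"])
qed

lemma rep_extension_AE:
  assumes "rep S f F" shows "AE x in lborel. F x = (if x \<in> S then f x else 0)"
  using assms unfolding rep_def by (auto elim!: eventually_mono)

text \<open>Completeness of Lebesgue measure: preimages under the extended \<open>f\<close> differ
  from those under \<open>F\<close> by null sets.\<close>

lemma rep_extension_measurable:
  assumes "rep S f F" shows "(\<lambda>x. if x \<in> S then f x else 0) \<in> borel_measurable lebesgue"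
proof (rule measurableI)
  fix A :: "real set" assume A: "A \<in> sets borel"
  have [measurable]: "F \<in> borel_measurable borel" using assms by (simp add: rep_def)
  show "(\<lambda>x. if x \<in> S then f x else 0) -` A \<inter> space lebesgue \<in> sets lebesgue"
  proof (rule completion.in_sets_AE)
    have "F -` A \<inter> space lborel \<in> sets lborel" using A by (intro measurable_sets[of F lborel borel]) simp_all
    then show "F -` A \<inter> space lborel \<in> sets lebesgue" by (rule sets_completionI_sets)
    show "AE x in lebesgue. x \<in> F -` A \<inter> space lborel \<longleftrightarrow> x \<in> (\<lambda>x. if x \<in> S then f x else 0) -` A \<inter> space lebesgue"
      unfolding AE_completion_iff by (rule eventually_mono[OF rep_extension_AE[OF assms]]) simp
  qed simp
qed simp

lemma rep_measurable:
  "rep S f F \<Longrightarrow> f \<in> borel_measurable (lebesgue_on S)"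
  by (rule borel_measurable_if_D) (rule rep_extension_measurable)

lemma rep_borel: "rep S f F \<Longrightarrow> F \<in> borel_measurable borel"
  by (simp add: rep_def)

lemma rep_integral:
  assumes S: "S \<in> sets borel" and r: "rep S f F"
  shows "(\<integral>x. f x \<partial>lebesgue_on S) = (\<integral>x. F x \<partial>lborel)"
    and "integrable (lebesgue_on S) f \<longleftrightarrow> integrable lborel F"
proof -
  have Sl: "S \<in> sets lebesgue" using S by simp
  have F: "F \<in> borel_measurable lborel" using r by (simp add: rep_def)
  have Fl: "F \<in> borel_measurable lebesgue" using F by (rule measurable_completion)
  have ae: "AE x in lebesgue. (if x \<in> S then f x else 0) = F x"
    unfolding AE_completion_iff by (rule eventually_mono[OF rep_extension_AE[OF r]]) simp
  have "(\<integral>x. f x \<partial>lebesgue_on S) = (\<integral>x. (if x \<in> S then f x else 0) \<partial>lebesgue)"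
    by (rule Lebesgue_Measure.integral_restrict_UNIV[OF Sl, symmetric])
  also have "\<dots> = (\<integral>x. F x \<partial>lebesgue)"
    by (rule integral_cong_AE[OF rep_extension_measurable[OF r] Fl ae])
  also have "\<dots> = (\<integral>x. F x \<partial>lborel)" by (rule integral_completion[OF F])
  finally show "(\<integral>x. f x \<partial>lebesgue_on S) = (\<integral>x. F x \<partial>lborel)" .
  have "integrable (lebesgue_on S) f \<longleftrightarrow> integrable lebesgue (\<lambda>x. if x \<in> S then f x else 0)"
    by (rule Lebesgue_Measure.integrable_restrict_UNIV[OF Sl, symmetric])
  also have "\<dots> \<longleftrightarrow> integrable lebesgue F"
    by (rule integrable_cong_AE[OF rep_extension_measurable[OF r] Fl ae])
  also have "\<dots> \<longleftrightarrow> integrable lborel F" by (rule integrable_completion[OF F])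
  finally show "integrable (lebesgue_on S) f \<longleftrightarrow> integrable lborel F" .
qed

lemma rep_add: "rep S f F \<Longrightarrow> rep S g G \<Longrightarrow> rep S (\<lambda>x. f x + g x) (\<lambda>x. F x + G x)"
  unfolding rep_def by (intro conjI) (auto elim!: eventually_elim2)

lemma rep_diff: "rep S f F \<Longrightarrow> rep S g G \<Longrightarrow> rep S (\<lambda>x. f x - g x) (\<lambda>x. F x - G x)"
  unfolding rep_def by (intro conjI) (auto elim!: eventually_elim2)

lemma rep_mult: "rep S f F \<Longrightarrow> rep S g G \<Longrightarrow> rep S (\<lambda>x. f x * g x) (\<lambda>x. F x * G x)"
  unfolding rep_def by (intro conjI) (auto elim!: eventually_elim2)

lemma rep_mult_borel: "rep S f F \<Longrightarrow> \<phi> \<in> borel_measurable borel \<Longrightarrow> rep S (\<lambda>x. f x * \<phi> x) (\<lambda>x. F x * \<phi> x)"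
  unfolding rep_def by (auto elim!: eventually_mono)

lemma rep_power2: "rep S f F \<Longrightarrow> rep S (\<lambda>x. (f x)\<^sup>2) (\<lambda>x. (F x)\<^sup>2)"
  unfolding rep_def by (auto elim!: eventually_mono)

lemma rep_cong_AE:
  assumes "S \<in> sets borel" "rep S f F" "AE x in lebesgue_on S. f x = f' x" shows "rep S f' F"
proof -
  have ae: "AE x in lborel. x \<in> S \<longrightarrow> f x = f' x" using assms(3) by (simp only: AE_lebesgue_on[OF assms(1)])
  have "AE x in lborel. x \<in> S \<longrightarrow> F x = f x" using assms(2) by (simp add: rep_def)
  with ae have "AE x in lborel. x \<in> S \<longrightarrow> F x = f' x" by eventually_elim simp
  then show ?thesis using assms(2) by (simp add: rep_def)
qed

section \<open>L2 on a set through representatives\<close>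

abbreviation L2_on :: "'a::euclidean_space set \<Rightarrow> ('a \<Rightarrow> real) set" where
  "L2_on S \<equiv> Lp_space (lebesgue_on S) 2"

abbreviation L2_norm_on :: "'a::euclidean_space set \<Rightarrow> ('a \<Rightarrow> real) \<Rightarrow> real" where
  "L2_norm_on S \<equiv> Lp_norm (lebesgue_on S) 2"

lemma abs_powr_2: "\<bar>x::real\<bar> powr 2 = x\<^sup>2"
  by (cases "x = 0") (simp_all add: powr_numeral)

lemma Lp_space_2: "f \<in> Lp_space M 2 \<longleftrightarrow> f \<in> borel_measurable M \<and> integrable M (\<lambda>x. (f x)\<^sup>2)"
  by (simp add: Lp_space_def abs_powr_2)

lemma Lp_norm_2: "Lp_norm M 2 f = sqrt (\<integral>x. (f x)\<^sup>2 \<partial>M)"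
  by (simp add: Lp_norm_def abs_powr_2 powr_half_sqrt)

lemma rep_L2_iff:
  assumes "S \<in> sets borel" "rep S f F" shows "f \<in> L2_on S \<longleftrightarrow> sq_int F"
  using rep_integral(2)[OF assms(1) rep_power2[OF assms(2)]] rep_measurable[OF assms(2)] rep_borel[OF assms(2)]
  by (simp add: Lp_space_2 sq_int_def)

lemma rep_L2_norm:
  assumes "S \<in> sets borel" "rep S f F" shows "L2_norm_on S f = nrm2 F"
  by (simp add: Lp_norm_2 nrm2_def rep_integral(1)[OF assms(1) rep_power2[OF assms(2)]])

lemma L2_rep:
  assumes "S \<in> sets borel" "f \<in> L2_on S"
  obtains F where "rep S f F" "sq_int F"
proof -
  have "f \<in> borel_measurable (lebesgue_on S)" using assms(2) by (simp add: Lp_space_2)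
  from rep_exists[OF assms(1) this] obtain F where F: "rep S f F" ..
  with rep_L2_iff[OF assms(1) F] assms(2) that show thesis by simp
qed

lemma L2_cong_AE:
  assumes S: "S \<in> sets borel" and f: "f \<in> L2_on S" and ae: "AE x in lebesgue_on S. f x = f' x"
  shows "f' \<in> L2_on S" "L2_norm_on S f' = L2_norm_on S f"
proof -
  obtain F where F: "rep S f F" "sq_int F" using L2_rep[OF S f] .
  have F': "rep S f' F" by (rule rep_cong_AE[OF S F(1) ae])
  show "f' \<in> L2_on S" using rep_L2_iff[OF S F'] F(2) by simp
  show "L2_norm_on S f' = L2_norm_on S f" using rep_L2_norm[OF S F'] rep_L2_norm[OF S F(1)] by simp
qed

lemma L2_diff:
  assumes S: "S \<in> sets borel" and "f \<in> L2_on S" "g \<in> L2_on S"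
  shows "(\<lambda>x. f x - g x) \<in> L2_on S"
proof -
  obtain F where F: "rep S f F" "sq_int F" using L2_rep[OF S assms(2)] .
  obtain G where G: "rep S g G" "sq_int G" using L2_rep[OF S assms(3)] .
  show ?thesis using rep_L2_iff[OF S rep_diff[OF F(1) G(1)]] sq_int_diff[OF F(2) G(2)] by simp
qed

lemma L2_locally_integrable:
  fixes f :: "'a::euclidean_space \<Rightarrow> real"
  assumes S: "open S" and f: "f \<in> L2_on S"
  shows "locally_integrable S f"
  unfolding locally_integrable_def
proof (intro allI impI)
  fix K :: "'a set" assume K: "compact K \<and> K \<subseteq> S"
  have Sb: "S \<in> sets borel" using S by simp
  have Kb: "K \<in> sets borel" using K by (simp add: borel_compact)
  obtain F where F: "rep S f F" "sq_int F" using L2_rep[OF Sb f] .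
  have r: "rep K f (\<lambda>x. indicator K x * F x)"
    unfolding rep_def
  proof (intro conjI)
    show "(\<lambda>x. indicator K x * F x) \<in> borel_measurable borel" using Kb rep_borel[OF F(1)] by measurable
    have "AE x in lborel. x \<in> S \<longrightarrow> F x = f x" using F(1) by (simp add: rep_def)
    then show "AE x in lborel. x \<in> K \<longrightarrow> indicator K x * F x = f x"
      by (rule eventually_mono) (use K in auto)
  qed simp
  have "integrable lborel (\<lambda>x. indicator K x * F x)"
    using K by (intro sq_int_imp_set_integrable F(2) Kb emeasure_compact_finite) simp
  then show "integrable (lebesgue_on K) f" using rep_integral(2)[OF Kb r] by simp
qed

section \<open>Weak derivatives\<close>

lemma test_function_borel:
  assumes "\<phi> \<in> test_functions \<Omega>" "i \<in> Basis"
  shows "\<phi> \<in> borel_measurable borel" "pderivative i \<phi> \<in> borel_measurable borel"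
  using assms unfolding test_functions_def
  by (auto intro!: borel_measurable_continuous_onI smooth_imp_continuous smooth_pderivative)

lemma test_dir_Basis:
  assumes "\<phi> \<in> test_functions \<Omega>" "i \<in> Basis"
  shows "test_dir \<Omega> i \<phi> (pderivative i \<phi>)"
proof -
  have "(\<Sum>j\<in>Basis. (i \<bullet> j) * pderivative j \<phi> x) = pderivative i \<phi> x" for x
  proof -
    have "(\<Sum>j\<in>Basis. (i \<bullet> j) * pderivative j \<phi> x) = (\<Sum>j\<in>Basis. if j = i then pderivative j \<phi> x else 0)"
      using assms(2) by (intro sum.cong) (auto simp: inner_Basis)
    then show ?thesis using assms(2) by simp
  qed
  with test_dir_smooth[OF assms(1), of i] show ?thesis by simp
qed

lemma has_weak_pd_iff_rep:
  fixes \<Omega> :: "'a::euclidean_space set"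
  assumes \<Omega>: "open \<Omega>" and i: "i \<in> Basis" and F: "rep \<Omega> f F" "sq_int F" and G: "rep \<Omega> g G" "sq_int G"
  shows "has_weak_pd \<Omega> i f g \<longleftrightarrow>
    (\<forall>\<phi>\<in>test_functions \<Omega>. (\<integral>x. F x * pderivative i \<phi> x \<partial>lborel) = - (\<integral>x. G x * \<phi> x \<partial>lborel))"
proof -
  have b: "\<Omega> \<in> sets borel" using \<Omega> by simp
  have "locally_integrable \<Omega> f" "locally_integrable \<Omega> g"
    using rep_L2_iff[OF b F(1)] rep_L2_iff[OF b G(1)] F(2) G(2) by (auto intro!: L2_locally_integrable[OF \<Omega>])
  then show ?thesis unfolding has_weak_pd_def
    using rep_integral(1)[OF b rep_mult_borel[OF F(1) test_function_borel(2)[OF _ i]]]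
      rep_integral(1)[OF b rep_mult_borel[OF G(1) test_function_borel(1)[OF _ i]]] by simp
qed

text \<open>The bridge from weak partial derivatives to the segment calculus. From left to right
  bumps suffice as test functions; from right to left every test function is admissible for
  integration by parts.\<close>

lemma has_weak_pd_dir_deriv:
  fixes \<Omega> :: "'a::euclidean_space set"
  assumes \<Omega>: "open \<Omega>" and i: "i \<in> Basis" and F: "rep \<Omega> f F" "sq_int F" and G: "rep \<Omega> g G" "sq_int G"
  shows "has_weak_pd \<Omega> i f g \<longleftrightarrow> dir_deriv \<Omega> i F G"
proof
  assume w: "has_weak_pd \<Omega> i f g"
  show "dir_deriv \<Omega> i F G"
  proof (rule dir_derivI_bump[OF \<Omega> F(2) G(2)])
    fix a b n \<phi>' assume ab: "cbox a b \<subseteq> \<Omega>" and t: "test_dir \<Omega> i (bump a b n) \<phi>'"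
    have "\<phi>' = pderivative i (bump a b n)"
      by (rule test_dir_unique[OF t test_dir_Basis[OF bump_test_function[OF ab] i]])
    then show "(\<integral>x. F x * \<phi>' x \<partial>lborel) = - (\<integral>x. G x * bump a b n x \<partial>lborel)"
      using w bump_test_function[OF ab] unfolding has_weak_pd_iff_rep[OF \<Omega> i F G] by simp
  qed
next
  assume "dir_deriv \<Omega> i F G"
  then show "has_weak_pd \<Omega> i f g"
    unfolding has_weak_pd_iff_rep[OF \<Omega> i F G]
    using dir_deriv_weak[OF \<Omega> _ F(2) G(2) test_dir_Basis[OF _ i]] by blast
qed

text \<open>Segments in an oblique direction are not composed of coordinate segments inside the
  domain. The weak formulation, however, is linear in the direction, so the passage to general
  \<open>h\<close> is made there.\<close>

lemma has_weak_pd_all_directions: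
  fixes \<Omega> :: "'a::euclidean_space set"
  assumes \<Omega>: "open \<Omega>" and F: "rep \<Omega> f F" "sq_int F"
    and G: "\<And>i. i \<in> Basis \<Longrightarrow> rep \<Omega> (g i) (G i)" "\<And>i. i \<in> Basis \<Longrightarrow> sq_int (G i)"
    and w: "\<And>i. i \<in> Basis \<Longrightarrow> has_weak_pd \<Omega> i f (g i)"
  shows "weak_gradient \<Omega> F G"
  unfolding weak_gradient_def
proof (intro conjI allI ballI)
  fix h :: 'a
  have sG: "sq_int (\<lambda>x. \<Sum>i\<in>Basis. (h \<bullet> i) * G i x)" by (intro sq_int_sum sq_int_cmult G)
  show "dir_deriv \<Omega> h F (\<lambda>x. \<Sum>i\<in>Basis. (h \<bullet> i) * G i x)"
  proof (rule dir_derivI_bump[OF \<Omega> F(2) sG])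
    fix a b n \<phi>' assume ab: "cbox a b \<subseteq> \<Omega>" and t: "test_dir \<Omega> h (bump a b n) \<phi>'"
    let ?\<phi> = "bump a b n"
    note tf = bump_test_function[OF ab, of n]
    have p: "\<phi>' = (\<lambda>x. \<Sum>i\<in>Basis. (h \<bullet> i) * pderivative i ?\<phi> x)" by (rule test_dir_unique[OF t test_dir_smooth[OF tf]])
    have s: "sq_int (pderivative i ?\<phi>)" if "i \<in> Basis" for i
      by (rule test_dir_sq_int(2)[OF test_dir_Basis[OF tf that]])
    have s0: "sq_int ?\<phi>" using test_dir_sq_int[OF t] by simp
    have "(\<integral>x. F x * \<phi>' x \<partial>lborel) = (\<integral>x. (\<Sum>i\<in>Basis. (h \<bullet> i) * (F x * pderivative i ?\<phi> x)) \<partial>lborel)"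
      unfolding p by (simp add: sum_distrib_left mult.left_commute)
    also have "\<dots> = (\<Sum>i\<in>Basis. (h \<bullet> i) * (\<integral>x. F x * pderivative i ?\<phi> x \<partial>lborel))"
      by (subst Bochner_Integration.integral_sum) (auto intro!: integrable_mult_right sq_int_mult F s)
    also have "\<dots> = (\<Sum>i\<in>Basis. (h \<bullet> i) * - (\<integral>x. G i x * ?\<phi> x \<partial>lborel))"
    proof (rule sum.cong[OF refl])
      fix i :: 'a assume i: "i \<in> Basis"
      have "(\<integral>x. F x * pderivative i ?\<phi> x \<partial>lborel) = - (\<integral>x. G i x * ?\<phi> x \<partial>lborel)"
        using w[OF i] tf unfolding has_weak_pd_iff_rep[OF \<Omega> i F G(1)[OF i] G(2)[OF i]] by simp
      then show "(h \<bullet> i) * (\<integral>x. F x * pderivative i ?\<phi> x \<partial>lborel) = (h \<bullet> i) * - (\<integral>x. G i x * ?\<phi> x \<partial>lborel)" by simp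
    qed
    also have "\<dots> = - (\<Sum>i\<in>Basis. (h \<bullet> i) * (\<integral>x. G i x * ?\<phi> x \<partial>lborel))" by (simp add: sum_negf)
    also have "(\<Sum>i\<in>Basis. (h \<bullet> i) * (\<integral>x. G i x * ?\<phi> x \<partial>lborel)) = (\<integral>x. (\<Sum>i\<in>Basis. (h \<bullet> i) * (G i x * ?\<phi> x)) \<partial>lborel)"
      by (subst Bochner_Integration.integral_sum) (auto intro!: integrable_mult_right sq_int_mult G s0)
    also have "\<dots> = (\<integral>x. (\<Sum>i\<in>Basis. (h \<bullet> i) * G i x) * ?\<phi> x \<partial>lborel)"
      by (simp add: sum_distrib_right mult.assoc)
    finally show "(\<integral>x. F x * \<phi>' x \<partial>lborel) = - (\<integral>x. (\<Sum>i\<in>Basis. (h \<bullet> i) * G i x) * ?\<phi> x \<partial>lborel)" .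
  qed
qed (use F G in \<open>auto simp: rep_def\<close>)

lemma bump_borel [measurable]: "bump a b n \<in> borel_measurable borel"
  by (intro borel_measurable_continuous_onI smooth_imp_continuous smooth_bump)

text \<open>\<open>weak_pd\<close> is selected by choice, so everything said about it rests on
  uniqueness. The candidates are only locally integrable; the difference is therefore treated on
  each closed box of a countable cover, where it is integrable.\<close>

lemma has_weak_pd_unique:
  fixes \<Omega> :: "'a::euclidean_space set"
  assumes \<Omega>: "open \<Omega>" and w: "has_weak_pd \<Omega> i f g" "has_weak_pd \<Omega> i f g'"
  shows "AE x in lebesgue_on \<Omega>. g x = g' x"
proof -
  have b: "\<Omega> \<in> sets borel" using \<Omega> by simp
  obtain \<D> where \<D>: "countable \<D>" "\<D> \<subseteq> Pow \<Omega>" "\<And>X. X \<in> \<D> \<Longrightarrow> \<exists>a b. X = cbox a b" "\<Union>\<D> = \<Omega>"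
    by (rule open_countable_Union_open_cbox[OF \<Omega>]) (rule that)
  have "AE x in lborel. x \<in> X \<longrightarrow> g x = g' x" if X: "X \<in> \<D>" for X
  proof -
    obtain a b where "X = cbox a b" using \<D>(3)[OF X] by (elim exE)
    note ab = this
    have sub: "X \<subseteq> \<Omega>" using \<D>(2) X by auto
    have Xb: "X \<in> sets borel" by (simp add: ab)
    have Xl: "X \<in> sets lebesgue" and \<Omega>l: "\<Omega> \<in> sets lebesgue" using Xb b by simp_all
    have "integrable (lebesgue_on X) g" "integrable (lebesgue_on X) g'"
      using w sub by (auto simp: has_weak_pd_def locally_integrable_def ab)
    then have i: "integrable (lebesgue_on X) (\<lambda>x. g x - g' x)" "integrable (lebesgue_on X) g" "integrable (lebesgue_on X) g'"
      by simp_all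
    have "(\<lambda>x. g x - g' x) \<in> borel_measurable (lebesgue_on X)" using i(1) by simp
    from rep_exists[OF Xb this] obtain F where F: "rep X (\<lambda>x. g x - g' x) F" ..
    have iF: "integrable lborel F" using rep_integral(2)[OF Xb F] i(1) by simp
    have [measurable]: "F \<in> borel_measurable borel" using F by (rule rep_borel)
    have "AE x in lborel. x \<in> box a b \<longrightarrow> F x = 0"
    proof (rule fundamental_lemma)
      show "integrable lborel (\<lambda>x. indicator (cbox c d) x * F x)" for c d
        using integrable_mult_indicator[OF _ iF, of "cbox c d"] by simp
      fix c d n assume cd: "cbox c d \<subseteq> box a b"
      let ?\<phi> = "bump c d n"
      have cdX: "cbox c d \<subseteq> X" using cd box_subset_cbox[of a b] by (auto simp: ab)
      have tf: "?\<phi> \<in> test_functions \<Omega>" using cdX sub by (intro bump_test_function) auto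
      have \<phi>0: "?\<phi> x = 0" if "x \<notin> X" for x using bump_eq_0[of x c d n] cdX that by auto
      \<comment> \<open>The bump vanishes off \<open>X\<close>, so the weak identities over
        \<open>\<Omega>\<close> become identities over \<open>X\<close>, where the integrals can be
        subtracted.\<close>
      have to_X: "(\<integral>x. k x * ?\<phi> x \<partial>lebesgue_on \<Omega>) = (\<integral>x. k x * ?\<phi> x \<partial>lebesgue_on X)" for k
      proof -
        have "(\<integral>x. k x * ?\<phi> x \<partial>lebesgue_on \<Omega>) = (\<integral>x. (if x \<in> \<Omega> then k x * ?\<phi> x else 0) \<partial>lebesgue)"
          by (rule Lebesgue_Measure.integral_restrict_UNIV[OF \<Omega>l, symmetric])
        also have "(\<lambda>x. if x \<in> \<Omega> then k x * ?\<phi> x else 0) = (\<lambda>x. if x \<in> X then k x * ?\<phi> x else 0)"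
          using sub \<phi>0 by (intro ext) auto
        also have "(\<integral>x. (if x \<in> X then k x * ?\<phi> x else 0) \<partial>lebesgue) = (\<integral>x. k x * ?\<phi> x \<partial>lebesgue_on X)"
          by (rule Lebesgue_Measure.integral_restrict_UNIV[OF Xl])
        finally show ?thesis .
      qed
      have \<phi>m: "?\<phi> \<in> borel_measurable (lebesgue_on X)"
        by (intro measurable_restrict_space1 measurable_completion) simp
      have ik: "integrable (lebesgue_on X) (\<lambda>x. k x * ?\<phi> x)" if k: "integrable (lebesgue_on X) k" for k :: "'a \<Rightarrow> real"
      proof (rule Bochner_Integration.integrable_bound[OF k])
        show "(\<lambda>x. k x * ?\<phi> x) \<in> borel_measurable (lebesgue_on X)" using k \<phi>m by measurable
        show "AE x in lebesgue_on X. norm (k x * ?\<phi> x) \<le> norm (k x)"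
          by (rule AE_I2) (simp add: abs_mult mult_left_le bump_nonneg bump_le_1)
      qed
      have "(\<integral>x. F x * ?\<phi> x \<partial>lborel) = (\<integral>x. (g x - g' x) * ?\<phi> x \<partial>lebesgue_on X)"
        by (rule rep_integral(1)[OF Xb rep_mult_borel[OF F], symmetric]) simp
      also have "\<dots> = (\<integral>x. g x * ?\<phi> x \<partial>lebesgue_on X) - (\<integral>x. g' x * ?\<phi> x \<partial>lebesgue_on X)"
        using ik[OF i(2)] ik[OF i(3)] by (subst Bochner_Integration.integral_diff[symmetric]) (simp_all add: algebra_simps)
      also have "\<dots> = 0" using w tf unfolding has_weak_pd_def to_X[symmetric] by force
      finally show "(\<integral>x. F x * ?\<phi> x \<partial>lborel) = 0" .
    qed (simp_all add: open_box)
    moreover have "AE x in lborel. x \<notin> cbox a b - box a b"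
      by (rule AE_not_in) (rule null_sets_cbox_Diff_box)
    moreover have "AE x in lborel. x \<in> X \<longrightarrow> F x = g x - g' x" using F by (simp add: rep_def)
    ultimately show ?thesis unfolding ab by eventually_elim auto
  qed
  then have "AE x in lborel. \<forall>X\<in>\<D>. x \<in> X \<longrightarrow> g x = g' x"
    using \<D>(1) by (subst AE_ball_countable) auto
  then have "AE x in lborel. x \<in> \<Omega> \<longrightarrow> g x = g' x" unfolding \<D>(4)[symmetric] by (rule eventually_mono) auto
  then show ?thesis by (simp only: AE_lebesgue_on[OF b])
qed

lemma weak_pd_eq:
  assumes "open \<Omega>" "has_weak_pd \<Omega> i f g"
  shows "has_weak_pd \<Omega> i f (weak_pd \<Omega> i f)" "AE x in lebesgue_on \<Omega>. weak_pd \<Omega> i f x = g x"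
proof -
  show *: "has_weak_pd \<Omega> i f (weak_pd \<Omega> i f)" unfolding weak_pd_def by (rule someI[of "has_weak_pd \<Omega> i f", OF assms(2)])
  show "AE x in lebesgue_on \<Omega>. weak_pd \<Omega> i f x = g x" by (rule has_weak_pd_unique[OF assms(1) * assms(2)])
qed

lemma weak_pd_L2:
  assumes "open \<Omega>" "has_weak_pd \<Omega> i f g" "g \<in> L2_on \<Omega>"
  shows "weak_pd \<Omega> i f \<in> L2_on \<Omega>" "L2_norm_on \<Omega> (weak_pd \<Omega> i f) = L2_norm_on \<Omega> g"
proof -
  have b: "\<Omega> \<in> sets borel" using assms(1) by simp
  have ae: "AE x in lebesgue_on \<Omega>. g x = weak_pd \<Omega> i f x"
    by (rule eventually_mono[OF weak_pd_eq(2)[OF assms(1,2)]]) simp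
  show "weak_pd \<Omega> i f \<in> L2_on \<Omega>" "L2_norm_on \<Omega> (weak_pd \<Omega> i f) = L2_norm_on \<Omega> g"
    using L2_cong_AE[OF b assms(3) ae] .
qed

lemma has_weak_pd_cong_AE:
  fixes \<Omega> :: "'a::euclidean_space set"
  assumes \<Omega>: "open \<Omega>" and i: "i \<in> Basis" and w: "has_weak_pd \<Omega> i f g" and L2: "f \<in> L2_on \<Omega>" "g \<in> L2_on \<Omega>"
    and ae: "AE x in lebesgue_on \<Omega>. f x = f' x" "AE x in lebesgue_on \<Omega>. g x = g' x"
  shows "has_weak_pd \<Omega> i f' g'"
proof -
  have b: "\<Omega> \<in> sets borel" using \<Omega> by simp
  obtain F where F: "rep \<Omega> f F" "sq_int F" using L2_rep[OF b L2(1)] .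
  obtain G where G: "rep \<Omega> g G" "sq_int G" using L2_rep[OF b L2(2)] .
  have "dir_deriv \<Omega> i F G" using w unfolding has_weak_pd_dir_deriv[OF \<Omega> i F G] .
  then show ?thesis
    using has_weak_pd_dir_deriv[OF \<Omega> i rep_cong_AE[OF b F(1) ae(1)] F(2) rep_cong_AE[OF b G(1) ae(2)] G(2)] by simp
qed

lemma has_weak_pd_diff:
  fixes \<Omega> :: "'a::euclidean_space set"
  assumes \<Omega>: "open \<Omega>" and i: "i \<in> Basis" and w: "has_weak_pd \<Omega> i f g" "has_weak_pd \<Omega> i f' g'"
    and L2: "f \<in> L2_on \<Omega>" "g \<in> L2_on \<Omega>" "f' \<in> L2_on \<Omega>" "g' \<in> L2_on \<Omega>"
  shows "has_weak_pd \<Omega> i (\<lambda>x. f x - f' x) (\<lambda>x. g x - g' x)"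
proof -
  have b: "\<Omega> \<in> sets borel" using \<Omega> by simp
  obtain F where F: "rep \<Omega> f F" "sq_int F" using L2_rep[OF b L2(1)] .
  obtain G where G: "rep \<Omega> g G" "sq_int G" using L2_rep[OF b L2(2)] .
  obtain F' where F': "rep \<Omega> f' F'" "sq_int F'" using L2_rep[OF b L2(3)] .
  obtain G' where G': "rep \<Omega> g' G'" "sq_int G'" using L2_rep[OF b L2(4)] .
  show ?thesis
    unfolding has_weak_pd_iff_rep[OF \<Omega> i rep_diff[OF F(1) F'(1)] sq_int_diff[OF F(2) F'(2)]
        rep_diff[OF G(1) G'(1)] sq_int_diff[OF G(2) G'(2)]]
  proof
    fix \<phi> assume \<phi>: "\<phi> \<in> test_functions \<Omega>"
    note s = test_dir_sq_int[OF test_dir_Basis[OF \<phi> i]]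
    have "(\<integral>x. F x * pderivative i \<phi> x \<partial>lborel) = - (\<integral>x. G x * \<phi> x \<partial>lborel)"
      "(\<integral>x. F' x * pderivative i \<phi> x \<partial>lborel) = - (\<integral>x. G' x * \<phi> x \<partial>lborel)"
      using w \<phi> unfolding has_weak_pd_iff_rep[OF \<Omega> i F G] has_weak_pd_iff_rep[OF \<Omega> i F' G'] by simp_all
    then show "(\<integral>x. (F x - F' x) * pderivative i \<phi> x \<partial>lborel) = - (\<integral>x. (G x - G' x) * \<phi> x \<partial>lborel)"
      using sq_int_mult[OF F(2) s(2)] sq_int_mult[OF F'(2) s(2)] sq_int_mult[OF G(2) s(1)] sq_int_mult[OF G'(2) s(1)]
      by (simp add: left_diff_distrib)
  qed
qed

section \<open>Sobolev spaces of first and second order\<close>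

text \<open>Formulated with the chosen derivative \<open>weak_pd\<close>, because that is the one in
  which the Sobolev norms are written.\<close>

definition H1_on :: "'a::euclidean_space set \<Rightarrow> ('a \<Rightarrow> real) \<Rightarrow> bool" where
  "H1_on \<Omega> f \<longleftrightarrow> f \<in> L2_on \<Omega> \<and>
     (\<forall>i\<in>Basis. has_weak_pd \<Omega> i f (weak_pd \<Omega> i f) \<and> weak_pd \<Omega> i f \<in> L2_on \<Omega>)"

definition H2_on :: "'a::euclidean_space set \<Rightarrow> ('a \<Rightarrow> real) \<Rightarrow> bool" where
  "H2_on \<Omega> f \<longleftrightarrow> H1_on \<Omega> f \<and> (\<forall>i\<in>Basis. H1_on \<Omega> (weak_pd \<Omega> i f))"

lemma Hs_norm_1: "Hs_norm 1 \<Omega> f = sqrt ((L2_norm_on \<Omega> f)\<^sup>2 + (\<Sum>i\<in>Basis. (L2_norm_on \<Omega> (weak_pd \<Omega> i f))\<^sup>2))"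
  by (simp add: Hs_norm_def)

lemma Hs_norm_1_power2: "(Hs_norm 1 \<Omega> f)\<^sup>2 = (L2_norm_on \<Omega> f)\<^sup>2 + (\<Sum>i\<in>Basis. (L2_norm_on \<Omega> (weak_pd \<Omega> i f))\<^sup>2)"
  unfolding Hs_norm_1 by (intro real_sqrt_pow2 add_nonneg_nonneg sum_nonneg) auto

lemma Hs_norm_1_nonneg: "0 \<le> Hs_norm 1 \<Omega> f"
  unfolding Hs_norm_1 by (intro real_sqrt_ge_zero add_nonneg_nonneg sum_nonneg) auto

lemma sum_Basis_member_le:
  fixes k :: "'a::euclidean_space \<Rightarrow> real"
  assumes "i \<in> Basis" "\<And>j. j \<in> Basis \<Longrightarrow> 0 \<le> k j" shows "k i \<le> (\<Sum>j\<in>Basis. k j)"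
  using assms by (intro member_le_sum) auto

lemma L2_norm_le_Hs_norm_1: "L2_norm_on \<Omega> f \<le> Hs_norm 1 \<Omega> f"
  by (rule power2_le_imp_le[OF _ Hs_norm_1_nonneg]) (simp add: Hs_norm_1_power2 sum_nonneg)

lemma weak_pd_norm_le_Hs_norm_1:
  assumes "i \<in> Basis" shows "L2_norm_on \<Omega> (weak_pd \<Omega> i f) \<le> Hs_norm 1 \<Omega> f"
proof (rule power2_le_imp_le[OF _ Hs_norm_1_nonneg])
  have "(L2_norm_on \<Omega> (weak_pd \<Omega> i f))\<^sup>2 \<le> (\<Sum>j\<in>Basis. (L2_norm_on \<Omega> (weak_pd \<Omega> j f))\<^sup>2)"
    using assms by (intro sum_Basis_member_le) auto
  then show "(L2_norm_on \<Omega> (weak_pd \<Omega> i f))\<^sup>2 \<le> (Hs_norm 1 \<Omega> f)\<^sup>2"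
    unfolding Hs_norm_1_power2 by (intro add_increasing) auto
qed

lemma Hs_norm_2_power2: "(Hs_norm 2 \<Omega> f)\<^sup>2 = (L2_norm_on \<Omega> f)\<^sup>2 + (\<Sum>i\<in>Basis. (Hs_norm 1 \<Omega> (weak_pd \<Omega> i f))\<^sup>2)"
proof -
  have "Hs_norm 2 \<Omega> f = sqrt ((L2_norm_on \<Omega> f)\<^sup>2 + (\<Sum>i\<in>Basis. (Hs_norm 1 \<Omega> (weak_pd \<Omega> i f))\<^sup>2))"
    unfolding Hs_norm_1_power2 by (simp add: Hs_norm_def numeral_2_eq_2)
  then show ?thesis by (simp only:) (intro real_sqrt_pow2 add_nonneg_nonneg sum_nonneg; simp)
qed

lemma Hs_norm_2_nonneg: "0 \<le> Hs_norm 2 \<Omega> f"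
proof -
  have "Hs_norm 2 \<Omega> f = sqrt ((L2_norm_on \<Omega> f)\<^sup>2 + (\<Sum>i\<in>Basis. (Hs_norm 1 \<Omega> (weak_pd \<Omega> i f))\<^sup>2))"
    unfolding Hs_norm_1_power2 by (simp add: Hs_norm_def numeral_2_eq_2)
  then show ?thesis by (simp only:) (intro real_sqrt_ge_zero add_nonneg_nonneg sum_nonneg; simp)
qed

lemma Hs_norm_1_weak_pd_le:
  assumes "i \<in> Basis" shows "Hs_norm 1 \<Omega> (weak_pd \<Omega> i f) \<le> Hs_norm 2 \<Omega> f"
proof (rule power2_le_imp_le[OF _ Hs_norm_2_nonneg])
  have "(Hs_norm 1 \<Omega> (weak_pd \<Omega> i f))\<^sup>2 \<le> (\<Sum>j\<in>Basis. (Hs_norm 1 \<Omega> (weak_pd \<Omega> j f))\<^sup>2)"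
    using assms by (intro sum_Basis_member_le) auto
  then show "(Hs_norm 1 \<Omega> (weak_pd \<Omega> i f))\<^sup>2 \<le> (Hs_norm 2 \<Omega> f)\<^sup>2"
    unfolding Hs_norm_2_power2 by (intro add_increasing) auto
qed

lemma Hs_norm_1_le_2: "Hs_norm 1 \<Omega> f \<le> Hs_norm 2 \<Omega> f"
proof (rule power2_le_imp_le[OF _ Hs_norm_2_nonneg])
  have "(L2_norm_on \<Omega> (weak_pd \<Omega> i f))\<^sup>2 \<le> (Hs_norm 1 \<Omega> (weak_pd \<Omega> i f))\<^sup>2" for i
    by (intro power_mono L2_norm_le_Hs_norm_1) (simp add: Lp_norm_2)
  then show "(Hs_norm 1 \<Omega> f)\<^sup>2 \<le> (Hs_norm 2 \<Omega> f)\<^sup>2"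
    unfolding Hs_norm_1_power2 Hs_norm_2_power2[of \<Omega> f] by (intro add_left_mono sum_mono) (simp add: Hs_norm_1_power2)
qed

text \<open>The existentially given derivative agrees almost everywhere with the chosen one.
  Arbitrary \<open>\<theta>\<close> covers the space of order 1 as well as that of order
  \<open>1 + \<epsilon>\<close>.\<close>

lemma in_sobolev_imp_H1:
  assumes \<Omega>: "open \<Omega>" and f: "in_sobolev (Suc 0) \<theta> \<Omega> f" shows "H1_on \<Omega> f"
  unfolding H1_on_def
proof (intro conjI ballI)
  show "f \<in> L2_on \<Omega>" using f by simp
  fix i :: 'a assume "i \<in> Basis"
  then obtain g where "has_weak_pd \<Omega> i f g \<and> in_sobolev 0 \<theta> \<Omega> g" using f by (simp only: in_sobolev.simps) blast
  then have g: "has_weak_pd \<Omega> i f g" "g \<in> L2_on \<Omega>" by simp_all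
  show "has_weak_pd \<Omega> i f (weak_pd \<Omega> i f)" by (rule weak_pd_eq(1)[OF \<Omega> g(1)])
  show "weak_pd \<Omega> i f \<in> L2_on \<Omega>" by (rule weak_pd_L2(1)[OF \<Omega> g])
qed

lemma H1_cong_AE:
  assumes \<Omega>: "open \<Omega>" and f: "H1_on \<Omega> f" and ae: "AE x in lebesgue_on \<Omega>. f x = f' x"
  shows "H1_on \<Omega> f'"
  unfolding H1_on_def
proof (intro conjI ballI)
  have b: "\<Omega> \<in> sets borel" using \<Omega> by simp
  show "f' \<in> L2_on \<Omega>" using L2_cong_AE(1)[OF b _ ae] f by (simp add: H1_on_def)
  fix i :: 'a assume i: "i \<in> Basis"
  have g: "has_weak_pd \<Omega> i f' (weak_pd \<Omega> i f)"
    by (rule has_weak_pd_cong_AE[OF \<Omega> i _ _ _ ae]) (use f i in \<open>auto simp: H1_on_def\<close>)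
  show "has_weak_pd \<Omega> i f' (weak_pd \<Omega> i f')" by (rule weak_pd_eq(1)[OF \<Omega> g])
  show "weak_pd \<Omega> i f' \<in> L2_on \<Omega>" by (rule weak_pd_L2(1)[OF \<Omega> g]) (use f i in \<open>auto simp: H1_on_def\<close>)
qed

text \<open>The second derivatives are provided for some first derivative; uniqueness carries them
  over to \<open>weak_pd\<close>.\<close>

lemma Hs_space_2_imp_H2:
  assumes \<Omega>: "open \<Omega>" and f: "f \<in> Hs_space 2 \<Omega>" shows "H2_on \<Omega> f"
proof -
  have s: "in_sobolev (Suc (Suc 0)) 0 \<Omega> f" using f by (simp add: Hs_space_def numeral_2_eq_2)
  have L2: "f \<in> L2_on \<Omega>" using s by (simp only: in_sobolev.simps)
  have g: "\<exists>g. has_weak_pd \<Omega> i f g \<and> H1_on \<Omega> g" if "i \<in> Basis" for i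
  proof -
    have "\<exists>g. has_weak_pd \<Omega> i f g \<and> in_sobolev (Suc 0) 0 \<Omega> g" using s that by (simp only: in_sobolev.simps(2)[of "Suc 0"])
    then obtain g where g: "has_weak_pd \<Omega> i f g \<and> in_sobolev (Suc 0) 0 \<Omega> g" ..
    then have "H1_on \<Omega> g" by (intro in_sobolev_imp_H1[OF \<Omega>, of 0]) simp
    with g show ?thesis by (intro exI[of _ g]) simp
  qed
  have *: "has_weak_pd \<Omega> i f (weak_pd \<Omega> i f)" "H1_on \<Omega> (weak_pd \<Omega> i f)" if i: "i \<in> Basis" for i
  proof -
    obtain g where g: "has_weak_pd \<Omega> i f g \<and> H1_on \<Omega> g" using g[OF i] ..
    note g = conjunct1[OF g] conjunct2[OF g]
    show "has_weak_pd \<Omega> i f (weak_pd \<Omega> i f)" by (rule weak_pd_eq(1)[OF \<Omega> g(1)])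
    have "AE x in lebesgue_on \<Omega>. g x = weak_pd \<Omega> i f x"
      by (rule eventually_mono[OF weak_pd_eq(2)[OF \<Omega> g(1)]]) (rule sym)
    then show "H1_on \<Omega> (weak_pd \<Omega> i f)" by (rule H1_cong_AE[OF \<Omega> g(2)])
  qed
  show ?thesis unfolding H2_on_def H1_on_def[of \<Omega> f] using L2 * by (simp add: H1_on_def)
qed

lemma weak_pd_diff:
  assumes \<Omega>: "open \<Omega>" and i: "i \<in> Basis" and f: "H1_on \<Omega> f" "H1_on \<Omega> g"
  shows "has_weak_pd \<Omega> i (\<lambda>x. f x - g x) (\<lambda>x. weak_pd \<Omega> i f x - weak_pd \<Omega> i g x)"
    and "(\<lambda>x. weak_pd \<Omega> i f x - weak_pd \<Omega> i g x) \<in> L2_on \<Omega>"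
    and "AE x in lebesgue_on \<Omega>. weak_pd \<Omega> i (\<lambda>x. f x - g x) x = weak_pd \<Omega> i f x - weak_pd \<Omega> i g x"
proof -
  show w: "has_weak_pd \<Omega> i (\<lambda>x. f x - g x) (\<lambda>x. weak_pd \<Omega> i f x - weak_pd \<Omega> i g x)"
    by (rule has_weak_pd_diff[OF \<Omega> i]) (use f i in \<open>auto simp: H1_on_def\<close>)
  show "(\<lambda>x. weak_pd \<Omega> i f x - weak_pd \<Omega> i g x) \<in> L2_on \<Omega>"
    by (rule L2_diff) (use f i \<Omega> in \<open>auto simp: H1_on_def\<close>)
  show "AE x in lebesgue_on \<Omega>. weak_pd \<Omega> i (\<lambda>x. f x - g x) x = weak_pd \<Omega> i f x - weak_pd \<Omega> i g x"
    by (rule weak_pd_eq(2)[OF \<Omega> w])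
qed

lemma H1_diff:
  assumes \<Omega>: "open \<Omega>" and f: "H1_on \<Omega> f" "H1_on \<Omega> g"
  shows "H1_on \<Omega> (\<lambda>x. f x - g x)"
  unfolding H1_on_def
proof (intro conjI ballI)
  show "(\<lambda>x. f x - g x) \<in> L2_on \<Omega>" by (rule L2_diff) (use f \<Omega> in \<open>auto simp: H1_on_def\<close>)
  fix i :: 'a assume i: "i \<in> Basis"
  show "has_weak_pd \<Omega> i (\<lambda>x. f x - g x) (weak_pd \<Omega> i (\<lambda>x. f x - g x))"
    by (rule weak_pd_eq(1)[OF \<Omega> weak_pd_diff(1)[OF \<Omega> i f]])
  show "weak_pd \<Omega> i (\<lambda>x. f x - g x) \<in> L2_on \<Omega>"
    by (rule weak_pd_L2(1)[OF \<Omega> weak_pd_diff(1,2)[OF \<Omega> i f]])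
qed

lemma L2_norm_diff_power2_le:
  assumes S: "S \<in> sets borel" and "f \<in> L2_on S" "g \<in> L2_on S"
  shows "(L2_norm_on S (\<lambda>x. f x - g x))\<^sup>2 \<le> 2 * (L2_norm_on S f)\<^sup>2 + 2 * (L2_norm_on S g)\<^sup>2"
proof -
  obtain F where F: "rep S f F" "sq_int F" using L2_rep[OF S assms(2)] .
  obtain G where G: "rep S g G" "sq_int G" using L2_rep[OF S assms(3)] .
  have "nrm2 (\<lambda>x. F x - G x) \<le> nrm2 F + nrm2 G"
    using nrm2_triangle[OF F(2) sq_int_minus[OF G(2)]] nrm2_cmult[of "-1" G] by simp
  then have "(nrm2 (\<lambda>x. F x - G x))\<^sup>2 \<le> (nrm2 F + nrm2 G)\<^sup>2" by (rule power_mono) simp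
  also have "\<dots> \<le> 2 * (nrm2 F)\<^sup>2 + 2 * (nrm2 G)\<^sup>2"
    using sum_squares_bound[of "nrm2 F" "nrm2 G"] by (simp add: power2_sum)
  finally show ?thesis
    by (simp add: rep_L2_norm[OF S rep_diff[OF F(1) G(1)]] rep_L2_norm[OF S F(1)] rep_L2_norm[OF S G(1)])
qed

lemma Hs_norm_1_diff_power2_le:
  assumes \<Omega>: "open \<Omega>" and f: "H1_on \<Omega> f" "H1_on \<Omega> g"
  shows "(Hs_norm 1 \<Omega> (\<lambda>x. f x - g x))\<^sup>2 \<le> 2 * (Hs_norm 1 \<Omega> f)\<^sup>2 + 2 * (Hs_norm 1 \<Omega> g)\<^sup>2"
proof -
  have b: "\<Omega> \<in> sets borel" using \<Omega> by simp
  have i: "(L2_norm_on \<Omega> (weak_pd \<Omega> i (\<lambda>x. f x - g x)))\<^sup>2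
      \<le> 2 * (L2_norm_on \<Omega> (weak_pd \<Omega> i f))\<^sup>2 + 2 * (L2_norm_on \<Omega> (weak_pd \<Omega> i g))\<^sup>2" if i: "i \<in> Basis" for i
    unfolding weak_pd_L2(2)[OF \<Omega> weak_pd_diff(1,2)[OF \<Omega> i f]]
    by (rule L2_norm_diff_power2_le[OF b]) (use f i in \<open>auto simp: H1_on_def\<close>)
  have "(L2_norm_on \<Omega> (\<lambda>x. f x - g x))\<^sup>2 \<le> 2 * (L2_norm_on \<Omega> f)\<^sup>2 + 2 * (L2_norm_on \<Omega> g)\<^sup>2"
    by (rule L2_norm_diff_power2_le[OF b]) (use f in \<open>auto simp: H1_on_def\<close>)
  moreover have "(\<Sum>i\<in>Basis. (L2_norm_on \<Omega> (weak_pd \<Omega> i (\<lambda>x. f x - g x)))\<^sup>2)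
      \<le> (\<Sum>i\<in>Basis. 2 * (L2_norm_on \<Omega> (weak_pd \<Omega> i f))\<^sup>2 + 2 * (L2_norm_on \<Omega> (weak_pd \<Omega> i g))\<^sup>2)"
    by (rule sum_mono[OF i])
  ultimately show ?thesis
    unfolding Hs_norm_1_power2 by (simp add: sum.distrib sum_distrib_left[symmetric] distrib_left)
qed

text \<open>For a test function the classical partial derivative represents the chosen weak one, so
  norms of \<open>weak_pd\<close> can be computed from it.\<close>

lemma H1_test_function:
  assumes \<Omega>: "open \<Omega>" and \<phi>: "\<phi> \<in> test_functions \<Omega>"
  shows "H1_on \<Omega> \<phi>" "rep \<Omega> \<phi> \<phi>" "sq_int \<phi>"
    and "\<And>i. i \<in> Basis \<Longrightarrow> rep \<Omega> (weak_pd \<Omega> i \<phi>) (pderivative i \<phi>)"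
    and "\<And>i. i \<in> Basis \<Longrightarrow> sq_int (pderivative i \<phi>)"
proof -
  have b: "\<Omega> \<in> sets borel" using \<Omega> by simp
  obtain K where K: "K \<subseteq> \<Omega>" "\<And>x. x \<notin> K \<Longrightarrow> \<phi> x = 0" by (rule test_dirE[OF test_dir_smooth[OF \<phi>, of 0]]) (rule that)
  have s: "sq_int \<phi>" by (rule test_dir_sq_int(1)[OF test_dir_smooth[OF \<phi>, of 0]])
  then show "sq_int \<phi>" .
  show r: "rep \<Omega> \<phi> \<phi>" using s K by (auto simp: rep_def sq_int_def)
  have r': "rep \<Omega> (pderivative i \<phi>) (pderivative i \<phi>)" and s': "sq_int (pderivative i \<phi>)" and w: "has_weak_pd \<Omega> i \<phi> (pderivative i \<phi>)"
    if i: "i \<in> Basis" for i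
  proof -
    note t = test_dir_Basis[OF \<phi> i]
    show s': "sq_int (pderivative i \<phi>)" by (rule test_dir_sq_int(2)[OF t])
    obtain K where K: "K \<subseteq> \<Omega>" "\<And>x. x \<notin> K \<Longrightarrow> pderivative i \<phi> x = 0" by (rule test_dirE[OF t]) (rule that)
    then show r': "rep \<Omega> (pderivative i \<phi>) (pderivative i \<phi>)" using s' by (auto simp: rep_def sq_int_def)
    show "has_weak_pd \<Omega> i \<phi> (pderivative i \<phi>)"
      unfolding has_weak_pd_dir_deriv[OF \<Omega> i r s r' s']
      by (rule dir_deriv_mono[OF test_dir_imp_dir_deriv[OF t]]) simp
  qed
  show "sq_int (pderivative i \<phi>)" if "i \<in> Basis" for i by (rule s'[OF that])
  show "rep \<Omega> (weak_pd \<Omega> i \<phi>) (pderivative i \<phi>)" if i: "i \<in> Basis" for i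
    by (rule rep_cong_AE[OF b r'[OF i]]) (use weak_pd_eq(2)[OF \<Omega> w[OF i]] in \<open>auto elim!: eventually_mono\<close>)
  show "H1_on \<Omega> \<phi>"
    unfolding H1_on_def
  proof (intro conjI ballI)
    show "\<phi> \<in> L2_on \<Omega>" using rep_L2_iff[OF b r] s by simp
    fix i :: 'a assume i: "i \<in> Basis"
    have "pderivative i \<phi> \<in> L2_on \<Omega>" using rep_L2_iff[OF b r'[OF i]] s'[OF i] by simp
    then show "weak_pd \<Omega> i \<phi> \<in> L2_on \<Omega>" by (rule weak_pd_L2(1)[OF \<Omega> w[OF i]])
    show "has_weak_pd \<Omega> i \<phi> (weak_pd \<Omega> i \<phi>)" by (rule weak_pd_eq(1)[OF \<Omega> w[OF i]])
  qed
qed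

section \<open>Products of H1 functions and bounded coefficients\<close>

lemma L4_bound_H1:
  fixes \<Omega> :: "'a::euclidean_space set"
  assumes \<Omega>: "open \<Omega>" "bounded \<Omega>" "C2_boundary \<Omega>" and dim: "DIM('a) \<le> 3"
  shows "\<exists>C\<ge>0. \<forall>f F. H1_on \<Omega> f \<longrightarrow> rep \<Omega> f F \<longrightarrow>
     sq_int (\<lambda>x. (F x)\<^sup>2) \<and> nrm2 (\<lambda>x. (F x)\<^sup>2) \<le> C * (Hs_norm 1 \<Omega> f)\<^sup>2"
proof -
  have b: "\<Omega> \<in> sets borel" using \<Omega> by simp
  obtain C where "C \<ge> 0 \<and> (\<forall>f g. weak_gradient \<Omega> f g \<longrightarrow>
     sq_int (\<lambda>x. (f x)\<^sup>2) \<and> nrm2 (\<lambda>x. (f x)\<^sup>2) \<le> C * (nrm2 f + (\<Sum>i\<in>Basis. nrm2 (g i)))\<^sup>2)"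
    using L4_embedding[OF \<Omega> dim] ..
  then have C: "C \<ge> 0" "\<And>f g. weak_gradient \<Omega> f g \<Longrightarrow>
     sq_int (\<lambda>x. (f x)\<^sup>2) \<and> nrm2 (\<lambda>x. (f x)\<^sup>2) \<le> C * (nrm2 f + (\<Sum>i\<in>Basis. nrm2 (g i)))\<^sup>2" by simp_all
  \<comment> \<open>The number of L2 norms in the sum, each of which is at most the H1 norm.\<close>
  define m where "m = 1 + real (DIM('a))"
  show ?thesis
  proof (intro exI[of _ "C * m\<^sup>2"] conjI allI impI)
    show "0 \<le> C * m\<^sup>2" using C(1) by simp
    fix f F assume f: "H1_on \<Omega> f" and F: "rep \<Omega> f F"
    have sF: "sq_int F" using rep_L2_iff[OF b F] f by (simp add: H1_on_def)
    have "\<forall>i\<in>Basis. \<exists>G. rep \<Omega> (weak_pd \<Omega> i f) G"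
      using f by (intro ballI rep_exists[OF b]) (simp add: H1_on_def Lp_space_2)
    from bchoice[OF this] obtain G where "\<forall>i\<in>Basis. rep \<Omega> (weak_pd \<Omega> i f) (G i)" ..
    then have G: "\<And>i. i \<in> Basis \<Longrightarrow> rep \<Omega> (weak_pd \<Omega> i f) (G i)" by simp
    have sG: "sq_int (G i)" if "i \<in> Basis" for i using rep_L2_iff[OF b G[OF that]] f that by (simp add: H1_on_def)
    have wg: "weak_gradient \<Omega> F G"
      by (rule has_weak_pd_all_directions[OF \<Omega>(1) F sF G sG]) (use f in \<open>auto simp: H1_on_def\<close>)
    from C(2)[OF wg] show "sq_int (\<lambda>x. (F x)\<^sup>2)" by simp
    have "nrm2 F \<le> Hs_norm 1 \<Omega> f" using L2_norm_le_Hs_norm_1[of \<Omega> f] by (simp add: rep_L2_norm[OF b F])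
    moreover have "(\<Sum>i\<in>Basis. nrm2 (G i)) \<le> (\<Sum>i\<in>(Basis::'a set). Hs_norm 1 \<Omega> f)"
    proof (rule sum_mono)
      fix i :: 'a assume i: "i \<in> Basis"
      show "nrm2 (G i) \<le> Hs_norm 1 \<Omega> f" using weak_pd_norm_le_Hs_norm_1[OF i, of \<Omega> f] by (simp add: rep_L2_norm[OF b G[OF i]])
    qed
    ultimately have "nrm2 F + (\<Sum>i\<in>Basis. nrm2 (G i)) \<le> m * Hs_norm 1 \<Omega> f" by (simp add: m_def algebra_simps)
    then have "(nrm2 F + (\<Sum>i\<in>Basis. nrm2 (G i)))\<^sup>2 \<le> (m * Hs_norm 1 \<Omega> f)\<^sup>2" by (rule power_mono) (simp add: sum_nonneg)
    then have "C * (nrm2 F + (\<Sum>i\<in>Basis. nrm2 (G i)))\<^sup>2 \<le> C * (m * Hs_norm 1 \<Omega> f)\<^sup>2" using C(1) by (rule mult_left_mono)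
    with C(2)[OF wg] show "nrm2 (\<lambda>x. (F x)\<^sup>2) \<le> C * m\<^sup>2 * (Hs_norm 1 \<Omega> f)\<^sup>2" by (simp add: power_mult_distrib)
  qed
qed

lemma nrm2_mult_le:
  assumes "sq_int (\<lambda>x. (F x)\<^sup>2)" "sq_int (\<lambda>x. (G x)\<^sup>2)" and [measurable]: "F \<in> borel_measurable borel" "G \<in> borel_measurable borel"
  shows "sq_int (\<lambda>x. F x * G x)" "(nrm2 (\<lambda>x. F x * G x))\<^sup>2 \<le> nrm2 (\<lambda>x. (F x)\<^sup>2) * nrm2 (\<lambda>x. (G x)\<^sup>2)"
proof -
  have i: "integrable lborel (\<lambda>x. (F x)\<^sup>2 * (G x)\<^sup>2)" by (rule sq_int_mult) fact+
  then show "sq_int (\<lambda>x. F x * G x)" by (simp add: sq_int_def power_mult_distrib)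
  show "(nrm2 (\<lambda>x. F x * G x))\<^sup>2 \<le> nrm2 (\<lambda>x. (F x)\<^sup>2) * nrm2 (\<lambda>x. (G x)\<^sup>2)"
    unfolding nrm2_power2 power_mult_distrib using abs_integral_mult_le[OF assms(1,2)] by simp
qed

text \<open>Hoelder with exponents 4 and 4. Every product of a derivative or of \<open>w\<close>
  with the test function is estimated through this bound.\<close>

lemma product_L2_bound:
  fixes \<Omega> :: "'a::euclidean_space set"
  assumes \<Omega>: "open \<Omega>" "bounded \<Omega>" "C2_boundary \<Omega>" and dim: "DIM('a) \<le> 3"
  shows "\<exists>C\<ge>0. \<forall>f F g G. H1_on \<Omega> f \<longrightarrow> rep \<Omega> f F \<longrightarrow> H1_on \<Omega> g \<longrightarrow> rep \<Omega> g G \<longrightarrow>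
     sq_int (\<lambda>x. F x * G x) \<and> nrm2 (\<lambda>x. F x * G x) \<le> C * Hs_norm 1 \<Omega> f * Hs_norm 1 \<Omega> g"
proof -
  obtain C where "C \<ge> 0 \<and> (\<forall>f F. H1_on \<Omega> f \<longrightarrow> rep \<Omega> f F \<longrightarrow>
     sq_int (\<lambda>x. (F x)\<^sup>2) \<and> nrm2 (\<lambda>x. (F x)\<^sup>2) \<le> C * (Hs_norm 1 \<Omega> f)\<^sup>2)"
    using L4_bound_H1[OF \<Omega> dim] ..
  then have C: "C \<ge> 0" "\<And>f F. H1_on \<Omega> f \<Longrightarrow> rep \<Omega> f F \<Longrightarrow>
     sq_int (\<lambda>x. (F x)\<^sup>2) \<and> nrm2 (\<lambda>x. (F x)\<^sup>2) \<le> C * (Hs_norm 1 \<Omega> f)\<^sup>2" by simp_all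
  show ?thesis
  proof (intro exI[of _ C] conjI allI impI C(1))
    fix f F g G assume f: "H1_on \<Omega> f" "rep \<Omega> f F" and g: "H1_on \<Omega> g" "rep \<Omega> g G"
    have m: "F \<in> borel_measurable borel" "G \<in> borel_measurable borel" using f g by (auto simp: rep_def)
    note F = C(2)[OF f] and G = C(2)[OF g]
    note FG = nrm2_mult_le[OF conjunct1[OF F] conjunct1[OF G] m]
    show "sq_int (\<lambda>x. F x * G x)" by (rule FG(1))
    have "(nrm2 (\<lambda>x. F x * G x))\<^sup>2 \<le> (C * (Hs_norm 1 \<Omega> f)\<^sup>2) * (C * (Hs_norm 1 \<Omega> g)\<^sup>2)"
      by (rule order_trans[OF FG(2)]) (use F G C(1) in \<open>auto intro!: mult_mono\<close>)
    also have "\<dots> = (C * Hs_norm 1 \<Omega> f * Hs_norm 1 \<Omega> g)\<^sup>2" by (simp add: power_mult_distrib power2_eq_square)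
    finally show "nrm2 (\<lambda>x. F x * G x) \<le> C * Hs_norm 1 \<Omega> f * Hs_norm 1 \<Omega> g"
      by (rule power2_le_imp_le) (intro mult_nonneg_nonneg C(1) Hs_norm_1_nonneg)
  qed
qed

text \<open>Truncation turns an almost-everywhere bound into one at every point, the form that
  multiplication by a bounded factor requires.\<close>

lemma bounded_rep:
  assumes S: "S \<in> sets borel" and f: "f \<in> borel_measurable (lebesgue_on S)" and C: "AE x in lebesgue_on S. \<bar>f x\<bar> \<le> C"
  obtains F where "rep S f F" "\<And>x. \<bar>F x\<bar> \<le> \<bar>C\<bar>"
proof -
  obtain F where F: "rep S f F" using rep_exists[OF S f] ..
  define G where "G x = max (- \<bar>C\<bar>) (min \<bar>C\<bar> (F x))" for x
  have [measurable]: "F \<in> borel_measurable borel" by (rule rep_borel[OF F])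
  have "G \<in> borel_measurable borel" unfolding G_def by measurable
  moreover have "G x = 0" if "x \<notin> S" for x using F that by (simp add: G_def rep_def)
  moreover have "AE x in lborel. x \<in> S \<longrightarrow> G x = f x"
  proof -
    have "AE x in lborel. x \<in> S \<longrightarrow> \<bar>f x\<bar> \<le> C" using C by (simp only: AE_lebesgue_on[OF S])
    moreover have "AE x in lborel. x \<in> S \<longrightarrow> F x = f x" using F by (simp add: rep_def)
    ultimately show ?thesis by eventually_elim (auto simp: G_def)
  qed
  ultimately have "rep S f G" by (simp add: rep_def)
  moreover have "\<bar>G x\<bar> \<le> \<bar>C\<bar>" for x unfolding G_def by linarith
  ultimately show thesis by (rule that)
qed

lemma Linf_rep:
  assumes S: "S \<in> sets borel" and f: "f \<in> Linf_space (lebesgue_on S)"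
  obtains F C where "rep S f F" "0 \<le> C" "\<And>x. \<bar>F x\<bar> \<le> C"
proof -
  have m: "f \<in> borel_measurable (lebesgue_on S)" and "\<exists>C. AE x in lebesgue_on S. \<bar>f x\<bar> \<le> C" using f by (auto simp: Linf_space_def)
  then obtain C where C: "AE x in lebesgue_on S. \<bar>f x\<bar> \<le> C" by (elim exE)
  obtain F where F: "rep S f F" "\<And>x. \<bar>F x\<bar> \<le> \<bar>C\<bar>" by (rule bounded_rep[OF S m C]) (rule that)
  show thesis by (rule that[OF F(1) abs_ge_zero F(2)])
qed

lemma Linf_mult_L2:
  assumes "sq_int f" "\<phi> \<in> borel_measurable borel" "\<And>x. \<bar>\<phi> x\<bar> \<le> B" "0 \<le> B"
  shows "sq_int (\<lambda>x. \<phi> x * f x)" "nrm2 (\<lambda>x. \<phi> x * f x) \<le> B * nrm2 f"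
proof -
  have [measurable]: "f \<in> borel_measurable borel" "\<phi> \<in> borel_measurable borel" using assms by (auto simp: sq_int_def)
  have le: "\<bar>\<phi> x * f x\<bar> \<le> \<bar>B * f x\<bar>" for x
    unfolding abs_mult using assms(3)[of x] assms(4) by (intro mult_right_mono) auto
  show "sq_int (\<lambda>x. \<phi> x * f x)" by (rule sq_intI_bound(1)[OF sq_int_cmult[OF assms(1)] _ le]) measurable
  have "nrm2 (\<lambda>x. \<phi> x * f x) \<le> nrm2 (\<lambda>x. B * f x)" by (rule sq_intI_bound(2)[OF sq_int_cmult[OF assms(1)] _ le]) measurable
  then show "nrm2 (\<lambda>x. \<phi> x * f x) \<le> B * nrm2 f" using assms(4) by (simp add: nrm2_cmult)
qed

lemma sq_int_indicator: "bounded \<Omega> \<Longrightarrow> \<Omega> \<in> sets borel \<Longrightarrow> sq_int (indicator \<Omega> :: 'a::euclidean_space \<Rightarrow> real)"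
  using emeasure_bounded_finite[of \<Omega>] integrable_real_indicator[of \<Omega> lborel]
  by (simp add: sq_int_def power2_eq_square flip: indicator_inter_arith)

lemma sq_int_bounded_rep:
  assumes "bounded \<Omega>" "\<Omega> \<in> sets borel" "rep \<Omega> f F" "\<And>x. \<bar>F x\<bar> \<le> C" shows "sq_int F"
proof (rule sq_intI_bound(1)[OF sq_int_cmult[OF sq_int_indicator[OF assms(1,2)], of C]])
  show "F \<in> borel_measurable borel" by (rule rep_borel[OF assms(3)])
  show "\<bar>F x\<bar> \<le> \<bar>C * indicator \<Omega> x\<bar>" for x
    using assms(3) assms(4)[of x] by (cases "x \<in> \<Omega>") (auto simp: rep_def)
qed

text \<open>The Leibniz rule with a Lipschitz coefficient, obtained by testing with
  \<open>\<phi>\<close> and integrating by parts in a product of three factors. It makes the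
  components of the flux weakly differentiable with L2 derivatives, so that \<open>weak_div\<close>
  refers to actual derivatives.\<close>

lemma weak_pd_coefficient_mult:
  fixes \<Omega> :: "'a::euclidean_space set"
  assumes \<Omega>: "open \<Omega>" "bounded \<Omega>" and a: "a \<in> W1inf_space \<Omega>" and f: "H1_on \<Omega> f" and i: "i \<in> Basis"
  shows "has_weak_pd \<Omega> i (\<lambda>x. a x * f x) (weak_pd \<Omega> i (\<lambda>x. a x * f x))"
    and "weak_pd \<Omega> i (\<lambda>x. a x * f x) \<in> L2_on \<Omega>"
proof -
  have b: "\<Omega> \<in> sets borel" using \<Omega> by simp
  have "a \<in> Linf_space (lebesgue_on \<Omega>)" and "\<exists>g\<in>Linf_space (lebesgue_on \<Omega>). has_weak_pd \<Omega> i a g"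
    using a i by (auto simp: W1inf_space_def)
  then obtain a' where a': "a' \<in> Linf_space (lebesgue_on \<Omega>)" "has_weak_pd \<Omega> i a a'" by (elim bexE)
  obtain A c where A: "rep \<Omega> a A" "0 \<le> c" "\<And>x. \<bar>A x\<bar> \<le> c" by (rule Linf_rep[OF b \<open>a \<in> Linf_space (lebesgue_on \<Omega>)\<close>]) (rule that)
  obtain A' c' where A': "rep \<Omega> a' A'" "0 \<le> c'" "\<And>x. \<bar>A' x\<bar> \<le> c'" by (rule Linf_rep[OF b a'(1)]) (rule that)
  have sA: "sq_int A" by (rule sq_int_bounded_rep[OF \<Omega>(2) b A(1,3)])
  have sA': "sq_int A'" by (rule sq_int_bounded_rep[OF \<Omega>(2) b A'(1,3)])
  have dA: "dir_deriv \<Omega> i A A'" using a'(2) unfolding has_weak_pd_dir_deriv[OF \<Omega>(1) i A(1) sA A'(1) sA'] .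
  have f': "f \<in> L2_on \<Omega>" "weak_pd \<Omega> i f \<in> L2_on \<Omega>" "has_weak_pd \<Omega> i f (weak_pd \<Omega> i f)" using f i by (auto simp: H1_on_def)
  obtain F where F: "rep \<Omega> f F" "sq_int F" using L2_rep[OF b f'(1)] .
  obtain G where G: "rep \<Omega> (weak_pd \<Omega> i f) G" "sq_int G" using L2_rep[OF b f'(2)] .
  have dF: "dir_deriv \<Omega> i F G" using f'(3) unfolding has_weak_pd_dir_deriv[OF \<Omega>(1) i F G] .
  note AF = Linf_mult_L2(1)[OF F(2) rep_borel[OF A(1)] A(3,2)]
  note AG = Linf_mult_L2(1)[OF G(2) rep_borel[OF A(1)] A(3,2)]
  note A'F = Linf_mult_L2(1)[OF F(2) rep_borel[OF A'(1)] A'(3,2)]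
  define h where "h x = a x * weak_pd \<Omega> i f x + a' x * f x" for x
  have rh: "rep \<Omega> h (\<lambda>x. A x * G x + A' x * F x)" unfolding h_def by (intro rep_add rep_mult A A' F G)
  have sh: "sq_int (\<lambda>x. A x * G x + A' x * F x)" by (intro sq_int_add AG A'F)
  have w: "has_weak_pd \<Omega> i (\<lambda>x. a x * f x) h"
    unfolding has_weak_pd_iff_rep[OF \<Omega>(1) i rep_mult[OF A(1) F(1)] AF rh sh]
  proof
    fix \<phi> assume \<phi>: "\<phi> \<in> test_functions \<Omega>"
    note t = test_dir_Basis[OF \<phi> i] and s = test_dir_sq_int[OF test_dir_Basis[OF \<phi> i]]
    have p: "(\<integral>x. A x * (F x * pderivative i \<phi> x + G x * \<phi> x) \<partial>lborel) = - (\<integral>x. A' x * (F x * \<phi> x) \<partial>lborel)"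
      by (rule integration_by_parts_product[OF \<Omega>(1) dA sA sA' dF F(2) G(2) t])
    have "(\<integral>x. A x * (F x * pderivative i \<phi> x + G x * \<phi> x) \<partial>lborel)
        = (\<integral>x. A x * F x * pderivative i \<phi> x + A x * G x * \<phi> x \<partial>lborel)" by (simp add: algebra_simps)
    also have "\<dots> = (\<integral>x. A x * F x * pderivative i \<phi> x \<partial>lborel) + (\<integral>x. A x * G x * \<phi> x \<partial>lborel)"
      by (intro Bochner_Integration.integral_add sq_int_mult AF AG s)
    finally have "(\<integral>x. A x * F x * pderivative i \<phi> x \<partial>lborel) = - ((\<integral>x. A x * G x * \<phi> x \<partial>lborel) + (\<integral>x. A' x * F x * \<phi> x \<partial>lborel))"
      using p by (simp add: mult.assoc)
    also have "(\<integral>x. A x * G x * \<phi> x \<partial>lborel) + (\<integral>x. A' x * F x * \<phi> x \<partial>lborel) = (\<integral>x. A x * G x * \<phi> x + A' x * F x * \<phi> x \<partial>lborel)"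
      by (intro Bochner_Integration.integral_add[symmetric] sq_int_mult AG A'F s)
    finally show "(\<integral>x. A x * F x * pderivative i \<phi> x \<partial>lborel) = - (\<integral>x. (A x * G x + A' x * F x) * \<phi> x \<partial>lborel)"
      by (simp add: distrib_right)
  qed
  have hL2: "h \<in> L2_on \<Omega>" using rep_L2_iff[OF b rh] sh by simp
  show "has_weak_pd \<Omega> i (\<lambda>x. a x * f x) (weak_pd \<Omega> i (\<lambda>x. a x * f x))" by (rule weak_pd_eq(1)[OF \<Omega>(1) w])
  show "weak_pd \<Omega> i (\<lambda>x. a x * f x) \<in> L2_on \<Omega>" by (rule weak_pd_L2(1)[OF \<Omega>(1) w hL2])
qed

section \<open>Norms of weak derivatives as limits of difference quotients\<close>

text \<open>A chosen derivative of \<open>w t\<close> carries no measurability in \<open>t\<close>,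
  but difference quotients do. The quotients are at most \<open>nrm2 G\<close> by the translation
  bound; pairing them with \<open>G\<close> gives the matching lower bound, where a derivative of
  \<open>G\<close> controls the error. Cutting off to \<open>K n\<close> keeps the segments inside
  \<open>\<Omega>\<close>.\<close>

lemma difference_quotient_norm_tendsto:
  fixes \<Omega> :: "'a::euclidean_space set"
  assumes \<Omega>: "open \<Omega>" and F: "dir_deriv \<Omega> h F G" "sq_int F" "sq_int G"
    and G: "dir_deriv \<Omega> h G G'" "sq_int G'" "\<And>x. x \<notin> \<Omega> \<Longrightarrow> G x = 0"
  defines "s \<equiv> \<lambda>n. 1 / real (Suc n)"
  defines "K \<equiv> \<lambda>n. {x. \<forall>\<tau>\<in>{0..s n}. x + \<tau> *\<^sub>R h \<in> \<Omega>}"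
  shows "(\<lambda>n. nrm2 (\<lambda>x. indicator (K n) x * (F (x + s n *\<^sub>R h) - F x)) / s n) \<longlonglongrightarrow> nrm2 G"
proof -
  have [measurable]: "F \<in> borel_measurable borel" "G \<in> borel_measurable borel" using F by (auto simp: sq_int_def)
  have s: "0 < s n" for n by (simp add: s_def)
  have oK: "open (K n)" for n unfolding K_def by (rule open_segment_translates[OF \<Omega>])
  then have [measurable]: "K n \<in> sets borel" for n by simp
  define D where "D n x = indicator (K n) x * (F (x + s n *\<^sub>R h) - F x)" for n x
  have Kseg: "x + \<tau> *\<^sub>R h \<in> \<Omega>" if "x \<in> K n" "0 \<le> \<tau>" "\<tau> \<le> s n" for n x \<tau> using that by (auto simp: K_def)
  have D: "sq_int (D n)" "nrm2 (D n) \<le> s n * nrm2 G" for n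
    unfolding D_def using s[of n] by (intro translation_bound[OF F(1,3)] Kseg[of _ n]; simp)+
  define a where "a n = nrm2 (D n) / s n" for n
  have upper: "a n \<le> nrm2 G" for n using D(2)[of n] s[of n] by (simp add: a_def field_simps)
  have "a \<longlonglongrightarrow> nrm2 G"
  proof (cases "nrm2 G = 0")
    case True
    have "a n = 0" for n using upper[of n] True s[of n] nrm2_nonneg[of "D n"] by (simp add: a_def field_simps)
    then have "a = (\<lambda>_. 0)" by (rule ext)
    with True show ?thesis by simp
  next
    case False
    then have G0: "0 < nrm2 G" using nrm2_nonneg[of G] by linarith
    \<comment> \<open>The part of the squared norm of \<open>G\<close> seen from base points in
      \<open>K n\<close>; it exhausts the whole, because each point of \<open>\<Omega>\<close>
      belongs to \<open>K n\<close> for large \<open>n\<close>.\<close>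
    define p where "p n = (\<integral>x. indicator (K n) x * (G x)\<^sup>2 \<partial>lborel)" for n
    have lower: "p n - s n * (nrm2 G' * nrm2 G) \<le> a n * nrm2 G" for n
    proof -
      define \<psi> where "\<psi> x = indicator (K n) x * G x" for x
      have \<psi>: "sq_int \<psi>" "nrm2 \<psi> \<le> nrm2 G"
        unfolding \<psi>_def by (intro sq_intI_bound[OF F(3)]; simp add: indicator_def)+
      have [measurable]: "\<psi> \<in> borel_measurable borel" using \<psi> by (simp add: sq_int_def)
      have T: "(\<integral>x. (F (x + s n *\<^sub>R h) - F x) * \<psi> x \<partial>lborel)
          = (\<integral>\<tau>. indicator {0..s n} \<tau> * (\<integral>x. G (x + \<tau> *\<^sub>R h) * \<psi> x \<partial>lborel) \<partial>lborel)"
      proof (rule dir_deriv_pairing[OF F \<psi>(1)])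
        show "0 \<le> s n" using s[of n] by simp
        fix x \<tau> assume "\<psi> x \<noteq> 0" "0 \<le> \<tau>" "\<tau> \<le> s n"
        then show "x + \<tau> *\<^sub>R h \<in> \<Omega>" by (intro Kseg) (auto simp: \<psi>_def indicator_def split: if_splits)
      qed
      have Gp: "(\<integral>x. G x * \<psi> x \<partial>lborel) = p n"
        unfolding p_def \<psi>_def by (intro Bochner_Integration.integral_cong) (auto simp: power2_eq_square)
      have "\<bar>(\<integral>\<tau>. indicator {0..s n} \<tau> * (\<integral>x. G (x + \<tau> *\<^sub>R h) * \<psi> x \<partial>lborel) \<partial>lborel) - s n * (\<integral>x. G x * \<psi> x \<partial>lborel)\<bar>
          \<le> s n * (s n * (nrm2 G' * nrm2 G))"
      proof (rule segment_average_close)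
        fix \<tau> assume t: "0 \<le> \<tau>" "\<tau> \<le> s n"
        have E: "sq_int (\<lambda>x. indicator (K n) x * (G (x + \<tau> *\<^sub>R h) - G x))"
          "nrm2 (\<lambda>x. indicator (K n) x * (G (x + \<tau> *\<^sub>R h) - G x)) \<le> \<tau> * nrm2 G'"
          using t by (intro translation_bound[OF G(1,2)] Kseg[of _ n]; simp)+
        have "(\<integral>x. G (x + \<tau> *\<^sub>R h) * \<psi> x \<partial>lborel) - (\<integral>x. G x * \<psi> x \<partial>lborel)
            = (\<integral>x. G (x + \<tau> *\<^sub>R h) * \<psi> x - G x * \<psi> x \<partial>lborel)"
          by (intro Bochner_Integration.integral_diff[symmetric] sq_int_mult sq_int_translation F(3) \<psi>)
        also have "\<dots> = (\<integral>x. (indicator (K n) x * (G (x + \<tau> *\<^sub>R h) - G x)) * G x \<partial>lborel)"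
          by (intro Bochner_Integration.integral_cong) (auto simp: \<psi>_def algebra_simps)
        also have "\<bar>\<dots>\<bar> \<le> nrm2 (\<lambda>x. indicator (K n) x * (G (x + \<tau> *\<^sub>R h) - G x)) * nrm2 G"
          by (rule abs_integral_mult_le[OF E(1) F(3)])
        also have "\<dots> \<le> \<tau> * nrm2 G' * nrm2 G" by (intro mult_right_mono E) simp
        also have "\<dots> \<le> s n * (nrm2 G' * nrm2 G)" using t by (simp add: mult.assoc mult_right_mono)
        finally show "\<bar>(\<integral>x. G (x + \<tau> *\<^sub>R h) * \<psi> x \<partial>lborel) - (\<integral>x. G x * \<psi> x \<partial>lborel)\<bar> \<le> s n * (nrm2 G' * nrm2 G)" .
      qed (use s[of n] in simp_all)
      then have "s n * p n - s n * (s n * (nrm2 G' * nrm2 G)) \<le> (\<integral>x. (F (x + s n *\<^sub>R h) - F x) * \<psi> x \<partial>lborel)"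
        unfolding T Gp by linarith
      also have "(\<integral>x. (F (x + s n *\<^sub>R h) - F x) * \<psi> x \<partial>lborel) = (\<integral>x. D n x * G x \<partial>lborel)"
        by (intro Bochner_Integration.integral_cong) (auto simp: \<psi>_def D_def)
      also have "\<dots> \<le> nrm2 (D n) * nrm2 G" using abs_integral_mult_le[OF D(1) F(3), of n] by linarith
      also have "\<dots> = s n * (a n * nrm2 G)" using s[of n] by (simp add: a_def)
      finally have "s n * (p n - s n * (nrm2 G' * nrm2 G)) \<le> s n * (a n * nrm2 G)" by (simp add: right_diff_distrib)
      then show ?thesis using s[of n] by simp
    qed
    have "p \<longlonglongrightarrow> (\<integral>x. (G x)\<^sup>2 \<partial>lborel)" unfolding p_def
    proof (rule integral_dominated_convergence[where w = "\<lambda>x. (G x)\<^sup>2"])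
      show "integrable lborel (\<lambda>x. (G x)\<^sup>2)" using F(3) by (simp add: sq_int_def)
      show "AE x in lborel. (\<lambda>n. indicator (K n) x * (G x)\<^sup>2) \<longlonglongrightarrow> (G x)\<^sup>2"
      proof (rule AE_I2)
        fix x
        show "(\<lambda>n. indicator (K n) x * (G x)\<^sup>2) \<longlonglongrightarrow> (G x)\<^sup>2"
        proof (cases "x \<in> \<Omega>")
          case True
          obtain e where e: "0 < e" "\<And>z \<tau>. z \<in> {x} \<Longrightarrow> \<bar>\<tau>\<bar> \<le> e \<Longrightarrow> z + \<tau> *\<^sub>R h \<in> \<Omega>"
            by (rule compact_translate_subset_open[of "{x}" \<Omega> h]) (use \<Omega> True in auto)
          obtain N where N: "1 / real (Suc N) < e" using nat_approx_posE[OF e(1)] by blast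
          have "\<forall>\<^sub>F n in sequentially. indicator (K n) x * (G x)\<^sup>2 = (G x)\<^sup>2"
          proof (rule eventually_sequentiallyI)
            fix n assume "N \<le> n"
            then have "s n \<le> 1 / real (Suc N)" unfolding s_def by (intro divide_left_mono) auto
            then have "x \<in> K n" using N e(2) by (auto simp: K_def)
            then show "indicator (K n) x * (G x)\<^sup>2 = (G x)\<^sup>2" by simp
          qed
          then show ?thesis by (rule tendsto_eventually)
        qed (simp add: G(3))
      qed
      show "AE x in lborel. norm (indicator (K n) x * (G x)\<^sup>2) \<le> (G x)\<^sup>2" for n
        by (rule AE_I2) (simp add: indicator_def)
    qed measurable
    then have "p \<longlonglongrightarrow> (nrm2 G)\<^sup>2" by (simp only: nrm2_power2)
    moreover have "s \<longlonglongrightarrow> 0" unfolding s_def using LIMSEQ_inverse_real_of_nat by (simp only: inverse_eq_divide)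
    ultimately have "(\<lambda>n. p n - s n * (nrm2 G' * nrm2 G)) \<longlonglongrightarrow> (nrm2 G)\<^sup>2 - 0 * (nrm2 G' * nrm2 G)"
      by (intro tendsto_diff tendsto_mult tendsto_const)
    then have "(\<lambda>n. p n - s n * (nrm2 G' * nrm2 G)) \<longlonglongrightarrow> nrm2 G * nrm2 G" by (simp add: power2_eq_square)
    then have "(\<lambda>n. a n * nrm2 G) \<longlonglongrightarrow> nrm2 G * nrm2 G"
    proof (rule tendsto_sandwich[rotated 2])
      show "\<forall>\<^sub>F n in sequentially. p n - s n * (nrm2 G' * nrm2 G) \<le> a n * nrm2 G" using lower by simp
      show "\<forall>\<^sub>F n in sequentially. a n * nrm2 G \<le> nrm2 G * nrm2 G" using upper by (simp add: mult_right_mono)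
    qed simp
    from tendsto_divide[OF this tendsto_const[of "nrm2 G"]] False show ?thesis by simp
  qed
  then show ?thesis by (simp add: a_def[abs_def] D_def[abs_def])
qed

text \<open>Written with integrals of \<open>F\<close> alone, so that for a function of space-time
  each member of the sequence is visibly measurable in time.\<close>

lemma weak_pd_norm_limit:
  fixes \<Omega> :: "'a::euclidean_space set"
  assumes \<Omega>: "open \<Omega>" and f: "H2_on \<Omega> f" and F: "rep \<Omega> f F" and i: "i \<in> Basis"
  shows "(\<lambda>n. (real (Suc n))\<^sup>2 * (\<integral>x. indicator {x. \<forall>\<tau>\<in>{0..1 / real (Suc n)}. x + \<tau> *\<^sub>R i \<in> \<Omega>} x *
      (F (x + (1 / real (Suc n)) *\<^sub>R i) - F x)\<^sup>2 \<partial>lborel)) \<longlonglongrightarrow> (L2_norm_on \<Omega> (weak_pd \<Omega> i f))\<^sup>2"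
proof -
  have b: "\<Omega> \<in> sets borel" using \<Omega> by simp
  have f1: "f \<in> L2_on \<Omega>" "weak_pd \<Omega> i f \<in> L2_on \<Omega>" "has_weak_pd \<Omega> i f (weak_pd \<Omega> i f)"
    and f2: "weak_pd \<Omega> i (weak_pd \<Omega> i f) \<in> L2_on \<Omega>" "has_weak_pd \<Omega> i (weak_pd \<Omega> i f) (weak_pd \<Omega> i (weak_pd \<Omega> i f))"
    using f i by (auto simp: H2_on_def H1_on_def)
  have sF: "sq_int F" using rep_L2_iff[OF b F] f1(1) by simp
  obtain G where G: "rep \<Omega> (weak_pd \<Omega> i f) G" "sq_int G" using L2_rep[OF b f1(2)] .
  obtain H where H: "rep \<Omega> (weak_pd \<Omega> i (weak_pd \<Omega> i f)) H" "sq_int H" using L2_rep[OF b f2(1)] .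
  have d: "dir_deriv \<Omega> i F G" using f1(3) unfolding has_weak_pd_dir_deriv[OF \<Omega> i F sF G] .
  have d2: "dir_deriv \<Omega> i G H" using f2(2) unfolding has_weak_pd_dir_deriv[OF \<Omega> i G H] .
  have "(\<lambda>n. (nrm2 (\<lambda>x. indicator {x. \<forall>\<tau>\<in>{0..1 / real (Suc n)}. x + \<tau> *\<^sub>R i \<in> \<Omega>} x * (F (x + (1 / real (Suc n)) *\<^sub>R i) - F x))
      / (1 / real (Suc n)))\<^sup>2) \<longlonglongrightarrow> (nrm2 G)\<^sup>2"
    by (intro tendsto_power difference_quotient_norm_tendsto[OF \<Omega> d sF G(2) d2 H(2)]) (use G(1) in \<open>simp add: rep_def\<close>)
  moreover have "(nrm2 (\<lambda>x. indicator {x. \<forall>\<tau>\<in>{0..1 / real (Suc n)}. x + \<tau> *\<^sub>R i \<in> \<Omega>} x * (F (x + (1 / real (Suc n)) *\<^sub>R i) - F x))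
      / (1 / real (Suc n)))\<^sup>2 = (real (Suc n))\<^sup>2 * (\<integral>x. indicator {x. \<forall>\<tau>\<in>{0..1 / real (Suc n)}. x + \<tau> *\<^sub>R i \<in> \<Omega>} x *
      (F (x + (1 / real (Suc n)) *\<^sub>R i) - F x)\<^sup>2 \<partial>lborel)" for n
  proof -
    have "(indicator A x * c)\<^sup>2 = indicator A x * c\<^sup>2" for A :: "'a set" and x and c :: real by (simp add: indicator_def)
    then show ?thesis by (simp only: power_divide power_mult_distrib[of "nrm2 _"] nrm2_power2) (simp add: field_simps)
  qed
  ultimately show ?thesis by (simp add: rep_L2_norm[OF b G(1)])
qed

section \<open>The elliptic pairing at a fixed time\<close>

lemma weak_div_coefficient_gradient:
  "weak_div \<Omega> (\<lambda>x. a x *\<^sub>R weak_grad \<Omega> f x) x = (\<Sum>i\<in>Basis. weak_pd \<Omega> i (\<lambda>x. a x * weak_pd \<Omega> i f x) x)"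
  unfolding weak_div_def
proof (rule sum.cong[OF refl])
  fix i :: 'a assume i: "i \<in> Basis"
  have "weak_grad \<Omega> f x \<bullet> i = weak_pd \<Omega> i f x" for x
  proof -
    have "weak_grad \<Omega> f x \<bullet> i = (\<Sum>j\<in>Basis. if j = i then weak_pd \<Omega> j f x else 0)"
      unfolding weak_grad_def inner_sum_left using i by (intro sum.cong) (auto simp: inner_Basis)
    then show ?thesis using i by simp
  qed
  then show "weak_pd \<Omega> i (\<lambda>y. (a y *\<^sub>R weak_grad \<Omega> f y) \<bullet> i) x = weak_pd \<Omega> i (\<lambda>x. a x * weak_pd \<Omega> i f x) x" by simp
qed

lemma rep_inverse:
  assumes y: "rep \<Omega> y Y" and lower: "AE x in lborel. x \<in> \<Omega> \<longrightarrow> c \<le> \<bar>y x\<bar>" and b[measurable]: "\<Omega> \<in> sets borel"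
  shows "rep \<Omega> (\<lambda>x. 1 / y x) (\<lambda>x. if x \<in> \<Omega> \<and> c \<le> \<bar>Y x\<bar> then 1 / Y x else 0)"
  unfolding rep_def
proof (intro conjI)
  have [measurable]: "Y \<in> borel_measurable borel" using y by (rule rep_borel)
  show "(\<lambda>x. if x \<in> \<Omega> \<and> c \<le> \<bar>Y x\<bar> then 1 / Y x else 0) \<in> borel_measurable borel" by measurable
  have "AE x in lborel. x \<in> \<Omega> \<longrightarrow> Y x = y x" using y by (simp add: rep_def)
  with lower show "AE x in lborel. x \<in> \<Omega> \<longrightarrow> (if x \<in> \<Omega> \<and> c \<le> \<bar>Y x\<bar> then 1 / Y x else 0) = 1 / y x"
    by eventually_elim simp
qed simp

text \<open>The derivative is moved from the flux difference onto the reciprocal of \<open>y\<close>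
  times \<open>\<phi>\<close>, so only first derivatives of \<open>z - y\<close> survive.
  Differentiating the reciprocal produces the derivative of \<open>y\<close> times
  \<open>\<phi>\<close>, an L2 function because both factors are H1; this is the source of the H2
  norm of \<open>y\<close>. Integrability is part of the claim so that components can be summed
  under the integral.\<close>

lemma flux_pairing_estimate:
  fixes \<Omega> :: "'a::euclidean_space set"
  assumes \<Omega>: "open \<Omega>" "bounded \<Omega>" "C2_boundary \<Omega>" and dim: "DIM('a) \<le> 3"
    and a: "a \<in> W1inf_space \<Omega>" and c: "0 < c"
  shows "\<exists>C\<ge>0. \<forall>y z \<phi> i. H2_on \<Omega> y \<longrightarrow> H2_on \<Omega> z \<longrightarrow> (AE x in lebesgue_on \<Omega>. c \<le> \<bar>y x\<bar>) \<longrightarrow> \<phi> \<in> test_functions \<Omega> \<longrightarrow> i \<in> Basis \<longrightarrow>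
     integrable (lebesgue_on \<Omega>) (\<lambda>x. (weak_pd \<Omega> i (\<lambda>x. a x * weak_pd \<Omega> i z x) x - weak_pd \<Omega> i (\<lambda>x. a x * weak_pd \<Omega> i y x) x) * (1 / y x * \<phi> x)) \<and>
     \<bar>\<integral>x. (weak_pd \<Omega> i (\<lambda>x. a x * weak_pd \<Omega> i z x) x - weak_pd \<Omega> i (\<lambda>x. a x * weak_pd \<Omega> i y x) x) * (1 / y x * \<phi> x) \<partial>lebesgue_on \<Omega>\<bar>
       \<le> C * Hs_norm 1 \<Omega> (\<lambda>x. z x - y x) * Hs_norm 1 \<Omega> \<phi> * (1 + Hs_norm 2 \<Omega> y)"
proof -
  have b: "\<Omega> \<in> sets borel" using \<Omega> by simp
  have "a \<in> Linf_space (lebesgue_on \<Omega>)" using a by (simp add: W1inf_space_def)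
  then obtain A cA where A: "rep \<Omega> a A" "0 \<le> cA" "\<And>x. \<bar>A x\<bar> \<le> cA" by (rule Linf_rep[OF b]) (rule that)
  obtain C2 where "C2 \<ge> 0 \<and> (\<forall>f F g G. H1_on \<Omega> f \<longrightarrow> rep \<Omega> f F \<longrightarrow> H1_on \<Omega> g \<longrightarrow> rep \<Omega> g G \<longrightarrow>
     sq_int (\<lambda>x. F x * G x) \<and> nrm2 (\<lambda>x. F x * G x) \<le> C2 * Hs_norm 1 \<Omega> f * Hs_norm 1 \<Omega> g)"
    using product_L2_bound[OF \<Omega> dim] ..
  then have C2: "C2 \<ge> 0" "\<And>f F g G. H1_on \<Omega> f \<Longrightarrow> rep \<Omega> f F \<Longrightarrow> H1_on \<Omega> g \<Longrightarrow> rep \<Omega> g G \<Longrightarrow>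
     sq_int (\<lambda>x. F x * G x) \<and> nrm2 (\<lambda>x. F x * G x) \<le> C2 * Hs_norm 1 \<Omega> f * Hs_norm 1 \<Omega> g" by simp_all
  \<comment> \<open>One summand for the derivative falling on \<open>\<phi>\<close>, one for the
    derivative falling on the reciprocal.\<close>
  define m where "m = 1 / c + C2 / c\<^sup>2"
  have m: "0 \<le> m" using c C2(1) by (simp add: m_def)
  show ?thesis
  proof (intro exI[of _ "cA * m"] conjI allI impI)
    show "0 \<le> cA * m" using A m by simp
    fix y z \<phi> and i :: 'a
    assume y: "H2_on \<Omega> y" and z: "H2_on \<Omega> z" and lower: "AE x in lebesgue_on \<Omega>. c \<le> \<bar>y x\<bar>"
      and \<phi>: "\<phi> \<in> test_functions \<Omega>" and i: "i \<in> Basis"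
    let ?P = "weak_pd \<Omega> i (\<lambda>x. a x * weak_pd \<Omega> i z x)" and ?Q = "weak_pd \<Omega> i (\<lambda>x. a x * weak_pd \<Omega> i y x)"
    let ?w = "\<lambda>x. z x - y x"
    have y1: "H1_on \<Omega> y" "H1_on \<Omega> (weak_pd \<Omega> i y)" and z1: "H1_on \<Omega> z" "H1_on \<Omega> (weak_pd \<Omega> i z)"
      using y z i by (auto simp: H2_on_def)
    have L2: "y \<in> L2_on \<Omega>" "weak_pd \<Omega> i y \<in> L2_on \<Omega>" "weak_pd \<Omega> i z \<in> L2_on \<Omega>" "has_weak_pd \<Omega> i y (weak_pd \<Omega> i y)"
      using y1 z1 i by (auto simp: H1_on_def)
    obtain Y where Y: "rep \<Omega> y Y" "sq_int Y" using L2_rep[OF b L2(1)] .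
    obtain Yi where Yi: "rep \<Omega> (weak_pd \<Omega> i y) Yi" "sq_int Yi" using L2_rep[OF b L2(2)] .
    obtain Zi where Zi: "rep \<Omega> (weak_pd \<Omega> i z) Zi" "sq_int Zi" using L2_rep[OF b L2(3)] .
    have dY: "dir_deriv \<Omega> i Y Yi" using L2(4) unfolding has_weak_pd_dir_deriv[OF \<Omega>(1) i Y Yi] .
    have lower': "AE x in lborel. x \<in> \<Omega> \<longrightarrow> c \<le> \<bar>y x\<bar>" using lower by (simp only: AE_lebesgue_on[OF b])
    have lowerY: "AE x in lborel. x \<in> \<Omega> \<longrightarrow> c \<le> \<bar>Y x\<bar>"
    proof -
      have "AE x in lborel. x \<in> \<Omega> \<longrightarrow> Y x = y x" using Y(1) by (simp add: rep_def)
      with lower' show ?thesis by eventually_elim simp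
    qed
    define r where "r = (\<lambda>x. if x \<in> \<Omega> \<and> c \<le> \<bar>Y x\<bar> then 1 / Y x else 0)"
    have R: "dir_deriv \<Omega> i r (\<lambda>x. - Yi x * (r x)\<^sup>2)" "sq_int r" "sq_int (\<lambda>x. - Yi x * (r x)\<^sup>2)" "\<And>x. \<bar>r x\<bar> \<le> 1 / c"
      unfolding r_def by (rule dir_deriv_inverse[OF \<Omega>(1,2) dY Y(2) Yi(2) c lowerY])+
    have rr: "rep \<Omega> (\<lambda>x. 1 / y x) r" unfolding r_def by (rule rep_inverse[OF Y(1) lower' b])
    define W where "W x = Zi x - Yi x" for x
    have W: "rep \<Omega> (\<lambda>x. weak_pd \<Omega> i z x - weak_pd \<Omega> i y x) W" "sq_int W"
      unfolding W_def by (intro rep_diff Zi Yi sq_int_diff)+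
    have WH: "nrm2 W \<le> Hs_norm 1 \<Omega> ?w"
      using weak_pd_norm_le_Hs_norm_1[OF i, of \<Omega> ?w] weak_pd_L2(2)[OF \<Omega>(1) weak_pd_diff(1,2)[OF \<Omega>(1) i z1(1) y1(1)]]
      by (simp add: rep_L2_norm[OF b W(1)])
    note AW = Linf_mult_L2[OF W(2) rep_borel[OF A(1)] A(3,2)]
    note P = weak_pd_coefficient_mult[OF \<Omega>(1,2) a z1(2) i] and Q = weak_pd_coefficient_mult[OF \<Omega>(1,2) a y1(2) i]
    have az: "(\<lambda>x. a x * weak_pd \<Omega> i z x) \<in> L2_on \<Omega>" 
      using rep_L2_iff[OF b rep_mult[OF A(1) Zi(1)]] Linf_mult_L2(1)[OF Zi(2) rep_borel[OF A(1)] A(3,2)] by simp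
    have ay: "(\<lambda>x. a x * weak_pd \<Omega> i y x) \<in> L2_on \<Omega>" 
      using rep_L2_iff[OF b rep_mult[OF A(1) Yi(1)]] Linf_mult_L2(1)[OF Yi(2) rep_borel[OF A(1)] A(3,2)] by simp
    have w: "has_weak_pd \<Omega> i (\<lambda>x. a x * weak_pd \<Omega> i z x - a x * weak_pd \<Omega> i y x) (\<lambda>x. ?P x - ?Q x)"
      by (rule has_weak_pd_diff[OF \<Omega>(1) i P(1) Q(1) az P(2) ay Q(2)])
    have PQ: "(\<lambda>x. ?P x - ?Q x) \<in> L2_on \<Omega>" by (rule L2_diff[OF b P(2) Q(2)])
    obtain G where G: "rep \<Omega> (\<lambda>x. ?P x - ?Q x) G" "sq_int G" using L2_rep[OF b PQ] .
    have rAW: "rep \<Omega> (\<lambda>x. a x * weak_pd \<Omega> i z x - a x * weak_pd \<Omega> i y x) (\<lambda>x. A x * W x)"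
      using rep_mult[OF A(1) W(1)] by (simp add: right_diff_distrib)
    have d1: "dir_deriv \<Omega> i (\<lambda>x. A x * W x) G" using w unfolding has_weak_pd_dir_deriv[OF \<Omega>(1) i rAW AW(1) G] .
    note t = test_dir_Basis[OF \<phi> i]
    note T = H1_test_function[OF \<Omega>(1) \<phi>]
    have [measurable]: "r \<in> borel_measurable borel" "\<phi> \<in> borel_measurable borel" "Yi \<in> borel_measurable borel"
      "pderivative i \<phi> \<in> borel_measurable borel"
      using rep_borel[OF rr] T(3) T(5)[OF i] Yi(2) by (auto simp: sq_int_def)
    \<comment> \<open>The derivative of \<open>r * \<phi>\<close> by the product rule.\<close>
    let ?K = "\<lambda>x. r x * pderivative i \<phi> x + (- Yi x * (r x)\<^sup>2) * \<phi> x"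
    have ibp: "(\<integral>x. (A x * W x) * ?K x \<partial>lborel) = - (\<integral>x. G x * (r x * \<phi> x) \<partial>lborel)"
      by (rule integration_by_parts_product[OF \<Omega>(1) d1 AW(1) G(2) R(1,2,3) t])
    have r\<phi>: "sq_int (\<lambda>x. r x * \<phi> x)" by (rule Linf_mult_L2(1)[OF T(3) _ R(4)]) (use c in auto)
    have rG: "rep \<Omega> (\<lambda>x. (?P x - ?Q x) * (1 / y x * \<phi> x)) (\<lambda>x. G x * (r x * \<phi> x))"
      by (intro rep_mult rep_mult_borel G(1) rr) simp
    show "integrable (lebesgue_on \<Omega>) (\<lambda>x. (?P x - ?Q x) * (1 / y x * \<phi> x))"
      unfolding rep_integral(2)[OF b rG] by (rule sq_int_mult[OF G(2) r\<phi>])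
    have K1: "sq_int (\<lambda>x. r x * pderivative i \<phi> x)" "nrm2 (\<lambda>x. r x * pderivative i \<phi> x) \<le> 1 / c * nrm2 (pderivative i \<phi>)"
      using c by (intro Linf_mult_L2[OF T(5)[OF i] _ R(4)]; simp)+
    have Y\<phi>: "sq_int (\<lambda>x. Yi x * \<phi> x)" "nrm2 (\<lambda>x. Yi x * \<phi> x) \<le> C2 * Hs_norm 1 \<Omega> (weak_pd \<Omega> i y) * Hs_norm 1 \<Omega> \<phi>"
      using C2(2)[OF y1(2) Yi(1) T(1,2)] by simp_all
    have rb: "\<bar>- (r x)\<^sup>2\<bar> \<le> 1 / c\<^sup>2" for x using power_mono[OF R(4)[of x], of 2] by (simp add: power_divide)
    have K2: "sq_int (\<lambda>x. - (r x)\<^sup>2 * (Yi x * \<phi> x))" "nrm2 (\<lambda>x. - (r x)\<^sup>2 * (Yi x * \<phi> x)) \<le> 1 / c\<^sup>2 * nrm2 (\<lambda>x. Yi x * \<phi> x)"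
      by (intro Linf_mult_L2[OF Y\<phi>(1) _ rb]; simp)+
    have Keq: "?K = (\<lambda>x. r x * pderivative i \<phi> x + - (r x)\<^sup>2 * (Yi x * \<phi> x))" by (rule ext) (simp add: mult_ac)
    have sK: "sq_int ?K" unfolding Keq by (rule sq_int_add[OF K1(1) K2(1)])
    have y\<phi>: "nrm2 (pderivative i \<phi>) \<le> Hs_norm 1 \<Omega> \<phi>"
      using weak_pd_norm_le_Hs_norm_1[OF i, of \<Omega> \<phi>] by (simp add: rep_L2_norm[OF b T(4)[OF i]])
    have H: "0 \<le> Hs_norm 1 \<Omega> \<phi>" "0 \<le> Hs_norm 1 \<Omega> ?w" "0 \<le> Hs_norm 2 \<Omega> y"
      by (rule Hs_norm_1_nonneg Hs_norm_2_nonneg)+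
    have "nrm2 ?K \<le> nrm2 (\<lambda>x. r x * pderivative i \<phi> x) + nrm2 (\<lambda>x. - (r x)\<^sup>2 * (Yi x * \<phi> x))"
      unfolding Keq by (rule nrm2_triangle[OF K1(1) K2(1)])
    also have "\<dots> \<le> 1 / c * nrm2 (pderivative i \<phi>) + 1 / c\<^sup>2 * nrm2 (\<lambda>x. Yi x * \<phi> x)" by (rule add_mono[OF K1(2) K2(2)])
    also have "\<dots> \<le> 1 / c * Hs_norm 1 \<Omega> \<phi> + 1 / c\<^sup>2 * (C2 * Hs_norm 1 \<Omega> (weak_pd \<Omega> i y) * Hs_norm 1 \<Omega> \<phi>)"
      using c by (intro add_mono mult_left_mono y\<phi> Y\<phi>(2)) auto
    also have "\<dots> \<le> 1 / c * Hs_norm 1 \<Omega> \<phi> + 1 / c\<^sup>2 * (C2 * Hs_norm 2 \<Omega> y * Hs_norm 1 \<Omega> \<phi>)"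
      using c C2(1) H by (intro add_left_mono mult_left_mono mult_right_mono Hs_norm_1_weak_pd_le i) auto
    also have "\<dots> \<le> m * Hs_norm 1 \<Omega> \<phi> * (1 + Hs_norm 2 \<Omega> y)"
    proof -
      have "m * Hs_norm 1 \<Omega> \<phi> * (1 + Hs_norm 2 \<Omega> y) - (1 / c * Hs_norm 1 \<Omega> \<phi> + 1 / c\<^sup>2 * (C2 * Hs_norm 2 \<Omega> y * Hs_norm 1 \<Omega> \<phi>))
        = 1 / c * Hs_norm 1 \<Omega> \<phi> * Hs_norm 2 \<Omega> y + C2 / c\<^sup>2 * Hs_norm 1 \<Omega> \<phi>"
        by (simp add: m_def algebra_simps add_divide_distrib)
      moreover have "0 \<le> 1 / c * Hs_norm 1 \<Omega> \<phi> * Hs_norm 2 \<Omega> y + C2 / c\<^sup>2 * Hs_norm 1 \<Omega> \<phi>" using c C2(1) H by simp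
      ultimately show ?thesis by linarith
    qed
    finally have nK: "nrm2 ?K \<le> m * Hs_norm 1 \<Omega> \<phi> * (1 + Hs_norm 2 \<Omega> y)" .
    have "\<bar>\<integral>x. (?P x - ?Q x) * (1 / y x * \<phi> x) \<partial>lebesgue_on \<Omega>\<bar> = \<bar>\<integral>x. (A x * W x) * ?K x \<partial>lborel\<bar>"
      unfolding rep_integral(1)[OF b rG] ibp by simp
    also have "\<dots> \<le> nrm2 (\<lambda>x. A x * W x) * nrm2 ?K" by (rule abs_integral_mult_le[OF AW(1) sK])
    also have "\<dots> \<le> (cA * Hs_norm 1 \<Omega> ?w) * (m * Hs_norm 1 \<Omega> \<phi> * (1 + Hs_norm 2 \<Omega> y))"
      by (intro mult_mono nK order_trans[OF AW(2)] mult_left_mono WH A mult_nonneg_nonneg H nrm2_nonneg)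
    finally show "\<bar>\<integral>x. (?P x - ?Q x) * (1 / y x * \<phi> x) \<partial>lebesgue_on \<Omega>\<bar>
       \<le> cA * m * Hs_norm 1 \<Omega> ?w * Hs_norm 1 \<Omega> \<phi> * (1 + Hs_norm 2 \<Omega> y)" by (simp add: mult_ac)
  qed
qed

lemma divergence_pairing_estimate:
  fixes \<Omega> :: "'a::euclidean_space set"
  assumes \<Omega>: "open \<Omega>" "bounded \<Omega>" "C2_boundary \<Omega>" and dim: "DIM('a) \<le> 3"
    and a: "a \<in> W1inf_space \<Omega>" and c: "0 < c"
  shows "\<exists>C\<ge>0. \<forall>y z \<phi>. H2_on \<Omega> y \<longrightarrow> H2_on \<Omega> z \<longrightarrow> (AE x in lebesgue_on \<Omega>. c \<le> \<bar>y x\<bar>) \<longrightarrow> \<phi> \<in> test_functions \<Omega> \<longrightarrow>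
     \<bar>\<integral>x. (weak_div \<Omega> (\<lambda>x. a x *\<^sub>R weak_grad \<Omega> z x) x - weak_div \<Omega> (\<lambda>x. a x *\<^sub>R weak_grad \<Omega> y x) x) * (1 / y x * \<phi> x) \<partial>lebesgue_on \<Omega>\<bar>
       \<le> C * Hs_norm 1 \<Omega> (\<lambda>x. z x - y x) * Hs_norm 1 \<Omega> \<phi> * (1 + Hs_norm 2 \<Omega> y)"
proof -
  let ?d = "\<lambda>y z i x. weak_pd \<Omega> i (\<lambda>x. a x * weak_pd \<Omega> i z x) x - weak_pd \<Omega> i (\<lambda>x. a x * weak_pd \<Omega> i y x) x"
  obtain C where "C \<ge> 0 \<and> (\<forall>y z \<phi> i. H2_on \<Omega> y \<longrightarrow> H2_on \<Omega> z \<longrightarrow> (AE x in lebesgue_on \<Omega>. c \<le> \<bar>y x\<bar>) \<longrightarrow> \<phi> \<in> test_functions \<Omega> \<longrightarrow> i \<in> Basis \<longrightarrow>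
     integrable (lebesgue_on \<Omega>) (\<lambda>x. ?d y z i x * (1 / y x * \<phi> x)) \<and>
     \<bar>\<integral>x. ?d y z i x * (1 / y x * \<phi> x) \<partial>lebesgue_on \<Omega>\<bar>
       \<le> C * Hs_norm 1 \<Omega> (\<lambda>x. z x - y x) * Hs_norm 1 \<Omega> \<phi> * (1 + Hs_norm 2 \<Omega> y))"
    using flux_pairing_estimate[OF \<Omega> dim a c] ..
  note C = conjunct1[OF this] conjunct2[OF this, rule_format]
  show ?thesis
  proof (intro exI[of _ "real DIM('a) * C"] conjI allI impI)
    show "0 \<le> real DIM('a) * C" using C(1) by simp
    fix y z \<phi>
    assume y: "H2_on \<Omega> y" and z: "H2_on \<Omega> z" and l: "AE x in lebesgue_on \<Omega>. c \<le> \<bar>y x\<bar>" and \<phi>: "\<phi> \<in> test_functions \<Omega>"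
    note E = C(2)[OF y z l \<phi>]
    have "(\<integral>x. (weak_div \<Omega> (\<lambda>x. a x *\<^sub>R weak_grad \<Omega> z x) x - weak_div \<Omega> (\<lambda>x. a x *\<^sub>R weak_grad \<Omega> y x) x) * (1 / y x * \<phi> x) \<partial>lebesgue_on \<Omega>)
      = (\<integral>x. (\<Sum>i\<in>Basis. ?d y z i x * (1 / y x * \<phi> x)) \<partial>lebesgue_on \<Omega>)"
      unfolding weak_div_coefficient_gradient by (simp only: sum_subtractf[symmetric] sum_distrib_right)
    also have "\<dots> = (\<Sum>i\<in>Basis. \<integral>x. ?d y z i x * (1 / y x * \<phi> x) \<partial>lebesgue_on \<Omega>)"
      by (rule Bochner_Integration.integral_sum) (rule conjunct1[OF E])
    also have "\<bar>\<dots>\<bar> \<le> (\<Sum>i\<in>Basis. \<bar>\<integral>x. ?d y z i x * (1 / y x * \<phi> x) \<partial>lebesgue_on \<Omega>\<bar>)" by (rule sum_abs)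
    also have "\<dots> \<le> (\<Sum>i\<in>(Basis::'a set). C * Hs_norm 1 \<Omega> (\<lambda>x. z x - y x) * Hs_norm 1 \<Omega> \<phi> * (1 + Hs_norm 2 \<Omega> y))"
      by (rule sum_mono) (rule conjunct2[OF E])
    finally show "\<bar>\<integral>x. (weak_div \<Omega> (\<lambda>x. a x *\<^sub>R weak_grad \<Omega> z x) x - weak_div \<Omega> (\<lambda>x. a x *\<^sub>R weak_grad \<Omega> y x) x) * (1 / y x * \<phi> x) \<partial>lebesgue_on \<Omega>\<bar>
       \<le> real DIM('a) * C * Hs_norm 1 \<Omega> (\<lambda>x. z x - y x) * Hs_norm 1 \<Omega> \<phi> * (1 + Hs_norm 2 \<Omega> y)"
      by (simp add: mult.assoc)
  qed
qed

section \<open>Functions of time and space\<close>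

text \<open>Preimages of null sets are cylinders over null sets, hence null, so measurability passes
  from the Borel sets to their completion.\<close>

lemma fst_lebesgue_measurable: "fst \<in> (lebesgue :: ('a::euclidean_space \<times> 'b::euclidean_space) measure) \<rightarrow>\<^sub>M (lebesgue :: 'a measure)"
proof (rule completion.measurable_completion2)
  show m: "fst \<in> (lebesgue :: ('a \<times> 'b) measure) \<rightarrow>\<^sub>M (lborel :: 'a measure)"
    by (rule measurable_completion) (simp, intro borel_measurable_continuous_onI continuous_on_fst continuous_on_id)
  show "null_sets lborel \<subseteq> null_sets (distr lebesgue lborel (fst :: 'a \<times> 'b \<Rightarrow> 'a))"
  proof
    fix N :: "'a set" assume N: "N \<in> null_sets lborel"
    have "emeasure (lborel \<Otimes>\<^sub>M lborel) (N \<times> (UNIV :: 'b set)) = 0"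
      using N by (subst lborel.emeasure_pair_measure_Times) auto
    moreover have "fst -` N = N \<times> (UNIV :: 'b set)" by auto
    moreover have "N \<times> (UNIV :: 'b set) \<in> sets borel" using N by (intro borel_Times) auto
    ultimately show "N \<in> null_sets (distr lebesgue lborel (fst :: 'a \<times> 'b \<Rightarrow> 'a))"
      using N m by (auto simp: null_sets_def emeasure_distr lborel_prod)
  qed
qed

lemma snd_lebesgue_measurable: "snd \<in> (lebesgue :: ('a::euclidean_space \<times> 'b::euclidean_space) measure) \<rightarrow>\<^sub>M (lebesgue :: 'b measure)"
proof (rule completion.measurable_completion2)
  show m: "snd \<in> (lebesgue :: ('a \<times> 'b) measure) \<rightarrow>\<^sub>M (lborel :: 'b measure)"
    by (rule measurable_completion) (simp, intro borel_measurable_continuous_onI continuous_on_snd continuous_on_id)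
  show "null_sets lborel \<subseteq> null_sets (distr lebesgue lborel (snd :: 'a \<times> 'b \<Rightarrow> 'b))"
  proof
    fix N :: "'b set" assume N: "N \<in> null_sets lborel"
    have "emeasure (lborel \<Otimes>\<^sub>M lborel) ((UNIV :: 'a set) \<times> N) = 0"
      using N by (subst lborel.emeasure_pair_measure_Times) auto
    moreover have "snd -` N = (UNIV :: 'a set) \<times> N" by auto
    moreover have "(UNIV :: 'a set) \<times> N \<in> sets borel" using N by (intro borel_Times) auto
    ultimately show "N \<in> null_sets (distr lebesgue lborel (snd :: 'a \<times> 'b \<Rightarrow> 'b))"
      using N m by (auto simp: null_sets_def emeasure_distr lborel_prod)
  qed
qed

lemma sigma_finite_lebesgue_on:
  assumes "S \<in> sets (lebesgue :: 'a::euclidean_space measure)"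
  shows "sigma_finite_measure (lebesgue_on S)"
proof (rule sigma_finite_measure_restrict_space)
  obtain A :: "'a set set" where A: "countable A" "A \<subseteq> sets lborel" "\<Union>A = space lborel" "\<And>a. a \<in> A \<Longrightarrow> emeasure lborel a \<noteq> \<infinity>"
    using lborel.sigma_finite_countable by metis
  show "sigma_finite_measure (lebesgue :: 'a measure)"
  proof (rule sigma_finite_measure.intro, intro exI[of _ A] conjI ballI)
    show "A \<subseteq> sets lebesgue" using A(2) by auto
    show "\<Union>A = space lebesgue" using A(3) by simp
    fix a assume "a \<in> A"
    then show "emeasure lebesgue a \<noteq> \<infinity>" using A(2,4) by auto
  qed fact
qed (use assms in simp)

text \<open>Sections in both variables are recorded: the equation is used at fixed \<open>t\<close>,
  whereas the weak time derivative is tested at fixed \<open>x\<close>.\<close>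

definition st_rep :: "real set \<Rightarrow> 'a::euclidean_space set \<Rightarrow> (real \<Rightarrow> 'a \<Rightarrow> real) \<Rightarrow> (real \<times> 'a \<Rightarrow> real) \<Rightarrow> bool" where
  "st_rep J \<Omega> u U \<longleftrightarrow> U \<in> borel_measurable borel \<and> (\<forall>z. z \<notin> J \<times> \<Omega> \<longrightarrow> U z = 0) \<and>
     (AE t in lborel. t \<in> J \<longrightarrow> rep \<Omega> (u t) (\<lambda>x. U (t, x))) \<and>
     (AE x in lborel. x \<in> \<Omega> \<longrightarrow> rep J (\<lambda>t. u t x) (\<lambda>t. U (t, x)))"

lemma st_repI:
  assumes [measurable]: "U \<in> borel_measurable borel" and 0: "\<And>z. z \<notin> J \<times> \<Omega> \<Longrightarrow> U z = 0"
    and 1: "AE t in lborel. t \<in> J \<longrightarrow> (AE x in lborel. x \<in> \<Omega> \<longrightarrow> U (t, x) = u t x)"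
    and 2: "AE x in lborel. x \<in> \<Omega> \<longrightarrow> (AE t in lborel. t \<in> J \<longrightarrow> U (t, x) = u t x)"
  shows "st_rep J \<Omega> u U"
proof -
  have m: "(\<lambda>x. U (t, x)) \<in> borel_measurable borel" "(\<lambda>t. U (t, x)) \<in> borel_measurable borel" for t x
    by (measurable; simp add: borel_prod[symmetric])+
  show ?thesis unfolding st_rep_def rep_def
    using 0 m 1 2 by (auto elim!: eventually_mono)
qed

text \<open>Two replacements: the completed product measurability gives \<open>g\<close> measurable
  for the product of the Lebesgue sigma-algebras, and \<open>g\<close> has a Borel version
  \<open>U\<close>. Each costs a null set of space-time, and almost all sections of it in either
  variable are null.\<close>

lemma st_rep_exists:
  fixes u :: "real \<Rightarrow> 'a::euclidean_space \<Rightarrow> real"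
  assumes J: "J \<in> sets borel" and \<Omega>: "\<Omega> \<in> sets borel"
    and u: "(\<lambda>(t, x). u t x) \<in> borel_measurable (completion (lebesgue_on J \<Otimes>\<^sub>M lebesgue_on \<Omega>))"
  shows "\<exists>U. st_rep J \<Omega> u U"
proof -
  let ?M1 = "lebesgue_on J" and ?M2 = "lebesgue_on \<Omega>"
  have Jl: "J \<in> sets lebesgue" and \<Omega>l: "\<Omega> \<in> sets lebesgue" using J \<Omega> by simp_all
  interpret M1: sigma_finite_measure ?M1 by (rule sigma_finite_lebesgue_on[OF Jl])
  interpret M2: sigma_finite_measure ?M2 by (rule sigma_finite_lebesgue_on[OF \<Omega>l])
  interpret P: pair_sigma_finite ?M1 ?M2 ..
  obtain g where g: "g \<in> borel_measurable (?M1 \<Otimes>\<^sub>M ?M2)" "AE z in ?M1 \<Otimes>\<^sub>M ?M2. (case z of (t, x) \<Rightarrow> u t x) = g z"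
    using completion_ex_borel_measurable_real[OF u] by (elim bexE)
  obtain N where N: "{z \<in> space (?M1 \<Otimes>\<^sub>M ?M2). (case z of (t, x) \<Rightarrow> u t x) \<noteq> g z} \<subseteq> N" "N \<in> null_sets (?M1 \<Otimes>\<^sub>M ?M2)"
    using AE_E[OF g(2)] by (metis (no_types, lifting) null_setsI)
  have sp: "space (?M1 \<Otimes>\<^sub>M ?M2) = J \<times> \<Omega>" by (simp add: space_pair_measure)
  have eqN: "u t x = g (t, x)" if "(t, x) \<notin> N" "t \<in> J" "x \<in> \<Omega>" for t x using N(1) that unfolding sp by auto
  have aeN: "AE z in ?M1 \<Otimes>\<^sub>M ?M2. z \<notin> N" using N(2) by (rule AE_not_in)
  have n1: "AE t in ?M1. AE x in ?M2. (t, x) \<notin> N" by (rule P.AE_pair[OF aeN])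
  \<comment> \<open>Exchanging the order of the quantifiers needs a measurable set, which is why a
    measurable null set \<open>N\<close> was extracted.\<close>
  have n2: "AE x in ?M2. AE t in ?M1. (t, x) \<notin> N"
  proof (subst P.AE_commute[symmetric])
    have "{z \<in> space (?M1 \<Otimes>\<^sub>M ?M2). (fst z, snd z) \<notin> N} = space (?M1 \<Otimes>\<^sub>M ?M2) - N" by auto
    then show "{z \<in> space (?M1 \<Otimes>\<^sub>M ?M2). (fst z, snd z) \<notin> N} \<in> sets (?M1 \<Otimes>\<^sub>M ?M2)" using N(2) by auto
  qed (rule n1)
  have S: "J \<times> \<Omega> \<in> sets borel" using J \<Omega> by (rule borel_Times)
  have "(\<lambda>z. (fst z, snd z)) \<in> lebesgue_on (J \<times> \<Omega>) \<rightarrow>\<^sub>M ?M1 \<Otimes>\<^sub>M ?M2"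
  proof (rule measurable_Pair)
    show "fst \<in> lebesgue_on (J \<times> \<Omega>) \<rightarrow>\<^sub>M ?M1"
      by (intro measurable_restrict_space2 measurable_restrict_space1 fst_lebesgue_measurable) auto
    show "snd \<in> lebesgue_on (J \<times> \<Omega>) \<rightarrow>\<^sub>M ?M2"
      by (intro measurable_restrict_space2 measurable_restrict_space1 snd_lebesgue_measurable) auto
  qed
  from measurable_compose[OF this g(1)] have "g \<in> borel_measurable (lebesgue_on (J \<times> \<Omega>))" by simp
  from rep_exists[OF S this] obtain U where U: "rep (J \<times> \<Omega>) g U" ..
  then have aeU: "AE z in lborel. z \<in> J \<times> \<Omega> \<longrightarrow> U z = g z" by (simp add: rep_def)
  obtain N' where N': "{z \<in> space lborel. \<not> (z \<in> J \<times> \<Omega> \<longrightarrow> U z = g z)} \<subseteq> N'" "N' \<in> null_sets lborel"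
    using AE_E[OF aeU] by (metis (no_types, lifting) null_setsI)
  have eqN': "U (t, x) = g (t, x)" if "(t, x) \<notin> N'" "t \<in> J" "x \<in> \<Omega>" for t x using N'(1) that by auto
  have aeN': "AE z in lborel \<Otimes>\<^sub>M lborel. z \<notin> N'" unfolding lborel_prod using N'(2) by (rule AE_not_in)
  have n1': "AE t in lborel. AE x in lborel. (t, x) \<notin> N'" by (rule lborel_pair.AE_pair[OF aeN'])
  have n2': "AE x in lborel. AE t in lborel. (t, x) \<notin> N'"
  proof (subst lborel_pair.AE_commute[symmetric])
    have "{z \<in> space (lborel \<Otimes>\<^sub>M lborel). (fst z, snd z) \<notin> N'} = - N'" by (auto simp: space_pair_measure)
    then show "{z \<in> space (lborel \<Otimes>\<^sub>M lborel). (fst z, snd z) \<notin> N'} \<in> sets (lborel \<Otimes>\<^sub>M lborel)"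
      using N'(2) unfolding lborel_prod by (auto simp: null_sets_def)
  qed (rule n1')
  have "st_rep J \<Omega> u U"
  proof (rule st_repI)
    show "U \<in> borel_measurable borel" by (rule rep_borel[OF U])
    show "U z = 0" if "z \<notin> J \<times> \<Omega>" for z using U that unfolding rep_def by blast
    show "AE t in lborel. t \<in> J \<longrightarrow> (AE x in lborel. x \<in> \<Omega> \<longrightarrow> U (t, x) = u t x)"
    proof -
      have "AE t in lborel. t \<in> J \<longrightarrow> (AE x in lborel. x \<in> \<Omega> \<longrightarrow> (t, x) \<notin> N)"
        using n1 by (simp only: AE_lebesgue_on[OF J] AE_lebesgue_on[OF \<Omega>])
      with n1' show ?thesis
      proof eventually_elim
        case (elim t)
        show ?case
        proof
          assume t: "t \<in> J"
          with elim(2) have "AE x in lborel. x \<in> \<Omega> \<longrightarrow> (t, x) \<notin> N" by simp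
          with elim(1) show "AE x in lborel. x \<in> \<Omega> \<longrightarrow> U (t, x) = u t x"
            by eventually_elim (use t eqN eqN' in simp)
        qed
      qed
    qed
    show "AE x in lborel. x \<in> \<Omega> \<longrightarrow> (AE t in lborel. t \<in> J \<longrightarrow> U (t, x) = u t x)"
    proof -
      have "AE x in lborel. x \<in> \<Omega> \<longrightarrow> (AE t in lborel. t \<in> J \<longrightarrow> (t, x) \<notin> N)"
        using n2 by (simp only: AE_lebesgue_on[OF J] AE_lebesgue_on[OF \<Omega>])
      with n2' show ?thesis
      proof eventually_elim
        case (elim x)
        show ?case
        proof
          assume x: "x \<in> \<Omega>"
          with elim(2) have "AE t in lborel. t \<in> J \<longrightarrow> (t, x) \<notin> N" by simp
          with elim(1) show "AE t in lborel. t \<in> J \<longrightarrow> U (t, x) = u t x"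
            by eventually_elim (use x eqN eqN' in simp)
        qed
      qed
    qed
  qed
  then show ?thesis by (intro exI[of _ U])
qed

lemma st_rep_borel: "st_rep J \<Omega> u U \<Longrightarrow> U \<in> borel_measurable borel"
  by (simp add: st_rep_def)

lemma st_rep_diff:
  assumes "st_rep J \<Omega> u U" "st_rep J \<Omega> v V"
  shows "st_rep J \<Omega> (\<lambda>t x. u t x - v t x) (\<lambda>z. U z - V z)"
proof -
  have 1: "AE t in lborel. t \<in> J \<longrightarrow> rep \<Omega> (u t) (\<lambda>x. U (t, x))" "AE t in lborel. t \<in> J \<longrightarrow> rep \<Omega> (v t) (\<lambda>x. V (t, x))"
    and 2: "AE x in lborel. x \<in> \<Omega> \<longrightarrow> rep J (\<lambda>t. u t x) (\<lambda>t. U (t, x))" "AE x in lborel. x \<in> \<Omega> \<longrightarrow> rep J (\<lambda>t. v t x) (\<lambda>t. V (t, x))"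
    using assms by (simp_all add: st_rep_def)
  have "AE t in lborel. t \<in> J \<longrightarrow> rep \<Omega> (\<lambda>x. u t x - v t x) (\<lambda>x. U (t, x) - V (t, x))"
    using 1 by eventually_elim (simp add: rep_diff)
  moreover have "AE x in lborel. x \<in> \<Omega> \<longrightarrow> rep J (\<lambda>t. u t x - v t x) (\<lambda>t. U (t, x) - V (t, x))"
    using 2 by eventually_elim (simp add: rep_diff)
  ultimately show ?thesis using assms by (simp add: st_rep_def borel_measurable_diff)
qed

text \<open>Tonelli: the inner integral of the square is the squared spatial norm, whose time
  integral is finite by assumption.\<close>

lemma st_rep_sq_int:
  fixes \<Omega> :: "'a::euclidean_space set"
  assumes J: "J \<in> sets borel" and \<Omega>: "\<Omega> \<in> sets borel" and u: "u \<in> L2Lp_space J (lebesgue_on \<Omega>) 2" and U: "st_rep J \<Omega> u U"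
  shows "sq_int U"
proof -
  have [measurable]: "U \<in> borel_measurable borel" by (rule st_rep_borel[OF U])
  have Um: "(\<lambda>z. ennreal ((U z)\<^sup>2)) \<in> borel_measurable (lborel \<Otimes>\<^sub>M lborel)" unfolding lborel_prod by measurable
  have Jl: "J \<in> sets lebesgue" using J by simp
  have "AE t in lebesgue_on J. u t \<in> L2_on \<Omega>" and int: "integrable (lebesgue_on J) (\<lambda>t. (L2_norm_on \<Omega> (u t))\<^sup>2)"
    using u by (simp_all add: L2Lp_space_def L2_time_def)
  then have L2: "AE t in lborel. t \<in> J \<longrightarrow> u t \<in> L2_on \<Omega>" by (simp only: AE_lebesgue_on[OF J])
  have slice: "AE t in lborel. (\<integral>\<^sup>+x. ennreal ((U (t, x))\<^sup>2) \<partial>lborel) = indicator J t * ennreal ((L2_norm_on \<Omega> (u t))\<^sup>2)"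
  proof -
    have "AE t in lborel. t \<in> J \<longrightarrow> rep \<Omega> (u t) (\<lambda>x. U (t, x))" using U by (simp add: st_rep_def)
    with L2 show ?thesis
    proof eventually_elim
      case (elim t)
      show ?case
      proof (cases "t \<in> J")
        case True
        then have r: "rep \<Omega> (u t) (\<lambda>x. U (t, x))" and l: "u t \<in> L2_on \<Omega>" using elim by simp_all
        have "sq_int (\<lambda>x. U (t, x))" using rep_L2_iff[OF \<Omega> r] l by simp
        from nn_integral_square[OF this] True show ?thesis by (simp add: rep_L2_norm[OF \<Omega> r])
      next
        case False
        then have "U (t, x) = 0" for x using U by (simp add: st_rep_def)
        with False show ?thesis by simp
      qed
    qed
  qed
  have "(\<integral>\<^sup>+z. ennreal ((U z)\<^sup>2) \<partial>lborel) = (\<integral>\<^sup>+t. \<integral>\<^sup>+x. ennreal ((U (t, x))\<^sup>2) \<partial>lborel \<partial>lborel)"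
    using lborel.nn_integral_fst[OF Um] by (simp add: lborel_prod)
  also have "\<dots> = (\<integral>\<^sup>+t. indicator J t * ennreal ((L2_norm_on \<Omega> (u t))\<^sup>2) \<partial>lborel)"
    by (rule nn_integral_cong_AE[OF slice])
  also have "\<dots> = (\<integral>\<^sup>+t. indicator J t * ennreal ((L2_norm_on \<Omega> (u t))\<^sup>2) \<partial>lebesgue)"
    by (rule nn_integral_completion[symmetric])
  also have "\<dots> = (\<integral>\<^sup>+t. ennreal ((L2_norm_on \<Omega> (u t))\<^sup>2) \<partial>lebesgue_on J)"
    using Jl by (subst nn_integral_restrict_space) (auto simp: mult.commute)
  also have "\<dots> < \<infinity>" using int by (simp add: integrable_iff_bounded)
  finally have "integrable lborel (\<lambda>z. (U z)\<^sup>2)" by (intro integrableI_nonneg) auto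
  then show ?thesis by (simp add: sq_int_def)
qed

lemma test_dir_tensor:
  fixes \<Omega> :: "'a::euclidean_space set" and \<eta> \<eta>' :: "real \<Rightarrow> real"
  assumes \<eta>: "test_dir J 1 \<eta> \<eta>'" and \<xi>: "continuous_on UNIV \<xi>" "compact K" "K \<subseteq> \<Omega>" "\<And>x. x \<notin> K \<Longrightarrow> \<xi> x = 0"
  shows "test_dir (J \<times> \<Omega>) (1, 0) (\<lambda>z. \<eta> (fst z) * \<xi> (snd z)) (\<lambda>z. \<eta>' (fst z) * \<xi> (snd z))"
  unfolding test_dir_def
proof (intro conjI allI)
  have c: "continuous_on UNIV \<eta>" "continuous_on UNIV \<eta>'" using \<eta> by (simp_all add: test_dir_def)
  have c\<xi>: "continuous_on UNIV (\<lambda>z::real \<times> 'a. \<xi> (snd z))"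
    by (rule continuous_on_compose2[OF \<xi>(1)]) (auto intro: continuous_on_snd)
  have c1: "continuous_on UNIV (\<lambda>z::real \<times> 'a. \<eta> (fst z))"
    by (rule continuous_on_compose2[OF c(1)]) (auto intro: continuous_on_fst)
  have c2: "continuous_on UNIV (\<lambda>z::real \<times> 'a. \<eta>' (fst z))"
    by (rule continuous_on_compose2[OF c(2)]) (auto intro: continuous_on_fst)
  show "continuous_on UNIV (\<lambda>z. \<eta> (fst z) * \<xi> (snd z))" by (rule continuous_on_mult[OF c1 c\<xi>])
  show "continuous_on UNIV (\<lambda>z. \<eta>' (fst z) * \<xi> (snd z))" by (rule continuous_on_mult[OF c2 c\<xi>])
  obtain L where L: "compact L" "L \<subseteq> J" "\<And>x. x \<notin> L \<Longrightarrow> \<eta> x = 0" "\<And>x. x \<notin> L \<Longrightarrow> \<eta>' x = 0"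
    by (rule test_dirE[OF \<eta>]) (rule that)
  show "\<exists>M. compact M \<and> M \<subseteq> J \<times> \<Omega> \<and> (\<forall>z. z \<notin> M \<longrightarrow> \<eta> (fst z) * \<xi> (snd z) = 0 \<and> \<eta>' (fst z) * \<xi> (snd z) = 0)"
  proof (intro exI[of _ "L \<times> K"] conjI allI impI)
    show "compact (L \<times> K)" by (rule compact_Times[OF L(1) \<xi>(2)])
    show "L \<times> K \<subseteq> J \<times> \<Omega>" using L(2) \<xi>(3) by auto
    fix z :: "real \<times> 'a" assume "z \<notin> L \<times> K"
    then have "fst z \<notin> L \<or> snd z \<notin> K" by (cases z) auto
    then show "\<eta> (fst z) * \<xi> (snd z) = 0" "\<eta>' (fst z) * \<xi> (snd z) = 0" using L(3,4) \<xi>(4) by auto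
  qed
  fix z :: "real \<times> 'a"
  have "((\<lambda>s. \<eta> (fst z + s *\<^sub>R 1)) has_real_derivative \<eta>' (fst z)) (at 0)" using \<eta> by (simp add: test_dir_def)
  from DERIV_cmult_right[OF this, of "\<xi> (snd z)"]
  show "((\<lambda>s. \<eta> (fst (z + s *\<^sub>R (1, 0))) * \<xi> (snd (z + s *\<^sub>R (1, 0)))) has_real_derivative \<eta>' (fst z) * \<xi> (snd z)) (at 0)"
    by simp
qed

lemma test_dir_deriv:
  fixes \<eta> :: "real \<Rightarrow> real"
  assumes "test_dir J 1 \<eta> \<eta>'" shows "deriv \<eta> t = \<eta>' t"
proof -
  have "((\<lambda>s. \<eta> (s + t)) has_real_derivative \<eta>' t) (at 0)" using assms by (simp add: test_dir_def add.commute[of _ t])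
  then have "(\<eta> has_real_derivative \<eta>' t) (at t)" using DERIV_shift[of \<eta> "\<eta>' t" 0 t] by simp
  then show ?thesis by (rule DERIV_imp_deriv)
qed

lemma bump_Pair: "bump (a1, a2) (b1, b2) n z = bump a1 b1 n (fst z) * bump a2 b2 n (snd z)"
proof -
  have inj: "inj_on (\<lambda>u. (u, 0)) (Basis :: 'a set)" "inj_on (\<lambda>u. (0, u)) (Basis :: 'b set)" by (auto intro!: inj_onI)
  have disj: "(\<lambda>u. (u, 0)) ` (Basis :: 'a set) \<inter> (\<lambda>u. (0, u)) ` (Basis :: 'b set) = {}" by auto
  show ?thesis
    unfolding bump_def Basis_prod_def
    by (subst prod.union_disjoint[OF _ _ disj], simp, simp)
      (simp only: prod.reindex[OF inj(1)] prod.reindex[OF inj(2)] comp_def, simp add: inner_prod_def)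
qed

lemma Fubini_lborel_pair:
  fixes k :: "real \<times> 'a::euclidean_space \<Rightarrow> real"
  assumes k: "integrable lborel k"
  shows "(\<integral>z. k z \<partial>lborel) = (\<integral>t. \<integral>x. k (t, x) \<partial>lborel \<partial>lborel)"
    and "(\<integral>z. k z \<partial>lborel) = (\<integral>x. \<integral>t. k (t, x) \<partial>lborel \<partial>lborel)"
    and "integrable lborel (\<lambda>t. \<integral>x. k (t, x) \<partial>lborel)"
    and "AE t in lborel. integrable lborel (\<lambda>x. k (t, x))"
proof -
  have k': "integrable (lborel \<Otimes>\<^sub>M lborel) k" unfolding lborel_prod by (rule k)
  then have k'': "integrable (lborel \<Otimes>\<^sub>M lborel) (\<lambda>(t, x). k (t, x))" by simp
  show 1: "(\<integral>z. k z \<partial>lborel) = (\<integral>t. \<integral>x. k (t, x) \<partial>lborel \<partial>lborel)"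
    using lborel_pair.integral_fst'[OF k'] by (simp add: lborel_prod)
  show "(\<integral>z. k z \<partial>lborel) = (\<integral>x. \<integral>t. k (t, x) \<partial>lborel \<partial>lborel)"
    using lborel_pair.Fubini_integral[OF k''] 1 by simp
  show "integrable lborel (\<lambda>t. \<integral>x. k (t, x) \<partial>lborel)" by (rule lborel_pair.integrable_fst'[OF k'])
  show "AE t in lborel. integrable lborel (\<lambda>x. k (t, x))" by (rule lborel_pair.AE_integrable_fst'[OF k'])
qed

text \<open>A space-time bump is a bump in time times a bump in space. For the time factor the
  vector-valued identity holds at almost every \<open>x\<close>; multiplying by the spatial factor
  and integrating over \<open>x\<close> gives the weak identity in direction
  \<open>(1, 0)\<close>.\<close>

lemma has_time_deriv_dir_deriv:
  fixes \<Omega> :: "'a::euclidean_space set"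
  assumes J: "open J" and \<Omega>: "open \<Omega>" and d: "has_time_deriv J (lebesgue_on \<Omega>) u v"
    and U: "st_rep J \<Omega> u U" and V: "st_rep J \<Omega> v V"
  shows "dir_deriv (J \<times> \<Omega>) (1, 0) U V"
proof -
  have bJ: "J \<in> sets borel" and b\<Omega>: "\<Omega> \<in> sets borel" using J \<Omega> by simp_all
  have u: "u \<in> L2Lp_space J (lebesgue_on \<Omega>) 2" "v \<in> L2Lp_space J (lebesgue_on \<Omega>) 2"
    and w: "\<And>\<phi>. \<phi> \<in> test_functions J \<Longrightarrow> AE x in lebesgue_on \<Omega>.
        (\<integral>t. deriv \<phi> t * u t x \<partial>lebesgue_on J) = - (\<integral>t. \<phi> t * v t x \<partial>lebesgue_on J)"
    using d by (auto simp: has_time_deriv_def)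
  have sU: "sq_int U" and sV: "sq_int V" by (rule st_rep_sq_int[OF bJ b\<Omega> u(1) U] st_rep_sq_int[OF bJ b\<Omega> u(2) V])+
  show ?thesis
  proof (rule dir_derivI_bump[OF open_Times[OF J \<Omega>] sU sV])
    fix a b :: "real \<times> 'a" and n \<phi>'
    assume ab: "cbox a b \<subseteq> J \<times> \<Omega>" and t: "test_dir (J \<times> \<Omega>) (1, 0) (bump a b n) \<phi>'"
    obtain a1 a2 where a: "a = (a1, a2)" by (cases a)
    obtain b1 b2 where b: "b = (b1, b2)" by (cases b)
    show "(\<integral>z. U z * \<phi>' z \<partial>lborel) = - (\<integral>z. V z * bump a b n z \<partial>lborel)"
    \<comment> \<open>An empty box does not force both of its factors into \<open>J\<close> and
      \<open>\<Omega>\<close>, but then the bump is zero.\<close>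
    proof (cases "cbox a b = {}")
      case True
      have 0: "bump a b n = (\<lambda>z. 0)" by (rule ext) (rule bump_eq_0, simp add: True)
      have "test_dir (J \<times> \<Omega>) (1, 0) (\<lambda>z::real \<times> 'a. 0) (\<lambda>z. 0)"
        unfolding test_dir_def by (auto intro!: exI[of _ "{}"])
      then have "\<phi>' = (\<lambda>z. 0)" using test_dir_unique[OF t] unfolding 0 by simp
      with 0 show ?thesis by simp
    next
      case False
      then have sub: "cbox a1 b1 \<subseteq> J" "cbox a2 b2 \<subseteq> \<Omega>" using ab unfolding a b cbox_Pair_eq times_subset_iff by blast+
      define \<eta> where "\<eta> = bump a1 b1 n"
      define \<xi> where "\<xi> = bump a2 b2 n"
      have \<eta>: "\<eta> \<in> test_functions J" unfolding \<eta>_def by (rule bump_test_function[OF sub(1)])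
      have t\<eta>: "test_dir J 1 \<eta> (pderivative 1 \<eta>)" by (rule test_dir_Basis[OF \<eta>]) simp
      have tens: "test_dir (J \<times> \<Omega>) (1, 0) (\<lambda>z. \<eta> (fst z) * \<xi> (snd z)) (\<lambda>z. pderivative 1 \<eta> (fst z) * \<xi> (snd z))"
        by (rule test_dir_tensor[OF t\<eta> _ compact_cbox sub(2)])
          (auto simp: \<xi>_def intro: smooth_imp_continuous smooth_bump bump_eq_0)
      have beq: "bump a b n = (\<lambda>z. \<eta> (fst z) * \<xi> (snd z))" by (rule ext) (simp add: a b bump_Pair \<eta>_def \<xi>_def)
      have \<phi>': "\<phi>' = (\<lambda>z. pderivative 1 \<eta> (fst z) * \<xi> (snd z))"
        using test_dir_unique[OF t] tens unfolding beq by simp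
      have s: "sq_int (bump a b n)" "sq_int \<phi>'" using test_dir_sq_int[OF t] .
      have [measurable]: "pderivative 1 \<eta> \<in> borel_measurable borel" "\<eta> \<in> borel_measurable borel"
        using test_dir_sq_int[OF t\<eta>] by (simp_all add: sq_int_def)
      have "AE x in lborel. x \<in> \<Omega> \<longrightarrow> (\<integral>t. deriv \<eta> t * u t x \<partial>lebesgue_on J) = - (\<integral>t. \<eta> t * v t x \<partial>lebesgue_on J)"
        using w[OF \<eta>] by (simp only: AE_lebesgue_on[OF b\<Omega>])
      moreover have "AE x in lborel. x \<in> \<Omega> \<longrightarrow> rep J (\<lambda>t. u t x) (\<lambda>t. U (t, x))" using U by (simp add: st_rep_def)
      moreover have "AE x in lborel. x \<in> \<Omega> \<longrightarrow> rep J (\<lambda>t. v t x) (\<lambda>t. V (t, x))" using V by (simp add: st_rep_def)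
      ultimately have ae: "AE x in lborel. (\<integral>t. U (t, x) * \<phi>' (t, x) \<partial>lborel) = - (\<integral>t. V (t, x) * bump a b n (t, x) \<partial>lborel)"
      proof eventually_elim
        case (elim x)
        show ?case
        proof (cases "x \<in> \<Omega>")
          case True
          then have ru: "rep J (\<lambda>t. u t x) (\<lambda>t. U (t, x))" and rv: "rep J (\<lambda>t. v t x) (\<lambda>t. V (t, x))"
            and e: "(\<integral>t. deriv \<eta> t * u t x \<partial>lebesgue_on J) = - (\<integral>t. \<eta> t * v t x \<partial>lebesgue_on J)" using elim by simp_all
          have "(\<integral>t. U (t, x) * pderivative 1 \<eta> t \<partial>lborel) = (\<integral>t. u t x * pderivative 1 \<eta> t \<partial>lebesgue_on J)"
            by (rule rep_integral(1)[OF bJ rep_mult_borel[OF ru], symmetric]) measurable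
          also have "\<dots> = - (\<integral>t. v t x * \<eta> t \<partial>lebesgue_on J)"
            using e by (simp add: test_dir_deriv[OF t\<eta>] mult.commute)
          also have "(\<integral>t. v t x * \<eta> t \<partial>lebesgue_on J) = (\<integral>t. V (t, x) * \<eta> t \<partial>lborel)"
            by (rule rep_integral(1)[OF bJ rep_mult_borel[OF rv]]) measurable
          finally have "(\<integral>t. U (t, x) * pderivative 1 \<eta> t \<partial>lborel) * \<xi> x = - ((\<integral>t. V (t, x) * \<eta> t \<partial>lborel) * \<xi> x)" by simp
          then show ?thesis unfolding \<phi>' beq by (simp add: mult.assoc[symmetric])
        next
          case False
          then have "\<xi> x = 0" using sub(2) unfolding \<xi>_def by (intro bump_eq_0) auto
          then show ?thesis unfolding \<phi>' beq by simp
        qed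
      qed
      have "(\<integral>z. U z * \<phi>' z \<partial>lborel) = (\<integral>x. \<integral>t. U (t, x) * \<phi>' (t, x) \<partial>lborel \<partial>lborel)"
        by (rule Fubini_lborel_pair(2)[OF sq_int_mult[OF sU s(2)]])
      also have "\<dots> = (\<integral>x. - (\<integral>t. V (t, x) * bump a b n (t, x) \<partial>lborel) \<partial>lborel)"
      proof (rule integral_cong_AE[OF _ _ ae])
        have [measurable]: "U \<in> borel_measurable (borel \<Otimes>\<^sub>M borel)" "V \<in> borel_measurable (borel \<Otimes>\<^sub>M borel)"
          "\<phi>' \<in> borel_measurable (borel \<Otimes>\<^sub>M borel)" "bump a b n \<in> borel_measurable (borel \<Otimes>\<^sub>M borel)"
          using sU sV s by (simp_all add: sq_int_def borel_prod)
        show "(\<lambda>x. \<integral>t. U (t, x) * \<phi>' (t, x) \<partial>lborel) \<in> borel_measurable lborel" by measurable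
        show "(\<lambda>x. - (\<integral>t. V (t, x) * bump a b n (t, x) \<partial>lborel)) \<in> borel_measurable lborel" by measurable
      qed
      also have "\<dots> = - (\<integral>z. V z * bump a b n z \<partial>lborel)"
        by (simp add: Fubini_lborel_pair(2)[OF sq_int_mult[OF sV s(1)]])
      finally show ?thesis .
    qed
  qed
qed

section \<open>Measurability of the spatial norm in time\<close>

lemma H2_diff:
  assumes \<Omega>: "open \<Omega>" and f: "H2_on \<Omega> f" "H2_on \<Omega> g"
  shows "H2_on \<Omega> (\<lambda>x. f x - g x)"
  unfolding H2_on_def
proof (intro conjI ballI)
  have H1: "H1_on \<Omega> f" "H1_on \<Omega> g" using f by (simp_all add: H2_on_def)
  show "H1_on \<Omega> (\<lambda>x. f x - g x)" by (rule H1_diff[OF \<Omega> H1])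
  fix i :: 'a assume i: "i \<in> Basis"
  have "H1_on \<Omega> (\<lambda>x. weak_pd \<Omega> i f x - weak_pd \<Omega> i g x)"
    using f i by (intro H1_diff[OF \<Omega>]) (simp_all add: H2_on_def)
  then show "H1_on \<Omega> (weak_pd \<Omega> i (\<lambda>x. f x - g x))"
    by (rule H1_cong_AE[OF \<Omega>]) (rule eventually_mono[OF weak_pd_diff(3)[OF \<Omega> i H1]], simp)
qed

text \<open>The squared norms of the chosen derivatives are limits of integrals of difference
  quotients of \<open>W\<close>, which are Borel in time. \<open>lim\<close> is measurable also
  where the limit fails to exist, and the H2 regularity makes it the right value for almost every
  time.\<close>

lemma Hs_norm_1_time_rep:
  fixes \<Omega> :: "'a::euclidean_space set"
  assumes \<Omega>: "open \<Omega>" and J: "J \<in> sets borel" and W: "st_rep J \<Omega> w W"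
    and H2: "AE t in lebesgue_on J. H2_on \<Omega> (w t)"
  shows "\<exists>F. rep J (\<lambda>t. (Hs_norm 1 \<Omega> (w t))\<^sup>2) F"
proof -
  have b: "\<Omega> \<in> sets borel" using \<Omega> by simp
  have [measurable]: "W \<in> borel_measurable (borel \<Otimes>\<^sub>M borel)" using st_rep_borel[OF W] by (simp add: borel_prod)
  have [measurable]: "J \<in> sets borel" by (rule J)
  define S where "S i n = {x. \<forall>\<tau>\<in>{0..1 / real (Suc n)}. x + \<tau> *\<^sub>R i \<in> \<Omega>}" for i and n :: nat
  have [measurable]: "S i n \<in> sets borel" for i n
    unfolding S_def by (intro borel_open open_segment_translates \<Omega>)
  define X where "X i n t = (real (Suc n))\<^sup>2 * (\<integral>x. indicator (S i n) x *
      (W (t, x + (1 / real (Suc n)) *\<^sub>R i) - W (t, x))\<^sup>2 \<partial>lborel)" for i and n :: nat and t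
  have [measurable]: "X i n \<in> borel_measurable borel" for i n unfolding X_def by measurable
  define F where "F t = indicator J t * ((\<integral>x. (W (t, x))\<^sup>2 \<partial>lborel) + (\<Sum>i\<in>Basis. lim (\<lambda>n. X i n t)))" for t
  have Fm: "F \<in> borel_measurable borel" unfolding F_def by measurable
  have "AE t in lborel. t \<in> J \<longrightarrow> rep \<Omega> (w t) (\<lambda>x. W (t, x))" using W by (simp add: st_rep_def)
  moreover have "AE t in lborel. t \<in> J \<longrightarrow> H2_on \<Omega> (w t)" using H2 by (simp only: AE_lebesgue_on[OF J])
  ultimately have "AE t in lborel. t \<in> J \<longrightarrow> F t = (Hs_norm 1 \<Omega> (w t))\<^sup>2"
  proof eventually_elim
    case (elim t)
    show ?case
    proof
      assume t: "t \<in> J"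
      with elim have r: "rep \<Omega> (w t) (\<lambda>x. W (t, x))" and h: "H2_on \<Omega> (w t)" by simp_all
      have "lim (\<lambda>n. X i n t) = (L2_norm_on \<Omega> (weak_pd \<Omega> i (w t)))\<^sup>2" if "i \<in> Basis" for i
        unfolding X_def S_def by (rule limI) (rule weak_pd_norm_limit[OF \<Omega> h r that])
      then show "F t = (Hs_norm 1 \<Omega> (w t))\<^sup>2"
        using t by (simp add: F_def Hs_norm_1_power2 rep_L2_norm[OF b r] nrm2_power2)
    qed
  qed
  with Fm have "rep J (\<lambda>t. (Hs_norm 1 \<Omega> (w t))\<^sup>2) F" by (simp add: rep_def F_def)
  then show ?thesis by (intro exI[of _ F])
qed

section \<open>The stability estimate\<close>

lemma dir_deriv_diff:
  fixes D :: "'a::euclidean_space set"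
  assumes D: "open D" and f: "dir_deriv D h f g" "sq_int f" "sq_int g" and f': "dir_deriv D h f' g'" "sq_int f'" "sq_int g'"
  shows "dir_deriv D h (\<lambda>x. f x - f' x) (\<lambda>x. g x - g' x)"
proof (rule dir_derivI_bump[OF D sq_int_diff[OF f(2) f'(2)] sq_int_diff[OF f(3) f'(3)]])
  fix a b n \<phi>' assume t: "test_dir D h (bump a b n) \<phi>'"
  note s = test_dir_sq_int[OF t]
  show "(\<integral>x. (f x - f' x) * \<phi>' x \<partial>lborel) = - (\<integral>x. (g x - g' x) * bump a b n x \<partial>lborel)"
    using dir_deriv_weak[OF D f t] dir_deriv_weak[OF D f' t]
      sq_int_mult[OF f(2) s(2)] sq_int_mult[OF f'(2) s(2)] sq_int_mult[OF f(3) s(1)] sq_int_mult[OF f'(3) s(1)]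
    by (simp add: left_diff_distrib)
qed

text \<open>A vanishing integral would make the open interval a null set. The value is the weight by
  which the pairing with \<open>q - qdag\<close> is multiplied after integration in time.\<close>

lemma integral_bump_pos:
  fixes a b :: real
  assumes "a < b" shows "0 < (\<integral>t. bump a b 0 t \<partial>lborel)"
proof -
  have "test_dir (cbox a b) 1 (bump a b 0) (pderivative 1 (bump a b 0))"
    by (rule test_dir_Basis[OF bump_test_function[OF order_refl]]) simp
  then have s: "sq_int (bump a b 0)" by (rule test_dir_sq_int(1))
  have i: "integrable lborel (bump a b 0)"
  proof -
    have "integrable lborel (\<lambda>t. indicator (cbox a b) t * bump a b 0 t)"
      using emeasure_lborel_cbox_finite[of a b] by (intro sq_int_imp_set_integrable s) auto
    moreover have "(\<lambda>t. indicator (cbox a b) t * bump a b 0 t) = bump a b 0"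
      using bump_eq_0[of _ a b 0] by (intro ext) (auto simp: indicator_def)
    ultimately show ?thesis by simp
  qed
  have "(\<integral>t. bump a b 0 t \<partial>lborel) \<noteq> 0"
  proof
    assume "(\<integral>t. bump a b 0 t \<partial>lborel) = 0"
    then have "AE t in lborel. bump a b 0 t = 0"
      using integral_nonneg_eq_0_iff_AE[OF i] bump_nonneg[of a b 0] by simp
    then have "AE t in lborel. t \<notin> box a b" using bump_nonzero_iff[of a b 0] by (auto elim!: eventually_mono)
    moreover have "box a b \<in> sets lborel" by simp
    ultimately have "box a b \<in> null_sets lborel" using AE_iff_null_sets[of "box a b" lborel] by blast
    then have "emeasure lborel (box a b) = 0" by (rule null_setsD1)
    then show False using assms by simp
  qed
  moreover have "0 \<le> (\<integral>t. bump a b 0 t \<partial>lborel)" by (intro integral_nonneg_AE) (simp add: bump_nonneg)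
  ultimately show ?thesis by linarith
qed

lemma integrable_lebesgue_on_mono:
  fixes k :: "'a::euclidean_space \<Rightarrow> real"
  assumes k: "integrable (lebesgue_on S) k" and R: "R \<subseteq> S" "R \<in> sets borel" "S \<in> sets borel"
  shows "integrable (lebesgue_on R) k"
proof -
  have "k \<in> borel_measurable (lebesgue_on S)" using k by simp
  from rep_exists[OF R(3) this] obtain F where F: "rep S k F" ..
  have r: "rep R k (\<lambda>x. indicator R x * F x)"
    using F R(1,2) unfolding rep_def by (auto elim!: eventually_mono intro!: borel_measurable_times)
  have "integrable lborel F" using rep_integral(2)[OF R(3) F] k by simp
  then have "integrable lborel (\<lambda>x. indicator R x * F x)" using R(2) integrable_mult_indicator[of R lborel F] by simp
  then show ?thesis using rep_integral(2)[OF R(2) r] by simp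
qed

text \<open>Integrability is available on the open time interval only, while \<open>I\<close> may
  contain the final time \<open>T\<close>. A single point is null, so \<open>k\<close> is integrable
  on \<open>I\<close> too and the integrals can be compared.\<close>

lemma integral_lebesgue_on_mono_endpoint:
  fixes k :: "real \<Rightarrow> real"
  assumes k: "integrable (lebesgue_on S) k" and pos: "\<And>t. 0 \<le> k t"
    and sets: "S \<in> sets borel" "J \<in> sets borel" "I \<in> sets borel" and sub: "J \<subseteq> I" "J \<subseteq> S" "I \<subseteq> insert T S"
  shows "(\<integral>t. k t \<partial>lebesgue_on J) \<le> (\<integral>t. k t \<partial>lebesgue_on I)"
proof -
  have "k \<in> borel_measurable (lebesgue_on S)" using k by simp
  from rep_exists[OF sets(1) this] obtain F where F: "rep S k F" ..
  have iF: "integrable lborel F" using rep_integral(2)[OF sets(1) F] k by simp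
  have ae: "AE t in lborel. t \<in> S \<longrightarrow> F t = k t" using F by (simp add: rep_def)
  have Fm: "F \<in> borel_measurable borel" by (rule rep_borel[OF F])
  have rJ: "rep J k (\<lambda>x. indicator J x * F x)"
    using ae Fm sets sub unfolding rep_def by (auto elim!: eventually_mono intro!: borel_measurable_times)
  have rI: "rep I k (\<lambda>x. indicator I x * F x)"
    unfolding rep_def
  proof (intro conjI)
    show "AE t in lborel. t \<in> I \<longrightarrow> indicator I t * F t = k t"
      using ae AE_lborel_singleton[of T] by eventually_elim (use sub in auto)
  qed (use Fm sets in \<open>auto intro!: borel_measurable_times\<close>)
  have F0: "AE t in lborel. 0 \<le> F t"
    using ae by eventually_elim (use F pos in \<open>auto simp: rep_def\<close>)
  have i: "integrable lborel (\<lambda>x. indicator A x * F x)" if "A \<in> sets borel" for A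
    using integrable_mult_indicator[of A lborel F] that iF by simp
  show ?thesis
    unfolding rep_integral(1)[OF sets(2) rJ] rep_integral(1)[OF sets(3) rI]
  proof (rule integral_mono_AE[OF i[OF sets(2)] i[OF sets(3)]])
    show "AE x in lborel. indicator J x * F x \<le> indicator I x * F x"
      using F0 by eventually_elim (use sub(1) in \<open>auto simp: indicator_def\<close>)
  qed
qed

text \<open>\<open>G\<close> is Borel on the whole line, whereas \<open>k\<close> is only Lebesgue
  measurable on \<open>J\<close>; the comparison is made under the completed measure.\<close>

lemma integral_abs_le_lebesgue_on:
  fixes G k :: "real \<Rightarrow> real"
  assumes J: "J \<in> sets borel" and G: "integrable lborel G" and k: "integrable (lebesgue_on J) k"
    and le: "AE t in lborel. \<bar>G t\<bar> \<le> (if t \<in> J then k t else 0)"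
  shows "\<bar>\<integral>t. G t \<partial>lborel\<bar> \<le> (\<integral>t. k t \<partial>lebesgue_on J)"
proof -
  have Gm: "G \<in> borel_measurable lborel" using G by simp
  have Jl: "J \<in> sets lebesgue" using J by simp
  have "(\<integral>t. G t \<partial>lborel) = (\<integral>t. G t \<partial>lebesgue)" by (rule integral_completion[OF Gm, symmetric])
  then have "\<bar>\<integral>t. G t \<partial>lborel\<bar> \<le> (\<integral>t. \<bar>G t\<bar> \<partial>lebesgue)" by simp
  also have "\<dots> \<le> (\<integral>t. (if t \<in> J then k t else 0) \<partial>lebesgue)"
  proof (rule integral_mono_AE)
    show "integrable lebesgue (\<lambda>t. \<bar>G t\<bar>)" using integrable_completion[OF Gm] G by simp
    show "integrable lebesgue (\<lambda>t. if t \<in> J then k t else 0)"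
      unfolding Lebesgue_Measure.integrable_restrict_UNIV[OF Jl] by (rule k)
    show "AE t in lebesgue. \<bar>G t\<bar> \<le> (if t \<in> J then k t else 0)" using le by (simp only: AE_completion_iff)
  qed
  also have "\<dots> = (\<integral>t. k t \<partial>lebesgue_on J)" by (rule Lebesgue_Measure.integral_restrict_UNIV[OF Jl])
  finally show ?thesis .
qed

section \<open>Estimates for the difference of two solutions\<close>

lemma parabolic_solutionD:
  assumes "parabolic_solution \<Omega> T a f g u0 q u"
  shows "u \<in> L2Hs_space {0<..<T} \<Omega> 2"
    and "has_time_deriv {0<..<T} (lebesgue_on \<Omega>) u (time_deriv {0<..<T} (lebesgue_on \<Omega>) u)"
    and "AE t in lebesgue_on {0<..<T}. AE x in lebesgue_on \<Omega>.
        time_deriv {0<..<T} (lebesgue_on \<Omega>) u t x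
          - weak_div \<Omega> (\<lambda>y. a y *\<^sub>R weak_grad \<Omega> (u t) y) x + q x * u t x = f t x"
proof -
  show "u \<in> L2Hs_space {0<..<T} \<Omega> 2" using assms by (simp add: parabolic_solution_def)
  have "\<exists>v. has_time_deriv {0<..<T} (lebesgue_on \<Omega>) u v" using assms by (simp add: parabolic_solution_def H1L2_space_def)
  then show "has_time_deriv {0<..<T} (lebesgue_on \<Omega>) u (time_deriv {0<..<T} (lebesgue_on \<Omega>) u)"
    unfolding time_deriv_def by (rule someI_ex)
  show "AE t in lebesgue_on {0<..<T}. AE x in lebesgue_on \<Omega>.
        time_deriv {0<..<T} (lebesgue_on \<Omega>) u t x
          - weak_div \<Omega> (\<lambda>y. a y *\<^sub>R weak_grad \<Omega> (u t) y) x + q x * u t x = f t x"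
    using assms by (simp add: parabolic_solution_def)
qed

lemma L2Hs_2D:
  assumes \<Omega>: "open \<Omega>" and u: "u \<in> L2Hs_space J \<Omega> 2" and J: "J \<in> sets borel"
  shows "AE t in lborel. t \<in> J \<longrightarrow> H2_on \<Omega> (u t)" and "integrable (lebesgue_on J) (\<lambda>t. (Hs_norm 2 \<Omega> (u t))\<^sup>2)"
proof -
  have "AE t in lebesgue_on J. u t \<in> Hs_space 2 \<Omega>" and i: "integrable (lebesgue_on J) (\<lambda>t. (Hs_norm 2 \<Omega> (u t))\<^sup>2)"
    using u by (simp_all add: L2Hs_space_def L2_time_def)
  then have "AE t in lborel. t \<in> J \<longrightarrow> u t \<in> Hs_space 2 \<Omega>" by (simp only: AE_lebesgue_on[OF J])
  then show "AE t in lborel. t \<in> J \<longrightarrow> H2_on \<Omega> (u t)" by eventually_elim (use Hs_space_2_imp_H2[OF \<Omega>] in blast)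
  show "integrable (lebesgue_on J) (\<lambda>t. (Hs_norm 2 \<Omega> (u t))\<^sup>2)" by (rule i)
qed

text \<open>Guards against the default value 0 of an undefined integral, under which the right-hand
  side of the stability estimate would collapse. Measurability in time comes from the difference
  quotients, the bound from the two H2 norms.\<close>

lemma Hs_norm_1_diff_time_integrable:
  fixes \<Omega> :: "'a::euclidean_space set"
  assumes \<Omega>: "open \<Omega>" and J: "J \<in> sets borel"
    and u: "u \<in> L2Hs_space J \<Omega> 2" and v: "v \<in> L2Hs_space J \<Omega> 2"
    and W: "st_rep J \<Omega> (\<lambda>t x. u t x - v t x) W"
  shows "integrable (lebesgue_on J) (\<lambda>t. (Hs_norm 1 \<Omega> (\<lambda>x. u t x - v t x))\<^sup>2)"
proof -
  note U = L2Hs_2D[OF \<Omega> u J] and V = L2Hs_2D[OF \<Omega> v J]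
  have h: "AE t in lborel. t \<in> J \<longrightarrow> H2_on \<Omega> (\<lambda>x. u t x - v t x)"
    using U(1) V(1) by eventually_elim (use H2_diff[OF \<Omega>] in blast)
  then have "AE t in lebesgue_on J. H2_on \<Omega> (\<lambda>x. u t x - v t x)" by (simp only: AE_lebesgue_on[OF J])
  from Hs_norm_1_time_rep[OF \<Omega> J W this] obtain F where F: "rep J (\<lambda>t. (Hs_norm 1 \<Omega> (\<lambda>x. u t x - v t x))\<^sup>2) F" ..
  have i: "integrable (lebesgue_on J) (\<lambda>t. 2 * (Hs_norm 2 \<Omega> (u t))\<^sup>2 + 2 * (Hs_norm 2 \<Omega> (v t))\<^sup>2)"
    using U(2) V(2) by simp
  show ?thesis
  proof (rule Bochner_Integration.integrable_bound[OF i rep_measurable[OF F]])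
    have "AE t in lborel. t \<in> J \<longrightarrow> norm ((Hs_norm 1 \<Omega> (\<lambda>x. u t x - v t x))\<^sup>2)
        \<le> norm (2 * (Hs_norm 2 \<Omega> (u t))\<^sup>2 + 2 * (Hs_norm 2 \<Omega> (v t))\<^sup>2)"
      using U(1) V(1)
    proof eventually_elim
      case (elim t)
      show ?case
      proof
        assume "t \<in> J"
        then have h1: "H1_on \<Omega> (u t)" "H1_on \<Omega> (v t)" using elim by (simp_all add: H2_on_def)
        have "(Hs_norm 1 \<Omega> (\<lambda>x. u t x - v t x))\<^sup>2 \<le> 2 * (Hs_norm 1 \<Omega> (u t))\<^sup>2 + 2 * (Hs_norm 1 \<Omega> (v t))\<^sup>2"
          by (rule Hs_norm_1_diff_power2_le[OF \<Omega> h1])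
        also have "\<dots> \<le> 2 * (Hs_norm 2 \<Omega> (u t))\<^sup>2 + 2 * (Hs_norm 2 \<Omega> (v t))\<^sup>2"
          by (intro add_mono mult_left_mono power_mono Hs_norm_1_le_2 Hs_norm_1_nonneg) simp_all
        finally show "norm ((Hs_norm 1 \<Omega> (\<lambda>x. u t x - v t x))\<^sup>2)
          \<le> norm (2 * (Hs_norm 2 \<Omega> (u t))\<^sup>2 + 2 * (Hs_norm 2 \<Omega> (v t))\<^sup>2)" by simp
      qed
    qed
    then show "AE t in lebesgue_on J. norm ((Hs_norm 1 \<Omega> (\<lambda>x. u t x - v t x))\<^sup>2)
        \<le> norm (2 * (Hs_norm 2 \<Omega> (u t))\<^sup>2 + 2 * (Hs_norm 2 \<Omega> (v t))\<^sup>2)" by (simp only: AE_lebesgue_on[OF J])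
  qed
qed

lemma time_deriv_st_reps:
  fixes \<Omega> :: "'a::euclidean_space set"
  assumes J: "open J" and \<Omega>: "open \<Omega>" and d: "has_time_deriv J (lebesgue_on \<Omega>) u v"
  obtains U V where "st_rep J \<Omega> u U" "st_rep J \<Omega> v V" "sq_int U" "sq_int V" "dir_deriv (J \<times> \<Omega>) (1, 0) U V"
proof -
  have b: "J \<in> sets borel" "\<Omega> \<in> sets borel" using J \<Omega> by simp_all
  have L2: "u \<in> L2Lp_space J (lebesgue_on \<Omega>) 2" "v \<in> L2Lp_space J (lebesgue_on \<Omega>) 2" using d by (simp_all add: has_time_deriv_def)
  then have m: "(\<lambda>(t, x). u t x) \<in> borel_measurable (completion (lebesgue_on J \<Otimes>\<^sub>M lebesgue_on \<Omega>))"
    "(\<lambda>(t, x). v t x) \<in> borel_measurable (completion (lebesgue_on J \<Otimes>\<^sub>M lebesgue_on \<Omega>))"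
    by (simp_all add: L2Lp_space_def L2_time_def)
  obtain U where U: "st_rep J \<Omega> u U" using st_rep_exists[OF b m(1)] ..
  obtain V where V: "st_rep J \<Omega> v V" using st_rep_exists[OF b m(2)] ..
  show thesis
    by (rule that[OF U V st_rep_sq_int[OF b L2(1) U] st_rep_sq_int[OF b L2(2) V] has_time_deriv_dir_deriv[OF J \<Omega> d U V]])
qed

text \<open>The difference of the equations at a fixed time is divided by \<open>y\<close> and
  tested with \<open>\<phi>\<close>; \<open>d\<close> stands for the difference of the divergences
  and \<open>v\<close> for that of the time derivatives. The zero-order terms are grouped so that
  \<open>y\<close> multiplies \<open>q - q'\<close>, and the division therefore leaves
  \<open>q - q'\<close> alone.\<close>

lemma pde_difference_pairing:
  fixes \<Omega> :: "'a::euclidean_space set"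
  assumes \<Omega>: "open \<Omega>" "bounded \<Omega>" and c: "0 < c"
    and Y: "rep \<Omega> y Y" and lower: "AE x in lebesgue_on \<Omega>. c \<le> \<bar>y x\<bar>"
    and W: "rep \<Omega> w W" "sq_int W" and V: "rep \<Omega> v V" "sq_int V" and \<phi>: "sq_int \<phi>"
    and Q: "rep \<Omega> q Q" "\<And>x. \<bar>Q x\<bar> \<le> b" and Q': "rep \<Omega> q' Q'" "\<And>x. \<bar>Q' x\<bar> \<le> b"
    and pde: "AE x in lebesgue_on \<Omega>. v x - d x + (q x * w x + (q x - q' x) * y x) = 0"
  defines "r \<equiv> \<lambda>x. if x \<in> \<Omega> \<and> c \<le> \<bar>Y x\<bar> then 1 / Y x else 0"
  shows "(\<integral>x. d x * (1 / y x * \<phi> x) \<partial>lebesgue_on \<Omega>) = (\<integral>x. (q x - q' x) * \<phi> x \<partial>lebesgue_on \<Omega>)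
      + (\<integral>x. V x * (r x * \<phi> x) \<partial>lborel) + (\<integral>x. (Q x * W x) * (r x * \<phi> x) \<partial>lborel)"
    and "\<bar>\<integral>x. (Q x * W x) * (r x * \<phi> x) \<partial>lborel\<bar> \<le> b / c * (nrm2 W * nrm2 \<phi>)"
proof -
  have bS: "\<Omega> \<in> sets borel" using \<Omega> by simp
  have b0: "0 \<le> b" using Q(2)[of undefined] by linarith
  have lower': "AE x in lborel. x \<in> \<Omega> \<longrightarrow> c \<le> \<bar>y x\<bar>" using lower by (simp only: AE_lebesgue_on[OF bS])
  have r: "rep \<Omega> (\<lambda>x. 1 / y x) r" unfolding r_def by (rule rep_inverse[OF Y lower' bS])
  have rb: "\<bar>r x\<bar> \<le> 1 / c" for x using c by (auto simp: r_def divide_simps)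
  have c0: "0 \<le> 1 / c" using c by simp
  have \<phi>m: "\<phi> \<in> borel_measurable borel" using \<phi> by (simp add: sq_int_def)
  note s1 = Linf_mult_L2[OF \<phi> rep_borel[OF r] rb c0]
  note s2 = Linf_mult_L2[OF W(2) rep_borel[OF Q(1)] Q(2) b0]
  have "\<bar>\<integral>x. (Q x * W x) * (r x * \<phi> x) \<partial>lborel\<bar> \<le> nrm2 (\<lambda>x. Q x * W x) * nrm2 (\<lambda>x. r x * \<phi> x)"
    by (rule abs_integral_mult_le[OF s2(1) s1(1)])
  also have "\<dots> \<le> (b * nrm2 W) * (1 / c * nrm2 \<phi>)"
    using b0 by (intro mult_mono s2(2) s1(2) mult_nonneg_nonneg nrm2_nonneg)
  finally show "\<bar>\<integral>x. (Q x * W x) * (r x * \<phi> x) \<partial>lborel\<bar> \<le> b / c * (nrm2 W * nrm2 \<phi>)" by simp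
  have s3: "sq_int (\<lambda>x. Q x - Q' x)"
    by (intro sq_int_diff sq_int_bounded_rep[OF \<Omega>(2) bS Q] sq_int_bounded_rep[OF \<Omega>(2) bS Q'])
  have rQ: "rep \<Omega> (\<lambda>x. (q x - q' x) * \<phi> x) (\<lambda>x. (Q x - Q' x) * \<phi> x)"
    by (rule rep_mult_borel[OF rep_diff[OF Q(1) Q'(1)] \<phi>m])
  have rr: "rep \<Omega> (\<lambda>x. 1 / y x * \<phi> x) (\<lambda>x. r x * \<phi> x)" by (rule rep_mult_borel[OF r \<phi>m])
  have i: "integrable lborel (\<lambda>x. (Q x - Q' x) * \<phi> x)" "integrable lborel (\<lambda>x. V x * (r x * \<phi> x))"
    "integrable lborel (\<lambda>x. (Q x * W x) * (r x * \<phi> x))"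
    by (intro sq_int_mult s3 \<phi> V s1 s2)+
  have R: "rep \<Omega> (\<lambda>x. (q x - q' x) * \<phi> x + v x * (1 / y x * \<phi> x) + (q x * w x) * (1 / y x * \<phi> x))
     (\<lambda>x. (Q x - Q' x) * \<phi> x + V x * (r x * \<phi> x) + (Q x * W x) * (r x * \<phi> x))"
    by (intro rep_add rQ rep_mult[OF V(1) rr] rep_mult[OF rep_mult[OF Q(1) W(1)] rr])
  have "rep \<Omega> (\<lambda>x. d x * (1 / y x * \<phi> x)) (\<lambda>x. (Q x - Q' x) * \<phi> x + V x * (r x * \<phi> x) + (Q x * W x) * (r x * \<phi> x))"
  proof (rule rep_cong_AE[OF bS R])
    show "AE x in lebesgue_on \<Omega>. (q x - q' x) * \<phi> x + v x * (1 / y x * \<phi> x) + (q x * w x) * (1 / y x * \<phi> x) = d x * (1 / y x * \<phi> x)"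
      using pde lower
    proof eventually_elim
      case (elim x)
      then have "y x \<noteq> 0" using c by auto
      moreover have e: "d x = v x + q x * w x + (q x - q' x) * y x" using elim(1) by linarith
      ultimately show ?case unfolding e by (simp add: field_simps)
    qed
  qed
  from rep_integral(1)[OF bS this]
  have "(\<integral>x. d x * (1 / y x * \<phi> x) \<partial>lebesgue_on \<Omega>)
      = (\<integral>x. (Q x - Q' x) * \<phi> x \<partial>lborel) + (\<integral>x. V x * (r x * \<phi> x) \<partial>lborel) + (\<integral>x. (Q x * W x) * (r x * \<phi> x) \<partial>lborel)"
    using i by simp
  then show "(\<integral>x. d x * (1 / y x * \<phi> x) \<partial>lebesgue_on \<Omega>) = (\<integral>x. (q x - q' x) * \<phi> x \<partial>lebesgue_on \<Omega>)
      + (\<integral>x. V x * (r x * \<phi> x) \<partial>lborel) + (\<integral>x. (Q x * W x) * (r x * \<phi> x) \<partial>lborel)"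
    by (simp add: rep_integral(1)[OF bS rQ])
qed

text \<open>At a fixed time, \<open>e\<close> and \<open>e'\<close> are the values of the bump in
  time and of its derivative, and \<open>V\<close> is the time derivative in the denominator. As
  \<open>V\<close> is only L2 in space, the L2 bound is put on the product of \<open>W\<close> and
  \<open>\<phi>\<close>.\<close>

lemma time_pairing_slice_bound:
  assumes W: "sq_int W" and \<phi>: "sq_int \<phi>" and W\<phi>: "sq_int (\<lambda>x. W x * \<phi> x)" and V: "sq_int V"
    and r[measurable]: "r \<in> borel_measurable borel" and rb: "\<And>x. \<bar>r x\<bar> \<le> 1 / c" and c: "0 < c"
    and e: "\<bar>e\<bar> \<le> 1" "\<bar>e'\<bar> \<le> B"
  shows "\<bar>\<integral>x. W x * (r x * (e' * \<phi> x) + (- V x * (r x)\<^sup>2) * (e * \<phi> x)) \<partial>lborel\<bar>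
    \<le> B / c * (nrm2 W * nrm2 \<phi>) + 1 / c\<^sup>2 * (nrm2 (\<lambda>x. W x * \<phi> x) * nrm2 V)"
proof -
  have c0: "0 \<le> 1 / c" "0 \<le> 1 / c\<^sup>2" using c by simp_all
  have r2: "\<bar>(r x)\<^sup>2\<bar> \<le> 1 / c\<^sup>2" for x using power_mono[OF rb[of x], of 2] by (simp add: power_divide)
  note a = Linf_mult_L2[OF \<phi> r rb c0(1)]
  have r2m: "(\<lambda>x. (r x)\<^sup>2) \<in> borel_measurable borel" by measurable
  note b = Linf_mult_L2[OF V r2m r2 c0(2)]
  have B0: "0 \<le> B" using e(2) by linarith
  have i1: "integrable lborel (\<lambda>x. W x * (r x * \<phi> x))" by (rule sq_int_mult[OF W a(1)])
  have i2: "integrable lborel (\<lambda>x. (W x * \<phi> x) * ((r x)\<^sup>2 * V x))" by (rule sq_int_mult[OF W\<phi> b(1)])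
  have "(\<integral>x. W x * (r x * (e' * \<phi> x) + (- V x * (r x)\<^sup>2) * (e * \<phi> x)) \<partial>lborel)
      = (\<integral>x. e' * (W x * (r x * \<phi> x)) - e * ((W x * \<phi> x) * ((r x)\<^sup>2 * V x)) \<partial>lborel)"
    by (intro Bochner_Integration.integral_cong) (auto simp: algebra_simps)
  also have "\<dots> = e' * (\<integral>x. W x * (r x * \<phi> x) \<partial>lborel) - e * (\<integral>x. (W x * \<phi> x) * ((r x)\<^sup>2 * V x) \<partial>lborel)"
    using i1 i2 by simp
  also have "\<bar>\<dots>\<bar> \<le> \<bar>e'\<bar> * \<bar>\<integral>x. W x * (r x * \<phi> x) \<partial>lborel\<bar> + \<bar>e\<bar> * \<bar>\<integral>x. (W x * \<phi> x) * ((r x)\<^sup>2 * V x) \<partial>lborel\<bar>"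
    by (rule order_trans[OF abs_triangle_ineq4]) (simp add: abs_mult)
  also have "\<dots> \<le> B * (nrm2 W * nrm2 (\<lambda>x. r x * \<phi> x)) + 1 * (nrm2 (\<lambda>x. W x * \<phi> x) * nrm2 (\<lambda>x. (r x)\<^sup>2 * V x))"
    by (intro add_mono mult_mono e abs_integral_mult_le W a(1) W\<phi> b(1) B0) simp_all
  also have "\<dots> \<le> B * (nrm2 W * (1 / c * nrm2 \<phi>)) + 1 * (nrm2 (\<lambda>x. W x * \<phi> x) * (1 / c\<^sup>2 * nrm2 V))"
    by (intro add_mono mult_left_mono a(2) b(2) B0 nrm2_nonneg) simp
  finally show ?thesis by (simp add: mult_ac)
qed

text \<open>
  Testing the difference of the two equations with \<open>\<eta>(t) \<phi>(x) / y(t, x)\<close>, where \<open>\<eta>\<close> is a bump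
  in time, isolates the pairing of \<open>q - q'\<close> with \<open>\<phi>\<close>, because \<open>q\<close> does not depend on time.
\<close>

lemma potential_pairing_estimate:
  fixes \<Omega> :: "'a::euclidean_space set"
  assumes \<Omega>: "open \<Omega>" "bounded \<Omega>" "C2_boundary \<Omega>" and dim: "DIM('a) \<le> 3"
    and a: "a \<in> W1inf_space \<Omega>" and c: "0 < c"
    and J: "J = {\<alpha><..<\<beta>}" "\<alpha> < \<beta>" "J \<subseteq> {0<..<T}"
    and y: "parabolic_solution \<Omega> T a f g u0 q' y" and q': "q' \<in> admissible \<Omega> ql qu"
    and lower: "AE t in lebesgue_on J. AE x in lebesgue_on \<Omega>. c \<le> \<bar>y t x\<bar>"
  shows "\<exists>C\<ge>0. \<forall>q z \<phi>. q \<in> admissible \<Omega> ql qu \<longrightarrow> parabolic_solution \<Omega> T a f g u0 q z \<longrightarrow> \<phi> \<in> test_functions \<Omega> \<longrightarrow>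
     integrable (lebesgue_on {0<..<T}) (\<lambda>t. (Hs_norm 1 \<Omega> (\<lambda>x. z t x - y t x))\<^sup>2) \<and>
     \<bar>\<integral>x. (q x - q' x) * \<phi> x \<partial>lebesgue_on \<Omega>\<bar>
       \<le> C * sqrt (\<integral>t. (Hs_norm 1 \<Omega> (\<lambda>x. z t x - y t x))\<^sup>2 \<partial>lebesgue_on J) * Hs_norm 1 \<Omega> \<phi>"
proof -
  let ?T = "{0<..<T}" and ?M = "lebesgue_on \<Omega>"
  have bS: "\<Omega> \<in> sets borel" using \<Omega> by simp
  have oJ: "open J" and bJ: "J \<in> sets borel" and bddJ: "bounded J" using J(1) by simp_all
  have oT: "open ?T" and bT: "?T \<in> sets borel" by simp_all
  have D: "open (J \<times> \<Omega>)" "bounded (J \<times> \<Omega>)" by (intro open_Times oJ \<Omega> bounded_Times bddJ)+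
  define yt where "yt = time_deriv ?T ?M y"
  note yD = parabolic_solutionD[OF y, folded yt_def]
  obtain Y Yt where Y: "st_rep ?T \<Omega> y Y" "st_rep ?T \<Omega> yt Yt" "sq_int Y" "sq_int Yt" "dir_deriv (?T \<times> \<Omega>) (1, 0) Y Yt"
    by (rule time_deriv_st_reps[OF oT \<Omega>(1) yD(2)]) (rule that)
  note yH = L2Hs_2D[OF \<Omega>(1) yD(1) bT]
  have [measurable]: "Y \<in> borel_measurable borel" "Yt \<in> borel_measurable borel" using Y(3,4) by (simp_all add: sq_int_def)
  have lowerJ: "AE t in lborel. t \<in> J \<longrightarrow> (AE x in lebesgue_on \<Omega>. c \<le> \<bar>y t x\<bar>)"
    using lower by (simp only: AE_lebesgue_on[OF bJ])
  have ytL2: "AE t in lborel. t \<in> ?T \<longrightarrow> yt t \<in> L2_on \<Omega>" and ytn: "integrable (lebesgue_on ?T) (\<lambda>t. (L2_norm_on \<Omega> (yt t))\<^sup>2)"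
  proof -
    have "yt \<in> L2Lp_space ?T ?M 2" using yD(2) by (simp add: has_time_deriv_def)
    then have "AE t in lebesgue_on ?T. yt t \<in> L2_on \<Omega>" and "integrable (lebesgue_on ?T) (\<lambda>t. (L2_norm_on \<Omega> (yt t))\<^sup>2)"
      by (simp_all add: L2Lp_space_def L2_time_def)
    then show "AE t in lborel. t \<in> ?T \<longrightarrow> yt t \<in> L2_on \<Omega>" "integrable (lebesgue_on ?T) (\<lambda>t. (L2_norm_on \<Omega> (yt t))\<^sup>2)"
      by (simp_all only: AE_lebesgue_on[OF bT])
  qed
  have yrep: "AE t in lborel. t \<in> ?T \<longrightarrow> rep \<Omega> (y t) (\<lambda>x. Y (t, x))" and ytrep: "AE t in lborel. t \<in> ?T \<longrightarrow> rep \<Omega> (yt t) (\<lambda>x. Yt (t, x))"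
    using Y(1,2) by (simp_all add: st_rep_def)
  \<comment> \<open>The lower bound is given time by time; differentiating the reciprocal in
    direction \<open>(1, 0)\<close> needs it almost everywhere in space-time.\<close>
  have lowerY: "AE z in lborel. z \<in> J \<times> \<Omega> \<longrightarrow> c \<le> \<bar>Y z\<bar>"
  proof -
    have ae: "AE t in lborel. AE x in lborel. (t, x) \<in> J \<times> \<Omega> \<longrightarrow> c \<le> \<bar>Y (t, x)\<bar>"
      using lowerJ yrep
    proof eventually_elim
      case (elim t)
      show ?case
      proof (cases "t \<in> J")
        case True
        have 1: "AE x in lborel. x \<in> \<Omega> \<longrightarrow> c \<le> \<bar>y t x\<bar>" using elim(1) True by (simp only: AE_lebesgue_on[OF bS])
        have 2: "AE x in lborel. x \<in> \<Omega> \<longrightarrow> Y (t, x) = y t x" using elim(2) True J(3) by (auto simp: rep_def)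
        from 1 2 show ?thesis by eventually_elim auto
      qed simp
    qed
    have Ds: "J \<times> \<Omega> \<in> sets borel" by (rule borel_Times[OF bJ bS])
    have ms: "{z \<in> space (lborel \<Otimes>\<^sub>M lborel). z \<in> J \<times> \<Omega> \<longrightarrow> c \<le> \<bar>Y z\<bar>} \<in> sets (lborel \<Otimes>\<^sub>M lborel)"
      unfolding lborel_prod using Ds by measurable
    from lborel_pair.AE_pair_measure[OF ms ae] show ?thesis by (simp only: lborel_prod)
  qed
  define r where "r = (\<lambda>z. if z \<in> J \<times> \<Omega> \<and> c \<le> \<bar>Y z\<bar> then 1 / Y z else 0)"
  have R: "dir_deriv (J \<times> \<Omega>) (1, 0) r (\<lambda>z. - Yt z * (r z)\<^sup>2)" "sq_int r" "sq_int (\<lambda>z. - Yt z * (r z)\<^sup>2)" "\<And>z. \<bar>r z\<bar> \<le> 1 / c"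
    unfolding r_def
    by (rule dir_deriv_inverse[OF D dir_deriv_mono[OF Y(5)] Y(3,4) c lowerY]; use J(3) in auto)+
  have [measurable]: "r \<in> borel_measurable borel" using R(2) by (simp add: sq_int_def)

  obtain C1 where "C1 \<ge> 0 \<and> (\<forall>y z \<phi>. H2_on \<Omega> y \<longrightarrow> H2_on \<Omega> z \<longrightarrow> (AE x in lebesgue_on \<Omega>. c \<le> \<bar>y x\<bar>) \<longrightarrow> \<phi> \<in> test_functions \<Omega> \<longrightarrow>
     \<bar>\<integral>x. (weak_div \<Omega> (\<lambda>x. a x *\<^sub>R weak_grad \<Omega> z x) x - weak_div \<Omega> (\<lambda>x. a x *\<^sub>R weak_grad \<Omega> y x) x) * (1 / y x * \<phi> x) \<partial>lebesgue_on \<Omega>\<bar>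
       \<le> C1 * Hs_norm 1 \<Omega> (\<lambda>x. z x - y x) * Hs_norm 1 \<Omega> \<phi> * (1 + Hs_norm 2 \<Omega> y))"
    using divergence_pairing_estimate[OF \<Omega> dim a c] ..
  note C1 = conjunct1[OF this] conjunct2[OF this, rule_format]
  obtain C2 where "C2 \<ge> 0 \<and> (\<forall>f F g G. H1_on \<Omega> f \<longrightarrow> rep \<Omega> f F \<longrightarrow> H1_on \<Omega> g \<longrightarrow> rep \<Omega> g G \<longrightarrow>
     sq_int (\<lambda>x. F x * G x) \<and> nrm2 (\<lambda>x. F x * G x) \<le> C2 * Hs_norm 1 \<Omega> f * Hs_norm 1 \<Omega> g)"
    using product_L2_bound[OF \<Omega> dim] ..
  note C2 = conjunct1[OF this] conjunct2[OF this, rule_format]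
  \<comment> \<open>One bound for all admissible \<open>q\<close>, which keeps the final constant
    independent of \<open>q\<close>.\<close>
  define Qb where "Qb = \<bar>max \<bar>ql\<bar> \<bar>qu\<bar>\<bar>"
  have Qb: "0 \<le> Qb" by (simp add: Qb_def)
  have Qrep: "\<exists>Q. rep \<Omega> q Q \<and> (\<forall>x. \<bar>Q x\<bar> \<le> Qb)" if "q \<in> admissible \<Omega> ql qu" for q
  proof -
    have m: "q \<in> borel_measurable (lebesgue_on \<Omega>)" and ae: "AE x in lebesgue_on \<Omega>. ql \<le> q x \<and> q x \<le> qu"
      using that by (simp_all add: admissible_def Lp_space_def)
    have "AE x in lebesgue_on \<Omega>. \<bar>q x\<bar> \<le> max \<bar>ql\<bar> \<bar>qu\<bar>" using ae by eventually_elim linarith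
    from bounded_rep[OF bS m this] show ?thesis unfolding Qb_def by metis
  qed
  obtain Q' where Q': "rep \<Omega> q' Q'" "\<And>x. \<bar>Q' x\<bar> \<le> Qb" using Qrep[OF q'] by (elim exE conjE) simp

  \<comment> \<open>The middle third, so that the closed support of the bump lies in the open
    interval \<open>J\<close>.\<close>
  define \<alpha>' where "\<alpha>' = (2 * \<alpha> + \<beta>) / 3"
  define \<beta>' where "\<beta>' = (\<alpha> + 2 * \<beta>) / 3"
  have \<alpha>\<beta>: "\<alpha>' < \<beta>'" "cbox \<alpha>' \<beta>' \<subseteq> J" using J(1,2) by (auto simp: \<alpha>'_def \<beta>'_def)
  define \<eta> where "\<eta> = bump \<alpha>' \<beta>' 0"
  define \<eta>' where "\<eta>' = pderivative 1 \<eta>"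
  have \<eta>t: "\<eta> \<in> test_functions J" unfolding \<eta>_def by (rule bump_test_function[OF \<alpha>\<beta>(2)])
  have t\<eta>: "test_dir J 1 \<eta> \<eta>'" unfolding \<eta>'_def by (rule test_dir_Basis[OF \<eta>t]) simp
  have \<eta>1: "\<bar>\<eta> t\<bar> \<le> 1" for t unfolding \<eta>_def using bump_nonneg[of \<alpha>' \<beta>' 0 t] bump_le_1[of \<alpha>' \<beta>' 0 t] by simp
  obtain B where B: "0 \<le> B" "\<And>t. \<bar>\<eta>' t\<bar> \<le> B" using test_dir_bounded[OF t\<eta>] by metis
  have \<eta>0: "\<eta> t = 0" "\<eta>' t = 0" if "t \<notin> J" for t
  proof -
    obtain L where L: "L \<subseteq> J" "\<And>x. x \<notin> L \<Longrightarrow> \<eta> x = 0" "\<And>x. x \<notin> L \<Longrightarrow> \<eta>' x = 0" using test_dirE[OF t\<eta>] by metis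
    show "\<eta> t = 0" "\<eta>' t = 0" using L that by auto
  qed
  define \<kappa> where "\<kappa> = (\<integral>t. \<eta> t \<partial>lborel)"
  have \<kappa>: "0 < \<kappa>" unfolding \<kappa>_def \<eta>_def by (rule integral_bump_pos[OF \<alpha>\<beta>(1)])
  \<comment> \<open>An integral of a non-integrable function would be 0, contrary to
    \<open>0 < \<kappa>\<close>.\<close>
  have \<eta>i: "integrable lborel \<eta>"
  proof (rule ccontr)
    assume "\<not> integrable lborel \<eta>"
    then have "\<kappa> = 0" unfolding \<kappa>_def by (rule not_integrable_integral_eq)
    with \<kappa> show False by simp
  qed
  have \<eta>m[measurable]: "\<eta> \<in> borel_measurable borel" "\<eta>' \<in> borel_measurable borel"
    using test_dir_sq_int[OF t\<eta>] by (simp_all add: sq_int_def)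
  \<comment> \<open>One summand each for the flux, for the time derivative moved onto the bump and
    onto the reciprocal, and for the zero-order term.\<close>
  define K where "K = C1 + (B / c + C2 / c\<^sup>2) + Qb / c"
  have K0: "0 \<le> K" using C1(1) C2(1) B(1) c Qb by (simp add: K_def)
  \<comment> \<open>All norms of \<open>y\<close> that multiply \<open>h t\<close> at time
    \<open>t\<close>. The 1 absorbs the terms without such a norm and makes
    \<open>h t \<le> h t * e t\<close>; square integrability on \<open>J\<close> holds because
    \<open>J\<close> has finite length.\<close>
  define e where "e t = 1 + Hs_norm 2 \<Omega> (y t) + L2_norm_on \<Omega> (yt t)" for t
  have L2n0: "0 \<le> L2_norm_on \<Omega> k" for k by (simp add: Lp_norm_2)
  have e1: "1 \<le> e t" "1 + Hs_norm 2 \<Omega> (y t) \<le> e t" "L2_norm_on \<Omega> (yt t) \<le> e t" for t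
    using Hs_norm_2_nonneg[of \<Omega> "y t"] L2n0[of "yt t"] by (simp_all add: e_def)
  have em: "e \<in> borel_measurable (lebesgue_on J)" and e2: "integrable (lebesgue_on J) (\<lambda>t. (e t)\<^sup>2)"
  proof -
    have i1: "integrable (lebesgue_on J) (\<lambda>t. (Hs_norm 2 \<Omega> (y t))\<^sup>2)" by (rule integrable_lebesgue_on_mono[OF yH(2) J(3) bJ bT])
    have i2: "integrable (lebesgue_on J) (\<lambda>t. (L2_norm_on \<Omega> (yt t))\<^sup>2)" by (rule integrable_lebesgue_on_mono[OF ytn J(3) bJ bT])
    have "(\<lambda>t. sqrt ((Hs_norm 2 \<Omega> (y t))\<^sup>2)) \<in> borel_measurable (lebesgue_on J)" using i1 by measurable
    then have m1: "(\<lambda>t. Hs_norm 2 \<Omega> (y t)) \<in> borel_measurable (lebesgue_on J)"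
      by (simp add: abs_of_nonneg[OF Hs_norm_2_nonneg])
    have "(\<lambda>t. sqrt ((L2_norm_on \<Omega> (yt t))\<^sup>2)) \<in> borel_measurable (lebesgue_on J)" using i2 by measurable
    then have m2: "(\<lambda>t. L2_norm_on \<Omega> (yt t)) \<in> borel_measurable (lebesgue_on J)"
      by (simp add: abs_of_nonneg[OF L2n0])
    have "(\<lambda>t. 1 + Hs_norm 2 \<Omega> (y t) + L2_norm_on \<Omega> (yt t)) \<in> borel_measurable (lebesgue_on J)"
      by (intro borel_measurable_add borel_measurable_const m1 m2)
    then show em: "e \<in> borel_measurable (lebesgue_on J)" unfolding e_def .
    have "J \<in> lmeasurable" using J(1) by simp
    then interpret fin: finite_measure "lebesgue_on J" by (rule finite_measure_lebesgue_on)
    have i3: "integrable (lebesgue_on J) (\<lambda>t. 3 * (1 + (Hs_norm 2 \<Omega> (y t))\<^sup>2 + (L2_norm_on \<Omega> (yt t))\<^sup>2))"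
      using i1 i2 by simp
    show "integrable (lebesgue_on J) (\<lambda>t. (e t)\<^sup>2)"
    proof (rule Bochner_Integration.integrable_bound[OF i3])
      show "(\<lambda>t. (e t)\<^sup>2) \<in> borel_measurable (lebesgue_on J)" using em by measurable
      have "(1 + p + s)\<^sup>2 \<le> 3 * (1 + p\<^sup>2 + s\<^sup>2)" for p s :: real
      proof -
        have "0 \<le> (1 - p)\<^sup>2 + (1 - s)\<^sup>2 + (p - s)\<^sup>2" by simp
        then show ?thesis by (simp add: power2_eq_square algebra_simps)
      qed
      then show "AE t in lebesgue_on J. norm ((e t)\<^sup>2) \<le> norm (3 * (1 + (Hs_norm 2 \<Omega> (y t))\<^sup>2 + (L2_norm_on \<Omega> (yt t))\<^sup>2))"
        by (intro AE_I2) (simp add: e_def)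
    qed
  qed
  \<comment> \<open>Depends on \<open>y\<close> through \<open>e\<close>, but not on
    \<open>q\<close>, \<open>z\<close> or \<open>\<phi>\<close>.\<close>
  define C where "C = K * sqrt (\<integral>t. (e t)\<^sup>2 \<partial>lebesgue_on J) / \<kappa>"
  show ?thesis
  proof (intro exI[of _ C] conjI allI impI)
    show "0 \<le> C" unfolding C_def using K0 \<kappa> by simp
    fix q z \<phi>
    assume q: "q \<in> admissible \<Omega> ql qu" and z: "parabolic_solution \<Omega> T a f g u0 q z" and \<phi>: "\<phi> \<in> test_functions \<Omega>"
    define zt where "zt = time_deriv ?T ?M z"
    note zD = parabolic_solutionD[OF z, folded zt_def]
    obtain Z Zt where Z: "st_rep ?T \<Omega> z Z" "st_rep ?T \<Omega> zt Zt" "sq_int Z" "sq_int Zt" "dir_deriv (?T \<times> \<Omega>) (1, 0) Z Zt"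
      by (rule time_deriv_st_reps[OF oT \<Omega>(1) zD(2)]) (rule that)
    note zH = L2Hs_2D[OF \<Omega>(1) zD(1) bT]
    obtain Q where Q: "rep \<Omega> q Q" "\<And>x. \<bar>Q x\<bar> \<le> Qb" using Qrep[OF q] by (elim exE conjE) simp
    define W where "W p = Z p - Y p" for p
    define V where "V p = Zt p - Yt p" for p
    have W: "st_rep ?T \<Omega> (\<lambda>t x. z t x - y t x) W" and V: "st_rep ?T \<Omega> (\<lambda>t x. zt t x - yt t x) V"
      unfolding W_def V_def by (rule st_rep_diff[OF Z(1) Y(1)], rule st_rep_diff[OF Z(2) Y(2)])
    have sW: "sq_int W" and sV: "sq_int V" unfolding W_def V_def by (intro sq_int_diff Z Y)+
    have dW: "dir_deriv (J \<times> \<Omega>) (1, 0) W V"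
      unfolding W_def V_def
      by (rule dir_deriv_mono[OF dir_deriv_diff[OF open_Times[OF oT \<Omega>(1)] Z(5,3,4) Y(5,3,4)]]) (use J(3) in auto)
    define h where "h t = Hs_norm 1 \<Omega> (\<lambda>x. z t x - y t x)" for t
    have h0: "0 \<le> h t" for t unfolding h_def by (rule Hs_norm_1_nonneg)
    show hT: "integrable (lebesgue_on ?T) (\<lambda>t. (Hs_norm 1 \<Omega> (\<lambda>x. z t x - y t x))\<^sup>2)"
      by (rule Hs_norm_1_diff_time_integrable[OF \<Omega>(1) bT zD(1) yD(1) W])
    have hJ: "integrable (lebesgue_on J) (\<lambda>t. (h t)\<^sup>2)"
      unfolding h_def by (rule integrable_lebesgue_on_mono[OF hT J(3) bJ bT])
    have "(\<lambda>t. sqrt ((h t)\<^sup>2)) \<in> borel_measurable (lebesgue_on J)" using hJ by measurable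
    then have hm: "h \<in> borel_measurable (lebesgue_on J)" using h0 by simp
    have heJ: "integrable (lebesgue_on J) (\<lambda>t. h t * e t)" by (rule integrable_mult_L2[OF hm em hJ e2])
    define H\<phi> where "H\<phi> = Hs_norm 1 \<Omega> \<phi>"
    have H\<phi>0: "0 \<le> H\<phi>" unfolding H\<phi>_def by (rule Hs_norm_1_nonneg)
    note T = H1_test_function[OF \<Omega>(1) \<phi>]
    have \<phi>n: "nrm2 \<phi> \<le> H\<phi>" using L2_norm_le_Hs_norm_1[of \<Omega> \<phi>] by (simp add: H\<phi>_def rep_L2_norm[OF bS T(2)])
    have [measurable]: "\<phi> \<in> borel_measurable borel" "Q \<in> borel_measurable borel" "W \<in> borel_measurable borel" "V \<in> borel_measurable borel"
      using T(3) rep_borel[OF Q(1)] sW sV by (simp_all add: sq_int_def)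
    define \<zeta> where "\<zeta> p = \<eta> (fst p) * \<phi> (snd p)" for p :: "real \<times> 'a"
    define \<zeta>' where "\<zeta>' p = \<eta>' (fst p) * \<phi> (snd p)" for p :: "real \<times> 'a"
    have t\<zeta>: "test_dir (J \<times> \<Omega>) (1, 0) \<zeta> \<zeta>'"
    proof -
      obtain L where L: "compact L" "L \<subseteq> \<Omega>" "\<And>x. x \<notin> L \<Longrightarrow> \<phi> x = 0" using test_dirE[OF test_dir_smooth[OF \<phi>, of 0]] by metis
      have "continuous_on UNIV \<phi>" using \<phi> by (simp add: test_functions_def smooth_imp_continuous)
      from test_dir_tensor[OF t\<eta> this L] show ?thesis unfolding \<zeta>_def[abs_def] \<zeta>'_def[abs_def] .
    qed
    note s\<zeta> = test_dir_mult_bounded[OF R(2) t\<zeta>] test_dir_mult_bounded[OF R(3) t\<zeta>]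
    \<comment> \<open>The time derivative of the difference, for which no bound is available, is
      exchanged for that of the bump and of the reciprocal.\<close>
    have ibp: "(\<integral>p. W p * (r p * \<zeta>' p + (- Yt p * (r p)\<^sup>2) * \<zeta> p) \<partial>lborel) = - (\<integral>p. V p * (r p * \<zeta> p) \<partial>lborel)"
      by (rule integration_by_parts_product[OF D(1) dW sW sV R(1,2,3) t\<zeta>])
    have ik: "integrable lborel (\<lambda>p. W p * (r p * \<zeta>' p + (- Yt p * (r p)\<^sup>2) * \<zeta> p))"
      by (intro sq_int_mult sW sq_int_add s\<zeta>)
    have ib: "integrable lborel (\<lambda>p. V p * (r p * \<zeta> p))" by (intro sq_int_mult sV s\<zeta>)
    have id: "integrable lborel (\<lambda>p. (Q (snd p) * W p) * (r p * \<zeta> p))"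
    proof (rule sq_int_mult[OF Linf_mult_L2(1)[OF sW _ _ Qb] s\<zeta>(1)])
      have "snd \<in> borel_measurable (borel :: (real \<times> 'a) measure)"
        by (intro borel_measurable_continuous_onI continuous_on_snd continuous_on_id)
      then show "(\<lambda>p::real \<times> 'a. Q (snd p)) \<in> borel_measurable borel"
        by (rule measurable_compose) (rule rep_borel[OF Q(1)])
      show "\<bar>Q (snd p)\<bar> \<le> Qb" for p :: "real \<times> 'a" by (rule Q(2))
    qed
    define k where "k t = (\<integral>x. W (t, x) * (r (t, x) * \<zeta>' (t, x) + (- Yt (t, x) * (r (t, x))\<^sup>2) * \<zeta> (t, x)) \<partial>lborel)" for t
    define b where "b t = (\<integral>x. V (t, x) * (r (t, x) * \<zeta> (t, x)) \<partial>lborel)" for t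
    define d where "d t = (\<integral>x. (Q x * W (t, x)) * (r (t, x) * \<zeta> (t, x)) \<partial>lborel)" for t
    define P where "P = (\<integral>x. (q x - q' x) * \<phi> x \<partial>lebesgue_on \<Omega>)"
    have ki: "integrable lborel k" "(\<integral>t. k t \<partial>lborel) = (\<integral>p. W p * (r p * \<zeta>' p + (- Yt p * (r p)\<^sup>2) * \<zeta> p) \<partial>lborel)"
      using Fubini_lborel_pair(1,3)[OF ik] by (simp_all add: k_def[abs_def])
    have bi: "integrable lborel b" "(\<integral>t. b t \<partial>lborel) = (\<integral>p. V p * (r p * \<zeta> p) \<partial>lborel)"
      using Fubini_lborel_pair(1,3)[OF ib] by (simp_all add: b_def[abs_def])
    have di: "integrable lborel d" using Fubini_lborel_pair(3)[OF id] by (simp add: d_def[abs_def])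
    \<comment> \<open>The first bracket equals \<open>\<eta> t\<close> times the pairing of the
      divergence difference, which is already estimated. After integration \<open>b\<close> and
      \<open>k\<close> cancel by the integration by parts and \<open>d\<close> cancels itself,
      leaving \<open>\<kappa> * P\<close>.\<close>
    define G where "G t = (\<eta> t * P + b t + d t) + k t - d t" for t
    have Gi: "integrable lborel G" unfolding G_def by (intro Bochner_Integration.integrable_diff Bochner_Integration.integrable_add ki bi di integrable_mult_left \<eta>i)
    have "(\<integral>t. G t \<partial>lborel) = (\<integral>t. \<eta> t * P + b t + k t \<partial>lborel)" unfolding G_def by (simp add: add.assoc)
    also have "\<dots> = \<kappa> * P + (\<integral>t. b t \<partial>lborel) + (\<integral>t. k t \<partial>lborel)" using \<eta>i bi(1) ki(1) by (simp add: \<kappa>_def)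
    also have "\<dots> = \<kappa> * P" using bi(2) ki(2) ibp by simp
    finally have GP: "(\<integral>t. G t \<partial>lborel) = \<kappa> * P" .

    have pz: "AE t in lborel. t \<in> ?T \<longrightarrow> (AE x in lebesgue_on \<Omega>. zt t x - weak_div \<Omega> (\<lambda>y. a y *\<^sub>R weak_grad \<Omega> (z t) y) x + q x * z t x = f t x)"
      and py: "AE t in lborel. t \<in> ?T \<longrightarrow> (AE x in lebesgue_on \<Omega>. yt t x - weak_div \<Omega> (\<lambda>x. a x *\<^sub>R weak_grad \<Omega> (y t) x) x + q' x * y t x = f t x)"
      using zD(3) yD(3) by (simp_all only: AE_lebesgue_on[OF bT])
    have Wrep: "AE t in lborel. t \<in> ?T \<longrightarrow> rep \<Omega> (\<lambda>x. z t x - y t x) (\<lambda>x. W (t, x))"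
      and Vrep: "AE t in lborel. t \<in> ?T \<longrightarrow> rep \<Omega> (\<lambda>x. zt t x - yt t x) (\<lambda>x. V (t, x))"
      using W V by (simp_all add: st_rep_def)
    have ztL2: "AE t in lborel. t \<in> ?T \<longrightarrow> zt t \<in> L2_on \<Omega>"
    proof -
      have "zt \<in> L2Lp_space ?T ?M 2" using zD(2) by (simp add: has_time_deriv_def)
      then have "AE t in lebesgue_on ?T. zt t \<in> L2_on \<Omega>" by (simp add: L2Lp_space_def L2_time_def)
      then show ?thesis by (simp only: AE_lebesgue_on[OF bT])
    qed
    \<comment> \<open>The bound is proved time by time, since the flux estimate and the L2 product
      bounds are spatial.\<close>
    have Gle: "AE t in lborel. \<bar>G t\<bar> \<le> (if t \<in> J then K * H\<phi> * (h t * e t) else 0)"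
      using pz py Wrep Vrep ztL2 ytL2 yrep ytrep zH(1) yH(1) lowerJ
    proof eventually_elim
      case (elim t)
      show ?case
      proof (cases "t \<in> J")
        case False
        then have "\<zeta> (t, x) = 0" "\<zeta>' (t, x) = 0" for x using \<eta>0 by (simp_all add: \<zeta>_def \<zeta>'_def)
        then have "G t = 0" using \<eta>0(1)[OF False] by (simp add: G_def b_def d_def k_def)
        with False show ?thesis by simp
      next
        case True
        then have tT: "t \<in> ?T" using J(3) by blast
        let ?dz = "weak_div \<Omega> (\<lambda>x. a x *\<^sub>R weak_grad \<Omega> (z t) x)" and ?dy = "weak_div \<Omega> (\<lambda>x. a x *\<^sub>R weak_grad \<Omega> (y t) x)"
        have E: "AE x in lebesgue_on \<Omega>. zt t x - ?dz x + q x * z t x = f t x" "AE x in lebesgue_on \<Omega>. yt t x - ?dy x + q' x * y t x = f t x"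
          "rep \<Omega> (\<lambda>x. z t x - y t x) (\<lambda>x. W (t, x))" "rep \<Omega> (\<lambda>x. zt t x - yt t x) (\<lambda>x. V (t, x))"
          "zt t \<in> L2_on \<Omega>" "yt t \<in> L2_on \<Omega>" "rep \<Omega> (y t) (\<lambda>x. Y (t, x))" "rep \<Omega> (yt t) (\<lambda>x. Yt (t, x))"
          "H2_on \<Omega> (z t)" "H2_on \<Omega> (y t)" "AE x in lebesgue_on \<Omega>. c \<le> \<bar>y t x\<bar>"
          using elim tT True by blast+
        have H1w: "H1_on \<Omega> (\<lambda>x. z t x - y t x)" using E(9,10) by (intro H1_diff[OF \<Omega>(1)]) (simp_all add: H2_on_def)
        then have "(\<lambda>x. z t x - y t x) \<in> L2_on \<Omega>" by (simp add: H1_on_def)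
        then have sWt: "sq_int (\<lambda>x. W (t, x))" using rep_L2_iff[OF bS E(3)] by simp
        have sVt: "sq_int (\<lambda>x. V (t, x))" using rep_L2_iff[OF bS E(4)] L2_diff[OF bS E(5,6)] by simp
        have sYt: "sq_int (\<lambda>x. Yt (t, x))" using rep_L2_iff[OF bS E(8)] E(6) by simp
        have nW: "nrm2 (\<lambda>x. W (t, x)) \<le> h t"
          using L2_norm_le_Hs_norm_1[of \<Omega> "\<lambda>x. z t x - y t x"] by (simp add: h_def rep_L2_norm[OF bS E(3)])
        have nYt: "nrm2 (\<lambda>x. Yt (t, x)) \<le> e t" using e1(3)[of t] by (simp add: rep_L2_norm[OF bS E(8)])
        have W\<phi>: "sq_int (\<lambda>x. W (t, x) * \<phi> x)" "nrm2 (\<lambda>x. W (t, x) * \<phi> x) \<le> C2 * h t * H\<phi>"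
          using C2(2)[OF H1w E(3) T(1,2)] by (simp_all add: h_def H\<phi>_def)
        have rt: "(\<lambda>x. r (t, x)) = (\<lambda>x. if x \<in> \<Omega> \<and> c \<le> \<bar>Y (t, x)\<bar> then 1 / Y (t, x) else 0)"
          using True by (simp add: r_def fun_eq_iff)
        have rm: "(\<lambda>x. r (t, x)) \<in> borel_measurable borel"
          unfolding rt using rep_borel[OF E(7)] bS by measurable
        have he: "0 \<le> h t * e t" "h t \<le> h t * e t"
          using h0[of t] e1(1)[of t] mult_left_mono[OF e1(1)[of t] h0[of t]] by simp_all
        have pde: "AE x in lebesgue_on \<Omega>. (zt t x - yt t x) - (?dz x - ?dy x) + (q x * (z t x - y t x) + (q x - q' x) * y t x) = 0"
          using E(1,2) by eventually_elim (simp add: algebra_simps)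
        \<comment> \<open>Expresses the pairing of the divergence difference through the integrand
          defining \<open>P\<close> and the spatial integrals in \<open>b t\<close> and
          \<open>d t\<close>.\<close>
        note PD = pde_difference_pairing[OF \<Omega>(1,2) c E(7,11,3) sWt E(4) sVt T(3) Q Q' pde, folded rt]
        have rt': "(if x \<in> \<Omega> \<and> c \<le> \<bar>Y (t, x)\<bar> then 1 / Y (t, x) else 0) = r (t, x)" for x using fun_cong[OF rt, of x] by simp
        have bd: "b t = \<eta> t * (\<integral>x. V (t, x) * (r (t, x) * \<phi> x) \<partial>lborel)"
          "d t = \<eta> t * (\<integral>x. (Q x * W (t, x)) * (r (t, x) * \<phi> x) \<partial>lborel)"
          unfolding b_def d_def \<zeta>_def by (simp_all add: mult.left_commute[of _ "\<eta> t"] mult.assoc flip: integral_mult_right_zero)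
        have "\<eta> t * P + b t + d t = \<eta> t * (\<integral>x. (?dz x - ?dy x) * (1 / y t x * \<phi> x) \<partial>lebesgue_on \<Omega>)"
          unfolding bd P_def using PD(1) by (simp add: rt' distrib_left)
        also have "\<bar>\<dots>\<bar> \<le> 1 * (C1 * h t * H\<phi> * (1 + Hs_norm 2 \<Omega> (y t)))"
          unfolding abs_mult h_def H\<phi>_def by (intro mult_mono \<eta>1 C1(2) E \<phi>) simp_all
        also have "\<dots> \<le> C1 * h t * H\<phi> * e t"
          using C1(1) h0 H\<phi>0 e1(2)[of t] by (simp add: mult_left_mono)
        finally have 1: "\<bar>\<eta> t * P + b t + d t\<bar> \<le> C1 * (H\<phi> * (h t * e t))" by (simp add: mult_ac)
        have "\<bar>d t\<bar> \<le> 1 * (Qb / c * (nrm2 (\<lambda>x. W (t, x)) * nrm2 \<phi>))"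
          unfolding bd abs_mult using PD(2) by (intro mult_mono \<eta>1) (simp_all add: rt')
        also have "\<dots> \<le> Qb / c * (h t * H\<phi>)"
          using Qb c h0 by (simp only: mult_1) (intro mult_left_mono mult_mono nW \<phi>n; simp)
        also have "\<dots> \<le> Qb / c * (H\<phi> * (h t * e t))"
          using Qb c mult_left_mono[OF he(2) H\<phi>0] by (intro mult_left_mono) (simp_all add: mult_ac)
        finally have 2: "\<bar>d t\<bar> \<le> Qb / c * (H\<phi> * (h t * e t))" .
        have "\<bar>k t\<bar> \<le> B / c * (nrm2 (\<lambda>x. W (t, x)) * nrm2 \<phi>) + 1 / c\<^sup>2 * (nrm2 (\<lambda>x. W (t, x) * \<phi> x) * nrm2 (\<lambda>x. Yt (t, x)))"
          unfolding k_def \<zeta>_def \<zeta>'_def fst_conv snd_conv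
          by (rule time_pairing_slice_bound[OF sWt T(3) W\<phi>(1) sYt rm R(4) c \<eta>1 B(2)])
        also have "\<dots> \<le> B / c * (h t * H\<phi>) + 1 / c\<^sup>2 * ((C2 * h t * H\<phi>) * e t)"
          using B(1) c h0 C2(1) H\<phi>0 by (intro add_mono mult_left_mono mult_mono nW \<phi>n W\<phi>(2) nYt) simp_all
        also have "\<dots> \<le> B / c * (H\<phi> * (h t * e t)) + C2 / c\<^sup>2 * (H\<phi> * (h t * e t))"
        proof (rule add_mono)
          show "B / c * (h t * H\<phi>) \<le> B / c * (H\<phi> * (h t * e t))"
            using B(1) c mult_left_mono[OF he(2) H\<phi>0] by (intro mult_left_mono) (simp_all add: mult_ac)
        qed (simp add: mult_ac)
        finally have 3: "\<bar>k t\<bar> \<le> B / c * (H\<phi> * (h t * e t)) + C2 / c\<^sup>2 * (H\<phi> * (h t * e t))" .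
        have "\<bar>G t\<bar> \<le> \<bar>\<eta> t * P + b t + d t\<bar> + \<bar>k t\<bar> + \<bar>d t\<bar>" unfolding G_def by linarith
        also have "\<dots> \<le> C1 * (H\<phi> * (h t * e t)) + (B / c * (H\<phi> * (h t * e t)) + C2 / c\<^sup>2 * (H\<phi> * (h t * e t))) + Qb / c * (H\<phi> * (h t * e t))"
          using 1 2 3 by linarith
        also have "\<dots> = K * H\<phi> * (h t * e t)" by (simp only: K_def distrib_right mult.assoc)
        finally show ?thesis using True by simp
      qed
    qed
    have "\<kappa> * \<bar>P\<bar> = \<bar>\<integral>t. G t \<partial>lborel\<bar>" unfolding GP using \<kappa> by (simp add: abs_mult)
    also have "\<dots> \<le> (\<integral>t. K * H\<phi> * (h t * e t) \<partial>lebesgue_on J)"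
      by (rule integral_abs_le_lebesgue_on[OF bJ Gi _ Gle]) (use heJ in simp)
    also have "\<dots> = K * H\<phi> * (\<integral>t. h t * e t \<partial>lebesgue_on J)" by simp
    \<comment> \<open>Cauchy-Schwarz in time separates the unknown difference from the fixed weight
      \<open>e\<close>.\<close>
    also have "\<dots> \<le> K * H\<phi> * (sqrt (\<integral>t. (h t)\<^sup>2 \<partial>lebesgue_on J) * sqrt (\<integral>t. (e t)\<^sup>2 \<partial>lebesgue_on J))"
      using K0 H\<phi>0 order_trans[OF abs_ge_self Cauchy_Schwarz_integral[OF hm em hJ e2]] by (intro mult_left_mono) simp_all
    finally have "\<bar>P\<bar> \<le> K * H\<phi> * (sqrt (\<integral>t. (h t)\<^sup>2 \<partial>lebesgue_on J) * sqrt (\<integral>t. (e t)\<^sup>2 \<partial>lebesgue_on J)) / \<kappa>"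
      using \<kappa> by (simp add: pos_le_divide_eq mult.commute)
    also have "\<dots> = C * sqrt (\<integral>t. (h t)\<^sup>2 \<partial>lebesgue_on J) * H\<phi>" by (simp add: C_def)
    finally show "\<bar>\<integral>x. (q x - q' x) * \<phi> x \<partial>lebesgue_on \<Omega>\<bar>
       \<le> C * sqrt (\<integral>t. (Hs_norm 1 \<Omega> (\<lambda>x. z t x - y t x))\<^sup>2 \<partial>lebesgue_on J) * Hs_norm 1 \<Omega> \<phi>"
      by (simp add: P_def h_def H\<phi>_def)
  qed
qed

section \<open>From test functions to the dual norm\<close>

lemma gagliardo_nonneg: "0 \<le> gagliardo \<theta> f z"
  by (simp add: gagliardo_def split: prod.split)

lemma Hs_order_1_plus:
  assumes "0 < \<epsilon>" "\<epsilon> < 1"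
  shows "nat \<lfloor>1 + \<epsilon>\<rfloor> = Suc 0" "frac (1 + \<epsilon>) = \<epsilon>"
proof -
  have "\<lfloor>1 + \<epsilon>\<rfloor> = 1" using assms by (simp add: floor_eq_iff)
  then show "nat \<lfloor>1 + \<epsilon>\<rfloor> = Suc 0" "frac (1 + \<epsilon>) = \<epsilon>" by (simp_all add: frac_def)
qed

lemma Hs_norm_1_plus:
  assumes "0 < \<epsilon>" "\<epsilon> < 1"
  shows "Hs_norm (1 + \<epsilon>) \<Omega> f = sqrt ((L2_norm_on \<Omega> f)\<^sup>2 + (\<Sum>i\<in>Basis. (L2_norm_on \<Omega> (weak_pd \<Omega> i f))\<^sup>2 +
    (\<integral>z. gagliardo \<epsilon> (weak_pd \<Omega> i f) z \<partial>lebesgue_on (\<Omega> \<times> \<Omega>))))"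
  using assms by (simp only: Hs_norm_def Hs_order_1_plus[OF assms] sobolev_sq.simps if_True)

text \<open>The two norms differ by the Gagliardo integrals of the first derivatives. These are
  nonnegative, also where an integral takes its default value 0.\<close>

lemma Hs_norm_1_le_1_plus:
  assumes "0 < \<epsilon>" "\<epsilon> < 1"
  shows "Hs_norm 1 \<Omega> f \<le> Hs_norm (1 + \<epsilon>) \<Omega> f"
  unfolding Hs_norm_1 Hs_norm_1_plus[OF assms]
  by (intro real_sqrt_le_mono add_left_mono sum_mono) (simp add: integral_nonneg_AE gagliardo_nonneg)

lemma AE_pair_fst_snd:
  fixes P :: "'a::euclidean_space \<Rightarrow> bool"
  assumes "AE x in lborel. P x"
  shows "AE z in lborel. P (fst z) \<and> P (snd z)"
proof -
  obtain N where N: "{x. \<not> P x} \<subseteq> N" "N \<in> null_sets lborel" using assms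
    by (auto elim!: AE_E simp: null_sets_def)
  have "emeasure (lborel \<Otimes>\<^sub>M lborel) (N \<times> (UNIV :: 'a set)) = 0" "emeasure (lborel \<Otimes>\<^sub>M lborel) ((UNIV :: 'a set) \<times> N) = 0"
    using N(2) by (subst lborel.emeasure_pair_measure_Times; auto)+
  moreover have "N \<times> (UNIV :: 'a set) \<in> sets borel" "(UNIV :: 'a set) \<times> N \<in> sets borel" using N(2) by (auto intro!: borel_Times)
  ultimately have "N \<times> (UNIV :: 'a set) \<in> null_sets lborel" "(UNIV :: 'a set) \<times> N \<in> null_sets lborel"
    by (simp_all add: null_sets_def lborel_prod)
  then have "N \<times> UNIV \<union> UNIV \<times> N \<in> null_sets lborel" by (rule null_sets.Un)
  then show ?thesis by (rule AE_I') (use N(1) in auto)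
qed

lemma zero_test_function:
  fixes \<Omega> :: "'a::euclidean_space set" and i :: 'a
  shows "(\<lambda>x. 0) \<in> test_functions \<Omega>" "pderivative i (\<lambda>x. 0) = (\<lambda>x. 0)"
proof -
  have d: "pderivative j (\<lambda>x::'a. 0) = (\<lambda>x. 0)" for j by (simp add: pderivative_def fun_eq_iff)
  have "C_k k (\<lambda>x::'a. 0)" for k by (induction k) (simp_all add: d)
  then show "(\<lambda>x. 0) \<in> test_functions \<Omega>" by (simp add: test_functions_def smooth_def)
  show "pderivative i (\<lambda>x. 0) = (\<lambda>x. 0)" by (rule d)
qed

text \<open>The supremum in the dual norm must range over a nonempty set. The chosen derivative of 0
  vanishes only almost everywhere, so its Gagliardo integral has to be evaluated through null
  sets.\<close>

lemma zero_in_Hs0_space: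
  fixes \<Omega> :: "'a::euclidean_space set"
  assumes \<Omega>: "open \<Omega>" and \<epsilon>: "0 < \<epsilon>" "\<epsilon> < 1"
  shows "(\<lambda>x. 0) \<in> Hs0_space (1 + \<epsilon>) \<Omega>"
proof -
  let ?z = "\<lambda>x::'a. 0 :: real"
  have b: "\<Omega> \<in> sets borel" using \<Omega> by simp
  note H = H1_test_function[OF \<Omega> zero_test_function(1)]
  have r: "rep \<Omega> (weak_pd \<Omega> i ?z) ?z" if "i \<in> Basis" for i using H(4)[OF that] by (simp add: zero_test_function(2))
  have w: "has_weak_pd \<Omega> i ?z ?z" if i: "i \<in> Basis" for i
  proof -
    have "sq_int ?z" by (rule H(3))
    then show ?thesis by (subst has_weak_pd_iff_rep[OF \<Omega> i H(2,3) H(2,3)]) simp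
  qed
  have L2: "?z \<in> L2_on \<Omega>" using H(1) by (simp add: H1_on_def)
  have "gagliardo \<epsilon> ?z = (\<lambda>z. 0)" by (simp add: gagliardo_def fun_eq_iff)
  then have "in_sobolev 0 \<epsilon> \<Omega> ?z" using L2 by simp
  with w L2 have "in_sobolev (Suc 0) \<epsilon> \<Omega> ?z" by auto
  then have Hs: "?z \<in> Hs_space (1 + \<epsilon>) \<Omega>" by (simp only: Hs_space_def Hs_order_1_plus[OF \<epsilon>] mem_Collect_eq)
  have "(\<integral>z. gagliardo \<epsilon> (weak_pd \<Omega> i ?z) z \<partial>lebesgue_on (\<Omega> \<times> \<Omega>)) = 0" if i: "i \<in> Basis" for i
  proof (rule integral_eq_zero_AE)
    have p: "\<Omega> \<times> \<Omega> \<in> sets borel" using open_Times[OF \<Omega> \<Omega>] by simp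
    have "AE x in lborel. x \<in> \<Omega> \<longrightarrow> 0 = weak_pd \<Omega> i ?z x" using r[OF i] by (simp add: rep_def)
    from AE_pair_fst_snd[OF this] show "AE z in lebesgue_on (\<Omega> \<times> \<Omega>). gagliardo \<epsilon> (weak_pd \<Omega> i ?z) z = 0"
      unfolding AE_lebesgue_on[OF p] by (rule eventually_mono) (auto simp: gagliardo_def)
  qed
  moreover have "L2_norm_on \<Omega> (weak_pd \<Omega> i ?z) = 0" if "i \<in> Basis" for i
    by (simp add: rep_L2_norm[OF b r[OF that]] nrm2_def)
  ultimately have "Hs_norm (1 + \<epsilon>) \<Omega> ?z = 0" by (simp add: Hs_norm_1_plus[OF \<epsilon>] Lp_norm_2)
  then show ?thesis using Hs zero_test_function(1) unfolding Hs0_space_def by (auto intro!: exI[of _ "\<lambda>n. ?z"])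
qed

lemma Hs_norm_1_zero:
  assumes \<Omega>: "open \<Omega>" shows "Hs_norm 1 \<Omega> (\<lambda>x. 0) = 0"
proof -
  have b: "\<Omega> \<in> sets borel" using \<Omega> by simp
  note H = H1_test_function[OF \<Omega> zero_test_function(1)]
  have "L2_norm_on \<Omega> (weak_pd \<Omega> i (\<lambda>x. 0)) = 0" if "i \<in> Basis" for i
    using rep_L2_norm[OF b H(4)[OF that]] by (simp add: nrm2_def zero_test_function(2))
  then show ?thesis by (simp add: Hs_norm_1 Lp_norm_2)
qed

text \<open>Approximation in order \<open>1 + \<epsilon>\<close> implies approximation in H1, so
  both sides pass to the limit. The factor 2 comes from using the squared inequality for differences
  twice.\<close>

lemma Hs0_pairing_bound:
  assumes \<Omega>: "open \<Omega>" and \<epsilon>: "0 < \<epsilon>" "\<epsilon> < 1" and p: "p \<in> L2_on \<Omega>" and C: "0 \<le> C"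
    and le: "\<And>\<phi>. \<phi> \<in> test_functions \<Omega> \<Longrightarrow> \<bar>\<integral>x. p x * \<phi> x \<partial>lebesgue_on \<Omega>\<bar> \<le> C * Hs_norm 1 \<Omega> \<phi>"
    and v: "v \<in> Hs0_space (1 + \<epsilon>) \<Omega>"
  shows "\<bar>\<integral>x. p x * v x \<partial>lebesgue_on \<Omega>\<bar> \<le> 2 * C * Hs_norm (1 + \<epsilon>) \<Omega> v"
proof -
  have b: "\<Omega> \<in> sets borel" using \<Omega> by simp
  obtain \<phi> where \<phi>: "\<And>n. \<phi> n \<in> test_functions \<Omega>" "(\<lambda>n. Hs_norm (1 + \<epsilon>) \<Omega> (\<lambda>x. \<phi> n x - v x)) \<longlonglongrightarrow> 0"
    using v by (auto simp: Hs0_space_def)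
  have "in_sobolev (Suc 0) \<epsilon> \<Omega> v"
    using v by (simp only: Hs0_space_def Hs_space_def Hs_order_1_plus[OF \<epsilon>] mem_Collect_eq)
  then have v1: "H1_on \<Omega> v" by (rule in_sobolev_imp_H1[OF \<Omega>])
  note T = H1_test_function[OF \<Omega> \<phi>(1)] and Z = H1_test_function[OF \<Omega> zero_test_function(1)]
  define \<delta> where "\<delta> n = Hs_norm 1 \<Omega> (\<lambda>x. \<phi> n x - v x)" for n
  have \<delta>: "\<delta> \<longlonglongrightarrow> 0"
    unfolding \<delta>_def by (rule tendsto_sandwich[OF _ _ tendsto_const \<phi>(2)]) (simp_all add: Hs_norm_1_nonneg Hs_norm_1_le_1_plus[OF \<epsilon>])
  obtain P where P: "rep \<Omega> p P" "sq_int P" using L2_rep[OF b p] .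
  obtain V where V: "rep \<Omega> v V" "sq_int V" using L2_rep[OF b] v1 unfolding H1_on_def by blast
  have conv: "(\<lambda>n. \<integral>x. p x * \<phi> n x \<partial>lebesgue_on \<Omega>) \<longlonglongrightarrow> (\<integral>x. p x * v x \<partial>lebesgue_on \<Omega>)"
  proof (rule LIM_zero_cancel, rule Lim_null_comparison)
    show "(\<lambda>n. nrm2 P * \<delta> n) \<longlonglongrightarrow> 0" using tendsto_mult_left[OF \<delta>, of "nrm2 P"] by simp
    have "\<bar>(\<integral>x. p x * \<phi> n x \<partial>lebesgue_on \<Omega>) - (\<integral>x. p x * v x \<partial>lebesgue_on \<Omega>)\<bar> \<le> nrm2 P * \<delta> n" for n
    proof -
      have "(\<integral>x. p x * \<phi> n x \<partial>lebesgue_on \<Omega>) - (\<integral>x. p x * v x \<partial>lebesgue_on \<Omega>) = (\<integral>x. P x * (\<phi> n x - V x) \<partial>lborel)"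
        by (simp add: rep_integral(1)[OF b rep_mult[OF P(1) T(2)]] rep_integral(1)[OF b rep_mult[OF P(1) V(1)]]
            right_diff_distrib Bochner_Integration.integral_diff sq_int_mult[OF P(2) T(3)] sq_int_mult[OF P(2) V(2)])
      also have "\<bar>\<dots>\<bar> \<le> nrm2 P * nrm2 (\<lambda>x. \<phi> n x - V x)" by (rule abs_integral_mult_le[OF P(2) sq_int_diff[OF T(3) V(2)]])
      also have "nrm2 (\<lambda>x. \<phi> n x - V x) \<le> \<delta> n"
        unfolding \<delta>_def rep_L2_norm[OF b rep_diff[OF T(2) V(1)], symmetric] by (rule L2_norm_le_Hs_norm_1)
      finally show ?thesis by (simp add: mult_left_mono)
    qed
    then show "\<forall>\<^sub>F n in sequentially. norm ((\<integral>x. p x * \<phi> n x \<partial>lebesgue_on \<Omega>) - (\<integral>x. p x * v x \<partial>lebesgue_on \<Omega>)) \<le> nrm2 P * \<delta> n"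
      by simp
  qed
  have "Hs_norm 1 \<Omega> (\<phi> n) \<le> sqrt (2 * (\<delta> n)\<^sup>2 + 4 * (Hs_norm 1 \<Omega> v)\<^sup>2)" for n
  proof (rule real_le_rsqrt)
    have d: "H1_on \<Omega> (\<lambda>x. \<phi> n x - v x)" "H1_on \<Omega> (\<lambda>x. 0 - v x)"
      by (rule H1_diff[OF \<Omega> T(1) v1], rule H1_diff[OF \<Omega> Z(1) v1])
    \<comment> \<open>Only a bound for differences is available, so \<open>\<phi> n\<close> is
      written as a difference and \<open>- v\<close> as \<open>0 - v\<close>. Two factors of 2 on
      the squared norm of \<open>v\<close> make the 4.\<close>
    have "(Hs_norm 1 \<Omega> (\<phi> n))\<^sup>2 = (Hs_norm 1 \<Omega> (\<lambda>x. (\<phi> n x - v x) - (0 - v x)))\<^sup>2" by simp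
    also have "\<dots> \<le> 2 * (\<delta> n)\<^sup>2 + 2 * (Hs_norm 1 \<Omega> (\<lambda>x. 0 - v x))\<^sup>2"
      unfolding \<delta>_def by (rule Hs_norm_1_diff_power2_le[OF \<Omega> d])
    also have "(Hs_norm 1 \<Omega> (\<lambda>x. 0 - v x))\<^sup>2 \<le> 2 * (Hs_norm 1 \<Omega> v)\<^sup>2"
      using Hs_norm_1_diff_power2_le[OF \<Omega> Z(1) v1] by (simp only: Hs_norm_1_zero[OF \<Omega>]) simp
    finally show "(Hs_norm 1 \<Omega> (\<phi> n))\<^sup>2 \<le> 2 * (\<delta> n)\<^sup>2 + 4 * (Hs_norm 1 \<Omega> v)\<^sup>2" by simp
  qed
  then have "\<bar>\<integral>x. p x * \<phi> n x \<partial>lebesgue_on \<Omega>\<bar> \<le> C * sqrt (2 * (\<delta> n)\<^sup>2 + 4 * (Hs_norm 1 \<Omega> v)\<^sup>2)" for n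
    using order_trans[OF le[OF \<phi>(1)] mult_left_mono[OF _ C]] by blast
  moreover have "(\<lambda>n. \<bar>\<integral>x. p x * \<phi> n x \<partial>lebesgue_on \<Omega>\<bar>) \<longlonglongrightarrow> \<bar>\<integral>x. p x * v x \<partial>lebesgue_on \<Omega>\<bar>"
    by (rule tendsto_rabs[OF conv])
  moreover have "(\<lambda>n. C * sqrt (2 * (\<delta> n)\<^sup>2 + 4 * (Hs_norm 1 \<Omega> v)\<^sup>2)) \<longlonglongrightarrow> C * sqrt (2 * 0\<^sup>2 + 4 * (Hs_norm 1 \<Omega> v)\<^sup>2)"
    by (intro tendsto_intros \<delta>)
  ultimately have "\<bar>\<integral>x. p x * v x \<partial>lebesgue_on \<Omega>\<bar> \<le> C * sqrt (2 * 0\<^sup>2 + 4 * (Hs_norm 1 \<Omega> v)\<^sup>2)"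
    by (intro LIMSEQ_le) auto
  also have "\<dots> = 2 * C * Hs_norm 1 \<Omega> v" using Hs_norm_1_nonneg[of \<Omega> v] by (simp add: real_sqrt_mult)
  also have "\<dots> \<le> 2 * C * Hs_norm (1 + \<epsilon>) \<Omega> v" using C by (intro mult_left_mono Hs_norm_1_le_1_plus \<epsilon>) simp
  finally show ?thesis .
qed

lemma Hs_dual_norm_le:
  assumes \<Omega>: "open \<Omega>" and \<epsilon>: "0 < \<epsilon>" "\<epsilon> < 1" and p: "p \<in> L2_on \<Omega>" and C: "0 \<le> C"
    and le: "\<And>\<phi>. \<phi> \<in> test_functions \<Omega> \<Longrightarrow> \<bar>\<integral>x. p x * \<phi> x \<partial>lebesgue_on \<Omega>\<bar> \<le> C * Hs_norm 1 \<Omega> \<phi>"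
  shows "Hs_dual_norm (1 + \<epsilon>) \<Omega> p \<le> 2 * C"
  unfolding Hs_dual_norm_def
proof (rule cSUP_least)
  show "Hs0_space (1 + \<epsilon>) \<Omega> \<noteq> {}" using zero_in_Hs0_space[OF \<Omega> \<epsilon>] by blast
  fix v assume v: "v \<in> Hs0_space (1 + \<epsilon>) \<Omega>"
  have n: "0 \<le> Hs_norm (1 + \<epsilon>) \<Omega> v" using Hs_norm_1_nonneg[of \<Omega> v] Hs_norm_1_le_1_plus[OF \<epsilon>, of \<Omega> v] by linarith
  show "\<bar>\<integral>x. p x * v x \<partial>lebesgue_on \<Omega>\<bar> / Hs_norm (1 + \<epsilon>) \<Omega> v \<le> 2 * C"
  proof (cases "Hs_norm (1 + \<epsilon>) \<Omega> v = 0")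
    \<comment> \<open>An element of norm zero contributes 0, as division by zero gives 0.\<close>
    case True then show ?thesis using C by simp
  next
    case False
    then show ?thesis using n Hs0_pairing_bound[OF \<Omega> \<epsilon> p C le v] by (simp add: pos_divide_le_eq)
  qed
qed

section \<open>The time interval and the stability constant\<close>

text \<open>A relatively open set may reach the final time \<open>T\<close>, whereas the bump in
  time needs room inside the open interval. Taking times strictly to the left of a point of
  \<open>I\<close> stays below \<open>T\<close> even when that point is \<open>T\<close>.\<close>

lemma openin_time_subinterval:
  fixes I :: "real set"
  assumes "openin (top_of_set {0<..T}) I" "I \<noteq> {}"
  obtains \<alpha> \<beta> where "\<alpha> < \<beta>" "{\<alpha><..<\<beta>} \<subseteq> I" "{\<alpha><..<\<beta>} \<subseteq> {0<..<T}"
proof -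
  obtain S where S: "open S" "I = {0<..T} \<inter> S" using assms(1) by (auto simp: openin_open)
  obtain p where p: "p \<in> I" using assms(2) by blast
  obtain e where e: "e > 0" "ball p e \<subseteq> S" using S p by (metis IntD2 openE)
  have p0: "0 < p" "p \<le> T" using p S(2) by auto
  show thesis
  proof (rule that)
    \<comment> \<open>The maximum with 0 cuts off times before the start.\<close>
    show "max 0 (p - e) < p" using p0 e(1) by simp
    show "{max 0 (p - e)<..<p} \<subseteq> {0<..<T}" using p0 by auto
    have "{max 0 (p - e)<..<p} \<subseteq> ball p e" by (auto simp: dist_real_def)
    then show "{max 0 (p - e)<..<p} \<subseteq> I" using e(2) p0 S(2) by auto
  qed
qed

text \<open>The pairing estimate is localised to a subinterval of \<open>I\<close>, where the norm
  of the difference is at most that over \<open>I\<close>; duality then turns it into the bound on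
  the norm of order \<open>- (1 + \<epsilon>)\<close>.\<close>

lemma potential_stability:
  fixes \<Omega> :: "'a::euclidean_space set"
  assumes \<Omega>: "open \<Omega>" "bounded \<Omega>" "C2_boundary \<Omega>" and dim: "DIM('a) \<le> 3"
    and I: "openin (top_of_set {0<..T}) I" "I \<noteq> {}"
    and a: "a \<in> W1inf_space \<Omega>"
    and u: "\<And>q. q \<in> admissible \<Omega> qlow qup \<Longrightarrow> parabolic_solution \<Omega> T a f g u0 q (u q)"
    and qdag: "qdag \<in> admissible \<Omega> qlow qup"
    and c: "0 < c" and lower: "AE t in lebesgue_on I. AE x in lebesgue_on \<Omega>. c \<le> \<bar>u qdag t x\<bar>"
    and \<epsilon>: "0 < \<epsilon>" "\<epsilon> < 1"
  shows "\<exists>C>0. \<forall>q\<in>admissible \<Omega> qlow qup. Hs_dual_norm (1 + \<epsilon>) \<Omega> (\<lambda>x. q x - qdag x)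
      \<le> C * L2_time_norm I (Hs_norm 1 \<Omega>) (\<lambda>t x. u q t x - u qdag t x)"
proof -
  obtain \<alpha> \<beta> where \<alpha>\<beta>: "\<alpha> < \<beta>" "{\<alpha><..<\<beta>} \<subseteq> I" "{\<alpha><..<\<beta>} \<subseteq> {0<..<T}"
    by (rule openin_time_subinterval[OF I]) (rule that)
  let ?J = "{\<alpha><..<\<beta>}"
  have "I \<in> sets borel"
  proof -
    obtain S where "open S" "I = {0<..T} \<inter> S" using I(1) by (auto simp: openin_open)
    then show ?thesis by simp
  qed
  note sets = this
  have "I \<subseteq> {0<..T}" using openin_imp_subset[OF I(1)] .
  then have IT: "I \<subseteq> insert T {0<..<T}" by auto
  have bJ: "?J \<in> sets borel" by simp
  have "AE t in lborel. t \<in> I \<longrightarrow> (AE x in lebesgue_on \<Omega>. c \<le> \<bar>u qdag t x\<bar>)" using lower by (simp only: AE_lebesgue_on[OF sets])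
  then have lowerJ: "AE t in lebesgue_on ?J. AE x in lebesgue_on \<Omega>. c \<le> \<bar>u qdag t x\<bar>"
    unfolding AE_lebesgue_on[OF bJ] by (rule eventually_mono) (use \<alpha>\<beta>(2) in blast)
  obtain K where K: "0 \<le> K" "\<And>q z \<phi>. q \<in> admissible \<Omega> qlow qup \<Longrightarrow> parabolic_solution \<Omega> T a f g u0 q z \<Longrightarrow> \<phi> \<in> test_functions \<Omega> \<Longrightarrow>
     integrable (lebesgue_on {0<..<T}) (\<lambda>t. (Hs_norm 1 \<Omega> (\<lambda>x. z t x - u qdag t x))\<^sup>2) \<and>
     \<bar>\<integral>x. (q x - qdag x) * \<phi> x \<partial>lebesgue_on \<Omega>\<bar>
       \<le> K * sqrt (\<integral>t. (Hs_norm 1 \<Omega> (\<lambda>x. z t x - u qdag t x))\<^sup>2 \<partial>lebesgue_on ?J) * Hs_norm 1 \<Omega> \<phi>"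
    using potential_pairing_estimate[OF \<Omega> dim a c refl \<alpha>\<beta>(1,3) u[OF qdag] qdag lowerJ] by (elim exE conjE) simp
  show ?thesis
  \<comment> \<open>The factor 2 is lost in the passage to the dual norm; the added 1 makes the
    constant positive when \<open>K = 0\<close>.\<close>
  proof (intro exI[of _ "2 * K + 1"] conjI ballI)
    show "0 < 2 * K + 1" using K(1) by simp
    fix q assume q: "q \<in> admissible \<Omega> qlow qup"
    let ?h = "\<lambda>t. (Hs_norm 1 \<Omega> (\<lambda>x. u q t x - u qdag t x))\<^sup>2"
    define N where "N = L2_time_norm I (Hs_norm 1 \<Omega>) (\<lambda>t x. u q t x - u qdag t x)"
    have N0: "0 \<le> N" unfolding N_def L2_time_norm_def by (simp add: integral_nonneg_AE)
    have int: "integrable (lebesgue_on {0<..<T}) ?h" using K(2)[OF q u[OF q] zero_test_function(1)] ..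
    have "(\<integral>t. ?h t \<partial>lebesgue_on ?J) \<le> (\<integral>t. ?h t \<partial>lebesgue_on I)"
      by (rule integral_lebesgue_on_mono_endpoint[OF int _ _ bJ sets \<alpha>\<beta>(2,3) IT]) simp_all
    then have J: "sqrt (\<integral>t. ?h t \<partial>lebesgue_on ?J) \<le> N" unfolding N_def L2_time_norm_def by (rule real_sqrt_le_mono)
    have "\<bar>\<integral>x. (q x - qdag x) * \<phi> x \<partial>lebesgue_on \<Omega>\<bar> \<le> (K * N) * Hs_norm 1 \<Omega> \<phi>" if "\<phi> \<in> test_functions \<Omega>" for \<phi>
    proof -
      have "K * sqrt (\<integral>t. ?h t \<partial>lebesgue_on ?J) * Hs_norm 1 \<Omega> \<phi> \<le> (K * N) * Hs_norm 1 \<Omega> \<phi>"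
        using K(1) J by (intro mult_right_mono mult_left_mono Hs_norm_1_nonneg)
      with K(2)[OF q u[OF q] that] show ?thesis by linarith
    qed
    moreover have "(\<lambda>x. q x - qdag x) \<in> L2_on \<Omega>"
      using q qdag \<Omega>(1) by (intro L2_diff) (simp_all add: admissible_def)
    ultimately have "Hs_dual_norm (1 + \<epsilon>) \<Omega> (\<lambda>x. q x - qdag x) \<le> 2 * (K * N)"
      using K(1) N0 by (intro Hs_dual_norm_le \<Omega> \<epsilon>) simp_all
    also have "\<dots> \<le> (2 * K + 1) * N" using N0 by (simp add: distrib_right)
    finally show "Hs_dual_norm (1 + \<epsilon>) \<Omega> (\<lambda>x. q x - qdag x)
      \<le> (2 * K + 1) * L2_time_norm I (Hs_norm 1 \<Omega>) (\<lambda>t x. u q t x - u qdag t x)" unfolding N_def .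
  qed
qed

theorem lemma4p1:
  fixes \<Omega> :: "'a::euclidean_space set"
    and I :: "real set"
    and T qlow qup c0 :: real
    and a u0 qdag :: "'a \<Rightarrow> real"
    and f g :: "real \<Rightarrow> 'a \<Rightarrow> real"
    and u :: "('a \<Rightarrow> real) \<Rightarrow> real \<Rightarrow> 'a \<Rightarrow> real"
  assumes "open \<Omega>" and "bounded \<Omega>" and "connected \<Omega>" and "C2_boundary \<Omega>"
    and "0 < T"
    and "openin (top_of_set {0<..T}) I" and "is_interval I" and "I \<noteq> {}"
    and "a \<in> W1inf_space \<Omega>" and "\<exists>a0>0. AE x in lebesgue_on \<Omega>. a0 \<le> a x"
    and "f \<in> L2Lp_space {0<..<T} (lebesgue_on \<Omega>) 2"
    and "g \<in> L2Hs_bd_space {0<..<T} \<Omega> (3/2)"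
    and "g \<in> HthetaL2_space (3/4) {0<..<T} (surface_measure \<Omega>)"
    and "u0 \<in> Hs_space 1 \<Omega>"
    and "0 < qlow" and "qlow \<le> qup"
    and "\<forall>q\<in>admissible \<Omega> qlow qup. parabolic_solution \<Omega> T a f g u0 q (u q)"
    and "qdag \<in> admissible \<Omega> qlow qup"
    and "0 < c0" and "AE t in lebesgue_on I. AE x in lebesgue_on \<Omega>. c0 \<le> \<bar>u qdag t x\<bar>"
  shows "(DIM('a) = 2 \<longrightarrow>
            (\<forall>\<epsilon>\<in>{0<..<1/2}. \<exists>C>0. \<forall>q\<in>admissible \<Omega> qlow qup.
               Hs_dual_norm (1 + \<epsilon>) \<Omega> (\<lambda>x. q x - qdag x)
                 \<le> C * L2_time_norm I (Hs_norm 1 \<Omega>) (\<lambda>t x. u q t x - u qdag t x)))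
       \<and> (DIM('a) = 3 \<and>
            time_deriv {0<..<T} (lebesgue_on \<Omega>) (u qdag) \<in> L2Lp_space I (lebesgue_on \<Omega>) 3 \<longrightarrow>
            (\<forall>\<epsilon>\<in>{0<..<1/2}. \<exists>C>0. \<forall>q\<in>admissible \<Omega> qlow qup.
               Hs_dual_norm (1 + \<epsilon>) \<Omega> (\<lambda>x. q x - qdag x)
                 \<le> C * L2_time_norm I (Hs_norm 1 \<Omega>) (\<lambda>t x. u q t x - u qdag t x)))"
proof -
  have "\<exists>C>0. \<forall>q\<in>admissible \<Omega> qlow qup. Hs_dual_norm (1 + \<epsilon>) \<Omega> (\<lambda>x. q x - qdag x)
      \<le> C * L2_time_norm I (Hs_norm 1 \<Omega>) (\<lambda>t x. u q t x - u qdag t x)"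
    if "DIM('a) \<le> 3" "\<epsilon> \<in> {0<..<1/2}" for \<epsilon>
    by (rule potential_stability[where u = u, OF assms(1,2,4) that(1) assms(6,8,9) _ assms(18,19,20)])
      (use assms(17) that(2) in auto)
  then show ?thesis by simp
qed

end
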